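(* Let $a,b\geq 4$ be integers, let $C_{a,b}\subset \mathbb P^1\times\mathbb P^1$ be a smooth curve of bidegree $(a,b)$, and let $f$ be an automorphism of $C_{a,b}$. (i) If $\mathrm{ord}(f)=ab$, then $C_{a,b}$ is isomorphic to the smooth curve in $\mathbb P^1\times\mathbb P^1$ defined by $X_0^aY_0^b+X_0^aY_1^b+X_1^aY_0^b+sX_1^aY_1^b=0$ for some $s\in\mathbb C^*$ (a family with parameter $s\in\mathbb C^*$). (ii) If $\mathrm{ord}(f)=(a-1)b$, then $C_{a,b}$ is isomorphic to the smooth curve in $\mathbb P^1\times\mathbb P^1$ defined by $X_0^aY_0^b+X_0^{a-1}X_1Y_1^b+X_0X_1^{a-1}Y_0^b+sX_1^aY_1^b=0$ for some $s\in\mathbb C^*$ (a family with parameter $s\in\mathbb C^*$). (iii) If $\mathrm{ord}(f)=a(b-1)$, then $C_{a,b}$ is isomorphic to the smooth curve in $\mathbb P^1\times\mathbb P^1$ defined by $X_0^aY_0^b+X_1^aY_0^{b-1}Y_1+X_0^aY_0Y_1^{b-1}+sX_1^aY_1^b=0$ for some $s\in\mathbb C^*$ (a family with parameter $s\in\mathbb C^*$). (iv) If $\mathrm{ord}(f)=(a-1)(b-1)+1$, then for some $(s,s')\in(\mathbb C^* )^2$ the curve $C_{a,b}$ is isomorphic to the smooth curve in $\mathbb P^1\times\mathbb P^1$ defined by $X_0^{a-1}X_1Y_0^b+X_0^aY_0Y_1^{b-1}+sX_1^aY_0^{b-1}Y_1+s'X_0X_1^{a-1}Y_1^b=0$, or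 by $X_0^aY_0^{b-1}Y_1+X_0X_1^{a-1}Y_0^b+sX_0^{a-1}X_1Y_1^b+s'X_1^aY_0Y_1^{b-1}=0$ (families with parameter $(s,s')\in(\mathbb C^* )^2$).
   Context: Everything is over $\mathbb C$, and $\mathbb C^*=\mathbb C\setminus\{0\}$. A curve of bidegree $(a,b)$ in $\mathbb P^1\times\mathbb P^1$ (coordinates $([X_0:X_1],[Y_0:Y_1])$) is the zero locus of a nonzero polynomial that is homogeneous of degree $a$ in $X_0,X_1$ and homogeneous of degree $b$ in $Y_0,Y_1$. $\mathrm{ord}(f)$ is the order of the automorphism $f$. *)

theory Defs
  imports "HOL-Analysis.Analysis" "HOL-Algebra.Bij" "HOL-Algebra.Multiplicative_Group"
begin

definition proportional :: "complex \<times> complex \<Rightarrow> complex \<times> complex \<Rightarrow> bool" where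
  "proportional u v \<longleftrightarrow>
     u \<noteq> (0, 0) \<and> (\<exists>t. t \<noteq> 0 \<and> v = (t * fst u, t * snd u))"

quotient_type proj1 = "complex \<times> complex" / partial: proportional
proof (rule part_equivpI)
  show "\<exists>u. proportional u u"
    by (rule exI [of _ "(1, 0)"], unfold proportional_def, auto intro: exI [of _ 1])
  show "symp proportional"
  proof (rule sympI)
    fix u v assume "proportional u v"
    then obtain t where t: "u \<noteq> (0, 0)" "t \<noteq> 0" "v = (t * fst u, t * snd u)"
      by (auto simp: proportional_def)
    then have "v \<noteq> (0, 0)" "u = (inverse t * fst v, inverse t * snd v)" "inverse t \<noteq> 0"
      by (auto simp: prod_eq_iff)
    then show "proportional v u" unfolding proportional_def by blast
  qed
  show "transp proportional"
  proof (rule transpI)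
    fix u v w assume "proportional u v" "proportional v w"
    then obtain s t where "u \<noteq> (0, 0)" "s \<noteq> 0" "v = (s * fst u, s * snd u)"
      "t \<noteq> 0" "w = (t * fst v, t * snd v)"
      unfolding proportional_def by blast
    then have "u \<noteq> (0, 0)" "t * s \<noteq> 0" "w = ((t * s) * fst u, (t * s) * snd u)" by auto
    then show "proportional u w" unfolding proportional_def by blast
  qed
qed

text \<open>The point \<open>[x0 : x1]\<close>; only meaningful if \<open>(x0, x1) \<noteq> (0, 0)\<close>.\<close>

definition pt :: "complex \<Rightarrow> complex \<Rightarrow> proj1" where
  "pt x0 x1 = abs_proj1 (x0, x1)"

lemma pt_eq_iff:
  assumes "(x0, x1) \<noteq> (0, 0)" "(y0, y1) \<noteq> (0, 0)"
  shows "pt x0 x1 = pt y0 y1 \<longleftrightarrow> (\<exists>t. t \<noteq> 0 \<and> y0 = t * x0 \<and> y1 = t * x1)"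
proof -
  have refl: "proportional u u" if "u \<noteq> (0, 0)" for u
    using that unfolding proportional_def by (auto intro: exI [of _ 1])
  have "pt x0 x1 = pt y0 y1 \<longleftrightarrow> proportional (x0, x1) (y0, y1)"
    using Quotient_rel [OF Quotient_proj1] refl [OF assms(1)] refl [OF assms(2)]
    by (auto simp: pt_def)
  then show ?thesis using assms by (auto simp: proportional_def)
qed

lemma proj1_cases:
  obtains x0 x1 where "(x0, x1) \<noteq> (0, 0)" "P = pt x0 x1"
proof -
  have "proportional (rep_proj1 P) (rep_proj1 P)" "abs_proj1 (rep_proj1 P) = P"
    using Quotient_rep_reflp [OF Quotient_proj1] Quotient_abs_rep [OF Quotient_proj1] by auto
  then show ?thesis
    using that [of "fst (rep_proj1 P)" "snd (rep_proj1 P)"]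
    by (auto simp: pt_def proportional_def)
qed

text \<open>
  Polynomials in \<open>X0, X1, Y0, Y1\<close> that are homogeneous of degree \<open>a\<close> in \<open>X0, X1\<close> and of degree
  \<open>b\<close> in \<open>Y0, Y1\<close>. Since the complex field is infinite, a polynomial is determined by the function
  it induces, and the two are identified.
\<close>

type_synonym form = "complex \<Rightarrow> complex \<Rightarrow> complex \<Rightarrow> complex \<Rightarrow> complex"

definition bihomogeneous :: "nat \<Rightarrow> nat \<Rightarrow> form \<Rightarrow> bool" where
  "bihomogeneous a b F \<longleftrightarrow>
     (\<exists>c :: nat \<Rightarrow> nat \<Rightarrow> complex. \<forall>X0 X1 Y0 Y1.
        F X0 X1 Y0 Y1 = (\<Sum>i\<le>a. \<Sum>j\<le>b. c i j * X0 ^ (a - i) * X1 ^ i * Y0 ^ (b - j) * Y1 ^ j))"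

definition zero_locus :: "form \<Rightarrow> (proj1 \<times> proj1) set" where
  "zero_locus F =
     {(pt X0 X1, pt Y0 Y1) | X0 X1 Y0 Y1.
        (X0, X1) \<noteq> (0, 0) \<and> (Y0, Y1) \<noteq> (0, 0) \<and> F X0 X1 Y0 Y1 = 0}"

lemma bihomogeneous_scale:
  assumes "bihomogeneous a b F"
  shows "F (s * X0) (s * X1) (t * Y0) (t * Y1) = s ^ a * t ^ b * F X0 X1 Y0 Y1"
proof -
  obtain c where c: "\<And>X0 X1 Y0 Y1. F X0 X1 Y0 Y1 =
      (\<Sum>i\<le>a. \<Sum>j\<le>b. c i j * X0 ^ (a - i) * X1 ^ i * Y0 ^ (b - j) * Y1 ^ j)"
    using assms unfolding bihomogeneous_def by blast
  have "c i j * (s * X0) ^ (a - i) * (s * X1) ^ i * (t * Y0) ^ (b - j) * (t * Y1) ^ j =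
      s ^ a * t ^ b * (c i j * X0 ^ (a - i) * X1 ^ i * Y0 ^ (b - j) * Y1 ^ j)"
    if "i \<le> a" "j \<le> b" for i j
  proof -
    have "s ^ a = s ^ (a - i) * s ^ i" "t ^ b = t ^ (b - j) * t ^ j"
      using that by (simp_all flip: power_add)
    then show ?thesis by (simp add: power_mult_distrib)
  qed
  then show ?thesis unfolding c sum_distrib_left by (intro sum.cong) auto
qed

lemma mem_zero_locus_iff:
  assumes "bihomogeneous a b F" "(X0, X1) \<noteq> (0, 0)" "(Y0, Y1) \<noteq> (0, 0)"
  shows "(pt X0 X1, pt Y0 Y1) \<in> zero_locus F \<longleftrightarrow> F X0 X1 Y0 Y1 = 0"
proof
  assume "(pt X0 X1, pt Y0 Y1) \<in> zero_locus F"
  then obtain X0' X1' Y0' Y1' where *: "(X0', X1') \<noteq> (0, 0)" "(Y0', Y1') \<noteq> (0, 0)"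
    "F X0' X1' Y0' Y1' = 0" "pt X0 X1 = pt X0' X1'" "pt Y0 Y1 = pt Y0' Y1'"
    unfolding zero_locus_def mem_Collect_eq prod.inject by blast
  obtain s where "X0 = s * X0'" "X1 = s * X1'"
    using pt_eq_iff [OF *(1) assms(2)] *(4) [symmetric] by blast
  moreover obtain t where "Y0 = t * Y0'" "Y1 = t * Y1'"
    using pt_eq_iff [OF *(2) assms(3)] *(5) [symmetric] by blast
  ultimately show "F X0 X1 Y0 Y1 = 0" using bihomogeneous_scale [OF assms(1)] *(3) by simp
next
  assume "F X0 X1 Y0 Y1 = 0"
  then show "(pt X0 X1, pt Y0 Y1) \<in> zero_locus F" using assms by (auto simp: zero_locus_def)
qed

text \<open>
  \<open>smooth_form a b F\<close>: the equation \<open>F = 0\<close> defines a smooth curve of bidegree \<open>(a, b)\<close>. This is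
  the Jacobian criterion for the equation \<open>F\<close> itself, so smoothness is that of the scheme \<open>F = 0\<close>
  (a non-reduced \<open>F\<close> is not smooth). By Euler's relations, for a point on the curve the vanishing
  of the four homogeneous partial derivatives is the same as that of the two affine ones in any
  standard chart containing the point.
\<close>

definition smooth_form :: "nat \<Rightarrow> nat \<Rightarrow> form \<Rightarrow> bool" where
  "smooth_form a b F \<longleftrightarrow>
     bihomogeneous a b F \<and>
     (\<exists>X0 X1 Y0 Y1. F X0 X1 Y0 Y1 \<noteq> 0) \<and>
     (\<forall>X0 X1 Y0 Y1. (X0, X1) \<noteq> (0, 0) \<longrightarrow> (Y0, Y1) \<noteq> (0, 0) \<longrightarrow> F X0 X1 Y0 Y1 = 0 \<longrightarrow>
        \<not> (deriv (\<lambda>x. F x X1 Y0 Y1) X0 = 0 \<and> deriv (\<lambda>x. F X0 x Y0 Y1) X1 = 0 \<and>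
           deriv (\<lambda>y. F X0 X1 y Y1) Y0 = 0 \<and> deriv (\<lambda>y. F X0 X1 Y0 y) Y1 = 0))"

text \<open>
  Morphisms between algebraic subsets of \<open>P\<^sup>1 \<times> P\<^sup>1\<close>: maps that near every point are given by
  bihomogeneous polynomials. The sets where a bihomogeneous polynomial \<open>H\<close> does not vanish form a
  base of the Zariski topology.
\<close>

definition morphism ::
  "(proj1 \<times> proj1) set \<Rightarrow> (proj1 \<times> proj1) set \<Rightarrow> (proj1 \<times> proj1 \<Rightarrow> proj1 \<times> proj1) \<Rightarrow> bool"
where
  "morphism C D \<phi> \<longleftrightarrow>
     \<phi> ` C \<subseteq> D \<and>
     (\<forall>p\<in>C. \<exists>H h h' k l m n A0 A1 B0 B1.
        bihomogeneous h h' H \<and> p \<notin> zero_locus H \<and>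
        bihomogeneous k l A0 \<and> bihomogeneous k l A1 \<and>
        bihomogeneous m n B0 \<and> bihomogeneous m n B1 \<and>
        (\<forall>X0 X1 Y0 Y1. (X0, X1) \<noteq> (0, 0) \<longrightarrow> (Y0, Y1) \<noteq> (0, 0) \<longrightarrow>
           (pt X0 X1, pt Y0 Y1) \<in> C - zero_locus H \<longrightarrow>
           (A0 X0 X1 Y0 Y1, A1 X0 X1 Y0 Y1) \<noteq> (0, 0) \<and>
           (B0 X0 X1 Y0 Y1, B1 X0 X1 Y0 Y1) \<noteq> (0, 0) \<and>
           \<phi> (pt X0 X1, pt Y0 Y1) =
             (pt (A0 X0 X1 Y0 Y1) (A1 X0 X1 Y0 Y1), pt (B0 X0 X1 Y0 Y1) (B1 X0 X1 Y0 Y1))))"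

definition isomorphism ::
  "(proj1 \<times> proj1) set \<Rightarrow> (proj1 \<times> proj1) set \<Rightarrow> (proj1 \<times> proj1 \<Rightarrow> proj1 \<times> proj1) \<Rightarrow> bool"
where
  "isomorphism C D \<phi> \<longleftrightarrow>
     bij_betw \<phi> C D \<and> morphism C D \<phi> \<and> morphism D C (inv_into C \<phi>)"

definition isomorphic :: "(proj1 \<times> proj1) set \<Rightarrow> (proj1 \<times> proj1) set \<Rightarrow> bool" where
  "isomorphic C D \<longleftrightarrow> (\<exists>\<phi>. isomorphism C D \<phi>)"

text \<open>
  The condition \<open>f \<in> Bij C\<close> adds extensionality, so that automorphisms are elements of
  \<open>BijGroup C\<close>. The order of an automorphism is its order there, which agrees with its order in
  the subgroup of all automorphisms of \<open>C\<close>; the value 0 stands for infinite order.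
\<close>

definition automorphisms :: "(proj1 \<times> proj1) set \<Rightarrow> (proj1 \<times> proj1 \<Rightarrow> proj1 \<times> proj1) set" where
  "automorphisms C = {f \<in> Bij C. isomorphism C C f}"

definition aut_order :: "(proj1 \<times> proj1) set \<Rightarrow> (proj1 \<times> proj1 \<Rightarrow> proj1 \<times> proj1) \<Rightarrow> nat" where
  "aut_order C f = group.ord (BijGroup C) f"

end

theory Submission
  imports Defs "HOL-Complex_Analysis.Complex_Analysis"
    "HOL-Computational_Algebra.Fundamental_Theorem_Algebra"
begin

text \<open>
  Let \<open>\<phi>\<close> be a component of an automorphism \<open>f\<close> of the curve \<open>C\<close>, followed by a coordinate with pole
  at a general point of the line, and let \<open>Q\<close> be its set of poles. For a form \<open>P\<close> of bidegree
  \<open>(a - 2, b - 2)\<close> the sum of \<open>P \<phi> / (\<partial>F/\<partial>y)\<close> over the points of a column of \<open>C\<close> is a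
  differential form on the projective line; if \<open>P\<close> vanishes on all of \<open>Q\<close> but one point, then it has
  at most one pole, so the residue there is zero and \<open>P\<close> vanishes at the last point, too. Taking for
  \<open>P\<close> products of lines shows that \<open>Q\<close> is a column or contains a row. Hence \<open>f\<close> is the restriction of
  \<open>(x, y) \<mapsto> (g x, h y)\<close> or, if \<open>a = b\<close>, of \<open>(x, y) \<mapsto> (g y, h x)\<close> with \<open>g\<close> and \<open>h\<close> linear.

  An \<open>f\<close> of the first kind with finite order \<open>N\<close> can be diagonalized, so \<open>\<rho>^i \<sigma>^j\<close> is the same for all
  monomials \<open>X0^(a-i) X1^i Y0^(b-j) Y1^j\<close> of \<open>F\<close>, where \<open>(\<rho>, \<sigma>)\<close> has order \<open>N\<close>; consequently \<open>N\<close>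
  divides all determinants formed from differences of exponents. Smoothness yields a monomial at or
  next to each corner of the rectangle of exponents, and the determinants of these four lie strictly
  between \<open>0\<close> and \<open>2 N\<close>, so they are equal to \<open>N\<close>. This fixes the four monomials, divisibility
  excludes all others, and a diagonal change of coordinates normalizes the coefficients.
\<close>

section \<open>Polynomial functions of two variables\<close>

text \<open>Over a general value \<open>\<phi>\<close> has exactly \<open>b\<close> poles, because
  \<open>f\<close> maps them bijectively to a column. A form of bidegree
  \<open>(a - 2, b - 2)\<close> can be made of \<open>a - 2\<close> columns and \<open>b - 2\<close>
  rows, and \<open>(a - 2) + (b - 2) \<ge> b - 1\<close> for \<open>a \<ge> 3\<close>: enough lines
  for all poles but one, unless too many of them share a column or a row. A general value also keeps
  the poles off ramified columns, where the first coordinate would not be a local parameter;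
  injectivity of \<open>f\<close> then makes the poles simple. A row containing only
  \<open>a\<close> of the \<open>b\<close> poles is not contradictory for \<open>\<phi>\<close>
  alone; it is ruled out by playing \<open>\<phi>\<close> against the other component
  \<open>\<psi>\<close>. All four orders are at least \<open>a b - a - b + 2\<close>, and
  \<open>a, b \<ge> 4\<close> makes twice this number exceed every corner determinant. Divisibility
  at the corners does not settle everything: degenerate patterns survive when, say,
  \<open>b = 2 a\<close>, and are removed by monomials on the sides of the rectangle. An
  \<open>f\<close> exchanging the factors has order at most \<open>2 (a + 1)\<close>, too small
  except for \<open>a = 4\<close> and order \<open>10\<close>, which a congruence excludes.\<close>

inductive poly2 :: "(complex \<Rightarrow> complex \<Rightarrow> complex) \<Rightarrow> bool" where
  const: "poly2 (\<lambda>x y. c)"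
| fst: "poly2 (\<lambda>x y. x)"
| snd: "poly2 (\<lambda>x y. y)"
| add: "poly2 f \<Longrightarrow> poly2 g \<Longrightarrow> poly2 (\<lambda>x y. f x y + g x y)"
| mult: "poly2 f \<Longrightarrow> poly2 g \<Longrightarrow> poly2 (\<lambda>x y. f x y * g x y)"

lemma poly2_power: "poly2 f \<Longrightarrow> poly2 (\<lambda>x y. f x y ^ n)"
  by (induction n) (auto intro: poly2.intros)

lemma poly2_sum: "(\<And>i. i \<in> A \<Longrightarrow> poly2 (f i)) \<Longrightarrow> poly2 (\<lambda>x y. \<Sum>i\<in>A. f i x y)"
  by (induction A rule: infinite_finite_induct) (auto intro: poly2.intros)

lemma poly2_uminus: "poly2 f \<Longrightarrow> poly2 (\<lambda>x y. - f x y)"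
  using poly2.mult [OF poly2.const [of "-1"], of f] by simp

lemma poly2_diff: "poly2 f \<Longrightarrow> poly2 g \<Longrightarrow> poly2 (\<lambda>x y. f x y - g x y)"
  using poly2.add [OF _ poly2_uminus, of f g] by simp

lemmas poly2_intros = poly2.intros poly2_power poly2_sum poly2_uminus poly2_diff

lemma poly2_compose:
  assumes "poly2 f" "poly2 u" "poly2 v"
  shows "poly2 (\<lambda>x y. f (u x y) (v x y))"
  using assms by (induction) (auto intro: poly2_intros)

lemma poly2_flip: "poly2 f \<Longrightarrow> poly2 (\<lambda>x y. f y x)"
  by (erule poly2_compose) (auto intro: poly2_intros)

lemma poly2_tendsto:
  assumes "poly2 f" "(u \<longlongrightarrow> x) A" "(v \<longlongrightarrow> y) A"
  shows "((\<lambda>z. f (u z) (v z)) \<longlongrightarrow> f x y) A"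
  using assms by (induction) (auto intro: tendsto_intros)

lemma poly2_continuous_on:
  assumes "poly2 f" "continuous_on A u" "continuous_on A v"
  shows "continuous_on A (\<lambda>z. f (u z) (v z))"
  using assms by (induction) (auto intro: continuous_intros)

lemma poly2_holomorphic_on:
  assumes "poly2 f" "u holomorphic_on A" "v holomorphic_on A"
  shows "(\<lambda>z. f (u z) (v z)) holomorphic_on A"
  using assms by (induction) (auto intro: holomorphic_intros)

definition d1 :: "(complex \<Rightarrow> complex \<Rightarrow> complex) \<Rightarrow> complex \<Rightarrow> complex \<Rightarrow> complex" where
  "d1 f x y = deriv (\<lambda>x. f x y) x"

definition d2 :: "(complex \<Rightarrow> complex \<Rightarrow> complex) \<Rightarrow> complex \<Rightarrow> complex \<Rightarrow> complex" where
  "d2 f x y = deriv (\<lambda>y. f x y) y"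

text \<open>The chain rule along arbitrary curves instead of two one-variable derivatives: in this
  form it is inherited by sums and products, so it follows by induction over \<open>poly2\<close>.
  Coordinate lines as curves then identify \<open>f1\<close> and \<open>f2\<close> with
  \<open>d1 f\<close> and \<open>d2 f\<close>.\<close>

definition partials where
  "partials f f1 f2 \<longleftrightarrow> (\<forall>u v u' v' z. (u has_field_derivative u') (at z) \<longrightarrow>
      (v has_field_derivative v') (at z) \<longrightarrow>
      ((\<lambda>z. f (u z) (v z)) has_field_derivative
        f1 (u z) (v z) * u' + f2 (u z) (v z) * (v' :: complex)) (at (z :: complex)))"

lemma partialsD:
  assumes "partials f f1 f2" "(u has_field_derivative u') (at z)" "(v has_field_derivative v') (at z)"
  shows "((\<lambda>z. f (u z) (v z)) has_field_derivative f1 (u z) (v z) * u' + f2 (u z) (v z) * v') (at z)"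
  using assms unfolding partials_def by blast

lemma poly2_partials:
  assumes "poly2 f"
  shows "\<exists>f1 f2. poly2 f1 \<and> poly2 f2 \<and> partials f f1 f2"
  using assms
proof induction
  case (const c)
  show ?case
    by (intro exI [of _ "\<lambda>_ _. 0"] conjI poly2.const) (auto simp: partials_def)
next
  case fst
  show ?case
    by (intro exI [of _ "\<lambda>_ _. 1"] exI [of _ "\<lambda>_ _. 0"] conjI poly2.const) (auto simp: partials_def)
next
  case snd
  show ?case
    by (intro exI [of _ "\<lambda>_ _. 0"] exI [of _ "\<lambda>_ _. 1"] conjI poly2.const) (auto simp: partials_def)
next
  case (add f g)
  then obtain f1 f2 g1 g2 where *: "poly2 f1" "poly2 f2" "poly2 g1" "poly2 g2"
    "partials f f1 f2" "partials g g1 g2"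
    by blast
  have "partials (\<lambda>x y. f x y + g x y) (\<lambda>x y. f1 x y + g1 x y) (\<lambda>x y. f2 x y + g2 x y)"
    unfolding partials_def
  proof (intro allI impI)
    fix u v :: "complex \<Rightarrow> complex" and u' v' z :: complex
    assume h: "(u has_field_derivative u') (at z)" "(v has_field_derivative v') (at z)"
    show "((\<lambda>z. f (u z) (v z) + g (u z) (v z)) has_field_derivative
        (f1 (u z) (v z) + g1 (u z) (v z)) * u' + (f2 (u z) (v z) + g2 (u z) (v z)) * v') (at z)"
      by (rule DERIV_cong [OF DERIV_add [OF partialsD [OF *(5) h] partialsD [OF *(6) h]]])
        (simp add: algebra_simps)
  qed
  moreover have "poly2 (\<lambda>x y. f1 x y + g1 x y)" "poly2 (\<lambda>x y. f2 x y + g2 x y)"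
    by (intro poly2.add *)+
  ultimately show ?case by blast
next
  case (mult f g)
  then obtain f1 f2 g1 g2 where *: "poly2 f1" "poly2 f2" "poly2 g1" "poly2 g2"
    "partials f f1 f2" "partials g g1 g2"
    by blast
  have "partials (\<lambda>x y. f x y * g x y) (\<lambda>x y. f1 x y * g x y + f x y * g1 x y)
      (\<lambda>x y. f2 x y * g x y + f x y * g2 x y)"
    unfolding partials_def
  proof (intro allI impI)
    fix u v :: "complex \<Rightarrow> complex" and u' v' z :: complex
    assume h: "(u has_field_derivative u') (at z)" "(v has_field_derivative v') (at z)"
    show "((\<lambda>z. f (u z) (v z) * g (u z) (v z)) has_field_derivative
        (f1 (u z) (v z) * g (u z) (v z) + f (u z) (v z) * g1 (u z) (v z)) * u' +
        (f2 (u z) (v z) * g (u z) (v z) + f (u z) (v z) * g2 (u z) (v z)) * v') (at z)"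
      by (rule DERIV_cong [OF DERIV_mult [OF partialsD [OF *(5) h] partialsD [OF *(6) h]]])
        (simp add: algebra_simps)
  qed
  moreover have "poly2 (\<lambda>x y. f1 x y * g x y + f x y * g1 x y)"
      "poly2 (\<lambda>x y. f2 x y * g x y + f x y * g2 x y)"
    by (intro poly2.add poly2.mult * mult.hyps)+
  ultimately show ?case by blast
qed

lemma
  assumes "poly2 f"
  shows poly2_has_field_derivative: "(u has_field_derivative u') (at z) \<Longrightarrow> (v has_field_derivative v') (at z) \<Longrightarrow>
       ((\<lambda>z. f (u z) (v z)) has_field_derivative d1 f (u z) (v z) * u' + d2 f (u z) (v z) * v') (at z)"
    and poly2_d1: "poly2 (d1 f)" and poly2_d2: "poly2 (d2 f)"
proof -
  obtain f1 f2 where *: "poly2 f1" "poly2 f2" "partials f f1 f2"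
    using poly2_partials [OF assms(1)] by blast
  have "d1 f x y = f1 x y" for x y
    unfolding d1_def
    by (rule DERIV_imp_deriv) (use partialsD [OF *(3), of "\<lambda>x. x" 1 x "\<lambda>x. y" 0] in simp)
  moreover have "d2 f x y = f2 x y" for x y
    unfolding d2_def
    by (rule DERIV_imp_deriv) (use partialsD [OF *(3), of "\<lambda>y. x" 0 y "\<lambda>y. y" 1] in simp)
  ultimately have eq: "d1 f = f1" "d2 f = f2" by (auto intro!: ext)
  show "(u has_field_derivative u') (at z) \<Longrightarrow> (v has_field_derivative v') (at z) \<Longrightarrow>
      ((\<lambda>z. f (u z) (v z)) has_field_derivative
           d1 f (u z) (v z) * u' + d2 f (u z) (v z) * v') (at z)"
    unfolding eq by (rule partialsD [OF *(3)])
  show "poly2 (d1 f)" "poly2 (d2 f)" unfolding eq by (rule *)+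
qed

definition cont4 :: "(complex \<Rightarrow> complex \<Rightarrow> complex \<Rightarrow> complex \<Rightarrow> complex) \<Rightarrow> bool" where
  "cont4 U \<longleftrightarrow>
    continuous_on UNIV (\<lambda>p. U (fst p) (fst (snd p)) (fst (snd (snd p))) (snd (snd (snd p))))"

lemma cont4_tendsto:
  assumes "cont4 U" "(u \<longlongrightarrow> x) A" "(v \<longlongrightarrow> y) A" "(w \<longlongrightarrow> x') A" "(z \<longlongrightarrow> y') A"
  shows "((\<lambda>t. U (u t) (v t) (w t) (z t)) \<longlongrightarrow> U x y x' y') A"
proof -
  let ?h = "\<lambda>p. U (fst p) (fst (snd p)) (fst (snd (snd p))) (snd (snd (snd p)))"
  have "isCont ?h (x, y, x', y')"
    using assms(1) unfolding cont4_def by (simp add: continuous_on_eq_continuous_at)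
  moreover have "((\<lambda>t. (u t, v t, w t, z t)) \<longlongrightarrow> (x, y, x', y')) A"
    by (intro tendsto_Pair assms)
  ultimately have "((\<lambda>t. ?h (u t, v t, w t, z t)) \<longlongrightarrow> ?h (x, y, x', y')) A"
    by (rule isCont_tendsto_compose)
  then show ?thesis by simp
qed

text \<open>Hadamard's identity. For two zeros of \<open>f\<close> on the same slice it reads
  \<open>(y - y') * V = 0\<close>, so a zero is unique where \<open>V\<close> is nonzero; for
  neighbouring zeros on different slices it yields the slope \<open>- U / V\<close> of the zero set.
  Both uniqueness and differentiability in the implicit function theorem rest on it.\<close>

lemma poly2_difference:
  assumes "poly2 f"
  shows "\<exists>U V. cont4 U \<and> cont4 V \<and>
    (\<forall>x y x' y'. f x y - f x' y' = (x - x') * U x y x' y' + (y - y') * V x y x' y')"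
  using assms
proof induction
  case (const c)
  show ?case
    by (intro exI [of _ "\<lambda>_ _ _ _. 0"]) (auto simp: cont4_def)
next
  case fst
  show ?case
    by (intro exI [of _ "\<lambda>_ _ _ _. 1"] exI [of _ "\<lambda>_ _ _ _. 0"]) (auto simp: cont4_def)
next
  case snd
  show ?case
    by (intro exI [of _ "\<lambda>_ _ _ _. 0"] exI [of _ "\<lambda>_ _ _ _. 1"]) (auto simp: cont4_def)
next
  case (add f g)
  then obtain U V U' V' where *: "cont4 U" "cont4 V" "cont4 U'" "cont4 V'"
    "\<And>x y x' y'. f x y - f x' y' = (x - x') * U x y x' y' + (y - y') * V x y x' y'"
    "\<And>x y x' y'. g x y - g x' y' = (x - x') * U' x y x' y' + (y - y') * V' x y x' y'"
    by blast
  show ?case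
  proof (intro exI conjI allI)
    fix x y x' y'
    show "f x y + g x y - (f x' y' + g x' y') =
      (x - x') * (U x y x' y' + U' x y x' y') + (y - y') * (V x y x' y' + V' x y x' y')"
      unfolding add_diff_add *(5,6) by (simp add: algebra_simps)
  qed (use * in \<open>simp_all add: cont4_def continuous_on_add\<close>)
next
  case (mult f g)
  then obtain U V U' V' where *: "cont4 U" "cont4 V" "cont4 U'" "cont4 V'"
    "\<And>x y x' y'. f x y - f x' y' = (x - x') * U x y x' y' + (y - y') * V x y x' y'"
    "\<And>x y x' y'. g x y - g x' y' = (x - x') * U' x y x' y' + (y - y') * V' x y x' y'"
    by blast
  have fg: "cont4 (\<lambda>x y x' y'. W x y x' y' * g x y + f x' y' * W' x y x' y')"
    if "cont4 W" "cont4 W'" for W W'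
    using that unfolding cont4_def
    by (intro continuous_on_add continuous_on_mult poly2_continuous_on [OF mult.hyps(1)]
        poly2_continuous_on [OF mult.hyps(2)] continuous_on_fst continuous_on_snd continuous_on_id)
  show ?case
  proof (intro exI conjI allI)
    fix x y x' y'
    have "f x y * g x y - f x' y' * g x' y' =
        (f x y - f x' y') * g x y + f x' y' * (g x y - g x' y')" by (simp add: algebra_simps)
    also have "\<dots> = (x - x') * (U x y x' y' * g x y + f x' y' * U' x y x' y') +
        (y - y') * (V x y x' y' * g x y + f x' y' * V' x y x' y')"
      unfolding *(5,6) by (simp add: algebra_simps)
    finally show "f x y * g x y - f x' y' * g x' y' = \<dots>" .
  qed (rule fg * )+
qed

section \<open>Zeros of a polynomial function near a given zero\<close>

lemma compact_pos_lower_bound: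
  assumes "poly2 f" "compact K" "\<And>y. y \<in> K \<Longrightarrow> f 0 y \<noteq> 0"
  obtains m \<delta> where "m > 0" "\<delta> > 0" "\<And>x y. norm x < \<delta> \<Longrightarrow> y \<in> K \<Longrightarrow> norm (f x y) \<ge> m"
proof (cases "K = {}")
  case True
  then show ?thesis using that [of 1 1] by auto
next
  case False
  have "continuous_on K (\<lambda>y. norm (f 0 y))"
    by (intro continuous_intros poly2_continuous_on [OF assms(1)])
  then obtain y0 where y0: "y0 \<in> K" "\<And>y. y \<in> K \<Longrightarrow> norm (f 0 y0) \<le> norm (f 0 y)"
    using continuous_attains_inf [OF assms(2) False] by blast
  define m where "m = norm (f 0 y0) / 2"
  have m: "m > 0" using assms(3) y0(1) by (simp add: m_def)
  have "compact (cball (0 :: complex) 1 \<times> K)" using assms(2) by (intro compact_Times) auto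
  moreover have "continuous_on (cball 0 1 \<times> K) (\<lambda>p. f (fst p) (snd p))"
    by (intro continuous_intros poly2_continuous_on [OF assms(1)])
  ultimately have "uniformly_continuous_on (cball 0 1 \<times> K) (\<lambda>p. f (fst p) (snd p))"
    by (rule compact_uniformly_continuous [rotated])
  then obtain d where d: "d > 0" "\<And>p q. p \<in> cball 0 1 \<times> K \<Longrightarrow> q \<in> cball 0 1 \<times> K \<Longrightarrow> dist q p < d \<Longrightarrow>
      dist (f (fst q) (snd q)) (f (fst p) (snd p)) < m"
    using m unfolding uniformly_continuous_on_def by metis
  show ?thesis
  proof (rule that [of m "min d 1"])
    fix x y :: complex assume x: "norm x < min d 1" and y: "y \<in> K"
    have "dist (f x y) (f 0 y) < m"
      using d(2) [of "(0, y)" "(x, y)"] x y by (auto simp: dist_Pair_Pair)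
    moreover have "norm (f 0 y) \<ge> 2 * m" using y0(2) [OF y] by (simp add: m_def)
    ultimately show "norm (f x y) \<ge> m"
      unfolding dist_norm by norm
  qed (use m d in auto)
qed

lemma poly2_near:
  assumes "poly2 f" "f 0 0 = c" "\<epsilon> > 0"
  obtains \<delta> where "\<delta> > 0" "\<And>x y. norm x < \<delta> \<Longrightarrow> norm y < \<delta> \<Longrightarrow> norm (f x y - c) < \<epsilon>"
proof -
  have "continuous_on UNIV (\<lambda>p. f (fst p) (snd p))"
    by (intro continuous_intros poly2_continuous_on [OF assms(1)])
  then obtain d where d: "d > 0" "\<And>p. dist p (0,0) < d \<Longrightarrow> dist (f (fst p) (snd p)) (f 0 0) < \<epsilon>"
    using assms(3) unfolding continuous_on_iff by (metis UNIV_I fst_conv snd_conv)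
  show ?thesis
  proof (rule that [of "d / 2"])
    fix x y :: complex assume "norm x < d / 2" "norm y < d / 2"
    then have "dist (x, y) (0, 0) < d"
      using norm_Pair_le [of x y] by (simp add: dist_norm)
    from d(2) [OF this] show "norm (f x y - c) < \<epsilon>" using assms(2) by (simp add: dist_norm)
  qed (use d in auto)
qed

lemma poly2_near_nonzero:
  assumes "poly2 f" "f 0 0 \<noteq> 0"
  obtains \<delta> where "\<delta> > 0" "\<And>x y. norm x < \<delta> \<Longrightarrow> norm y < \<delta> \<Longrightarrow> f x y \<noteq> 0"
proof -
  obtain \<delta> where "\<delta> > 0" "\<And>x y. norm x < \<delta> \<Longrightarrow> norm y < \<delta> \<Longrightarrow> norm (f x y - f 0 0) < norm (f 0 0)"
    using poly2_near [OF assms(1) refl, of "norm (f 0 0)"] assms(2) by auto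
  then show ?thesis using that [of \<delta>] by fastforce
qed

text \<open>\<open>0\<close> is an isolated zero of \<open>f 0\<close>, so on a small circle
  \<open>f x\<close> is bounded below by some \<open>m\<close> for all \<open>x\<close> near
  \<open>0\<close>. If \<open>f x\<close> had no zero inside, the maximum modulus principle for its
  reciprocal would give \<open>|f x 0| \<ge> m\<close>, although \<open>f x 0\<close> is close to
  \<open>f 0 0 = 0\<close>. Zeros of any multiplicity are covered, in particular ramification
  points.\<close>

lemma poly2_root_nearby:
  assumes "poly2 f" "f 0 0 = 0" "f 0 y1 \<noteq> 0" "\<epsilon> > 0"
  obtains \<delta> where "\<delta> > 0" "\<And>x. norm x < \<delta> \<Longrightarrow> \<exists>y. norm y < \<epsilon> \<and> f x y = 0"
proof -
  have hol: "f x holomorphic_on A" for x A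
    using poly2_holomorphic_on [OF assms(1), of "\<lambda>_. x" A "\<lambda>y. y"] by simp
  obtain r where r: "r > 0" "\<And>z. z \<in> ball 0 r - {0} \<Longrightarrow> f 0 z \<noteq> 0"
    using isolated_zeros [OF hol [of 0 UNIV], of 0 y1] assms(2,3) by auto
  define \<rho> where "\<rho> = min r \<epsilon> / 2"
  have \<rho>: "\<rho> > 0" "\<rho> < r" "\<rho> < \<epsilon>" using r(1) assms(4) by (auto simp: \<rho>_def)
  have nz: "f 0 y \<noteq> 0" if "y \<in> sphere 0 \<rho>" for y
    using r(2) [of y] \<rho> that by auto
  obtain m \<delta>1 where m: "m > 0" "\<delta>1 > 0"
    "\<And>x y. norm x < \<delta>1 \<Longrightarrow> y \<in> sphere 0 \<rho> \<Longrightarrow> norm (f x y) \<ge> m"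
    using compact_pos_lower_bound [OF assms(1) compact_sphere nz] by blast
  obtain \<delta>2 where \<delta>2: "\<delta>2 > 0" "\<And>x y. norm x < \<delta>2 \<Longrightarrow> norm y < \<delta>2 \<Longrightarrow> norm (f x y) < m"
    using poly2_near [OF assms(1,2) m(1)] by auto
  show ?thesis
  proof (rule that [of "min \<delta>1 \<delta>2"])
    fix x :: complex assume x: "norm x < min \<delta>1 \<delta>2"
    show "\<exists>y. norm y < \<epsilon> \<and> f x y = 0"
    proof (rule ccontr)
      assume "\<not> ?thesis"
      then have nz: "f x y \<noteq> 0" if "y \<in> cball 0 \<rho>" for y using that \<rho> by force
      have "norm (inverse (f x 0)) \<le> inverse m"
      proof (rule maximum_modulus_frontier [of "\<lambda>y. inverse (f x y)" "cball 0 \<rho>"])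
        show "(\<lambda>y. inverse (f x y)) holomorphic_on interior (cball 0 \<rho>)"
          by (intro holomorphic_on_inverse hol) (use nz in auto)
        have "(\<lambda>y. inverse (f x y)) holomorphic_on cball 0 \<rho>"
          by (intro holomorphic_on_inverse hol nz) auto
        then show "continuous_on (closure (cball 0 \<rho>)) (\<lambda>y. inverse (f x y))"
          by (simp add: holomorphic_on_imp_continuous_on)
        fix z :: complex assume "z \<in> frontier (cball 0 \<rho>)"
        then have "norm (f x z) \<ge> m" using m(3) [of x z] x \<rho>(1) by auto
        then show "norm (inverse (f x z)) \<le> inverse m"
          using m(1) by (simp add: norm_inverse le_imp_inverse_le)
      qed (use \<rho> in auto)
      then have "norm (f x 0) \<ge> m"
        using m(1) nz [of 0] \<rho>(1) by (simp add: norm_inverse)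
      then show False using \<delta>2(2) [of x 0] \<delta>2(1) x by auto
    qed
  qed (use m \<delta>2 in auto)
qed

lemma poly2_shift: "poly2 f \<Longrightarrow> poly2 (\<lambda>x y. f (x0 + x) (y0 + y))"
  by (erule poly2_compose) (intro poly2_intros)+

lemma cont4_diag_d2:
  assumes "poly2 f" "cont4 V"
    "\<And>x y x' y'. f x y - f x' y' = (x - x') * U x y x' y' + (y - y') * V x y x' y'"
  shows "V x y x y = d2 f x y"
proof -
  have "((\<lambda>z. V x z x y) \<longlongrightarrow> V x y x y) (at y)"
    by (intro cont4_tendsto [OF assms(2)] tendsto_intros)
  moreover have "\<forall>\<^sub>F z in at y. V x z x y = (f x z - f x y) / (z - y)"
    unfolding assms(3) by (auto simp: eventually_at_filter)
  ultimately have "((\<lambda>z. (f x z - f x y) / (z - y)) \<longlongrightarrow> V x y x y) (at y)"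
    by (rule Lim_transform_eventually)
  then have "(f x has_field_derivative V x y x y) (at y)"
    by (simp add: has_field_derivative_iff)
  then show ?thesis unfolding d2_def by (metis DERIV_imp_deriv)
qed

lemma cont4_near_nonzero:
  assumes "cont4 V" "V 0 0 0 0 \<noteq> 0"
  obtains \<delta> where "\<delta> > 0"
    "\<And>x y x' y'. norm x < \<delta> \<Longrightarrow> norm y < \<delta> \<Longrightarrow> norm x' < \<delta> \<Longrightarrow> norm y' < \<delta> \<Longrightarrow> V x y x' y' \<noteq> 0"
proof -
  have "continuous_on UNIV (\<lambda>p. V (fst p) (fst (snd p)) (fst (snd (snd p))) (snd (snd (snd p))))"
    using assms by (simp add: cont4_def)
  then obtain d where d: "d > 0" "\<And>p. dist p (0,0,0,0) < d \<Longrightarrow>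
      dist (V (fst p) (fst (snd p)) (fst (snd (snd p))) (snd (snd (snd p)))) (V 0 0 0 0) < norm (V 0 0 0 0)"
    using assms(2) unfolding continuous_on_iff by (metis UNIV_I fst_conv snd_conv zero_less_norm_iff)
  show ?thesis
  proof (rule that [of "d / 4"])
    fix x y x' y' :: complex
    assume "norm x < d / 4" "norm y < d / 4" "norm x' < d / 4" "norm y' < d / 4"
    then have "dist (x, y, x', y') (0, 0, 0, 0) < d"
      using norm_Pair_le [of x "(y, x', y')"] norm_Pair_le [of y "(x', y')"] norm_Pair_le [of x' y']
      by (simp add: dist_norm)
    from d(2) [OF this] show "V x y x' y' \<noteq> 0" by (auto simp: dist_norm)
  qed (use d in auto)
qed

text \<open>Existence of \<open>g x\<close> is \<open>poly2_root_nearby\<close>. Uniqueness is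
  \<open>poly2_difference\<close>, since \<open>V\<close> equals \<open>d2 f\<close> on the diagonal
  and is nonzero near the origin. The same identity, solved for the difference quotient of
  \<open>g\<close>, shows that \<open>g\<close> is holomorphic once it is continuous.\<close>

lemma implicit_function:
  assumes "poly2 f" "f 0 0 = 0" "d2 f 0 0 \<noteq> 0"
  shows "\<exists>\<delta>>0. \<exists>\<epsilon>>0. \<exists>g. g holomorphic_on ball 0 \<delta> \<and> g 0 = 0 \<and>
    (\<forall>x. norm x < \<delta> \<longrightarrow> norm (g x) < \<epsilon> \<and> f x (g x) = 0 \<and>
      (\<forall>y. norm y < \<epsilon> \<longrightarrow> f x y = 0 \<longrightarrow> y = g x))"
proof -
  obtain U V where UV: "cont4 U" "cont4 V"
    "\<And>x y x' y'. f x y - f x' y' = (x - x') * U x y x' y' + (y - y') * V x y x' y'"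
    using poly2_difference [OF assms(1)] by blast
  note V_d2 = cont4_diag_d2 [OF assms(1) UV(2,3)]
  have nonconst: "\<exists>y'. f x y' \<noteq> 0" if "d2 f x y \<noteq> 0" for x y
  proof (rule ccontr)
    assume "\<not> ?thesis"
    then have "f x = (\<lambda>_. 0)" by auto
    then show False using that by (simp add: d2_def)
  qed
  obtain \<epsilon> where \<epsilon>: "\<epsilon> > 0"
    "\<And>x y x' y'. norm x < \<epsilon> \<Longrightarrow> norm y < \<epsilon> \<Longrightarrow> norm x' < \<epsilon> \<Longrightarrow> norm y' < \<epsilon> \<Longrightarrow> V x y x' y' \<noteq> 0"
    using cont4_near_nonzero [OF UV(2)] assms(3) V_d2 by metis
  obtain y1 where "f 0 y1 \<noteq> 0" using nonconst assms(3) by blast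
  then obtain \<delta>1 where \<delta>1: "\<delta>1 > 0" "\<And>x. norm x < \<delta>1 \<Longrightarrow> \<exists>y. norm y < \<epsilon> \<and> f x y = 0"
    using poly2_root_nearby [OF assms(1,2) _ \<epsilon>(1)] by blast
  define \<delta> where "\<delta> = min \<delta>1 \<epsilon>"
  have \<delta>: "\<delta> > 0" "\<delta> \<le> \<delta>1" "\<delta> \<le> \<epsilon>" using \<delta>1 \<epsilon> by (auto simp: \<delta>_def)
  define g where "g x = (SOME y. norm y < \<epsilon> \<and> f x y = 0)" for x
  have g: "norm (g x) < \<epsilon> \<and> f x (g x) = 0" if "norm x < \<delta>" for x
    unfolding g_def by (rule someI_ex) (use \<delta>1(2) that \<delta> in auto)
  have uniq: "y = g x" if "norm x < \<delta>" "norm y < \<epsilon>" "f x y = 0" for x y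
    using UV(3) [of x y x "g x"] g [OF that(1)] that \<epsilon>(2) [of x y x "g x"] \<delta> by auto
  have g0: "g 0 = 0" using uniq [of 0 0] \<delta> \<epsilon> assms(2) by auto
  have "(g has_field_derivative (- U x (g x) x (g x) / V x (g x) x (g x))) (at x)"
    if x: "x \<in> ball 0 \<delta>" for x
  proof -
    have xn: "norm x < \<delta>" using x by simp
    have cont: "(g \<longlongrightarrow> g x) (at x)"
    proof (rule tendstoI)
      fix e :: real assume e: "e > 0"
      \<comment> \<open>Capped by the distance to the uniqueness radius \<open>\<epsilon>\<close>:
        the zero found near \<open>g x\<close> lies in the disc where \<open>g z\<close> is the only
        zero, so it is \<open>g z\<close>.\<close>
      define e' where "e' = min e (\<epsilon> - norm (g x))"
      have e': "e' > 0" using e g [OF xn] by (simp add: e'_def)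
      have "d2 f x (g x) \<noteq> 0" using V_d2 [of x "g x"] \<epsilon>(2) [of x "g x" x "g x"] g [OF xn] xn \<delta> by auto
      then obtain y' where "f x y' \<noteq> 0" using nonconst by blast
      then obtain d where d: "d > 0" "\<And>t. norm t < d \<Longrightarrow> \<exists>y. norm y < e' \<and> f (x + t) (g x + y) = 0"
        using poly2_root_nearby [OF poly2_shift [OF assms(1)], of x "g x" "y' - g x" e'] g [OF xn] e'
        by auto
      have "dist (g z) (g x) < e" if z: "dist z x < min d (\<delta> - norm x)" for z
      proof -
        have "norm (z - x) < d" "norm (z - x) < \<delta> - norm x" using z by (auto simp: dist_norm)
        then have zn: "norm z < \<delta>" by norm
        obtain y where y: "norm y < e'" "f z (g x + y) = 0"
          using d(2) [OF \<open>norm (z - x) < d\<close>] by auto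
        have "norm (g x + y) < \<epsilon>" using y(1) norm_triangle_ineq [of "g x" y] by (simp add: e'_def)
        then have "g x + y = g z" using uniq [OF zn] y(2) by blast
        then show ?thesis using y(1) by (metis add_diff_cancel_left' dist_norm e'_def min_less_iff_conj)
      qed
      moreover have "min d (\<delta> - norm x) > 0" using d(1) xn by auto
      ultimately show "\<forall>\<^sub>F z in at x. dist (g z) (g x) < e"
        unfolding eventually_at by blast
    qed
    have "((\<lambda>z. - U z (g z) x (g x) / V z (g z) x (g x)) \<longlongrightarrow> - U x (g x) x (g x) / V x (g x) x (g x)) (at x)"
      using \<epsilon>(2) [of x "g x" x "g x"] g [OF xn] xn \<delta>
      by (intro tendsto_divide tendsto_minus cont4_tendsto [OF UV(1)] cont4_tendsto [OF UV(2)]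
          cont tendsto_const tendsto_ident_at) auto
    moreover have "\<forall>\<^sub>F z in at x. - U z (g z) x (g x) / V z (g z) x (g x) = (g z - g x) / (z - x)"
    proof -
      have "\<forall>\<^sub>F z in at x. z \<in> ball 0 \<delta> - {x}"
        using x by (intro eventually_at_in_open) auto
      then show ?thesis
      proof eventually_elim
        case (elim z)
        then have zn: "norm z < \<delta>" "z \<noteq> x" by auto
        have "V z (g z) x (g x) \<noteq> 0" using \<epsilon>(2) g [OF xn] g [OF zn(1)] xn zn \<delta> by auto
        moreover have "(z - x) * U z (g z) x (g x) + (g z - g x) * V z (g z) x (g x) = 0"
          using UV(3) [of z "g z" x "g x"] g [OF xn] g [OF zn(1)] by simp
        ultimately show ?case using zn(2)
          by (simp add: divide_simps) (simp add: algebra_simps eq_neg_iff_add_eq_0)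
      qed
    qed
    ultimately show ?thesis
      unfolding has_field_derivative_iff by (rule Lim_transform_eventually)
  qed
  then have "g holomorphic_on ball 0 \<delta>"
    using field_differentiable_at_within unfolding holomorphic_on_def field_differentiable_def by blast
  then show ?thesis
    by (intro exI [of _ \<delta>] conjI exI [of _ \<epsilon>] exI [of _ g]) (use \<delta> \<epsilon> g g0 uniq in auto)
qed



text \<open>With \<open>g w = w ^ n * h w\<close> the quotient \<open>g / g'\<close> behaves like
  \<open>w / n\<close> and tends to \<open>0\<close>. At a ramification point this will say that the
  first coordinate vanishes faster than the derivative along the column.\<close>

lemma nonconstant_zero_bound:
  assumes "g holomorphic_on ball 0 r" "r > 0" "g 0 = 0" "z1 \<in> ball 0 r" "g z1 \<noteq> 0" "\<epsilon> > 0"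
  obtains \<delta> where "\<delta> > 0" "\<delta> \<le> r"
    "\<And>z. norm z < \<delta> \<Longrightarrow> norm (g z) \<le> \<epsilon> * norm (deriv g z)"
    "\<And>z. norm z < \<delta> \<Longrightarrow> z \<noteq> 0 \<Longrightarrow> g z \<noteq> 0"
proof -
  have nc: "\<not> g constant_on ball 0 r"
    using assms(2-5) unfolding constant_on_def by (metis centre_in_ball)
  have z0: "0 \<in> ball 0 r" using assms(2) by simp
  have "\<exists>n \<rho> h. 0 < n \<and> 0 < \<rho> \<and> ball (0 :: complex) \<rho> \<subseteq> ball 0 r \<and> h holomorphic_on ball 0 \<rho> \<and>
      (\<forall>w\<in>ball 0 \<rho>. g w = w ^ n * h w \<and> h w \<noteq> 0)"
  proof (rule holomorphic_factor_zero_nonconstant [OF assms(1) open_ball connected_ball z0 assms(3) nc])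
    fix h \<rho> n
    assume A: "0 < n" "0 < \<rho>" "ball (0 :: complex) \<rho> \<subseteq> ball 0 r" "h holomorphic_on ball 0 \<rho>"
      "\<And>w. w \<in> ball 0 \<rho> \<Longrightarrow> g w = (w - 0) ^ n * h w" "\<And>w. w \<in> ball 0 \<rho> \<Longrightarrow> h w \<noteq> 0"
    show ?thesis
      by (intro exI [of _ n] exI [of _ \<rho>] exI [of _ h] conjI ballI A(1-4); use A(5,6) in simp)
  qed
  then obtain n \<rho> h where h: "0 < n" "0 < \<rho>" "ball (0 :: complex) \<rho> \<subseteq> ball 0 r" "h holomorphic_on ball 0 \<rho>"
    "\<And>w. w \<in> ball 0 \<rho> \<Longrightarrow> g w = w ^ n * h w" "\<And>w. w \<in> ball 0 \<rho> \<Longrightarrow> h w \<noteq> 0"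
    by auto
  have h0: "h 0 \<noteq> 0" using h by simp
  have dh: "(h has_field_derivative deriv h z) (at z)" if "z \<in> ball 0 \<rho>" for z
    using holomorphic_derivI [OF h(4) open_ball that] .
  have cont: "(h \<longlongrightarrow> h 0) (at 0)" "(deriv h \<longlongrightarrow> deriv h 0) (at 0)"
    using holomorphic_on_imp_continuous_on [OF h(4)]
      holomorphic_on_imp_continuous_on [OF holomorphic_deriv [OF h(4) open_ball]] h(2)
    by (simp_all add: continuous_on_eq_continuous_at continuous_at)
  \<comment> \<open>\<open>g' z = z ^ (n - 1) * (n * h z + z * h' z)\<close>. After cancelling
    \<open>z ^ (n - 1)\<close>, the claim compares \<open>|z * h z|\<close>, which tends to
    \<open>0\<close>, with \<open>\<epsilon>\<close> times a quantity tending to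
    \<open>|n * h 0| > 0\<close>.\<close>
  have "((\<lambda>z. of_nat n * h z + z * deriv h z) \<longlongrightarrow> of_nat n * h 0 + 0 * deriv h 0) (at 0)"
    by (intro tendsto_intros cont)
  then have "((\<lambda>z. norm (of_nat n * h z + z * deriv h z) * \<epsilon> - norm z * norm (h z)) \<longlongrightarrow>
      norm (of_nat n * h 0 + 0 * deriv h 0) * \<epsilon> - norm (0 :: complex) * norm (h 0)) (at 0)"
    by (intro tendsto_intros cont)
  moreover have "norm (of_nat n * h 0 + 0 * deriv h 0) * \<epsilon> - norm (0 :: complex) * norm (h 0) > 0"
    using h(1) h0 assms(6) by (simp add: norm_mult)
  ultimately have "\<forall>\<^sub>F z in at 0. norm (of_nat n * h z + z * deriv h z) * \<epsilon> - norm z * norm (h z) > 0"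
    by (rule order_tendstoD)
  then obtain d where d: "d > 0" "\<And>z. z \<noteq> 0 \<Longrightarrow> norm z < d \<Longrightarrow>
      norm z * norm (h z) < norm (of_nat n * h z + z * deriv h z) * \<epsilon>"
    unfolding eventually_at by (auto simp: dist_norm)
  show ?thesis
  proof (rule that [of "min d \<rho>"])
    show "min d \<rho> \<le> r"
      using h(2,3) by (metis ball_subset_ball_iff min.coboundedI2 not_le dist_self add_0 order_le_less)
    show "g z \<noteq> 0" if "norm z < min d \<rho>" "z \<noteq> 0" for z
      using h(5,6) that by auto
    fix z :: complex assume z: "norm z < min d \<rho>"
    show "norm (g z) \<le> \<epsilon> * norm (deriv g z)"
    proof (cases "z = 0")
      case True
      then show ?thesis using assms(3,6) by simp
    next
      case False
      have zb: "z \<in> ball 0 \<rho>" using z by simp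
      have "((\<lambda>w. w ^ n * h w) has_field_derivative
          (of_nat n * z ^ (n - 1)) * h z + deriv h z * z ^ n) (at z)"
        using DERIV_mult [OF DERIV_power [OF DERIV_ident] dh [OF zb], of n] by simp
      then have "(g has_field_derivative (of_nat n * z ^ (n - 1)) * h z + deriv h z * z ^ n) (at z)"
        by (rule has_field_derivative_transform_within_open [of _ _ _ "ball 0 \<rho>"]) (use zb h(5) in auto)
      then have "deriv g z = of_nat n * z ^ (n - 1) * h z + deriv h z * z ^ n"
        by (rule DERIV_imp_deriv)
      also have "z ^ n = z * z ^ (n - 1)" using h(1) by (cases n) auto
      finally have "deriv g z = z ^ (n - 1) * (of_nat n * h z + z * deriv h z)"
        by (simp add: algebra_simps)
      then have "\<epsilon> * norm (deriv g z) = norm z ^ (n - 1) * (norm (of_nat n * h z + z * deriv h z) * \<epsilon>)"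
        by (simp add: norm_mult norm_power)
      also have "\<dots> \<ge> norm z ^ (n - 1) * (norm z * norm (h z))"
        using d(2) [OF False] z by (intro mult_left_mono) auto
      also have "norm z ^ (n - 1) * (norm z * norm (h z)) = norm (g z)"
        using h(1) h(5) [OF zb] by (cases n) (auto simp: norm_mult norm_power)
      finally show ?thesis .
    qed
  qed (use d h in auto)
qed

text \<open>At a ramification point \<open>d2 f\<close> vanishes, but more slowly than \<open>x\<close>.\<close>

lemma poly2_slice_small:
  assumes "poly2 f" "f 0 0 = 0" "d1 f 0 0 \<noteq> 0 \<or> d2 f 0 0 \<noteq> 0" "f 0 y1 \<noteq> 0" "\<epsilon> > 0"
  obtains \<delta> where "\<delta> > 0"
    "\<And>x y. x \<noteq> 0 \<Longrightarrow> norm x < \<delta> \<Longrightarrow> norm y < \<delta> \<Longrightarrow> f x y = 0 \<Longrightarrow> d2 f x y \<noteq> 0 \<and> norm x \<le> \<epsilon> * norm (d2 f x y)"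
proof (cases "d2 f 0 0 = 0")
  case False
  define c where "c = d2 f 0 0"
  obtain \<delta> where \<delta>: "\<delta> > 0" "\<And>x y. norm x < \<delta> \<Longrightarrow> norm y < \<delta> \<Longrightarrow> norm (d2 f x y - c) < norm c / 2"
    using poly2_near [OF poly2_d2 [OF assms(1)] c_def [symmetric], of "norm c / 2"] False
    by (auto simp: c_def)
  show ?thesis
  proof (rule that [of "min \<delta> (\<epsilon> * norm c / 2)"])
    fix x y :: complex
    assume *: "x \<noteq> 0" "norm x < min \<delta> (\<epsilon> * norm c / 2)" "norm y < min \<delta> (\<epsilon> * norm c / 2)"
    then have "norm (d2 f x y - c) < norm c / 2" using \<delta>(2) by auto
    then have "norm (d2 f x y) \<ge> norm c / 2" by norm
    then have "\<epsilon> * norm (d2 f x y) \<ge> \<epsilon> * (norm c / 2)" using assms(5) by (intro mult_left_mono) auto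
    then show "d2 f x y \<noteq> 0 \<and> norm x \<le> \<epsilon> * norm (d2 f x y)"
      using * False \<open>norm (d2 f x y) \<ge> norm c / 2\<close> c_def by auto
  qed (use \<delta> assms(5) False c_def in auto)
next
  case True
  \<comment> \<open>Here \<open>d1 f\<close> is nonzero instead, so the curve is a graph
    \<open>x = g y\<close> over the second coordinate, and the variables change roles.\<close>
  define f' where "f' = (\<lambda>x y. f y x)"
  define c where "c = d1 f 0 0"
  have c: "c \<noteq> 0" using assms(3) True by (simp add: c_def)
  have f': "poly2 f'" "f' 0 0 = 0" "d2 f' 0 0 \<noteq> 0"
    using poly2_flip [OF assms(1)] assms(2) c by (auto simp: f'_def d1_def d2_def c_def)
  obtain \<delta>1 \<epsilon>1 g where g: "\<delta>1 > 0" "\<epsilon>1 > 0" "g holomorphic_on ball 0 \<delta>1" "g 0 = 0"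
    "\<And>x. norm x < \<delta>1 \<Longrightarrow> norm (g x) < \<epsilon>1 \<and> f' x (g x) = 0"
    "\<And>x y. norm x < \<delta>1 \<Longrightarrow> norm y < \<epsilon>1 \<Longrightarrow> f' x y = 0 \<Longrightarrow> y = g x"
    using implicit_function [OF f'] by blast
  have hol0: "f 0 holomorphic_on UNIV"
    using poly2_holomorphic_on [OF assms(1), of "\<lambda>_. 0" UNIV "\<lambda>y. y"] by simp
  obtain r where r: "r > 0" "\<And>z. z \<in> ball 0 r - {0} \<Longrightarrow> f 0 z \<noteq> 0"
    using isolated_zeros [OF hol0, of 0 y1] assms(2,4) by auto
  define z1 where "z1 = complex_of_real (min r \<delta>1 / 2)"
  have z1: "z1 \<in> ball 0 r - {0}" "z1 \<in> ball 0 \<delta>1" using r(1) g(1) by (auto simp: z1_def)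
  have "g z1 \<noteq> 0"
  proof
    assume "g z1 = 0"
    then have "f 0 z1 = 0" using g(5) [of z1] z1 by (simp add: f'_def)
    then show False using r(2) z1 by blast
  qed
  moreover have "\<epsilon> * (norm c / 2) > 0" using assms(5) c by simp
  ultimately obtain \<delta>2 where \<delta>2: "\<delta>2 > 0" "\<delta>2 \<le> \<delta>1"
    "\<And>z. norm z < \<delta>2 \<Longrightarrow> norm (g z) \<le> \<epsilon> * (norm c / 2) * norm (deriv g z)"
    "\<And>z. norm z < \<delta>2 \<Longrightarrow> z \<noteq> 0 \<Longrightarrow> g z \<noteq> 0"
    using nonconstant_zero_bound [OF g(3,1,4) z1(2)] by metis
  obtain \<delta>3 where \<delta>3: "\<delta>3 > 0" "\<And>x y. norm x < \<delta>3 \<Longrightarrow> norm y < \<delta>3 \<Longrightarrow> norm (d1 f x y - c) < norm c / 2"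
    using poly2_near [OF poly2_d1 [OF assms(1)] c_def [symmetric], of "norm c / 2"] c by auto
  show ?thesis
  proof (rule that [of "min \<epsilon>1 (min \<delta>2 \<delta>3)"])
    fix x y :: complex
    assume *: "x \<noteq> 0" "norm x < min \<epsilon>1 (min \<delta>2 \<delta>3)" "norm y < min \<epsilon>1 (min \<delta>2 \<delta>3)" "f x y = 0"
    have xg: "x = g y" by (rule g(6)) (use * \<delta>2 in \<open>auto simp: f'_def\<close>)
    have yb: "y \<in> ball 0 \<delta>1" using * \<delta>2 by auto
    \<comment> \<open>Differentiating \<open>f (g t) t = 0\<close> gives
      \<open>d2 f = - d1 f * g'\<close> with \<open>d1 f\<close> bounded away from \<open>0\<close>;
      hence \<open>|x| = |g y|\<close> is small against \<open>|d2 f x y|\<close> by the bound on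
      \<open>g / g'\<close>.\<close>
    have "((\<lambda>t. f (g t) t) has_field_derivative d1 f (g y) y * deriv g y + d2 f (g y) y * 1) (at y)"
      by (intro poly2_has_field_derivative assms(1) holomorphic_derivI [OF g(3) open_ball yb] DERIV_ident)
    moreover have "((\<lambda>t. f (g t) t) has_field_derivative 0) (at y)"
      by (rule has_field_derivative_transform_within_open [of "\<lambda>_. 0" _ _ "ball 0 \<delta>1"])
        (use yb g(5) in \<open>auto simp: f'_def\<close>)
    ultimately have "d1 f x y * deriv g y + d2 f x y = 0"
      using DERIV_unique xg by fastforce
    then have "d2 f x y = - (d1 f x y * deriv g y)" by (simp add: eq_neg_iff_add_eq_0 add.commute)
    then have 1: "norm (d2 f x y) = norm (d1 f x y) * norm (deriv g y)"
      by (simp add: norm_mult)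
    have "norm (d1 f x y - c) < norm c / 2" using \<delta>3(2) * by auto
    then have 2: "norm (d1 f x y) \<ge> norm c / 2" by norm
    have "norm x \<le> \<epsilon> * (norm c / 2 * norm (deriv g y))" using \<delta>2(3) [of y] * xg by (auto simp: mult.assoc)
    also have "\<dots> \<le> \<epsilon> * norm (d2 f x y)"
      unfolding 1 using 2 assms(5) by (intro mult_left_mono mult_right_mono) auto
    finally show "d2 f x y \<noteq> 0 \<and> norm x \<le> \<epsilon> * norm (d2 f x y)"
      using *(1) by auto
  qed (use \<delta>2 \<delta>3 g in auto)
qed

section \<open>Removable singularities and Liouville's theorem\<close>

lemma entire_off_finite:
  fixes h :: "complex \<Rightarrow> complex"
  assumes "finite S" "\<And>x. x \<notin> S \<Longrightarrow> h field_differentiable at x"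
    "\<And>s. s \<in> S \<Longrightarrow> ((\<lambda>x. (x - s) * h x) \<longlongrightarrow> 0) (at s)"
  obtains g where "g holomorphic_on UNIV" "\<And>z. z \<notin> S \<Longrightarrow> g z = h z"
proof -
  have hol: "h holomorphic_on A" if "A \<inter> S = {}" for A
    unfolding holomorphic_on_def
    by (rule ballI, rule field_differentiable_at_within, rule assms(2)) (use that in blast)
  have "h \<in> O[at s](\<lambda>_. 1)" if s: "s \<in> S" for s
  proof -
    define A where "A = UNIV - (S - {s})"
    have "open A" unfolding A_def using assms(1) by (intro open_Diff finite_imp_closed) auto
    then have i: "s \<in> interior A" by (simp add: A_def interior_open)
    have hA: "h holomorphic_on (A - {s})" by (rule hol) (auto simp: A_def)
    obtain B where "\<forall>\<^sub>F z in at s. norm (h z) \<le> B"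
      using assms(3) [OF s]
      unfolding holomorphic_on_extend_lim [OF hA i, symmetric] holomorphic_on_extend_bounded [OF hA i]
      by blast
    then show ?thesis by (intro bigoI [of _ B]) simp
  qed
  moreover have "h holomorphic_on (UNIV - S)" by (rule hol) blast
  ultimately have "\<exists>g. g holomorphic_on UNIV \<and> (\<forall>z\<in>UNIV - S. g z = h z)"
    using assms(1) by (intro removable_singularities) auto
  then show ?thesis using that by blast
qed

text \<open>The singularities are removable, and an entire function vanishing at infinity is zero.
  The limit condition at the points of \<open>S\<close> is the form in which the absence of poles of
  a trace is established later.\<close>

lemma zero_off_finite:
  fixes h :: "complex \<Rightarrow> complex"
  assumes "finite S" "\<And>x. x \<notin> S \<Longrightarrow> h field_differentiable at x"
    "\<And>s. s \<in> S \<Longrightarrow> ((\<lambda>x. (x - s) * h x) \<longlongrightarrow> 0) (at s)"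
    "(h \<longlongrightarrow> 0) at_infinity" "x \<notin> S"
  shows "h x = 0"
proof -
  obtain g where g: "g holomorphic_on UNIV" "\<And>z. z \<notin> S \<Longrightarrow> g z = h z"
    using entire_off_finite [OF assms(1-3)] by blast
  obtain r0 where r0: "\<And>s. s \<in> S \<Longrightarrow> norm s \<le> r0"
    using finite_imp_bounded [OF assms(1)] by (auto simp: bounded_iff)
  have "\<forall>\<^sub>F z in at_infinity. z \<notin> S"
    unfolding eventually_at_infinity by (intro exI [of _ "r0 + 1"]) (use r0 in force)
  then have "\<forall>\<^sub>F z in at_infinity. h z = g z"
    by eventually_elim (use g(2) in simp)
  then have "(g \<longlongrightarrow> 0) at_infinity"
    by (rule Lim_transform_eventually [OF assms(4)])
  then show ?thesis using Liouville_weak_0 [OF g(1)] g(2) [OF assms(5)] by simp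
qed

text \<open>The entire extension grows at most quadratically, so it is a polynomial of degree at
  most two; the limit at infinity is its quadratic coefficient.\<close>

lemma linear_off_finite:
  fixes h :: "complex \<Rightarrow> complex"
  assumes "finite S" "\<And>x. x \<notin> S \<Longrightarrow> h field_differentiable at x"
    "\<And>s. s \<in> S \<Longrightarrow> ((\<lambda>x. (x - s) * h x) \<longlongrightarrow> 0) (at s)"
    "((\<lambda>x. h x / x\<^sup>2) \<longlongrightarrow> 0) at_infinity"
  shows "\<exists>\<alpha> \<beta>. \<forall>x. x \<notin> S \<longrightarrow> h x = \<alpha> + \<beta> * x"
proof -
  obtain g where g: "g holomorphic_on UNIV" "\<And>z. z \<notin> S \<Longrightarrow> g z = h z"
    using entire_off_finite [OF assms(1-3)] by blast
  obtain r0 where r0: "\<And>s. s \<in> S \<Longrightarrow> norm s \<le> r0"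
    using finite_imp_bounded [OF assms(1)] by (auto simp: bounded_iff)
  have "\<forall>\<^sub>F z in at_infinity. z \<notin> S"
    unfolding eventually_at_infinity by (intro exI [of _ "r0 + 1"]) (use r0 in force)
  then have "\<forall>\<^sub>F z in at_infinity. h z / z\<^sup>2 = g z / z\<^sup>2"
    by eventually_elim (use g(2) in simp)
  then have lim: "((\<lambda>z. g z / z\<^sup>2) \<longlongrightarrow> 0) at_infinity"
    by (rule Lim_transform_eventually [OF assms(4)])
  then have "\<forall>\<^sub>F z in at_infinity. norm (g z / z\<^sup>2) < 1"
    using tendstoD [OF lim zero_less_one] by simp
  then obtain A where A: "\<And>z. A \<le> norm z \<Longrightarrow> norm (g z / z\<^sup>2) < 1"
    unfolding eventually_at_infinity by blast
  have "norm (g z) \<le> 1 * norm z ^ 2" if "max A 1 \<le> norm z" for z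
  proof -
    have "norm z ^ 2 > 0" using that by (intro zero_less_power) linarith
    then show ?thesis using A [of z] that by (simp add: norm_divide norm_power)
  qed
  note Liouville_polynomial [OF g(1) this]
  then have L: "g z = (\<Sum>k\<le>2. (deriv ^^ k) g 0 / fact k * z ^ k)" for z by blast
  define p q r where "p = g 0" and "q = deriv g 0" and "r = (deriv ^^ 2) g 0 / 2"
  have quad: "g z = p + q * z + r * z\<^sup>2" for z
    by (subst L) (simp add: p_def q_def r_def numeral_2_eq_2)
  have inv: "((\<lambda>z :: complex. inverse z) \<longlongrightarrow> 0) at_infinity" by (rule tendsto_inverse_0)
  have "((\<lambda>z. p * inverse z * inverse z + q * inverse z + r) \<longlongrightarrow> p * 0 * 0 + q * 0 + r) at_infinity"
    by (intro tendsto_add tendsto_mult tendsto_const inv)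
  moreover have "\<forall>\<^sub>F z in at_infinity. p * inverse z * inverse z + q * inverse z + r = g z / z\<^sup>2"
    using eventually_not_equal_at_infinity [of 0]
    by eventually_elim (subst quad, simp add: field_simps power2_eq_square)
  ultimately have "((\<lambda>z. g z / z\<^sup>2) \<longlongrightarrow> r) at_infinity"
    using Lim_transform_eventually by fastforce
  then have "r = 0" using lim by (rule tendsto_unique [OF trivial_limit_at_infinity])
  then show ?thesis using quad g(2) by (intro exI [of _ p] exI [of _ q]) (auto simp flip: g(2))
qed

text \<open>The exceptional set lies in a closed disc and has no limit point.\<close>

lemma finite_isolated:
  fixes P :: "complex \<Rightarrow> bool"
  assumes "\<And>s. \<exists>\<delta>>0. \<forall>x. x \<noteq> 0 \<longrightarrow> norm x < \<delta> \<longrightarrow> P (s + x)"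
    "\<And>x. norm x > r \<Longrightarrow> P x"
  shows "finite {x. \<not> P x}"
proof -
  have "finite (cball 0 r \<inter> {x. \<not> P x})"
  proof (rule finite_not_islimpt_in_compact)
    fix s
    obtain \<delta> where d: "\<delta> > 0" "\<And>x. x \<noteq> 0 \<Longrightarrow> norm x < \<delta> \<Longrightarrow> P (s + x)" using assms(1) by blast
    show "\<not> s islimpt {x. \<not> P x}"
    proof
      assume "s islimpt {x. \<not> P x}"
      then obtain x where "\<not> P x" "x \<noteq> s" "dist x s < \<delta>"
        using d(1) unfolding islimpt_approachable by blast
      then show False using d(2) [of "x - s"] by (simp add: dist_norm)
    qed
  qed auto
  also have "cball 0 r \<inter> {x. \<not> P x} = {x. \<not> P x}"
    using assms(2) by (force simp: not_less [symmetric])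
  finally show ?thesis .
qed

section \<open>Points, forms and smoothness\<close>

declare split_paired_All [simp del] split_paired_Ex [simp del]

type_synonym cvec = "complex \<times> complex"

definition sc :: "complex \<Rightarrow> cvec \<Rightarrow> cvec" where "sc c u = (c * fst u, c * snd u)"

text \<open>If \<open>dt e d \<noteq> 0\<close>, then \<open>x \<mapsto> PT (lin e d x)\<close> is
  an affine coordinate centred at \<open>PT e\<close> that misses only \<open>PT d\<close>. Varying
  \<open>e\<close> and \<open>d\<close> puts any point at \<open>x = 0\<close>, and exchanging them
  moves infinity to \<open>0\<close>, so local arguments treat all points of the line alike.\<close>

definition lin :: "cvec \<Rightarrow> cvec \<Rightarrow> complex \<Rightarrow> cvec" where
  "lin e d x = (fst e + x * fst d, snd e + x * snd d)"

definition dt :: "cvec \<Rightarrow> cvec \<Rightarrow> complex" where "dt u v = fst u * snd v - snd u * fst v"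

text \<open>A complement of \<open>u\<close> given by a formula: \<open>dt u (perp u)\<close> is the
  squared norm of \<open>u\<close>. It supplies a chart direction at every point.\<close>

definition perp :: "cvec \<Rightarrow> cvec" where "perp u = (- cnj (snd u), cnj (fst u))"

definition PT :: "cvec \<Rightarrow> proj1" where "PT u = pt (fst u) (snd u)"

definition rp :: "proj1 \<Rightarrow> cvec" where "rp y = (SOME u. u \<noteq> 0 \<and> PT u = y)"

definition ev :: "form \<Rightarrow> cvec \<Rightarrow> cvec \<Rightarrow> complex" where
  "ev F X Y = F (fst X) (snd X) (fst Y) (snd Y)"

lemma vec_eq_0_iff: "u = 0 \<longleftrightarrow> fst u = 0 \<and> snd u = (0 :: complex)"
  by (simp add: prod_eq_iff)

lemma dt_perp: "dt u (perp u) = complex_of_real ((norm u)\<^sup>2)"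
  by (simp add: dt_def perp_def norm_prod_def complex_norm_square flip: of_real_power)

lemma dt_perp_nonzero: "u \<noteq> 0 \<Longrightarrow> dt u (perp u) \<noteq> 0"
  by (simp add: dt_perp)

lemma dt_nonzeroD: "dt u v \<noteq> 0 \<Longrightarrow> u \<noteq> 0" "dt u v \<noteq> 0 \<Longrightarrow> v \<noteq> 0"
  by (auto simp: dt_def)

lemma lin_0 [simp]: "lin e d 0 = e"
  by (simp add: lin_def)

lemma lin_lin: "lin (lin e d x) d y = lin e d (x + y)"
  by (simp add: lin_def algebra_simps)

lemma dt_lin [simp]: "dt (lin e d x) d = dt e d" "dt e (lin e d x) = x * dt e d"
  by (simp_all add: dt_def lin_def algebra_simps)

lemma lin_nonzero: "dt e d \<noteq> 0 \<Longrightarrow> lin e d x \<noteq> 0"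
  by (metis dt_lin(1) dt_nonzeroD(1))

lemma dt_commute: "dt v u = - dt u v"
  by (simp add: dt_def)

lemma dt_sc [simp]: "dt (sc c u) v = c * dt u v" "dt u (sc c v) = c * dt u v"
  by (simp_all add: dt_def sc_def algebra_simps)

lemma sc_eq_0_iff [simp]: "sc c u = 0 \<longleftrightarrow> c = 0 \<or> u = 0"
  by (auto simp: sc_def vec_eq_0_iff)

lemma dt_eq_0E:
  assumes "dt u v = 0" "u \<noteq> 0"
  obtains t where "v = sc t u"
proof (cases "fst u = 0")
  case True
  then have "v = sc (snd v / snd u) u"
    using assms by (auto simp: dt_def sc_def vec_eq_0_iff prod_eq_iff)
  then show ?thesis by (rule that)
next
  case False
  then have "v = sc (fst v / fst u) u"
    using assms by (auto simp: dt_def sc_def prod_eq_iff field_simps)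
  then show ?thesis by (rule that)
qed

lemma PT_eq_iff:
  assumes "u \<noteq> 0" "v \<noteq> 0"
  shows "PT u = PT v \<longleftrightarrow> dt u v = 0"
proof -
  have "PT u = PT v \<longleftrightarrow> (\<exists>t. t \<noteq> 0 \<and> fst v = t * fst u \<and> snd v = t * snd u)"
    unfolding PT_def using assms by (intro pt_eq_iff) (auto simp: vec_eq_0_iff)
  also have "\<dots> \<longleftrightarrow> dt u v = 0"
  proof
    assume "dt u v = 0"
    then obtain t where "v = sc t u" using dt_eq_0E assms(1) by blast
    then show "\<exists>t. t \<noteq> 0 \<and> fst v = t * fst u \<and> snd v = t * snd u"
      using assms(2) by (intro exI [of _ t]) (auto simp: sc_def vec_eq_0_iff)
  qed (auto simp: dt_def)
  finally show ?thesis .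
qed

lemma PT_sc: "c \<noteq> 0 \<Longrightarrow> u \<noteq> 0 \<Longrightarrow> PT (sc c u) = PT u"
  by (subst PT_eq_iff) (auto simp: dt_def [of u u])

lemma rp: "rp y \<noteq> 0" "PT (rp y) = y"
proof -
  obtain x0 x1 where "(x0, x1) \<noteq> (0, 0)" "y = pt x0 x1" by (rule proj1_cases)
  then have "(x0, x1) \<noteq> 0 \<and> PT (x0, x1) = y" by (auto simp: PT_def vec_eq_0_iff)
  then have "rp y \<noteq> 0 \<and> PT (rp y) = y" unfolding rp_def by (rule someI)
  then show "rp y \<noteq> 0" "PT (rp y) = y" by auto
qed

lemma rp_PTE:
  assumes "u \<noteq> 0"
  obtains t where "t \<noteq> 0" "rp (PT u) = sc t u"
proof -
  have "dt u (rp (PT u)) = 0" using PT_eq_iff [OF assms rp(1) [of "PT u"]] rp(2) by simp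
  then obtain t where t: "rp (PT u) = sc t u" using dt_eq_0E assms by blast
  moreover have "t \<noteq> 0" using t rp(1) [of "PT u"] by auto
  ultimately show ?thesis using that by blast
qed

lemma basis_expand:
  assumes "dt k m \<noteq> 0"
  shows "v = sc (dt v m / dt k m) k + sc (dt k v / dt k m) m"
  using assms by (auto simp: prod_eq_iff sc_def field_simps) (simp_all add: dt_def algebra_simps)

text \<open>Cramer's rule: in the chart centred at \<open>k\<close> with \<open>m\<close> at
  infinity, the point \<open>v\<close> has the coordinate \<open>dt k v / dt v m\<close>.\<close>

lemma basis_expand_lin:
  assumes "dt k m \<noteq> 0" "dt v m \<noteq> 0"
  shows "v = sc (dt v m / dt k m) (lin k m (dt k v / dt v m))"
proof -
  have "sc (dt v m / dt k m) (lin k m (dt k v / dt v m)) =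
      sc (dt v m / dt k m) k + sc (dt k v / dt k m) m"
    using assms by (simp add: sc_def lin_def prod_eq_iff field_simps)
  then show ?thesis using basis_expand [OF assms(1), of v] by simp
qed

lemma zero_locus_iff:
  assumes "bihomogeneous a b F" "X \<noteq> 0" "Y \<noteq> 0"
  shows "(PT X, PT Y) \<in> zero_locus F \<longleftrightarrow> ev F X Y = 0"
  unfolding PT_def ev_def using assms by (intro mem_zero_locus_iff) (auto simp: vec_eq_0_iff)

lemma ev_sc: "bihomogeneous a b F \<Longrightarrow> ev F (sc s X) (sc t Y) = s ^ a * t ^ b * ev F X Y"
  unfolding ev_def sc_def using bihomogeneous_scale by simp

lemma sc_1 [simp]: "sc 1 u = u"
  by (simp add: sc_def)

lemma ev_sc_left: "bihomogeneous a b F \<Longrightarrow> ev F (sc s X) Y = s ^ a * ev F X Y"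
  using ev_sc [of a b F s X 1 Y] by simp

lemma ev_sc_right: "bihomogeneous a b F \<Longrightarrow> ev F X (sc t Y) = t ^ b * ev F X Y"
  using ev_sc [of a b F 1 X t Y] by simp

lemma ev_tendsto:
  assumes "bihomogeneous a b F" "(X \<longlongrightarrow> X0) A" "(Y \<longlongrightarrow> Y0) A"
  shows "((\<lambda>t. ev F (X t) (Y t)) \<longlongrightarrow> ev F X0 Y0) A"
proof -
  obtain c where c: "\<And>X0 X1 Y0 Y1. F X0 X1 Y0 Y1 =
      (\<Sum>i\<le>a. \<Sum>j\<le>b. c i j * X0 ^ (a - i) * X1 ^ i * Y0 ^ (b - j) * Y1 ^ j)"
    using assms(1) unfolding bihomogeneous_def by blast
  show ?thesis unfolding ev_def c by (intro tendsto_intros assms(2,3))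
qed

lemma poly2_linear: "poly2 (\<lambda>x y. p + x * q)" "poly2 (\<lambda>x y. p + y * q)"
  by (intro poly2_intros)+

lemma poly2_slice:
  assumes "bihomogeneous a b F"
  shows "poly2 (\<lambda>x y. ev F (lin e d x) (lin k m y))"
proof -
  obtain c where c: "\<And>X0 X1 Y0 Y1. F X0 X1 Y0 Y1 =
      (\<Sum>i\<le>a. \<Sum>j\<le>b. c i j * X0 ^ (a - i) * X1 ^ i * Y0 ^ (b - j) * Y1 ^ j)"
    using assms unfolding bihomogeneous_def by blast
  show ?thesis unfolding ev_def c lin_def fst_conv snd_conv
    by (intro poly2_sum poly2.mult poly2_power poly2_linear poly2.const)
qed

lemma poly2_fixed:
  assumes "bihomogeneous a b F"
  shows "poly2 (\<lambda>u v. ev F (u, v) Y)" "poly2 (\<lambda>u v. ev F X (u, v))"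
proof -
  obtain c where c: "\<And>X0 X1 Y0 Y1. F X0 X1 Y0 Y1 =
      (\<Sum>i\<le>a. \<Sum>j\<le>b. c i j * X0 ^ (a - i) * X1 ^ i * Y0 ^ (b - j) * Y1 ^ j)"
    using assms unfolding bihomogeneous_def by blast
  show "poly2 (\<lambda>u v. ev F (u, v) Y)" "poly2 (\<lambda>u v. ev F X (u, v))"
    unfolding ev_def c fst_conv snd_conv
    by (intro poly2_sum poly2.mult poly2_power poly2.intros)+
qed

section \<open>Directional derivatives, Euler's relations and the Jacobian criterion\<close>

definition dX :: "form \<Rightarrow> cvec \<Rightarrow> cvec \<Rightarrow> cvec \<Rightarrow> complex" where
  "dX F X Y d = deriv (\<lambda>x. ev F (lin X d x) Y) 0"

definition dY :: "form \<Rightarrow> cvec \<Rightarrow> cvec \<Rightarrow> cvec \<Rightarrow> complex" where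
  "dY F X Y m = deriv (\<lambda>y. ev F X (lin Y m y)) 0"

lemma dY_linear:
  assumes "bihomogeneous a b F"
  shows "((\<lambda>y. ev F X (lin Y m y)) has_field_derivative dY F X Y m) (at 0)"
    and "dY F X Y m = deriv (\<lambda>y. F (fst X) (snd X) y (snd Y)) (fst Y) * fst m
      + deriv (\<lambda>y. F (fst X) (snd X) (fst Y) y) (snd Y) * snd m"
proof -
  have "((\<lambda>y. ev F X (fst Y + y * fst m, snd Y + y * snd m)) has_field_derivative
     d1 (\<lambda>u v. ev F X (u, v)) (fst Y + 0 * fst m) (snd Y + 0 * snd m) * fst m +
     d2 (\<lambda>u v. ev F X (u, v)) (fst Y + 0 * fst m) (snd Y + 0 * snd m) * snd m) (at 0)"
    by (intro poly2_has_field_derivative [OF poly2_fixed(2) [OF assms]])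
      (auto intro!: derivative_eq_intros)
  then have *: "((\<lambda>y. ev F X (lin Y m y)) has_field_derivative
     deriv (\<lambda>y. F (fst X) (snd X) y (snd Y)) (fst Y) * fst m
      + deriv (\<lambda>y. F (fst X) (snd X) (fst Y) y) (snd Y) * snd m) (at 0)"
    by (simp add: lin_def d1_def d2_def ev_def)
  then show "dY F X Y m = deriv (\<lambda>y. F (fst X) (snd X) y (snd Y)) (fst Y) * fst m
      + deriv (\<lambda>y. F (fst X) (snd X) (fst Y) y) (snd Y) * snd m"
    unfolding dY_def by (rule DERIV_imp_deriv)
  with * show "((\<lambda>y. ev F X (lin Y m y)) has_field_derivative dY F X Y m) (at 0)" by simp
qed

lemma dX_linear:
  assumes "bihomogeneous a b F"
  shows "((\<lambda>x. ev F (lin X d x) Y) has_field_derivative dX F X Y d) (at 0)"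
    and "dX F X Y d = deriv (\<lambda>x. F x (snd X) (fst Y) (snd Y)) (fst X) * fst d
      + deriv (\<lambda>x. F (fst X) x (fst Y) (snd Y)) (snd X) * snd d"
proof -
  have "((\<lambda>y. ev F (fst X + y * fst d, snd X + y * snd d) Y) has_field_derivative
     d1 (\<lambda>u v. ev F (u, v) Y) (fst X + 0 * fst d) (snd X + 0 * snd d) * fst d +
     d2 (\<lambda>u v. ev F (u, v) Y) (fst X + 0 * fst d) (snd X + 0 * snd d) * snd d) (at 0)"
    by (intro poly2_has_field_derivative [OF poly2_fixed(1) [OF assms]])
      (auto intro!: derivative_eq_intros)
  then have *: "((\<lambda>y. ev F (lin X d y) Y) has_field_derivative
     deriv (\<lambda>x. F x (snd X) (fst Y) (snd Y)) (fst X) * fst d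
      + deriv (\<lambda>x. F (fst X) x (fst Y) (snd Y)) (snd X) * snd d) (at 0)"
    by (simp add: lin_def d1_def d2_def ev_def)
  then show "dX F X Y d = deriv (\<lambda>x. F x (snd X) (fst Y) (snd Y)) (fst X) * fst d
      + deriv (\<lambda>x. F (fst X) x (fst Y) (snd Y)) (snd X) * snd d"
    unfolding dX_def by (rule DERIV_imp_deriv)
  with * show "((\<lambda>x. ev F (lin X d x) Y) has_field_derivative dX F X Y d) (at 0)" by simp
qed

lemma d2_slice:
  "d2 (\<lambda>x y. ev F (lin e d x) (lin k m y)) x y = dY F (lin e d x) (lin k m y) m"
proof -
  have "deriv (\<lambda>y. ev F (lin e d x) (lin k m y)) y =
      deriv (\<lambda>t. ev F (lin e d x) (lin k m (y + t))) 0"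
    using deriv_shift_0 [of "\<lambda>y. ev F (lin e d x) (lin k m y)" y] by (simp add: o_def)
  then show ?thesis unfolding d2_def dY_def lin_lin .
qed

lemma d1_slice:
  "d1 (\<lambda>x y. ev F (lin e d x) (lin k m y)) x y = dX F (lin e d x) (lin k m y) d"
proof -
  have "deriv (\<lambda>x. ev F (lin e d x) (lin k m y)) x =
      deriv (\<lambda>t. ev F (lin e d (x + t)) (lin k m y)) 0"
    using deriv_shift_0 [of "\<lambda>x. ev F (lin e d x) (lin k m y)" x] by (simp add: o_def)
  then show ?thesis unfolding d1_def dX_def lin_lin .
qed

lemma lin_self: "lin X X t = sc (1 + t) X"
  by (simp add: lin_def sc_def algebra_simps)

lemma dY_self:
  assumes "bihomogeneous a b F"
  shows "dY F X Y Y = of_nat b * ev F X Y"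
proof -
  have "((\<lambda>t. (1 + t) ^ b * ev F X Y) has_field_derivative of_nat b * ev F X Y) (at 0)"
    by (auto intro!: derivative_eq_intros)
  then show ?thesis
    unfolding dY_def lin_self ev_sc_right [OF assms] by (rule DERIV_imp_deriv)
qed

lemma dX_self:
  assumes "bihomogeneous a b F"
  shows "dX F X Y X = of_nat a * ev F X Y"
proof -
  have "((\<lambda>t. (1 + t) ^ a * ev F X Y) has_field_derivative of_nat a * ev F X Y) (at 0)"
    by (auto intro!: derivative_eq_intros)
  then show ?thesis
    unfolding dX_def lin_self ev_sc_left [OF assms] by (rule DERIV_imp_deriv)
qed

text \<open>By Euler's relation \<open>dY F X Y m = kap F X Y * dt Y m\<close> on the curve, so \<open>perp\<close> is an arbitrary choice.\<close>

definition kap :: "form \<Rightarrow> cvec \<Rightarrow> cvec \<Rightarrow> complex" where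
  "kap F X Y = dY F X Y (perp Y) / dt Y (perp Y)"

lemma dY_add: "bihomogeneous a b F \<Longrightarrow> dY F X Y (m + m') = dY F X Y m + dY F X Y m'"
  and dY_cmult: "bihomogeneous a b F \<Longrightarrow> dY F X Y (sc c m) = c * dY F X Y m"
  by (simp_all add: dY_linear(2) sc_def algebra_simps)

lemma dX_add: "bihomogeneous a b F \<Longrightarrow> dX F X Y (m + m') = dX F X Y m + dX F X Y m'"
  and dX_cmult: "bihomogeneous a b F \<Longrightarrow> dX F X Y (sc c m) = c * dX F X Y m"
  by (simp_all add: dX_linear(2) sc_def algebra_simps)

lemma dY_eq_kap:
  assumes "bihomogeneous a b F" "Y \<noteq> 0" "ev F X Y = 0"
  shows "dY F X Y m = kap F X Y * dt Y m"
proof -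
  note nz = dt_perp_nonzero [OF assms(2)]
  have "dY F X Y m = dY F X Y (sc (dt m (perp Y) / dt Y (perp Y)) Y + sc (dt Y m / dt Y (perp Y)) (perp Y))"
    using basis_expand [OF nz, of m] by simp
  also have "\<dots> = dt Y m / dt Y (perp Y) * dY F X Y (perp Y)"
    unfolding dY_add [OF assms(1)] dY_cmult [OF assms(1)] dY_self [OF assms(1)] assms(3) by simp
  finally show ?thesis by (simp add: kap_def)
qed

lemma dY_sc:
  assumes "bihomogeneous a b F" "t \<noteq> 0" "b \<ge> 1"
  shows "dY F (sc s X) (sc t Y) m = s ^ a * t ^ (b - 1) * dY F X Y m"
proof -
  have *: "lin (sc t Y) (sc t m) y = sc t (lin Y m y)" for y
    by (simp add: lin_def sc_def algebra_simps)
  have "((\<lambda>y. s ^ a * t ^ b * ev F X (lin Y m y)) has_field_derivative s ^ a * t ^ b * dY F X Y m) (at 0)"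
    by (intro DERIV_cmult dY_linear(1) [OF assms(1)])
  then have "dY F (sc s X) (sc t Y) (sc t m) = s ^ a * t ^ b * dY F X Y m"
    unfolding dY_def * ev_sc [OF assms(1)] by (intro DERIV_imp_deriv) (simp add: dY_def)
  then have "t * dY F (sc s X) (sc t Y) m = t * (s ^ a * t ^ (b - 1) * dY F X Y m)"
    unfolding dY_cmult [OF assms(1)] using assms(3) by (cases b) auto
  then show ?thesis using assms(2) by simp
qed

text \<open>Differentiation lowers the degree in \<open>Y\<close> by one and division by
  \<open>dt Y m\<close> by one more, so on the curve \<open>kap\<close> has bidegree
  \<open>(a, b - 2)\<close>. Hence \<open>P / kap\<close> has degree \<open>0\<close> in
  \<open>Y\<close> and \<open>-2\<close> in \<open>X\<close> if \<open>P\<close> has bidegree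
  \<open>(a - 2, b - 2)\<close>.\<close>

lemma kap_sc:
  assumes "bihomogeneous a b F" "Y \<noteq> 0" "ev F X Y = 0" "t \<noteq> 0" "b \<ge> 2"
  shows "kap F (sc s X) (sc t Y) = s ^ a * t ^ (b - 2) * kap F X Y"
proof -
  have z: "sc t Y \<noteq> 0" "ev F (sc s X) (sc t Y) = 0" using assms by (simp_all add: ev_sc)
  have "kap F (sc s X) (sc t Y) * dt (sc t Y) (perp Y) = s ^ a * t ^ (b - 1) * (kap F X Y * dt Y (perp Y))"
    using dY_eq_kap [OF assms(1) z, of "perp Y"] dY_eq_kap [OF assms(1-3), of "perp Y"]
      dY_sc [OF assms(1,4), of s X Y "perp Y"] assms(5) by (simp only: mult.assoc)
  also have "t ^ (b - 1) = t * t ^ (b - 2)"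
    using assms(5) by (metis Suc_1 Suc_diff_Suc Suc_le_lessD diff_Suc_1' numeral_2_eq_2 power_Suc)
  finally show ?thesis using dt_perp_nonzero [OF assms(2)] assms(4) by simp
qed

text \<open>On the curve, Euler's relations make \<open>dX\<close> and \<open>dY\<close> vanish in
  the directions \<open>X\<close> and \<open>Y\<close>. One transversal direction in each factor
  therefore decides the Jacobian criterion, and the definition is independent of charts.\<close>

definition smf :: "form \<Rightarrow> bool" where
  "smf F \<longleftrightarrow> (\<forall>X Y d m. X \<noteq> 0 \<longrightarrow> Y \<noteq> 0 \<longrightarrow> ev F X Y = 0 \<longrightarrow> dt X d \<noteq> 0 \<longrightarrow> dt Y m \<noteq> 0 \<longrightarrow>
     dX F X Y d \<noteq> 0 \<or> dY F X Y m \<noteq> 0)"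

lemma smooth_form_iff:
  "smooth_form a b F \<longleftrightarrow> bihomogeneous a b F \<and> smf F"
proof
  assume s: "smooth_form a b F"
  then have bih: "bihomogeneous a b F" by (simp add: smooth_form_def)
  have "smf F" unfolding smf_def
  proof (intro allI impI)
    fix X Y d m :: cvec
    assume nz: "X \<noteq> 0" "Y \<noteq> 0" and z: "ev F X Y = 0" and d: "dt X d \<noteq> 0" "dt Y m \<noteq> 0"
    show "dX F X Y d \<noteq> 0 \<or> dY F X Y m \<noteq> 0"
    proof (rule ccontr)
      assume "\<not> ?thesis"
      then have 0: "dX F X Y d = 0" "dY F X Y m = 0" by auto
      have "dX F X Y v = 0" for v
        by (subst basis_expand [OF d(1), of v])
          (simp add: dX_add [OF bih] dX_cmult [OF bih] dX_self [OF bih] 0 z)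
      then have "dX F X Y (1, 0) = 0" "dX F X Y (0, 1) = 0" by auto
      moreover have "dY F X Y v = 0" for v
        by (subst basis_expand [OF d(2), of v])
          (simp add: dY_add [OF bih] dY_cmult [OF bih] dY_self [OF bih] 0 z)
      then have "dY F X Y (1, 0) = 0" "dY F X Y (0, 1) = 0" by auto
      ultimately show False
        using s nz z unfolding smooth_form_def ev_def dX_linear(2) [OF bih] dY_linear(2) [OF bih]
        by (metis add.right_neutral add_0 fst_conv mult.right_neutral mult_zero_right prod.collapse
            snd_conv zero_prod_def)
    qed
  qed
  with bih show "bihomogeneous a b F \<and> smf F" by simp
next
  assume "bihomogeneous a b F \<and> smf F"
  then have bih: "bihomogeneous a b F" and s: "smf F" by auto
  \<comment> \<open>The zero form would be singular at every point, so \<open>smf\<close> excludes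
    it.\<close>
  have "\<exists>X0 X1 Y0 Y1. F X0 X1 Y0 Y1 \<noteq> 0"
  proof (rule ccontr)
    assume "\<not> ?thesis"
    then have "ev F X Y = 0" for X Y by (simp add: ev_def)
    then have "dX F X Y d = 0" "dY F X Y m = 0" "ev F X Y = 0" for X Y d m
      by (simp_all add: dX_def dY_def)
    moreover have "dt (1, 0) (0, 1) \<noteq> 0" by (simp add: dt_def)
    ultimately show False
      using s dt_nonzeroD unfolding smf_def by metis
  qed
  moreover have "\<not> (deriv (\<lambda>x. F x X1 Y0 Y1) X0 = 0 \<and> deriv (\<lambda>x. F X0 x Y0 Y1) X1 = 0 \<and>
           deriv (\<lambda>y. F X0 X1 y Y1) Y0 = 0 \<and> deriv (\<lambda>y. F X0 X1 Y0 y) Y1 = 0)"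
    if "(X0, X1) \<noteq> (0, 0)" "(Y0, Y1) \<noteq> (0, 0)" "F X0 X1 Y0 Y1 = 0" for X0 X1 Y0 Y1
  proof
    assume "deriv (\<lambda>x. F x X1 Y0 Y1) X0 = 0 \<and> deriv (\<lambda>x. F X0 x Y0 Y1) X1 = 0 \<and>
           deriv (\<lambda>y. F X0 X1 y Y1) Y0 = 0 \<and> deriv (\<lambda>y. F X0 X1 Y0 y) Y1 = 0"
    then have "dX F (X0, X1) (Y0, Y1) d = 0" "dY F (X0, X1) (Y0, Y1) m = 0" for d m
      by (simp_all add: dX_linear(2) [OF bih] dY_linear(2) [OF bih])
    moreover have "(X0, X1) \<noteq> 0" "(Y0, Y1) \<noteq> 0" using that by (auto simp: vec_eq_0_iff)
    moreover have "ev F (X0, X1) (Y0, Y1) = 0" using that by (simp add: ev_def)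
    ultimately show False using s dt_perp_nonzero unfolding smf_def by blast
  qed
  ultimately show "smooth_form a b F" using bih unfolding smooth_form_def by blast
qed

section \<open>Binary forms and the columns of the curve\<close>

definition bform :: "nat \<Rightarrow> (cvec \<Rightarrow> complex) \<Rightarrow> bool" where
  "bform b G \<longleftrightarrow> (\<exists>g. \<forall>Y. G Y = (\<Sum>j\<le>b. g j * fst Y ^ (b - j) * snd Y ^ j))"

lemma bform_ev:
  assumes "bihomogeneous a b F"
  shows "bform b (ev F X)"
proof -
  obtain c where c: "\<And>X0 X1 Y0 Y1. F X0 X1 Y0 Y1 =
      (\<Sum>i\<le>a. \<Sum>j\<le>b. c i j * X0 ^ (a - i) * X1 ^ i * Y0 ^ (b - j) * Y1 ^ j)"
    using assms unfolding bihomogeneous_def by blast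
  have "ev F X Y = (\<Sum>j\<le>b. (\<Sum>i\<le>a. c i j * fst X ^ (a - i) * snd X ^ i) * fst Y ^ (b - j) * snd Y ^ j)" for Y
    unfolding ev_def c sum_distrib_right by (rule sum.swap)
  then show ?thesis unfolding bform_def
    by (intro exI [of _ "\<lambda>j. \<Sum>i\<le>a. c i j * fst X ^ (a - i) * snd X ^ i"] allI)
qed

text \<open>Differentiation with respect to \<open>X\<close> affects only the coefficients, so the
  degree in \<open>Y\<close> stays \<open>b\<close>; a zero of this binary form is what refutes a
  column contained in the curve.\<close>

lemma bform_dX:
  assumes "bihomogeneous a b F"
  shows "bform b (\<lambda>Y. dX F X Y d)"
proof -
  obtain c where c: "\<And>X0 X1 Y0 Y1. F X0 X1 Y0 Y1 =
      (\<Sum>i\<le>a. \<Sum>j\<le>b. c i j * X0 ^ (a - i) * X1 ^ i * Y0 ^ (b - j) * Y1 ^ j)"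
    using assms unfolding bihomogeneous_def by blast
  define h where "h j x = (\<Sum>i\<le>a. c i j * fst (lin X d x) ^ (a - i) * snd (lin X d x) ^ i)" for j x
  have ev: "ev F (lin X d x) Y = (\<Sum>j\<le>b. h j x * fst Y ^ (b - j) * snd Y ^ j)" for x Y
    unfolding ev_def c h_def sum_distrib_right by (rule sum.swap)
  have "h j field_differentiable at 0" for j
    unfolding h_def lin_def fst_conv snd_conv by (intro derivative_intros)
  then have "(h j has_field_derivative deriv (h j) 0) (at 0)" for j
    by (simp add: DERIV_deriv_iff_field_differentiable)
  then have "((\<lambda>x. \<Sum>j\<le>b. h j x * fst Y ^ (b - j) * snd Y ^ j) has_field_derivative
      (\<Sum>j\<le>b. deriv (h j) 0 * fst Y ^ (b - j) * snd Y ^ j)) (at 0)" for Y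
    by (intro DERIV_sum DERIV_cmult_right)
  then have "dX F X Y d = (\<Sum>j\<le>b. deriv (h j) 0 * fst Y ^ (b - j) * snd Y ^ j)" for Y
    unfolding dX_def ev by (intro DERIV_imp_deriv)
  then show ?thesis unfolding bform_def by (intro exI [of _ "\<lambda>j. deriv (h j) 0"] allI)
qed

lemma bform_scale: "bform b G \<Longrightarrow> G (sc t Y) = t ^ b * G Y"
proof -
  assume "bform b G"
  then obtain g where g: "\<And>Y. G Y = (\<Sum>j\<le>b. g j * fst Y ^ (b - j) * snd Y ^ j)"
    unfolding bform_def by blast
  have "t ^ (b - j) * t ^ j = t ^ b" if "j \<le> b" for j
    using that by (simp flip: power_add)
  then show ?thesis unfolding g sum_distrib_left
    by (intro sum.cong) (auto simp: sc_def power_mult_distrib algebra_simps)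
qed

lemma coeff_linear_power_mult:
  fixes p :: "complex poly"
  assumes "Polynomial.degree p \<le> n"
  shows "Polynomial.degree ([:k, m:] * p) \<le> Suc n"
    and "Polynomial.coeff ([:k, m:] * p) (Suc n) = m * Polynomial.coeff p n"
proof -
  have "[:k, m:] * p = Polynomial.smult k p + pCons 0 (Polynomial.smult m p)"
    by (simp add: mult_pCons_left)
  moreover have "Polynomial.coeff p (Suc n) = 0" using assms by (simp add: coeff_eq_0)
  ultimately show "Polynomial.coeff ([:k, m:] * p) (Suc n) = m * Polynomial.coeff p n"
    by simp
  have "Polynomial.degree ([:k, m:] * p) \<le> Polynomial.degree [:k, m:] + Polynomial.degree p"
    by (rule degree_mult_le)
  also have "\<dots> \<le> Suc n" using assms by simp
  finally show "Polynomial.degree ([:k, m:] * p) \<le> Suc n" .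
qed

lemma linear_powers:
  fixes k0 m0 k1 m1 :: complex
  shows "Polynomial.degree ([:k0, m0:] ^ i * [:k1, m1:] ^ j) \<le> i + j \<and>
    Polynomial.coeff ([:k0, m0:] ^ i * [:k1, m1:] ^ j) (i + j) = m0 ^ i * m1 ^ j"
proof (induction i)
  case 0
  show ?case
  proof (induction j)
    case (Suc j)
    then show ?case
      using coeff_linear_power_mult [of "[:k1, m1:] ^ j" j k1 m1] by simp
  qed auto
next
  case (Suc i)
  then show ?case
    using coeff_linear_power_mult [of "[:k0, m0:] ^ i * [:k1, m1:] ^ j" "i + j" k0 m0]
    by (simp del: mult_pCons_left add: mult.assoc)
qed

text \<open>Dehomogenization with \<open>m\<close> as the point at infinity: the coefficient of
  degree \<open>b\<close> is the value at \<open>m\<close>, so the degree is exactly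
  \<open>b\<close> unless \<open>m\<close> is a zero of \<open>G\<close>.\<close>

lemma bform_poly:
  assumes "bform b G"
  obtains p where "Polynomial.degree p \<le> b" "Polynomial.coeff p b = G m"
    "\<And>y. poly p y = G (lin k m y)"
proof -
  obtain g where g: "\<And>Y. G Y = (\<Sum>j\<le>b. g j * fst Y ^ (b - j) * snd Y ^ j)"
    using assms unfolding bform_def by blast
  define q where "q j = [:fst k, fst m:] ^ (b - j) * [:snd k, snd m:] ^ j" for j
  have q: "Polynomial.degree (q j) \<le> b" "Polynomial.coeff (q j) b = fst m ^ (b - j) * snd m ^ j" if "j \<le> b" for j
    using linear_powers [of "fst k" "fst m" "b - j" "snd k" "snd m" j] that by (simp_all add: q_def)
  define p where "p = (\<Sum>j\<le>b. Polynomial.smult (g j) (q j))"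
  show ?thesis
  proof (rule that [of p])
    show "Polynomial.degree p \<le> b" unfolding p_def
      by (intro degree_sum_le) (auto intro: order.trans [OF degree_smult_le] q)
    show "Polynomial.coeff p b = G m"
      unfolding p_def g coeff_sum by (intro sum.cong) (auto simp: q)
    show "poly p y = G (lin k m y)" for y
      unfolding p_def g poly_sum by (intro sum.cong) (auto simp: q_def lin_def poly_power)
  qed
qed

lemma bform_root:
  assumes "bform b G" "b \<ge> 1"
  obtains Y where "Y \<noteq> 0" "G Y = 0"
proof (cases "G (0, 1) = 0")
  case True
  then show ?thesis using that [of "(0, 1)"] by (simp add: vec_eq_0_iff)
next
  case False
  obtain p where p: "Polynomial.degree p \<le> b" "Polynomial.coeff p b = G (0, 1)"
    "\<And>y. poly p y = G (lin (1, 0) (0, 1) y)"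
    using bform_poly [OF assms(1), where m = "(0, 1)" and k = "(1, 0)"] by metis
  have "Polynomial.degree p = b" using p(1,2) False le_degree [of p b] by auto
  then have "\<not> constant (poly p)" using assms(2) constant_degree [of p] by simp
  then obtain y where "poly p y = 0" using fundamental_theorem_of_algebra by blast
  then show ?thesis using that [of "lin (1, 0) (0, 1) y"] p(3)
    by (auto simp: lin_def vec_eq_0_iff)
qed

definition zer :: "(cvec \<Rightarrow> complex) \<Rightarrow> proj1 set" where
  "zer G = {y. G (rp y) = 0}"

lemma zer_iff:
  assumes "bform b G" "Y \<noteq> 0"
  shows "PT Y \<in> zer G \<longleftrightarrow> G Y = 0"
proof -
  obtain t where "t \<noteq> 0" "rp (PT Y) = sc t Y" using rp_PTE assms(2) by blast
  then show ?thesis by (simp add: zer_def bform_scale [OF assms(1)])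
qed

lemma zer_image:
  assumes "bform b G" "dt k m \<noteq> 0" "G m \<noteq> 0"
  shows "zer G = (\<lambda>y. PT (lin k m y)) ` {y. G (lin k m y) = 0}"
    and "inj_on (\<lambda>y. PT (lin k m y)) A"
proof -
  have nz: "lin k m y \<noteq> 0" for y by (rule lin_nonzero [OF assms(2)])
  have "y \<in> (\<lambda>y. PT (lin k m y)) ` {y. G (lin k m y) = 0}" if "y \<in> zer G" for y
  proof -
    have z: "G (rp y) = 0" using that by (simp add: zer_def)
    have "dt (rp y) m \<noteq> 0"
    proof
      assume "dt (rp y) m = 0"
      then obtain t where "m = sc t (rp y)" using dt_eq_0E rp(1) by blast
      then have "G m = t ^ b * G (rp y)" using bform_scale [OF assms(1)] by simp
      then show False using z assms(3) by simp
    qed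
    then have eq: "rp y = sc (dt (rp y) m / dt k m) (lin k m (dt k (rp y) / dt (rp y) m))"
      and c: "dt (rp y) m / dt k m \<noteq> 0"
      using basis_expand_lin [OF assms(2)] assms(2) by auto
    have "G (lin k m (dt k (rp y) / dt (rp y) m)) = 0"
      using z c bform_scale [OF assms(1)] by (subst (asm) eq) simp
    moreover have "PT (lin k m (dt k (rp y) / dt (rp y) m)) = y"
      using PT_sc [OF c nz] eq rp(2) by metis
    ultimately show ?thesis by (metis (mono_tags, lifting) image_eqI mem_Collect_eq)
  qed
  then show "zer G = (\<lambda>y. PT (lin k m y)) ` {y. G (lin k m y) = 0}"
    using zer_iff [OF assms(1) nz] by auto
  show "inj_on (\<lambda>y. PT (lin k m y)) A"
  proof (rule inj_onI)
    fix y z assume "PT (lin k m y) = PT (lin k m z)"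
    then have "dt (lin k m y) (lin k m z) = 0" using PT_eq_iff [OF nz nz] by simp
    then have "(z - y) * dt k m = 0" by (simp add: dt_def lin_def algebra_simps)
    then show "y = z" using assms(2) by simp
  qed
qed

text \<open>A vector \<open>m\<close> with \<open>G m \<noteq> 0\<close> is placed at infinity, so
  that all zeros are roots of a polynomial of degree exactly \<open>b\<close>. If they are simple,
  the polynomial is squarefree and splits into \<open>b\<close> distinct linear factors.\<close>

lemma bform_zeros:
  assumes "bform b G" "G m \<noteq> 0" "b \<ge> 1"
  shows "finite (zer G)" "card (zer G) \<le> b"
    and "(\<And>Y n. Y \<noteq> 0 \<Longrightarrow> G Y = 0 \<Longrightarrow> dt Y n \<noteq> 0 \<Longrightarrow> deriv (\<lambda>y. G (lin Y n y)) 0 \<noteq> 0) \<Longrightarrow> card (zer G) = b"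
proof -
  have m0: "m \<noteq> 0"
  proof
    assume "m = 0"
    then have "G m = 0 ^ b * G m" using bform_scale [OF assms(1), of 0 0] by (simp add: sc_def zero_prod_def)
    moreover have "(0 :: complex) ^ b = 0" using assms(3) by (cases b) auto
    ultimately show False using assms(2) by simp
  qed
  define k where "k = perp m"
  have km: "dt k m \<noteq> 0" using dt_perp_nonzero [OF m0] dt_commute [of m k] by (simp add: k_def)
  obtain p where p: "Polynomial.degree p \<le> b" "Polynomial.coeff p b = G m"
    "\<And>y. poly p y = G (lin k m y)"
    using bform_poly [OF assms(1), where m = m and k = k] by metis
  have deg: "Polynomial.degree p = b" using p(1,2) assms(2) le_degree [of p b] by auto
  have p0: "p \<noteq> 0" using p(2) assms(2) by auto
  have zer: "zer G = (\<lambda>y. PT (lin k m y)) ` {y. poly p y = 0}"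
    and inj: "inj_on (\<lambda>y. PT (lin k m y)) A" for A
    using zer_image [OF assms(1) km assms(2)] p(3) by auto
  show "finite (zer G)" unfolding zer using poly_roots_finite [OF p0] by simp
  show "card (zer G) \<le> b"
    unfolding zer card_image [OF inj] using card_poly_roots_bound [OF p0] deg by simp
  assume simple: "\<And>Y n. Y \<noteq> 0 \<Longrightarrow> G Y = 0 \<Longrightarrow> dt Y n \<noteq> 0 \<Longrightarrow> deriv (\<lambda>y. G (lin Y n y)) 0 \<noteq> 0"
  have "poly (pderiv p) y \<noteq> 0" if "poly p y = 0" for y
  proof -
    have "deriv (\<lambda>z. G (lin (lin k m y) m z)) 0 \<noteq> 0"
      using that p(3) km by (intro simple lin_nonzero) auto
    moreover have "((\<lambda>z. poly p (y + z)) has_field_derivative poly (pderiv p) y) (at 0)"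
      using DERIV_chain2 [of "poly p" _ "\<lambda>z. y + z" 0 1] poly_DERIV [of p y]
      by (auto intro!: derivative_eq_intros)
    then have "deriv (\<lambda>z. poly p (y + z)) 0 = poly (pderiv p) y"
      by (rule DERIV_imp_deriv)
    ultimately show ?thesis unfolding lin_lin p(3) by simp
  qed
  then have "rsquarefree p" by (auto simp: rsquarefree_roots)
  then have eq: "Polynomial.smult (lead_coeff p) (\<Prod>z|poly p z = 0. [:-z, 1:]) = p"
    by (rule complex_poly_decompose_rsquarefree)
  have "b = Polynomial.degree (Polynomial.smult (lead_coeff p) (\<Prod>z|poly p z = 0. [:-z, 1:]))"
    using eq deg by simp
  also have "\<dots> = (\<Sum>z|poly p z = 0. 1)"
    using p0 by (simp add: degree_prod_eq_sum_degree)
  finally show "card (zer G) = b"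
    unfolding zer card_image [OF inj] by simp
qed

text \<open>Along a column contained in the curve the derivative \<open>dY\<close> vanishes, while
  \<open>dX\<close> restricts to a binary form of degree \<open>b \<ge> 1\<close>, which has a zero.
  This zero would be a singular point.\<close>

lemma column_not_contained:
  assumes "bihomogeneous a b F" "smf F" "b \<ge> 1" "X \<noteq> 0"
  obtains Y where "Y \<noteq> 0" "ev F X Y \<noteq> 0"
proof -
  have "\<exists>Y. Y \<noteq> 0 \<and> ev F X Y \<noteq> 0"
  proof (rule ccontr)
    assume "\<not> ?thesis"
    then have z: "ev F X Y = 0" if "Y \<noteq> 0" for Y using that by blast
    obtain Y where Y: "Y \<noteq> 0" "dX F X Y (perp X) = 0"
      using bform_root [OF bform_dX [OF assms(1)] assms(3)] by blast
    have "ev F X (lin Y (perp Y) y) = 0" for y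
      by (intro z lin_nonzero dt_perp_nonzero Y)
    then have "dY F X Y (perp Y) = 0" by (simp add: dY_def)
    then show False
      using assms(2,4) Y z [OF Y(1)] dt_perp_nonzero unfolding smf_def by blast
  qed
  then show ?thesis using that by blast
qed

text \<open>The column over \<open>X\<close> contains no ramification point of the first projection:
  it meets the curve transversally and has the full number \<open>b\<close> of points.\<close>

definition unram :: "form \<Rightarrow> cvec \<Rightarrow> bool" where
  "unram F X \<longleftrightarrow> (\<forall>Y. Y \<noteq> 0 \<longrightarrow> ev F X Y = 0 \<longrightarrow> kap F X Y \<noteq> 0)"

definition col :: "form \<Rightarrow> cvec \<Rightarrow> proj1 set" where
  "col F X = zer (ev F X)"

lemma col_iff:
  assumes "bihomogeneous a b F" "Y \<noteq> 0"
  shows "PT Y \<in> col F X \<longleftrightarrow> ev F X Y = 0"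
  unfolding col_def by (rule zer_iff [OF bform_ev [OF assms(1)] assms(2)])

lemma col_iff_rp: "y \<in> col F X \<longleftrightarrow> ev F X (rp y) = 0"
  by (simp add: col_def zer_def)

lemma col_iff_zero_locus:
  assumes "bihomogeneous a b F" "X \<noteq> 0"
  shows "y \<in> col F X \<longleftrightarrow> (PT X, y) \<in> zero_locus F"
  using zero_locus_iff [OF assms rp(1) [of y]] by (simp add: rp col_iff_rp)

lemma col_card:
  assumes "bihomogeneous a b F" "smf F" "b \<ge> 1" "X \<noteq> 0"
  shows "finite (col F X)" "card (col F X) \<le> b" "unram F X \<Longrightarrow> card (col F X) = b"
proof -
  obtain m where m: "ev F X m \<noteq> 0" using column_not_contained [OF assms] by blast
  note * = bform_zeros [OF bform_ev [OF assms(1)] m assms(3)]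
  show "finite (col F X)" "card (col F X) \<le> b" unfolding col_def by (rule *)+
  assume u: "unram F X"
  show "card (col F X) = b" unfolding col_def
  proof (rule *(3))
    fix Y n :: cvec assume "Y \<noteq> 0" "ev F X Y = 0" "dt Y n \<noteq> 0"
    then have "dY F X Y n \<noteq> 0"
      using u [unfolded unram_def, rule_format, of Y] dY_eq_kap [OF assms(1), of Y X n] by simp
    then show "deriv (\<lambda>y. ev F X (lin Y n y)) 0 \<noteq> 0" by (simp add: dY_def)
  qed
qed

lemma unram_sc:
  assumes "bihomogeneous a b F" "c \<noteq> 0" "b \<ge> 2"
  shows "unram F (sc c X) \<longleftrightarrow> unram F X"
proof -
  have "kap F (sc c X) Y \<noteq> 0 \<longleftrightarrow> kap F X Y \<noteq> 0" if "Y \<noteq> 0" "ev F X Y = 0" for Y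
    using kap_sc [OF assms(1) that, of 1 c] assms by simp
  then show ?thesis unfolding unram_def using assms(2) by (auto simp: ev_sc_left [OF assms(1)])
qed

section \<open>Ramification of the first projection\<close>

lemma lin_tendsto: "(x \<longlongrightarrow> x0) A \<Longrightarrow> ((\<lambda>t. lin e d (x t)) \<longlongrightarrow> lin e d x0) A"
  unfolding lin_def by (intro tendsto_intros)

lemma dt_tendsto:
  "(u \<longlongrightarrow> u0) A \<Longrightarrow> (v \<longlongrightarrow> v0) A \<Longrightarrow> ((\<lambda>t. dt (u t) (v t)) \<longlongrightarrow> dt u0 v0) A"
  unfolding dt_def by (intro tendsto_intros)

text \<open>Properness of the projection: what holds near each point of the column over
  \<open>e\<close> holds on all neighbouring columns. Otherwise counterexamples, normalized to the
  unit sphere, accumulate at some \<open>k\<close>, which lies over \<open>e\<close> by continuity,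
  and eventually enter the chart around \<open>k\<close>. The column \<open>x = 0\<close> itself is
  left out because the properties of interest fail there.\<close>

lemma column_local_global:
  assumes bih: "bihomogeneous a b F" and "dt e d \<noteq> 0"
    and local: "\<And>k m. dt k m \<noteq> 0 \<Longrightarrow> ev F e k = 0 \<Longrightarrow>
      \<exists>\<delta>>0. \<forall>x y. x \<noteq> 0 \<longrightarrow> norm x < \<delta> \<longrightarrow> norm y < \<delta> \<longrightarrow> ev F (lin e d x) (lin k m y) = 0 \<longrightarrow>
        Pr x (PT (lin k m y))"
  shows "\<exists>\<delta>>0. \<forall>x. x \<noteq> 0 \<longrightarrow> norm x < \<delta> \<longrightarrow> (\<forall>y\<in>col F (lin e d x). Pr x y)"
proof (rule ccontr)
  assume neg: "\<not> ?thesis"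
  have "\<exists>x y. x \<noteq> 0 \<and> norm x < inverse (Suc n) \<and> y \<in> col F (lin e d x) \<and> \<not> Pr x y" for n
    using neg by (auto dest!: spec [of _ "inverse (Suc n)"])
  then obtain xs ys where xy: "\<And>n. xs n \<noteq> 0" "\<And>n. norm (xs n) < inverse (Suc n)"
    "\<And>n. ys n \<in> col F (lin e d (xs n))" "\<And>n. \<not> Pr (xs n) (ys n)"
    by metis
  define Y where "Y n = sc (complex_of_real (inverse (norm (rp (ys n))))) (rp (ys n))" for n
  have sc_norm: "norm (sc c u) = norm c * norm u" for c u
    by (simp add: sc_def norm_prod_def norm_mult power_mult_distrib real_sqrt_mult
        flip: distrib_left)
  have Y1: "Y n \<in> sphere 0 1" for n
    using rp(1) [of "ys n"] by (simp add: Y_def sc_norm norm_inverse)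
  have Ynz: "Y n \<noteq> 0" for n using Y1 [of n] by auto
  have YPT: "PT (Y n) = ys n" for n
    unfolding Y_def using rp [of "ys n"] by (subst PT_sc) auto
  have Yev: "ev F (lin e d (xs n)) (Y n) = 0" for n
    using xy(3) [of n] by (simp add: Y_def ev_sc_right [OF bih] col_iff_rp)
  obtain k r where k: "k \<in> sphere (0 :: cvec) 1" "strict_mono r" "(Y \<circ> r) \<longlonglongrightarrow> k"
    using compact_sphere [of "0 :: cvec" 1] Y1 unfolding compact_def by metis
  have xs0: "xs \<longlonglongrightarrow> 0"
    by (rule Lim_null_comparison [OF _ LIMSEQ_inverse_real_of_nat])
      (use xy(2) in \<open>auto intro!: always_eventually less_imp_le\<close>)
  then have xr: "(\<lambda>n. xs (r n)) \<longlonglongrightarrow> 0" using LIMSEQ_subseq_LIMSEQ [OF xs0 k(2)] by (simp add: o_def)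
  have Yr: "(\<lambda>n. Y (r n)) \<longlonglongrightarrow> k" using k(3) by (simp add: o_def)
  have "(\<lambda>n. ev F (lin e d (xs (r n))) (Y (r n))) \<longlonglongrightarrow> ev F (lin e d 0) k"
    by (intro ev_tendsto [OF bih] lin_tendsto xr Yr)
  then have ek: "ev F e k = 0" using Yev LIMSEQ_unique [OF tendsto_const] by fastforce
  define m where "m = perp k"
  have km: "dt k m \<noteq> 0" unfolding m_def by (rule dt_perp_nonzero) (use k(1) in auto)
  obtain \<delta> where \<delta>: "\<delta> > 0" "\<And>x y. x \<noteq> 0 \<Longrightarrow> norm x < \<delta> \<Longrightarrow> norm y < \<delta> \<Longrightarrow>
      ev F (lin e d x) (lin k m y) = 0 \<Longrightarrow> Pr x (PT (lin k m y))"
    using local [OF km ek] by blast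
  have t1: "(\<lambda>n. dt (Y (r n)) m) \<longlonglongrightarrow> dt k m" by (intro dt_tendsto Yr tendsto_const)
  have t2: "(\<lambda>n. dt k (Y (r n)) / dt (Y (r n)) m) \<longlonglongrightarrow> dt k k / dt k m"
    by (intro tendsto_divide dt_tendsto Yr tendsto_const km)
  have "\<forall>\<^sub>F n in sequentially. dt (Y (r n)) m \<noteq> 0"
    using tendsto_imp_eventually_ne [OF t1 km] .
  moreover have "\<forall>\<^sub>F n in sequentially. norm (dt k (Y (r n)) / dt (Y (r n)) m) < \<delta>"
    using tendstoD [OF t2 \<delta>(1)] by (simp add: dt_def)
  moreover have "\<forall>\<^sub>F n in sequentially. norm (xs (r n)) < \<delta>"
    using tendstoD [OF xr \<delta>(1)] by simp
  ultimately have "\<forall>\<^sub>F n in sequentially. False"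
  proof eventually_elim
    case (elim n)
    define y where "y = dt k (Y (r n)) / dt (Y (r n)) m"
    define c where "c = dt (Y (r n)) m / dt k m"
    have c: "c \<noteq> 0" "Y (r n) = sc c (lin k m y)"
      using basis_expand_lin [OF km elim(1)] elim(1) km by (auto simp: c_def y_def)
    have "ev F (lin e d (xs (r n))) (lin k m y) = 0"
      using Yev [of "r n"] c by (simp add: ev_sc_right [OF bih])
    then have "Pr (xs (r n)) (PT (lin k m y))"
      using \<delta>(2) xy(1) elim(2,3) unfolding y_def by blast
    moreover have "PT (lin k m y) = ys (r n)"
      using PT_sc [OF c(1) lin_nonzero [OF km]] YPT [of "r n"] c(2) by metis
    ultimately show False using xy(4) by metis
  qed
  then show False by simp
qed

text \<open>The column over \<open>e\<close> has a point off the curve. If this is the point at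
  infinity of the chart, then the polynomial in the chart has a nonzero leading coefficient and
  still does not vanish identically.\<close>

lemma chart_nonzero:
  assumes "bihomogeneous a b F" "smf F" "b \<ge> 1" "e \<noteq> 0" "dt k m \<noteq> 0"
  obtains y where "ev F e (lin k m y) \<noteq> 0"
proof -
  obtain Y where Y: "Y \<noteq> 0" "ev F e Y \<noteq> 0" using column_not_contained [OF assms(1-4)] by blast
  show ?thesis
  proof (cases "dt Y m = 0")
    case False
    have "ev F e (lin k m (dt k Y / dt Y m)) \<noteq> 0"
      using basis_expand_lin [OF assms(5) False] Y(2) by (metis ev_sc_right [OF assms(1)] mult_zero_right)
    then show ?thesis by (rule that)
  next
    case True
    then obtain t where t: "m = sc t Y" using dt_eq_0E [of Y m] Y(1) by blast
    have "t \<noteq> 0" using t dt_nonzeroD(2) [OF assms(5)] by auto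
    then have "ev F e m \<noteq> 0" using Y(2) t by (simp add: ev_sc_right [OF assms(1)])
    moreover obtain p where "Polynomial.coeff p b = ev F e m" "\<And>y. poly p y = ev F e (lin k m y)"
      using bform_poly [OF bform_ev [OF assms(1)], where m = m and k = k] by metis
    ultimately show ?thesis using that poly_all_0_iff_0 [of p] by (metis coeff_0)
  qed
qed

text \<open>In the chart \<open>kap\<close> is \<open>d2 f / dt k m\<close> on the curve, so this is
  the estimate for slices in intrinsic terms: near any column \<open>kap\<close> has no zero off the
  column itself, and \<open>x / kap\<close> tends to \<open>0\<close> even at a ramification
  point.\<close>

lemma local_small:
  assumes bih: "bihomogeneous a b F" and "smf F" "b \<ge> 1" and ed: "dt e d \<noteq> 0" and km: "dt k m \<noteq> 0"
    and ek: "ev F e k = 0" and "\<epsilon> > 0"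
  shows "\<exists>\<delta>>0. \<forall>x y. x \<noteq> 0 \<longrightarrow> norm x < \<delta> \<longrightarrow> norm y < \<delta> \<longrightarrow>
      ev F (lin e d x) (lin k m y) = 0 \<longrightarrow> kap F (lin e d x) (lin k m y) \<noteq> 0 \<and>
      norm x \<le> \<epsilon> * norm (kap F (lin e d x) (lin k m y))"
proof -
  define f where "f = (\<lambda>x y. ev F (lin e d x) (lin k m y))"
  have f: "poly2 f" unfolding f_def by (rule poly2_slice [OF bih])
  obtain y1 where y1: "f 0 y1 \<noteq> 0"
    using chart_nonzero [OF bih assms(2,3) dt_nonzeroD(1) [OF ed] km] unfolding f_def by auto
  have "dX F e k d \<noteq> 0 \<or> dY F e k m \<noteq> 0"
    using assms(2) ek ed km dt_nonzeroD(1) [OF ed] dt_nonzeroD(1) [OF km] unfolding smf_def by blast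
  then have "d1 f 0 0 \<noteq> 0 \<or> d2 f 0 0 \<noteq> 0"
    by (simp add: f_def d1_slice d2_slice)
  moreover have "f 0 0 = 0" using ek by (simp add: f_def)
  moreover have "\<epsilon> / norm (dt k m) > 0" using assms(7) km by simp
  ultimately obtain \<delta> where \<delta>: "\<delta> > 0" "\<And>x y. x \<noteq> 0 \<Longrightarrow> norm x < \<delta> \<Longrightarrow> norm y < \<delta> \<Longrightarrow>
      f x y = 0 \<Longrightarrow> d2 f x y \<noteq> 0 \<and> norm x \<le> \<epsilon> / norm (dt k m) * norm (d2 f x y)"
    using poly2_slice_small [OF f _ _ y1] by blast
  show ?thesis
  proof (intro exI [of _ \<delta>] conjI [OF \<delta>(1)] allI impI)
    fix x y assume *: "x \<noteq> 0" "norm x < \<delta>" "norm y < \<delta>" "ev F (lin e d x) (lin k m y) = 0"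
    have "d2 f x y = kap F (lin e d x) (lin k m y) * dt k m"
      unfolding f_def d2_slice dY_eq_kap [OF bih lin_nonzero [OF km] *(4)] by simp
    then show "kap F (lin e d x) (lin k m y) \<noteq> 0 \<and> norm x \<le> \<epsilon> * norm (kap F (lin e d x) (lin k m y))"
      using \<delta>(2) [OF *(1-3)] *(4) km by (simp add: f_def norm_mult)
  qed
qed

lemma kap_rp_nonzero_iff:
  assumes "bihomogeneous a b F" "b \<ge> 2" "Y \<noteq> 0" "ev F X Y = 0"
  shows "kap F X (rp (PT Y)) \<noteq> 0 \<longleftrightarrow> kap F X Y \<noteq> 0"
proof -
  obtain t where "t \<noteq> 0" "rp (PT Y) = sc t Y" using rp_PTE assms(3) by blast
  then show ?thesis using kap_sc [OF assms(1,3,4), of t 1] assms(2) by simp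
qed

lemma unram_rp:
  assumes "bihomogeneous a b F" "b \<ge> 2"
  shows "unram F X \<longleftrightarrow> (\<forall>y\<in>col F X. kap F X (rp y) \<noteq> 0)"
proof
  assume "\<forall>y\<in>col F X. kap F X (rp y) \<noteq> 0"
  then show "unram F X"
    unfolding unram_def using kap_rp_nonzero_iff [OF assms] col_iff [OF assms(1)] by blast
qed (use rp(1) in \<open>auto simp: unram_def col_iff_rp\<close>)

lemma unram_punctured:
  assumes "bihomogeneous a b F" "smf F" "b \<ge> 2" "dt e d \<noteq> 0"
  shows "\<exists>\<delta>>0. \<forall>x. x \<noteq> 0 \<longrightarrow> norm x < \<delta> \<longrightarrow> unram F (lin e d x)"
proof -
  have "\<exists>\<delta>>0. \<forall>x. x \<noteq> 0 \<longrightarrow> norm x < \<delta> \<longrightarrow> (\<forall>y\<in>col F (lin e d x). kap F (lin e d x) (rp y) \<noteq> 0)"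
  proof (rule column_local_global [OF assms(1,4)])
    fix k m assume km: "dt k m \<noteq> 0" and ek: "ev F e k = 0"
    have "b \<ge> 1" using assms(3) by simp
    from local_small [OF assms(1,2) this assms(4) km ek zero_less_one]
    obtain \<delta> where \<delta>: "\<delta> > 0" "\<And>x y. x \<noteq> 0 \<Longrightarrow> norm x < \<delta> \<Longrightarrow> norm y < \<delta> \<Longrightarrow>
      ev F (lin e d x) (lin k m y) = 0 \<Longrightarrow> kap F (lin e d x) (lin k m y) \<noteq> 0"
      by blast
    then show "\<exists>\<delta>>0. \<forall>x y. x \<noteq> 0 \<longrightarrow> norm x < \<delta> \<longrightarrow> norm y < \<delta> \<longrightarrow> ev F (lin e d x) (lin k m y) = 0 \<longrightarrow>
        kap F (lin e d x) (rp (PT (lin k m y))) \<noteq> 0"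
      using kap_rp_nonzero_iff [OF assms(1,3) lin_nonzero [OF km]] by (intro exI [of _ \<delta>]) auto
  qed
  then show ?thesis using unram_rp [OF assms(1,3)] by simp
qed

lemma lin_infinity: "x \<noteq> 0 \<Longrightarrow> lin e d x = sc x (lin d e (inverse x))"
  by (simp add: lin_def sc_def field_simps)

text \<open>Ramified columns are isolated, also around \<open>PT d\<close>: for large
  \<open>x\<close> the chart centred at \<open>d\<close> with coordinate \<open>1 / x\<close>
  applies.\<close>

lemma finite_ramified:
  assumes "bihomogeneous a b F" "smf F" "b \<ge> 2" "dt e d \<noteq> 0"
  shows "finite {x. \<not> unram F (lin e d x)}"
proof -
  obtain \<delta> where \<delta>: "\<delta> > 0" "\<And>x. x \<noteq> 0 \<Longrightarrow> norm x < \<delta> \<Longrightarrow> unram F (lin d e x)"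
    using unram_punctured [OF assms(1-3), of d e] assms(4) dt_commute [of e d] by auto
  show ?thesis
  proof (rule finite_isolated)
    show "\<exists>\<delta>>0. \<forall>x. x \<noteq> 0 \<longrightarrow> norm x < \<delta> \<longrightarrow> unram F (lin e d (s + x))" for s
      using unram_punctured [OF assms(1-3), of "lin e d s" d] assms(4) by (simp add: lin_lin)
    fix x :: complex assume x: "norm x > inverse \<delta>"
    then have x0: "x \<noteq> 0" using \<delta>(1) by auto
    have "norm (inverse x) < \<delta>"
      using less_imp_inverse_less [OF x] \<delta>(1) by (simp add: norm_inverse)
    then have "unram F (lin d e (inverse x))" using \<delta>(2) x0 by simp
    then show "unram F (lin e d x)"
      unfolding lin_infinity [OF x0] using unram_sc [OF assms(1) x0 assms(3)] by simp
  qed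
qed

text \<open>Over an unramified column each of the \<open>b\<close> points extends to a branch by the
  implicit function theorem. Different branches stay apart near \<open>e\<close>, and no column has
  more than \<open>b\<close> points, so the branches exhaust the neighbouring columns.\<close>

lemma branches:
  assumes bih: "bihomogeneous a b F" and "smf F" "b \<ge> 2" and ed: "dt e d \<noteq> 0" and "unram F e"
  shows "\<exists>r>0. \<exists>g. (\<forall>y\<in>col F e. g y holomorphic_on ball 0 r \<and> g y 0 = 0 \<and>
      (\<forall>x\<in>ball 0 r. ev F (lin e d x) (lin (rp y) (perp (rp y)) (g y x)) = 0)) \<and>
    (\<forall>x\<in>ball 0 r. inj_on (\<lambda>y. PT (lin (rp y) (perp (rp y)) (g y x))) (col F e) \<and>
      col F (lin e d x) = (\<lambda>y. PT (lin (rp y) (perp (rp y)) (g y x))) ` col F e)"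
proof -
  have b1: "b \<ge> 1" using assms(3) by simp
  have e0: "e \<noteq> 0" using dt_nonzeroD(1) [OF ed] .
  note fin = col_card(1) [OF bih assms(2) b1 e0]
  have "\<exists>\<delta> g. \<delta> > 0 \<and> g holomorphic_on ball 0 \<delta> \<and> g 0 = 0 \<and>
      (\<forall>x\<in>ball 0 \<delta>. ev F (lin e d x) (lin (rp y) (perp (rp y)) (g x)) = 0)"
    if y: "y \<in> col F e" for y
  proof -
    have z: "ev F e (rp y) = 0" using y by (simp add: col_iff_rp)
    have "dY F e (rp y) (perp (rp y)) \<noteq> 0"
      using assms(5) rp(1) [of y] z dt_perp_nonzero dY_eq_kap [OF bih rp(1) z]
      by (simp add: unram_def del: split_paired_All)
    then have "d2 (\<lambda>x t. ev F (lin e d x) (lin (rp y) (perp (rp y)) t)) 0 0 \<noteq> 0"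
      by (simp add: d2_slice)
    from implicit_function [OF poly2_slice [OF bih] _ this]
    obtain \<delta> \<epsilon> g where "\<delta> > 0" "g holomorphic_on ball 0 \<delta>" "g 0 = 0"
      "\<forall>x. norm x < \<delta> \<longrightarrow> norm (g x) < \<epsilon> \<and> ev F (lin e d x) (lin (rp y) (perp (rp y)) (g x)) = 0"
      using z by auto
    then show ?thesis by (intro exI [of _ \<delta>] exI [of _ g]) auto
  qed
  then obtain \<delta> g where g: "\<And>y. y \<in> col F e \<Longrightarrow> \<delta> y > 0 \<and> g y holomorphic_on ball 0 (\<delta> y) \<and> g y 0 = 0 \<and>
      (\<forall>x\<in>ball 0 (\<delta> y). ev F (lin e d x) (lin (rp y) (perp (rp y)) (g y x)) = 0)"
    by metis
  define h where "h y x = lin (rp y) (perp (rp y)) (g y x)" for y x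
  have hnz: "h y x \<noteq> 0" for y x
    unfolding h_def by (intro lin_nonzero dt_perp_nonzero rp)
  have cont: "(g y \<longlongrightarrow> 0) (at 0)" if "y \<in> col F e" for y
    using g [OF that] holomorphic_on_imp_continuous_on [of "g y" "ball 0 (\<delta> y)"]
    by (metis centre_in_ball continuous_on_eq_continuous_at isCont_def open_ball)
  have "\<forall>\<^sub>F x in at 0. \<forall>y\<in>col F e. \<forall>y'\<in>col F e. y \<noteq> y' \<longrightarrow> dt (h y x) (h y' x) \<noteq> 0"
  proof (intro eventually_ball_finite fin ballI)
    fix y y' assume yy: "y \<in> col F e" "y' \<in> col F e"
    show "\<forall>\<^sub>F x in at 0. y \<noteq> y' \<longrightarrow> dt (h y x) (h y' x) \<noteq> 0"
    proof (cases "y = y'")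
      case False
      have "((\<lambda>x. dt (h y x) (h y' x)) \<longlongrightarrow> dt (lin (rp y) (perp (rp y)) 0) (lin (rp y') (perp (rp y')) 0)) (at 0)"
        unfolding h_def by (intro dt_tendsto lin_tendsto cont yy)
      moreover have "dt (lin (rp y) (perp (rp y)) 0) (lin (rp y') (perp (rp y')) 0) \<noteq> 0"
        using False PT_eq_iff [OF rp(1) rp(1), of y y'] by (simp add: rp)
      ultimately have "\<forall>\<^sub>F x in at 0. dt (h y x) (h y' x) \<noteq> 0"
        by (rule tendsto_imp_eventually_ne)
      then show ?thesis by eventually_elim simp
    qed simp
  qed
  then obtain r1 where r1: "r1 > 0" "\<And>x y y'. x \<noteq> 0 \<Longrightarrow> norm x < r1 \<Longrightarrow> y \<in> col F e \<Longrightarrow> y' \<in> col F e \<Longrightarrow>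
      y \<noteq> y' \<Longrightarrow> dt (h y x) (h y' x) \<noteq> 0"
    unfolding eventually_at by (auto simp: dist_norm)
  define r where "r = Min (insert r1 (\<delta> ` col F e))"
  have r: "r > 0" "r \<le> r1" "\<And>y. y \<in> col F e \<Longrightarrow> r \<le> \<delta> y"
    using fin r1 g by (auto simp: r_def)
  have inj: "inj_on (\<lambda>y. PT (h y x)) (col F e)" if x: "x \<in> ball 0 r" for x
  proof (rule inj_onI)
    fix y y' assume yy: "y \<in> col F e" "y' \<in> col F e" and eq: "PT (h y x) = PT (h y' x)"
    show "y = y'"
    proof (cases "x = 0")
      case True
      then show ?thesis using eq g [OF yy(1)] g [OF yy(2)] by (simp add: h_def rp)
    next
      case False
      then show ?thesis
        using eq r1(2) [OF False _ yy] r x PT_eq_iff [OF hnz hnz] by fastforce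
    qed
  qed
  have sub: "(\<lambda>y. PT (h y x)) ` col F e \<subseteq> col F (lin e d x)" if x: "x \<in> ball 0 r" for x
  proof clarify
    fix y assume y: "y \<in> col F e"
    have "x \<in> ball 0 (\<delta> y)" using x r(3) [OF y] by auto
    then show "PT (h y x) \<in> col F (lin e d x)"
      using g [OF y] col_iff [OF bih hnz] by (simp add: h_def)
  qed
  have eq: "col F (lin e d x) = (\<lambda>y. PT (h y x)) ` col F e" if x: "x \<in> ball 0 r" for x
  proof (rule sym, rule card_subset_eq)
    have l0: "lin e d x \<noteq> 0" by (rule lin_nonzero [OF ed])
    show f: "finite (col F (lin e d x))" by (rule col_card(1) [OF bih assms(2) b1 l0])
    have "card ((\<lambda>y. PT (h y x)) ` col F e) = b"
      unfolding card_image [OF inj [OF x]] by (rule col_card(3) [OF bih assms(2) b1 e0 assms(5)])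
    moreover have "card ((\<lambda>y. PT (h y x)) ` col F e) \<le> card (col F (lin e d x))"
      by (rule card_mono [OF f sub [OF x]])
    ultimately show "card ((\<lambda>y. PT (h y x)) ` col F e) = card (col F (lin e d x))"
      using col_card(2) [OF bih assms(2) b1 l0] by simp
  qed (rule sub [OF x])
  show ?thesis
  proof (rule exI [of _ r], rule conjI [OF r(1)], rule exI [of _ g], intro conjI [of "Ball _ _"] ballI)
    fix y assume y: "y \<in> col F e"
    have "ball 0 r \<subseteq> ball (0 :: complex) (\<delta> y)" using r(3) [OF y] by (rule subset_ball)
    then show "g y holomorphic_on ball 0 r \<and> g y 0 = 0 \<and>
      (\<forall>x\<in>ball 0 r. ev F (lin e d x) (lin (rp y) (perp (rp y)) (g y x)) = 0)"
      using g [OF y] by (auto intro: holomorphic_on_subset)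
  next
    fix x :: complex assume x: "x \<in> ball 0 r"
    show "inj_on (\<lambda>y. PT (lin (rp y) (perp (rp y)) (g y x))) (col F e) \<and>
        col F (lin e d x) = (\<lambda>y. PT (lin (rp y) (perp (rp y)) (g y x))) ` col F e"
      using inj [OF x] eq [OF x] by (simp add: h_def)
  qed
qed

section \<open>Sums over the columns of the curve\<close>

text \<open>A local quotient of polynomial functions without common zeros on the curve.
  \<open>Q\<close> is the set of poles, where the value of \<open>\<xi>\<close> is arbitrary.
  Besides the coordinate of a map, the constant \<open>1\<close> with \<open>Q = {}\<close> will be
  an instance.\<close>

definition merom :: "form \<Rightarrow> (proj1 \<times> proj1 \<Rightarrow> complex) \<Rightarrow> (proj1 \<times> proj1) set \<Rightarrow> bool" where
  "merom F \<xi> Q \<longleftrightarrow> (\<forall>e d k m. dt e d \<noteq> 0 \<longrightarrow> dt k m \<noteq> 0 \<longrightarrow> ev F e k = 0 \<longrightarrow>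
     (\<exists>M N \<delta>. poly2 M \<and> poly2 N \<and> \<delta> > 0 \<and>
       (\<forall>x y. norm x < \<delta> \<longrightarrow> norm y < \<delta> \<longrightarrow> ev F (lin e d x) (lin k m y) = 0 \<longrightarrow>
         (M x y \<noteq> 0 \<or> N x y \<noteq> 0) \<and>
         ((PT (lin e d x), PT (lin k m y)) \<in> Q \<longleftrightarrow> N x y = 0) \<and>
         (N x y \<noteq> 0 \<longrightarrow> \<xi> (PT (lin e d x), PT (lin k m y)) = M x y / N x y))))"

text \<open>The order of a pole is measured by the first coordinate, hence the condition on ramification.\<close>

definition simple_poles :: "form \<Rightarrow> (proj1 \<times> proj1 \<Rightarrow> complex) \<Rightarrow> (proj1 \<times> proj1) set \<Rightarrow> bool" where
  "simple_poles F \<xi> Q \<longleftrightarrow> (\<forall>e d k m. dt e d \<noteq> 0 \<longrightarrow> dt k m \<noteq> 0 \<longrightarrow> ev F e k = 0 \<longrightarrow>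
     (PT e, PT k) \<in> Q \<longrightarrow> unram F e \<and>
     (\<exists>B \<delta>. \<delta> > 0 \<and> (\<forall>x y. x \<noteq> 0 \<longrightarrow> norm x < \<delta> \<longrightarrow> norm y < \<delta> \<longrightarrow>
       ev F (lin e d x) (lin k m y) = 0 \<longrightarrow>
       (PT (lin e d x), PT (lin k m y)) \<notin> Q \<and> norm (x * \<xi> (PT (lin e d x), PT (lin k m y))) \<le> B)))"

text \<open>One term of the trace of the differential
  \<open>P \<xi> dx / (\<partial>F/\<partial>y)\<close>, with \<open>kap\<close> in place of the
  affine derivative. If \<open>P\<close> has degree \<open>b - 2\<close> in \<open>Y\<close>, like
  \<open>kap\<close>, then the chosen representative of \<open>y\<close> does not matter.\<close>

definition tm :: "form \<Rightarrow> form \<Rightarrow> (proj1 \<times> proj1 \<Rightarrow> complex) \<Rightarrow> cvec \<Rightarrow> proj1 \<Rightarrow> complex" where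
  "tm F P \<xi> X y = ev P X (rp y) / kap F X (rp y) * \<xi> (PT X, y)"

text \<open>Homogeneous of degree \<open>-2\<close> in \<open>X\<close> if \<open>P\<close> has bidegree \<open>(a - 2, b - 2)\<close>, that is, a differential form
  on the line.\<close>

definition Rs :: "form \<Rightarrow> form \<Rightarrow> (proj1 \<times> proj1 \<Rightarrow> complex) \<Rightarrow> cvec \<Rightarrow> complex" where
  "Rs F P \<xi> X = (\<Sum>y\<in>col F X. tm F P \<xi> X y)"

lemma meromD:
  assumes "merom F \<xi> Q" "dt e d \<noteq> 0" "dt k m \<noteq> 0" "ev F e k = 0"
  shows "\<exists>M N \<delta>. poly2 M \<and> poly2 N \<and> \<delta> > 0 \<and>
       (\<forall>x y. norm x < \<delta> \<longrightarrow> norm y < \<delta> \<longrightarrow> ev F (lin e d x) (lin k m y) = 0 \<longrightarrow>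
         (M x y \<noteq> 0 \<or> N x y \<noteq> 0) \<and>
         ((PT (lin e d x), PT (lin k m y)) \<in> Q \<longleftrightarrow> N x y = 0) \<and>
         (N x y \<noteq> 0 \<longrightarrow> \<xi> (PT (lin e d x), PT (lin k m y)) = M x y / N x y))"
  using assms(1) [unfolded merom_def, rule_format, OF assms(2-4)] .

lemma simple_polesD:
  assumes "simple_poles F \<xi> Q" "dt e d \<noteq> 0" "dt k m \<noteq> 0" "ev F e k = 0" "(PT e, PT k) \<in> Q"
  shows "unram F e" and "\<exists>B \<delta>. \<delta> > 0 \<and> (\<forall>x y. x \<noteq> 0 \<longrightarrow> norm x < \<delta> \<longrightarrow> norm y < \<delta> \<longrightarrow>
       ev F (lin e d x) (lin k m y) = 0 \<longrightarrow>
       (PT (lin e d x), PT (lin k m y)) \<notin> Q \<and> norm (x * \<xi> (PT (lin e d x), PT (lin k m y))) \<le> B)"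
  using assms(1) [unfolded simple_poles_def, rule_format, OF assms(2-5)] by (rule conjunct1, rule conjunct2)

lemma tm_PT:
  assumes "bihomogeneous a b F" "bihomogeneous a' (b - 2) P" "b \<ge> 2" "Y \<noteq> 0" "ev F X Y = 0"
  shows "tm F P \<xi> X (PT Y) = ev P X Y / kap F X Y * \<xi> (PT X, PT Y)"
proof -
  obtain t where t: "t \<noteq> 0" "rp (PT Y) = sc t Y" using rp_PTE assms(4) by blast
  then show ?thesis
    unfolding tm_def using kap_sc [OF assms(1,4,5) t(1) assms(3), of 1]
    by (simp add: ev_sc_right [OF assms(2)])
qed

lemma Rs_sc:
  assumes "bihomogeneous a b F" "bihomogeneous (a - 2) (b - 2) P" "a \<ge> 2" "b \<ge> 2" "c \<noteq> 0" "X \<noteq> 0"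
  shows "Rs F P \<xi> (sc c X) = Rs F P \<xi> X / c\<^sup>2"
proof -
  have col: "col F (sc c X) = col F X"
    unfolding set_eq_iff col_iff_rp using assms(5) by (simp add: ev_sc_left [OF assms(1)])
  have "tm F P \<xi> (sc c X) y = tm F P \<xi> X y / c\<^sup>2" if "y \<in> col F X" for y
  proof -
    have z: "ev F X (rp y) = 0" using that by (simp add: col_iff_rp)
    have "c ^ a = c ^ (a - 2) * c\<^sup>2"
      using assms(3) by (metis le_add_diff_inverse2 power_add)
    then show ?thesis
      unfolding tm_def using kap_sc [OF assms(1) rp(1) z, of 1 c] assms(4,5)
      by (simp add: ev_sc_left [OF assms(2)] PT_sc [OF assms(5,6)])
  qed
  then show ?thesis unfolding Rs_def col by (simp add: sum_divide_distrib)
qed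

lemma poly2_bounded_near:
  assumes "poly2 f"
  shows "\<exists>\<delta>>0. \<exists>B>0. \<forall>x y. norm x < \<delta> \<longrightarrow> norm y < \<delta> \<longrightarrow> norm (f x y) \<le> B"
proof -
  obtain \<delta> where \<delta>: "\<delta> > 0" "\<And>x y. norm x < \<delta> \<Longrightarrow> norm y < \<delta> \<Longrightarrow> norm (f x y - f 0 0) < 1"
    using poly2_near [OF assms refl zero_less_one] by blast
  show ?thesis
  proof (rule exI [of _ \<delta>], rule conjI [OF \<delta>(1)], rule exI [of _ "norm (f 0 0) + 1"], intro conjI allI impI)
    fix x y :: complex assume "norm x < \<delta>" "norm y < \<delta>"
    then have "norm (f x y - f 0 0) < 1" by (rule \<delta>(2))
    then show "norm (f x y) \<le> norm (f 0 0) + 1" by norm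
  qed (simp add: add_nonneg_pos)
qed

lemma poly2_inverse_bounded_near:
  assumes "poly2 f" "f 0 0 \<noteq> 0"
  shows "\<exists>\<delta>>0. \<exists>B>0. \<forall>x y. norm x < \<delta> \<longrightarrow> norm y < \<delta> \<longrightarrow> f x y \<noteq> 0 \<and> norm (inverse (f x y)) \<le> B"
proof -
  define c where "c = norm (f 0 0)"
  have c: "c > 0" using assms(2) by (simp add: c_def)
  obtain \<delta> where \<delta>: "\<delta> > 0" "\<And>x y. norm x < \<delta> \<Longrightarrow> norm y < \<delta> \<Longrightarrow> norm (f x y - f 0 0) < c / 2"
    using poly2_near [OF assms(1) refl, of "c / 2"] c by auto
  show ?thesis
  proof (rule exI [of _ \<delta>], rule conjI [OF \<delta>(1)], rule exI [of _ "inverse (c / 2)"], rule conjI [rotated], intro allI impI)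
    fix x y :: complex assume "norm x < \<delta>" "norm y < \<delta>"
    then have "norm (f x y - f 0 0) < c / 2" by (rule \<delta>(2))
    then have 1: "c / 2 \<le> norm (f x y)" unfolding c_def by norm
    then have "inverse (norm (f x y)) \<le> inverse (c / 2)"
      using c by (intro le_imp_inverse_le) auto
    then show "f x y \<noteq> 0 \<and> norm (inverse (f x y)) \<le> inverse (c / 2)"
      using 1 c by (auto simp: norm_inverse)
  qed (use c in auto)
qed

text \<open>Away from the poles of \<open>\<xi>\<close> only the denominator \<open>kap\<close> can
  become small, and \<open>x / kap\<close> tends to \<open>0\<close> even at ramification points. So
  ramification contributes no pole to the trace.\<close>

lemma tm_regular_small:
  assumes bih: "bihomogeneous a b F" and "smf F" "b \<ge> 2" and P: "bihomogeneous a' (b - 2) P"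
    and mer: "merom F \<xi> Q" and ed: "dt e d \<noteq> 0" and km: "dt k m \<noteq> 0" and ek: "ev F e k = 0"
    and Q: "(PT e, PT k) \<notin> Q" and "\<epsilon> > 0"
  shows "\<exists>\<delta>>0. \<forall>x y. x \<noteq> 0 \<longrightarrow> norm x < \<delta> \<longrightarrow> norm y < \<delta> \<longrightarrow> ev F (lin e d x) (lin k m y) = 0 \<longrightarrow>
     (PT (lin e d x), PT (lin k m y)) \<notin> Q \<and> norm (x * tm F P \<xi> (lin e d x) (PT (lin k m y))) \<le> \<epsilon>"
proof -
  obtain M N \<delta>1 where MN: "poly2 M" "poly2 N" "\<delta>1 > 0"
    "\<And>x y. norm x < \<delta>1 \<Longrightarrow> norm y < \<delta>1 \<Longrightarrow> ev F (lin e d x) (lin k m y) = 0 \<Longrightarrow>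
         (M x y \<noteq> 0 \<or> N x y \<noteq> 0) \<and>
         ((PT (lin e d x), PT (lin k m y)) \<in> Q \<longleftrightarrow> N x y = 0) \<and>
         (N x y \<noteq> 0 \<longrightarrow> \<xi> (PT (lin e d x), PT (lin k m y)) = M x y / N x y)"
    using meromD [OF mer ed km ek] by (elim exE conjE) blast
  have N0: "N 0 0 \<noteq> 0" using MN(3) MN(4) [of 0 0] ek Q by auto
  obtain BM \<delta>2 where BM: "\<delta>2 > 0" "BM > 0" "\<And>x y. norm x < \<delta>2 \<Longrightarrow> norm y < \<delta>2 \<Longrightarrow> norm (M x y) \<le> BM"
    using poly2_bounded_near [OF MN(1)] by blast
  obtain BN \<delta>3 where BN: "\<delta>3 > 0" "BN > 0"
    "\<And>x y. norm x < \<delta>3 \<Longrightarrow> norm y < \<delta>3 \<Longrightarrow> N x y \<noteq> 0 \<and> norm (inverse (N x y)) \<le> BN"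
    using poly2_inverse_bounded_near [OF MN(2) N0] by blast
  obtain BP \<delta>4 where BP: "\<delta>4 > 0" "BP > 0"
    "\<And>x y. norm x < \<delta>4 \<Longrightarrow> norm y < \<delta>4 \<Longrightarrow> norm (ev P (lin e d x) (lin k m y)) \<le> BP"
    using poly2_bounded_near [OF poly2_slice [OF P, of e d k m]] by blast
  define \<epsilon>' where "\<epsilon>' = \<epsilon> / (BP * BM * BN)"
  have \<epsilon>': "\<epsilon>' > 0" using assms(10) BM BN BP by (simp add: \<epsilon>'_def)
  have b1: "b \<ge> 1" using assms(3) by simp
  obtain \<delta>5 where \<delta>5: "\<delta>5 > 0" "\<And>x y. x \<noteq> 0 \<Longrightarrow> norm x < \<delta>5 \<Longrightarrow> norm y < \<delta>5 \<Longrightarrow>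
      ev F (lin e d x) (lin k m y) = 0 \<Longrightarrow> kap F (lin e d x) (lin k m y) \<noteq> 0 \<and>
      norm x \<le> \<epsilon>' * norm (kap F (lin e d x) (lin k m y))"
    using local_small [OF bih assms(2) b1 ed km ek \<epsilon>'] by blast
  show ?thesis
  proof (rule exI [of _ "min \<delta>1 (min \<delta>2 (min \<delta>3 (min \<delta>4 \<delta>5)))"], rule conjI [rotated], intro allI impI)
    fix x y
    assume x0: "x \<noteq> 0" and x: "norm x < min \<delta>1 (min \<delta>2 (min \<delta>3 (min \<delta>4 \<delta>5)))"
      and y: "norm y < min \<delta>1 (min \<delta>2 (min \<delta>3 (min \<delta>4 \<delta>5)))"
      and z: "ev F (lin e d x) (lin k m y) = 0"
    let ?\<kappa> = "kap F (lin e d x) (lin k m y)" and ?P = "ev P (lin e d x) (lin k m y)"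
    have x': "norm x < \<delta>1" "norm x < \<delta>2" "norm x < \<delta>3" "norm x < \<delta>4" "norm x < \<delta>5"
      and y': "norm y < \<delta>1" "norm y < \<delta>2" "norm y < \<delta>3" "norm y < \<delta>4" "norm y < \<delta>5"
      using x y unfolding min_less_iff_conj by blast+
    have N: "N x y \<noteq> 0" "norm (inverse (N x y)) \<le> BN" using BN(3) [OF x'(3) y'(3)] by blast+
    have PB: "norm ?P \<le> BP" by (rule BP(3) [OF x'(4) y'(4)])
    have MB: "norm (M x y) \<le> BM" by (rule BM(3) [OF x'(2) y'(2)])
    have \<xi>: "(PT (lin e d x), PT (lin k m y)) \<notin> Q"
      "\<xi> (PT (lin e d x), PT (lin k m y)) = M x y * inverse (N x y)"
      using MN(4) [OF x'(1) y'(1) z] N(1) unfolding divide_inverse by blast+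
    have \<kappa>: "?\<kappa> \<noteq> 0" "norm x \<le> \<epsilon>' * norm ?\<kappa>" using \<delta>5(2) [OF x0 x'(5) y'(5) z] by blast+
    have k1: "norm (x / ?\<kappa>) \<le> \<epsilon>'" using \<kappa> by (simp add: norm_divide divide_le_eq)
    have "x * tm F P \<xi> (lin e d x) (PT (lin k m y)) = (x / ?\<kappa>) * ?P * M x y * inverse (N x y)"
      unfolding tm_PT [OF bih P assms(3) lin_nonzero [OF km] z] \<xi>(2) by simp
    also have "norm \<dots> = norm (x / ?\<kappa>) * norm ?P * norm (M x y) * norm (inverse (N x y))"
      by (simp only: norm_mult)
    also have "\<dots> \<le> \<epsilon>' * BP * BM * BN"
      by (intro mult_mono k1 PB MB N(2) mult_nonneg_nonneg norm_ge_zero less_imp_le [OF \<epsilon>']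
          less_imp_le [OF BP(2)] less_imp_le [OF BM(2)])
    also have "\<dots> = \<epsilon>" using BM BN BP by (simp add: \<epsilon>'_def)
    finally show "(PT (lin e d x), PT (lin k m y)) \<notin> Q \<and>
        norm (x * tm F P \<xi> (lin e d x) (PT (lin k m y))) \<le> \<epsilon>"
      using \<xi>(1) by simp
  qed (use MN BM BN BP \<delta>5 in auto)
qed

text \<open>A pole lies on an unramified column, where \<open>kap\<close> stays away from
  \<open>0\<close>, and \<open>x * \<xi>\<close> is bounded because the pole is simple. What remains
  is the factor \<open>P\<close>, so a zero of \<open>P\<close> removes the pole of the
  term.\<close>

lemma tm_pole_bound:
  assumes bih: "bihomogeneous a b F" and "b \<ge> 2" and P: "bihomogeneous a' (b - 2) P"
    and sp: "simple_poles F \<xi> Q" and ed: "dt e d \<noteq> 0" and km: "dt k m \<noteq> 0" and ek: "ev F e k = 0"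
    and Q: "(PT e, PT k) \<in> Q"
  shows "\<exists>\<delta>>0. \<exists>B>0. \<forall>x y. x \<noteq> 0 \<longrightarrow> norm x < \<delta> \<longrightarrow> norm y < \<delta> \<longrightarrow> ev F (lin e d x) (lin k m y) = 0 \<longrightarrow>
     (PT (lin e d x), PT (lin k m y)) \<notin> Q \<and>
     norm (x * tm F P \<xi> (lin e d x) (PT (lin k m y))) \<le> B * norm (ev P (lin e d x) (lin k m y))"
proof -
  obtain B1 \<delta>1 where 1: "\<delta>1 > 0"
    "\<And>x y. x \<noteq> 0 \<Longrightarrow> norm x < \<delta>1 \<Longrightarrow> norm y < \<delta>1 \<Longrightarrow> ev F (lin e d x) (lin k m y) = 0 \<Longrightarrow>
       (PT (lin e d x), PT (lin k m y)) \<notin> Q \<and> norm (x * \<xi> (PT (lin e d x), PT (lin k m y))) \<le> B1"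
    using simple_polesD(2) [OF sp ed km ek Q] by (elim exE conjE) blast
  define f where "f = (\<lambda>x y. ev F (lin e d x) (lin k m y))"
  have f: "poly2 f" unfolding f_def by (rule poly2_slice [OF bih])
  have k0: "k \<noteq> 0" using dt_nonzeroD(1) [OF km] .
  have kap: "kap F (lin e d x) (lin k m y) = d2 f x y / dt k m" if "f x y = 0" for x y
    using dY_eq_kap [OF bih lin_nonzero [OF km], of "lin e d x" y m] that km by (simp add: f_def d2_slice)
  have "d2 f 0 0 \<noteq> 0"
    using kap [of 0 0] simple_polesD(1) [OF sp ed km ek Q] k0 ek by (auto simp: unram_def f_def)
  then obtain B2 \<delta>2 where 2: "\<delta>2 > 0" "B2 > 0"
    "\<And>x y. norm x < \<delta>2 \<Longrightarrow> norm y < \<delta>2 \<Longrightarrow> d2 f x y \<noteq> 0 \<and> norm (inverse (d2 f x y)) \<le> B2"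
    using poly2_inverse_bounded_near [OF poly2_d2 [OF f]] by blast
  show ?thesis
  proof (rule exI [of _ "min \<delta>1 \<delta>2"], rule conjI [rotated], rule exI [of _ "\<bar>B1\<bar> * (B2 * norm (dt k m)) + 1"],
      rule conjI [rotated], intro allI impI)
    fix x y assume *: "x \<noteq> 0" "norm x < min \<delta>1 \<delta>2" "norm y < min \<delta>1 \<delta>2" "ev F (lin e d x) (lin k m y) = 0"
    let ?\<xi> = "\<xi> (PT (lin e d x), PT (lin k m y))" and ?P = "ev P (lin e d x) (lin k m y)"
    have \<xi>: "(PT (lin e d x), PT (lin k m y)) \<notin> Q" "norm (x * ?\<xi>) \<le> \<bar>B1\<bar>"
      using 1(2) [of x y] * by auto
    have d2: "norm (inverse (d2 f x y)) \<le> B2" using 2(3) [of x y] * by auto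
    have "x * tm F P \<xi> (lin e d x) (PT (lin k m y)) = (x * ?\<xi>) * (inverse (d2 f x y) * dt k m) * ?P"
      unfolding tm_PT [OF bih P assms(2) lin_nonzero [OF km] *(4)]
      using kap [of x y] *(4) by (simp add: f_def field_simps)
    also have "norm \<dots> = norm (x * ?\<xi>) * (norm (inverse (d2 f x y)) * norm (dt k m)) * norm ?P"
      by (simp only: norm_mult)
    also have "\<dots> \<le> (\<bar>B1\<bar> * (B2 * norm (dt k m)) + 1) * norm ?P"
    proof (rule mult_right_mono)
      have "norm (x * ?\<xi>) * (norm (inverse (d2 f x y)) * norm (dt k m)) \<le> \<bar>B1\<bar> * (B2 * norm (dt k m))"
        using \<xi>(2) d2 2(2) by (intro mult_mono) auto
      then show "norm (x * ?\<xi>) * (norm (inverse (d2 f x y)) * norm (dt k m)) \<le> \<bar>B1\<bar> * (B2 * norm (dt k m)) + 1"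
        by simp
    qed auto
    finally show "(PT (lin e d x), PT (lin k m y)) \<notin> Q \<and>
     norm (x * tm F P \<xi> (lin e d x) (PT (lin k m y))) \<le> (\<bar>B1\<bar> * (B2 * norm (dt k m)) + 1) * norm ?P"
      using \<xi>(1) by simp
  qed (use 1 2 in \<open>auto intro!: add_nonneg_pos\<close>)
qed

lemma tm_small:
  assumes bih: "bihomogeneous a b F" and "smf F" "b \<ge> 2" and P: "bihomogeneous a' (b - 2) P"
    and mer: "merom F \<xi> Q" and sp: "simple_poles F \<xi> Q" and ed: "dt e d \<noteq> 0"
    and km: "dt k m \<noteq> 0" and ek: "ev F e k = 0" and van: "(PT e, PT k) \<in> Q \<Longrightarrow> ev P e k = 0"
    and \<epsilon>: "\<epsilon> > 0"
  shows "\<exists>\<delta>>0. \<forall>x y. x \<noteq> 0 \<longrightarrow> norm x < \<delta> \<longrightarrow> norm y < \<delta> \<longrightarrow> ev F (lin e d x) (lin k m y) = 0 \<longrightarrow>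
        norm (x * tm F P \<xi> (lin e d x) (PT (lin k m y))) \<le> \<epsilon>"
proof (cases "(PT e, PT k) \<in> Q")
  case False
  then show ?thesis
    using tm_regular_small [OF bih assms(2,3) P mer ed km ek False \<epsilon>] by blast
next
  case True
  obtain \<delta> B where B: "\<delta> > 0" "B > 0" "\<And>x y. x \<noteq> 0 \<Longrightarrow> norm x < \<delta> \<Longrightarrow> norm y < \<delta> \<Longrightarrow>
    ev F (lin e d x) (lin k m y) = 0 \<Longrightarrow>
    norm (x * tm F P \<xi> (lin e d x) (PT (lin k m y))) \<le> B * norm (ev P (lin e d x) (lin k m y))"
    using tm_pole_bound [OF bih assms(3) P sp ed km ek True] by blast
  have "ev P (lin e d 0) (lin k m 0) = 0"
    using van [OF True] by simp
  moreover have "\<epsilon> / B > 0" using \<epsilon> B by simp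
  ultimately obtain \<delta>' where \<delta>': "\<delta>' > 0"
    "\<And>x y. norm x < \<delta>' \<Longrightarrow> norm y < \<delta>' \<Longrightarrow> norm (ev P (lin e d x) (lin k m y) - 0) < \<epsilon> / B"
    using poly2_near [OF poly2_slice [OF P, of e d k m]] by blast
  have "norm (x * tm F P \<xi> (lin e d x) (PT (lin k m y))) \<le> \<epsilon>"
    if "x \<noteq> 0" "norm x < min \<delta> \<delta>'" "norm y < min \<delta> \<delta>'" "ev F (lin e d x) (lin k m y) = 0" for x y
  proof -
    have "norm (x * tm F P \<xi> (lin e d x) (PT (lin k m y))) \<le> B * norm (ev P (lin e d x) (lin k m y))"
      using B(3) [of x y] that by auto
    also have "\<dots> \<le> B * (\<epsilon> / B)"
      using \<delta>'(2) [of x y] that B(2) by (intro mult_left_mono) auto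
    also have "\<dots> = \<epsilon>" using B(2) by simp
    finally show ?thesis .
  qed
  moreover have "min \<delta> \<delta>' > 0" using B \<delta>' by simp
  ultimately show ?thesis by blast
qed

lemma sum_le_card_mult:
  fixes f :: "'a \<Rightarrow> complex"
  assumes "card A \<le> b" "\<And>y. y \<in> A \<Longrightarrow> norm (f y) \<le> \<epsilon>" "\<epsilon> \<ge> 0"
  shows "norm (sum f A) \<le> real b * \<epsilon>"
proof -
  have "norm (sum f A) \<le> real (card A) * \<epsilon>"
    using sum_norm_bound [of A f \<epsilon>] assms(2) by simp
  also have "\<dots> \<le> real b * \<epsilon>" using assms(1,3) by (intro mult_right_mono) auto
  finally show ?thesis .
qed

text \<open>The estimate for single terms is uniform on neighbouring columns by
  \<open>column_local_global\<close>, and a column has at most \<open>b\<close> terms.\<close>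

lemma column_tendsto_0:
  fixes w :: "complex \<Rightarrow> proj1 \<Rightarrow> complex"
  assumes bih: "bihomogeneous a b F" and "smf F" "b \<ge> 1" and ed: "dt e d \<noteq> 0"
    and small: "\<And>k m \<epsilon>. dt k m \<noteq> 0 \<Longrightarrow> ev F e k = 0 \<Longrightarrow> \<epsilon> > 0 \<Longrightarrow>
      \<exists>\<delta>>0. \<forall>x y. x \<noteq> 0 \<longrightarrow> norm x < \<delta> \<longrightarrow> norm y < \<delta> \<longrightarrow> ev F (lin e d x) (lin k m y) = 0 \<longrightarrow>
        norm (w x (PT (lin k m y))) \<le> \<epsilon>"
  shows "((\<lambda>x. \<Sum>y\<in>col F (lin e d x). w x y) \<longlongrightarrow> 0) (at 0)"
proof (rule tendstoI)
  fix \<epsilon> :: real assume \<epsilon>: "\<epsilon> > 0"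
  define \<epsilon>' where "\<epsilon>' = \<epsilon> / (2 * real b)"
  have \<epsilon>': "\<epsilon>' > 0" "real b * \<epsilon>' < \<epsilon>" using \<epsilon> assms(3) by (auto simp: \<epsilon>'_def field_simps)
  have "\<exists>\<delta>>0. \<forall>x. x \<noteq> 0 \<longrightarrow> norm x < \<delta> \<longrightarrow> (\<forall>y\<in>col F (lin e d x). norm (w x y) \<le> \<epsilon>')"
    by (rule column_local_global [OF bih ed small]) (use \<epsilon>' in auto)
  then obtain \<delta> where \<delta>: "\<delta> > 0"
    "\<And>x y. x \<noteq> 0 \<Longrightarrow> norm x < \<delta> \<Longrightarrow> y \<in> col F (lin e d x) \<Longrightarrow> norm (w x y) \<le> \<epsilon>'" by blast
  have "norm (\<Sum>y\<in>col F (lin e d x). w x y) < \<epsilon>" if "x \<noteq> 0" "norm x < \<delta>" for x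
  proof -
    have "norm (\<Sum>y\<in>col F (lin e d x). w x y) \<le> real b * \<epsilon>'"
      using col_card(2) [OF bih assms(2,3) lin_nonzero [OF ed]] \<delta>(2) [OF that] \<epsilon>'(1)
      by (intro sum_le_card_mult) auto
    then show ?thesis using \<epsilon>'(2) by simp
  qed
  then show "\<forall>\<^sub>F x in at 0. dist (\<Sum>y\<in>col F (lin e d x). w x y) 0 < \<epsilon>"
    unfolding eventually_at using \<delta>(1) by auto
qed

lemma Rs_column_limit:
  assumes bih: "bihomogeneous a b F" and "smf F" "b \<ge> 2" and P: "bihomogeneous a' (b - 2) P"
    and mer: "merom F \<xi> Q" and sp: "simple_poles F \<xi> Q" and ed: "dt e d \<noteq> 0"
    and van: "\<And>k. k \<noteq> 0 \<Longrightarrow> ev F e k = 0 \<Longrightarrow> (PT e, PT k) \<in> Q \<Longrightarrow> ev P e k = 0"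
  shows "((\<lambda>x. x * Rs F P \<xi> (lin e d x)) \<longlongrightarrow> 0) (at 0)"
proof -
  have b1: "b \<ge> 1" using assms(3) by simp
  have "((\<lambda>x. \<Sum>y\<in>col F (lin e d x). x * tm F P \<xi> (lin e d x) y) \<longlongrightarrow> 0) (at 0)"
  proof (rule column_tendsto_0 [OF bih assms(2) b1 ed])
    fix k m and \<epsilon> :: real assume km: "dt k m \<noteq> 0" and ek: "ev F e k = 0" and \<epsilon>: "\<epsilon> > 0"
    have "(PT e, PT k) \<in> Q \<Longrightarrow> ev P e k = 0" using van dt_nonzeroD(1) [OF km] ek by blast
    then show "\<exists>\<delta>>0. \<forall>x y. x \<noteq> 0 \<longrightarrow> norm x < \<delta> \<longrightarrow> norm y < \<delta> \<longrightarrow> ev F (lin e d x) (lin k m y) = 0 \<longrightarrow>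
        norm (x * tm F P \<xi> (lin e d x) (PT (lin k m y))) \<le> \<epsilon>"
      by (rule tm_small [OF bih assms(2,3) P mer sp ed km ek _ \<epsilon>])
  qed
  then show ?thesis by (simp add: Rs_def sum_distrib_left)
qed

text \<open>Where \<open>P\<close> need not vanish at the poles, \<open>x * tm\<close> is still
  bounded: the trace has at most a simple pole, and one more factor \<open>x\<close> makes it
  removable.\<close>

lemma Rs_column_limit2:
  assumes bih: "bihomogeneous a b F" and "smf F" "b \<ge> 2" and P: "bihomogeneous a' (b - 2) P"
    and mer: "merom F \<xi> Q" and sp: "simple_poles F \<xi> Q" and ed: "dt e d \<noteq> 0"
  shows "((\<lambda>x. x * (x * Rs F P \<xi> (lin e d x))) \<longlongrightarrow> 0) (at 0)"
proof -
  have b1: "b \<ge> 1" using assms(3) by simp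
  have "((\<lambda>x. \<Sum>y\<in>col F (lin e d x). x * (x * tm F P \<xi> (lin e d x) y)) \<longlongrightarrow> 0) (at 0)"
  proof (rule column_tendsto_0 [OF bih assms(2) b1 ed])
    fix k m and \<epsilon> :: real assume km: "dt k m \<noteq> 0" and ek: "ev F e k = 0" and \<epsilon>: "\<epsilon> > 0"
    have "\<exists>\<delta>>0. \<exists>B>0. \<forall>x y. x \<noteq> 0 \<longrightarrow> norm x < \<delta> \<longrightarrow> norm y < \<delta> \<longrightarrow> ev F (lin e d x) (lin k m y) = 0 \<longrightarrow>
        norm (x * tm F P \<xi> (lin e d x) (PT (lin k m y))) \<le> B"
    proof (cases "(PT e, PT k) \<in> Q")
      case False
      then show ?thesis
        using tm_regular_small [OF bih assms(2,3) P mer ed km ek False \<epsilon>] \<epsilon> by blast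
    next
      case True
      obtain \<delta> B where B: "\<delta> > 0" "B > 0" "\<And>x y. x \<noteq> 0 \<Longrightarrow> norm x < \<delta> \<Longrightarrow> norm y < \<delta> \<Longrightarrow>
        ev F (lin e d x) (lin k m y) = 0 \<Longrightarrow>
        norm (x * tm F P \<xi> (lin e d x) (PT (lin k m y))) \<le> B * norm (ev P (lin e d x) (lin k m y))"
        using tm_pole_bound [OF bih assms(3) P sp ed km ek True] by blast
      obtain B' \<delta>' where B': "\<delta>' > 0" "B' > 0"
        "\<And>x y. norm x < \<delta>' \<Longrightarrow> norm y < \<delta>' \<Longrightarrow> norm (ev P (lin e d x) (lin k m y)) \<le> B'"
        using poly2_bounded_near [OF poly2_slice [OF P, of e d k m]] by blast
      have "norm (x * tm F P \<xi> (lin e d x) (PT (lin k m y))) \<le> B * B'"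
        if "x \<noteq> 0" "norm x < min \<delta> \<delta>'" "norm y < min \<delta> \<delta>'" "ev F (lin e d x) (lin k m y) = 0" for x y
      proof -
        have "norm (x * tm F P \<xi> (lin e d x) (PT (lin k m y))) \<le> B * norm (ev P (lin e d x) (lin k m y))"
          using B(3) [of x y] that by auto
        also have "\<dots> \<le> B * B'"
          using B'(3) [of x y] that B(2) by (intro mult_left_mono) auto
        finally show ?thesis .
      qed
      moreover have "min \<delta> \<delta>' > 0" "B * B' > 0" using B B' by simp_all
      ultimately show ?thesis by blast
    qed
    then obtain \<delta> B where B: "\<delta> > 0" "B > 0" "\<And>x y. x \<noteq> 0 \<Longrightarrow> norm x < \<delta> \<Longrightarrow> norm y < \<delta> \<Longrightarrow>
        ev F (lin e d x) (lin k m y) = 0 \<Longrightarrow> norm (x * tm F P \<xi> (lin e d x) (PT (lin k m y))) \<le> B"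
      by blast
    have "norm (x * (x * tm F P \<xi> (lin e d x) (PT (lin k m y)))) \<le> \<epsilon>"
      if "x \<noteq> 0" "norm x < min \<delta> (\<epsilon> / B)" "norm y < min \<delta> (\<epsilon> / B)" "ev F (lin e d x) (lin k m y) = 0" for x y
    proof -
      have "norm (x * (x * tm F P \<xi> (lin e d x) (PT (lin k m y)))) =
          norm x * norm (x * tm F P \<xi> (lin e d x) (PT (lin k m y)))" by (simp add: norm_mult)
      also have "\<dots> \<le> (\<epsilon> / B) * B"
        using B(3) [of x y] that \<epsilon> B(2) by (intro mult_mono) auto
      also have "\<dots> = \<epsilon>" using B(2) by simp
      finally show ?thesis .
    qed
    moreover have "min \<delta> (\<epsilon> / B) > 0" using B \<epsilon> by simp
    ultimately show "\<exists>\<delta>>0. \<forall>x y. x \<noteq> 0 \<longrightarrow> norm x < \<delta> \<longrightarrow> norm y < \<delta> \<longrightarrow>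
        ev F (lin e d x) (lin k m y) = 0 \<longrightarrow> norm (x * (x * tm F P \<xi> (lin e d x) (PT (lin k m y)))) \<le> \<epsilon>"
      by blast
  qed
  then show ?thesis by (simp add: Rs_def sum_distrib_left)
qed

text \<open>A column free of ramification and poles, so that the trace is holomorphic near
  it.\<close>

definition good :: "form \<Rightarrow> (proj1 \<times> proj1) set \<Rightarrow> cvec \<Rightarrow> bool" where
  "good F Q X \<longleftrightarrow> unram F X \<and> (\<forall>y\<in>col F X. (PT X, y) \<notin> Q)"

lemma poly2_field_differentiable:
  assumes "poly2 f" "u field_differentiable at z" "v field_differentiable at z"
  shows "(\<lambda>z. f (u z) (v z)) field_differentiable at z"
  using assms poly2_has_field_derivative [OF assms(1)] unfolding field_differentiable_def by blast

text \<open>The branches turn the sum over a varying column into a sum over the fixed finite set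
  \<open>col F e\<close>, whose terms are quotients of polynomial functions along holomorphic
  branches.\<close>

lemma trace_differentiable:
  fixes \<tau> :: "complex \<Rightarrow> proj1 \<Rightarrow> complex"
  assumes bih: "bihomogeneous a b F" and "smf F" "b \<ge> 2" and ed: "dt e d \<noteq> 0" and "unram F e"
    and loc: "\<And>k m. dt k m \<noteq> 0 \<Longrightarrow> ev F e k = 0 \<Longrightarrow> \<exists>K L \<delta>. poly2 K \<and> poly2 L \<and> L 0 0 \<noteq> 0 \<and> \<delta> > 0 \<and>
      (\<forall>x y. norm x < \<delta> \<longrightarrow> norm y < \<delta> \<longrightarrow> ev F (lin e d x) (lin k m y) = 0 \<longrightarrow>
        \<tau> x (PT (lin k m y)) = K x y / L x y)"
  shows "(\<lambda>x. \<Sum>y\<in>col F (lin e d x). \<tau> x y) field_differentiable at 0"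
proof -
  have b1: "b \<ge> 1" using assms(3) by simp
  note fin = col_card(1) [OF bih assms(2) b1 dt_nonzeroD(1) [OF ed]]
  obtain g r where r: "r > 0" and g: "\<And>y. y \<in> col F e \<Longrightarrow> g y holomorphic_on ball 0 r \<and> g y 0 = 0 \<and>
      (\<forall>x\<in>ball 0 r. ev F (lin e d x) (lin (rp y) (perp (rp y)) (g y x)) = 0)"
    and col: "\<And>x. x \<in> ball 0 r \<Longrightarrow> inj_on (\<lambda>y. PT (lin (rp y) (perp (rp y)) (g y x))) (col F e) \<and>
      col F (lin e d x) = (\<lambda>y. PT (lin (rp y) (perp (rp y)) (g y x))) ` col F e"
    using branches [OF bih assms(2,3) ed assms(5)] by blast
  define h where "h y x = PT (lin (rp y) (perp (rp y)) (g y x))" for y x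
  have "\<exists>K L \<delta>. poly2 K \<and> poly2 L \<and> L 0 0 \<noteq> 0 \<and> \<delta> > 0 \<and>
      (\<forall>x t. norm x < \<delta> \<longrightarrow> norm t < \<delta> \<longrightarrow> ev F (lin e d x) (lin (rp y) (perp (rp y)) t) = 0 \<longrightarrow>
        \<tau> x (PT (lin (rp y) (perp (rp y)) t)) = K x t / L x t)" if "y \<in> col F e" for y
    by (rule loc) (use that in \<open>auto simp: col_iff_rp dt_perp_nonzero rp\<close>)
  then obtain K L \<delta> where KL: "\<And>y. y \<in> col F e \<Longrightarrow> poly2 (K y) \<and> poly2 (L y) \<and> L y 0 0 \<noteq> 0 \<and> \<delta> y > 0 \<and>
      (\<forall>x t. norm x < \<delta> y \<longrightarrow> norm t < \<delta> y \<longrightarrow> ev F (lin e d x) (lin (rp y) (perp (rp y)) t) = 0 \<longrightarrow>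
        \<tau> x (PT (lin (rp y) (perp (rp y)) t)) = K y x t / L y x t)"
    by metis
  have gd: "g y field_differentiable at 0" if "y \<in> col F e" for y
    using g [OF that] r by (meson centre_in_ball holomorphic_on_imp_differentiable_at open_ball)
  have ev1: "\<forall>\<^sub>F x in nhds 0. \<forall>y\<in>col F e. \<tau> x (h y x) = K y x (g y x) / L y x (g y x)"
  proof (intro eventually_ball_finite fin ballI)
    fix y assume y: "y \<in> col F e"
    have "isCont (g y) 0" using gd [OF y] by (rule field_differentiable_imp_continuous_at)
    then have "(g y \<longlongrightarrow> g y 0) (nhds 0)" unfolding isCont_def tendsto_at_iff_tendsto_nhds .
    then have "\<forall>\<^sub>F x in nhds 0. norm (g y x) < \<delta> y"
      using KL [OF y] g [OF y] tendstoD [of "g y" 0 "nhds 0" "\<delta> y"] by simp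
    moreover have "\<forall>\<^sub>F x in nhds (0 :: complex). x \<in> ball 0 r" "\<forall>\<^sub>F x in nhds (0 :: complex). x \<in> ball 0 (\<delta> y)"
      using r KL [OF y] by (intro eventually_nhds_in_open; simp)+
    ultimately show "\<forall>\<^sub>F x in nhds 0. \<tau> x (h y x) = K y x (g y x) / L y x (g y x)"
      by eventually_elim (use KL [OF y] g [OF y] in \<open>simp add: h_def\<close>)
  qed
  moreover have ev2: "\<forall>\<^sub>F x in nhds (0 :: complex). x \<in> ball 0 r"
    using r by (intro eventually_nhds_in_open) auto
  ultimately have E: "\<forall>\<^sub>F x in nhds 0. (\<Sum>y\<in>col F e. K y x (g y x) / L y x (g y x)) = (\<Sum>y\<in>col F (lin e d x). \<tau> x y)"
  proof eventually_elim
    case (elim x)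
    have inj: "inj_on (\<lambda>y. h y x) (col F e)" and img: "col F (lin e d x) = (\<lambda>y. h y x) ` col F e"
      using col [OF elim(2)] unfolding h_def by blast+
    show ?case unfolding img sum.reindex [OF inj] o_def
      by (rule sum.cong) (use elim(1) in auto)
  qed
  have "(\<lambda>x. \<Sum>y\<in>col F e. K y x (g y x) / L y x (g y x)) field_differentiable at 0"
  proof (rule field_differentiable_sum)
    fix y assume y: "y \<in> col F e"
    show "(\<lambda>x. K y x (g y x) / L y x (g y x)) field_differentiable at 0"
    proof (rule field_differentiable_divide)
      show "(\<lambda>x. K y x (g y x)) field_differentiable at 0" "(\<lambda>x. L y x (g y x)) field_differentiable at 0"
        using KL [OF y] by (blast intro: poly2_field_differentiable [OF _ field_differentiable_ident gd [OF y]])+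
      show "L y 0 (g y 0) \<noteq> 0" using KL [OF y] g [OF y] by simp
    qed
  qed
  then show ?thesis
    unfolding field_differentiable_def DERIV_cong_ev [OF refl E refl] .
qed

lemma good_punctured:
  assumes bih: "bihomogeneous a b F" and "smf F" "b \<ge> 2" and mer: "merom F \<xi> Q" and sp: "simple_poles F \<xi> Q"
    and ed: "dt e d \<noteq> 0"
  shows "\<exists>\<delta>>0. \<forall>x. x \<noteq> 0 \<longrightarrow> norm x < \<delta> \<longrightarrow> good F Q (lin e d x)"
proof -
  obtain \<delta>1 where \<delta>1: "\<delta>1 > 0" "\<And>x. x \<noteq> 0 \<Longrightarrow> norm x < \<delta>1 \<Longrightarrow> unram F (lin e d x)"
    using unram_punctured [OF bih assms(2,3) ed] by blast
  have "\<exists>\<delta>>0. \<forall>x. x \<noteq> 0 \<longrightarrow> norm x < \<delta> \<longrightarrow> (\<forall>y\<in>col F (lin e d x). (PT (lin e d x), y) \<notin> Q)"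
  proof (rule column_local_global [OF bih ed])
    fix k m assume km: "dt k m \<noteq> 0" and ek: "ev F e k = 0"
    show "\<exists>\<delta>>0. \<forall>x y. x \<noteq> 0 \<longrightarrow> norm x < \<delta> \<longrightarrow> norm y < \<delta> \<longrightarrow>
        ev F (lin e d x) (lin k m y) = 0 \<longrightarrow> (PT (lin e d x), PT (lin k m y)) \<notin> Q"
    proof (cases "(PT e, PT k) \<in> Q")
      case True
      then show ?thesis using simple_polesD(2) [OF sp ed km ek] by blast
    next
      case False
      obtain M N \<delta> where MN: "poly2 N" "\<delta> > 0"
        "\<And>x y. norm x < \<delta> \<Longrightarrow> norm y < \<delta> \<Longrightarrow> ev F (lin e d x) (lin k m y) = 0 \<Longrightarrow>
          ((PT (lin e d x), PT (lin k m y)) \<in> Q \<longleftrightarrow> N x y = 0)"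
        using meromD [OF mer ed km ek] by (elim exE conjE) blast
      have "N 0 0 \<noteq> 0" using MN(3) [of 0 0] MN(2) ek False by simp
      then obtain \<delta>' where \<delta>': "\<delta>' > 0" "\<And>x y. norm x < \<delta>' \<Longrightarrow> norm y < \<delta>' \<Longrightarrow> N x y \<noteq> 0"
        using poly2_near_nonzero [OF MN(1)] by blast
      have "(PT (lin e d x), PT (lin k m y)) \<notin> Q"
        if "norm x < min \<delta> \<delta>'" "norm y < min \<delta> \<delta>'" "ev F (lin e d x) (lin k m y) = 0" for x y
        using MN(3) [of x y] \<delta>'(2) [of x y] that unfolding min_less_iff_conj by blast
      moreover have "min \<delta> \<delta>' > 0" using MN \<delta>' by simp
      ultimately show ?thesis by blast
    qed
  qed
  then obtain \<delta>2 where \<delta>2: "\<delta>2 > 0"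
    "\<And>x y. x \<noteq> 0 \<Longrightarrow> norm x < \<delta>2 \<Longrightarrow> y \<in> col F (lin e d x) \<Longrightarrow> (PT (lin e d x), y) \<notin> Q" by blast
  show ?thesis
    by (rule exI [of _ "min \<delta>1 \<delta>2"]) (use \<delta>1 \<delta>2 in \<open>auto simp: good_def\<close>)
qed

lemma good_sc:
  assumes "bihomogeneous a b F" "c \<noteq> 0" "b \<ge> 2" "X \<noteq> 0"
  shows "good F Q (sc c X) \<longleftrightarrow> good F Q X"
proof -
  have "col F (sc c X) = col F X"
    unfolding set_eq_iff col_iff_rp using assms(2) by (simp add: ev_sc_left [OF assms(1)])
  then show ?thesis
    unfolding good_def using unram_sc [OF assms(1-3)] PT_sc [OF assms(2,4)] by simp
qed

lemma finite_bad:
  assumes "bihomogeneous a b F" "smf F" "b \<ge> 2" "merom F \<xi> Q" "simple_poles F \<xi> Q" "dt e d \<noteq> 0"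
  shows "finite {x. \<not> good F Q (lin e d x)}"
proof -
  have de: "dt d e \<noteq> 0" using assms(6) dt_commute [of e d] by auto
  obtain \<delta> where \<delta>: "\<delta> > 0" "\<And>x. x \<noteq> 0 \<Longrightarrow> norm x < \<delta> \<Longrightarrow> good F Q (lin d e x)"
    using good_punctured [OF assms(1-5) de] by blast
  show ?thesis
  proof (rule finite_isolated)
    show "\<exists>\<delta>>0. \<forall>x. x \<noteq> 0 \<longrightarrow> norm x < \<delta> \<longrightarrow> good F Q (lin e d (s + x))" for s
      using good_punctured [OF assms(1-5), of "lin e d s" d] assms(6) by (simp add: lin_lin)
    fix x :: complex assume x: "norm x > inverse \<delta>"
    then have x0: "x \<noteq> 0" using \<delta>(1) by auto
    have "norm (inverse x) < \<delta>"
      using less_imp_inverse_less [OF x] \<delta>(1) by (simp add: norm_inverse)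
    then have "good F Q (lin d e (inverse x))" using \<delta>(2) x0 by simp
    then show "good F Q (lin e d x)"
      unfolding lin_infinity [OF x0] using good_sc [OF assms(1) x0 assms(3) lin_nonzero [OF de]] by simp
  qed
qed

lemma Rs_differentiable:
  assumes bih: "bihomogeneous a b F" and "smf F" "b \<ge> 2" and P: "bihomogeneous a' (b - 2) P"
    and mer: "merom F \<xi> Q" and ed: "dt e d \<noteq> 0" and gd: "good F Q e"
  shows "(\<lambda>x. Rs F P \<xi> (lin e d x)) field_differentiable at 0"
  unfolding Rs_def
proof (rule trace_differentiable [OF bih assms(2,3) ed])
  show u: "unram F e" using gd by (simp add: good_def)
  fix k m assume km: "dt k m \<noteq> 0" and ek: "ev F e k = 0"
  have k0: "k \<noteq> 0" using dt_nonzeroD(1) [OF km] .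
  have nQ: "(PT e, PT k) \<notin> Q" using gd col_iff [OF bih k0] ek by (simp add: good_def)
  obtain M N \<delta> where MN: "poly2 M" "poly2 N" "\<delta> > 0"
    "\<And>x y. norm x < \<delta> \<Longrightarrow> norm y < \<delta> \<Longrightarrow> ev F (lin e d x) (lin k m y) = 0 \<Longrightarrow>
         ((PT (lin e d x), PT (lin k m y)) \<in> Q \<longleftrightarrow> N x y = 0) \<and>
         (N x y \<noteq> 0 \<longrightarrow> \<xi> (PT (lin e d x), PT (lin k m y)) = M x y / N x y)"
    using meromD [OF mer ed km ek] by (elim exE conjE) blast
  have N0: "N 0 0 \<noteq> 0" using MN(4) [of 0 0] MN(3) ek nQ by simp
  obtain \<delta>' where \<delta>': "\<delta>' > 0" "\<And>x y. norm x < \<delta>' \<Longrightarrow> norm y < \<delta>' \<Longrightarrow> N x y \<noteq> 0"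
    using poly2_near_nonzero [OF MN(2) N0] by blast
  define f where "f = (\<lambda>x y. ev F (lin e d x) (lin k m y))"
  have f: "poly2 f" unfolding f_def by (rule poly2_slice [OF bih])
  have kap: "kap F (lin e d x) (lin k m y) * dt k m = d2 f x y" if "f x y = 0" for x y
    using dY_eq_kap [OF bih lin_nonzero [OF km], of "lin e d x" y m] that km by (simp add: f_def d2_slice)
  have d20: "d2 f 0 0 \<noteq> 0"
    using kap [of 0 0] u k0 ek km by (auto simp: unram_def f_def)
  \<comment> \<open>Inserting \<open>kap = d2 f / dt k m\<close> and \<open>\<xi> = M / N\<close>
    makes the term a quotient \<open>K / L\<close>; the denominator is nonzero at the centre because
    the column is good.\<close>
  define K where "K = (\<lambda>x y. dt k m * ev P (lin e d x) (lin k m y) * M x y)"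
  define L where "L = (\<lambda>x y. d2 f x y * N x y)"
  have "poly2 K" unfolding K_def by (intro poly2.mult poly2.const poly2_slice [OF P] MN)
  moreover have "poly2 L" unfolding L_def by (intro poly2.mult poly2_d2 f MN)
  moreover have "L 0 0 \<noteq> 0" using d20 N0 by (simp add: L_def)
  moreover have "min \<delta> \<delta>' > 0" using MN \<delta>' by simp
  moreover have "tm F P \<xi> (lin e d x) (PT (lin k m y)) = K x y / L x y"
    if "norm x < min \<delta> \<delta>'" "norm y < min \<delta> \<delta>'" and z: "ev F (lin e d x) (lin k m y) = 0" for x y
  proof -
    have N: "N x y \<noteq> 0" and \<xi>: "\<xi> (PT (lin e d x), PT (lin k m y)) = M x y / N x y"
      using MN(4) [of x y] \<delta>'(2) [of x y] that unfolding min_less_iff_conj by blast+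
    have "kap F (lin e d x) (lin k m y) = d2 f x y / dt k m"
      using kap [of x y] z km by (simp add: f_def field_simps)
    then show ?thesis
      unfolding tm_PT [OF bih P assms(3) lin_nonzero [OF km] z] \<xi> K_def L_def by simp
  qed
  ultimately show "\<exists>K L \<delta>. poly2 K \<and> poly2 L \<and> L 0 0 \<noteq> 0 \<and> 0 < \<delta> \<and>
      (\<forall>x y. norm x < \<delta> \<longrightarrow> norm y < \<delta> \<longrightarrow> ev F (lin e d x) (lin k m y) = 0 \<longrightarrow>
        tm F P \<xi> (lin e d x) (PT (lin k m y)) = K x y / L x y)"
    by blast
qed

lemma differentiable_shift:
  fixes f :: "complex \<Rightarrow> complex"
  assumes "(\<lambda>x. f (s + x)) field_differentiable at 0"
  shows "f field_differentiable at s"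
  using assms DERIV_shift [of f _ 0 s] unfolding field_differentiable_def
  by (auto simp: add.commute)

lemma tendsto_shift_0:
  fixes f :: "complex \<Rightarrow> complex"
  assumes "((\<lambda>x. f (s + x)) \<longlongrightarrow> l) (at 0)"
  shows "(f \<longlongrightarrow> l) (at s)"
  using assms LIM_offset_zero_cancel [of f s l] by simp

text \<open>The differential \<open>R x dx\<close> has at most one pole, a simple one at
  \<open>x = 0\<close>, so its residue there is zero. Concretely, \<open>h x = x * R x\<close> has
  only removable singularities, and since \<open>Rs\<close> has degree \<open>-2\<close> it equals
  \<open>w * Rs F P \<xi> (lin d e w)\<close> with \<open>w = 1 / x\<close>. This tends to
  \<open>0\<close> as \<open>w\<close> does, and Liouville's theorem gives
  \<open>h = 0\<close>.\<close>

lemma Rs_vanishes: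
  assumes bih: "bihomogeneous a b F" and "smf F" "a \<ge> 2" "b \<ge> 2"
    and P: "bihomogeneous (a - 2) (b - 2) P"
    and mer: "merom F \<xi> Q" and sp: "simple_poles F \<xi> Q" and ed: "dt e d \<noteq> 0"
    and van: "\<And>X k. X \<noteq> 0 \<Longrightarrow> k \<noteq> 0 \<Longrightarrow> ev F X k = 0 \<Longrightarrow> (PT X, PT k) \<in> Q \<Longrightarrow> dt X e \<noteq> 0 \<Longrightarrow> ev P X k = 0"
    and "x \<noteq> 0" "good F Q (lin e d x)"
  shows "Rs F P \<xi> (lin e d x) = 0"
proof -
  define R where "R = (\<lambda>x. Rs F P \<xi> (lin e d x))"
  define h where "h = (\<lambda>x. x * R x)"
  define S where "S = insert 0 {x. \<not> good F Q (lin e d x)}"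
  have de: "dt d e \<noteq> 0" using ed dt_commute [of e d] by auto
  have "h x = 0"
  proof (rule zero_off_finite [of S h])
    show "finite S" unfolding S_def using finite_bad [OF bih assms(2,4) mer sp ed] by simp
    show "h field_differentiable at s" if "s \<notin> S" for s
    proof -
      have "good F Q (lin e d s)" using that by (simp add: S_def)
      then have "(\<lambda>x. R (s + x)) field_differentiable at 0"
        using Rs_differentiable [OF bih assms(2,4) P mer, of "lin e d s" d] ed
        by (simp add: R_def lin_lin)
      then have "R field_differentiable at s" by (rule differentiable_shift)
      then show ?thesis unfolding h_def by (intro field_differentiable_mult field_differentiable_ident)
    qed
    show "((\<lambda>x. (x - s) * h x) \<longlongrightarrow> 0) (at s)" if "s \<in> S" for s
    proof (cases "s = 0")
      case True
      then show ?thesis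
        using Rs_column_limit2 [OF bih assms(2,4) P mer sp ed] by (simp add: h_def R_def)
    next
      case False
      have c0: "((\<lambda>x. x * Rs F P \<xi> (lin (lin e d s) d x)) \<longlongrightarrow> 0) (at 0)"
      proof (rule Rs_column_limit [OF bih assms(2,4) P mer sp])
        show es: "dt (lin e d s) d \<noteq> 0" using ed by simp
        fix k assume "k \<noteq> 0" "ev F (lin e d s) k = 0" "(PT (lin e d s), PT k) \<in> Q"
        moreover have "dt (lin e d s) e \<noteq> 0"
          using ed False dt_commute [of "lin e d s" e] by simp
        ultimately show "ev P (lin e d s) k = 0" using van lin_nonzero [OF ed] by blast
      qed
      have 1: "((\<lambda>x. (x - s) * R x) \<longlongrightarrow> 0) (at s)"
        by (rule tendsto_shift_0) (use c0 in \<open>simp add: R_def lin_lin\<close>)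
      have "((\<lambda>x. x * ((x - s) * R x)) \<longlongrightarrow> s * 0) (at s)"
        by (intro tendsto_mult 1 tendsto_ident_at)
      then show ?thesis by (simp add: h_def algebra_simps)
    qed
    have "((\<lambda>w. w * Rs F P \<xi> (lin d e w)) \<longlongrightarrow> 0) (at 0)"
    proof (rule Rs_column_limit [OF bih assms(2,4) P mer sp de])
      fix k assume "k \<noteq> 0" "ev F d k = 0" "(PT d, PT k) \<in> Q"
      then show "ev P d k = 0" using van de dt_nonzeroD(1) [OF de] by blast
    qed
    then have "((\<lambda>x. inverse x * Rs F P \<xi> (lin d e (inverse x))) \<longlongrightarrow> 0) at_infinity"
      by (rule filterlim_compose)
        (auto simp: filterlim_at intro!: tendsto_inverse_0 eventually_not_equal_at_infinity)
    moreover have "\<forall>\<^sub>F x in at_infinity. inverse x * Rs F P \<xi> (lin d e (inverse x)) = h x"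
      using eventually_not_equal_at_infinity [of 0]
    proof eventually_elim
      case (elim x)
      then show ?case
        unfolding h_def R_def lin_infinity [OF elim]
        by (subst Rs_sc [OF bih P assms(3,4) elim lin_nonzero [OF de]]) (simp add: field_simps power2_eq_square)
    qed
    ultimately show "(h \<longlongrightarrow> 0) at_infinity" by (rule Lim_transform_eventually)
    show "x \<notin> S" using assms(10,11) by (simp add: S_def)
  qed
  then show ?thesis using assms(10) by (simp add: h_def R_def)
qed

section \<open>Forms through the poles of a function\<close>

lemma bihom_const: "bihomogeneous 0 0 (\<lambda>X0 X1 Y0 Y1. c)"
  unfolding bihomogeneous_def by (rule exI [of _ "\<lambda>_ _. c"]) simp

lemma bihom_add:
  assumes "bihomogeneous a b F" "bihomogeneous a b G"
  shows "bihomogeneous a b (\<lambda>X0 X1 Y0 Y1. F X0 X1 Y0 Y1 + G X0 X1 Y0 Y1)"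
proof -
  obtain c where c: "\<And>X0 X1 Y0 Y1. F X0 X1 Y0 Y1 =
      (\<Sum>i\<le>a. \<Sum>j\<le>b. c i j * X0 ^ (a - i) * X1 ^ i * Y0 ^ (b - j) * Y1 ^ j)"
    using assms(1) unfolding bihomogeneous_def by blast
  obtain c' where c': "\<And>X0 X1 Y0 Y1. G X0 X1 Y0 Y1 =
      (\<Sum>i\<le>a. \<Sum>j\<le>b. c' i j * X0 ^ (a - i) * X1 ^ i * Y0 ^ (b - j) * Y1 ^ j)"
    using assms(2) unfolding bihomogeneous_def by blast
  show ?thesis unfolding bihomogeneous_def
    by (rule exI [of _ "\<lambda>i j. c i j + c' i j"]) (simp add: c c' sum.distrib algebra_simps)
qed

lemma bihom_cmult:
  assumes "bihomogeneous a b F"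
  shows "bihomogeneous a b (\<lambda>X0 X1 Y0 Y1. s * F X0 X1 Y0 Y1)"
proof -
  obtain c where c: "\<And>X0 X1 Y0 Y1. F X0 X1 Y0 Y1 =
      (\<Sum>i\<le>a. \<Sum>j\<le>b. c i j * X0 ^ (a - i) * X1 ^ i * Y0 ^ (b - j) * Y1 ^ j)"
    using assms(1) unfolding bihomogeneous_def by blast
  show ?thesis unfolding bihomogeneous_def
    by (rule exI [of _ "\<lambda>i j. s * c i j"]) (simp add: c sum_distrib_left mult.assoc)
qed

lemma bihom_mult_X0:
  assumes "bihomogeneous a b F"
  shows "bihomogeneous (Suc a) b (\<lambda>X0 X1 Y0 Y1. X0 * F X0 X1 Y0 Y1)"
proof -
  obtain c where c: "\<And>X0 X1 Y0 Y1. F X0 X1 Y0 Y1 =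
      (\<Sum>i\<le>a. \<Sum>j\<le>b. c i j * X0 ^ (a - i) * X1 ^ i * Y0 ^ (b - j) * Y1 ^ j)"
    using assms(1) unfolding bihomogeneous_def by blast
  define c' where "c' i j = (if i \<le> a then c i j else 0)" for i j
  have "X0 * F X0 X1 Y0 Y1 =
      (\<Sum>i\<le>Suc a. \<Sum>j\<le>b. c' i j * X0 ^ (Suc a - i) * X1 ^ i * Y0 ^ (b - j) * Y1 ^ j)"
    for X0 X1 Y0 Y1
    unfolding c sum.atMost_Suc sum_distrib_left
    by (simp add: c'_def Suc_diff_le algebra_simps)
  then show ?thesis unfolding bihomogeneous_def by blast
qed

lemma bihom_mult_X1:
  assumes "bihomogeneous a b F"
  shows "bihomogeneous (Suc a) b (\<lambda>X0 X1 Y0 Y1. X1 * F X0 X1 Y0 Y1)"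
proof -
  obtain c where c: "\<And>X0 X1 Y0 Y1. F X0 X1 Y0 Y1 =
      (\<Sum>i\<le>a. \<Sum>j\<le>b. c i j * X0 ^ (a - i) * X1 ^ i * Y0 ^ (b - j) * Y1 ^ j)"
    using assms(1) unfolding bihomogeneous_def by blast
  define c' where "c' i j = (case i of 0 \<Rightarrow> 0 | Suc i \<Rightarrow> c i j)" for i j
  have "X1 * F X0 X1 Y0 Y1 =
      (\<Sum>i\<le>Suc a. \<Sum>j\<le>b. c' i j * X0 ^ (Suc a - i) * X1 ^ i * Y0 ^ (b - j) * Y1 ^ j)"
    for X0 X1 Y0 Y1
    unfolding c sum.atMost_Suc_shift sum_distrib_left
    by (simp add: c'_def algebra_simps)
  then show ?thesis unfolding bihomogeneous_def by blast
qed

lemma bihom_mult_linX: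
  assumes "bihomogeneous a b F"
  shows "bihomogeneous (Suc a) b (\<lambda>X0 X1 Y0 Y1. (p * X0 + q * X1) * F X0 X1 Y0 Y1)"
  using bihom_add [OF bihom_cmult [OF bihom_mult_X0 [OF assms], of p]
      bihom_cmult [OF bihom_mult_X1 [OF assms], of q]]
  by (simp add: algebra_simps)

definition swF :: "form \<Rightarrow> form" where
  "swF F = (\<lambda>X0 X1 Y0 Y1. F Y0 Y1 X0 X1)"

lemma swF_swF [simp]: "swF (swF F) = F"
  by (simp add: swF_def)

lemma ev_swF [simp]: "ev (swF F) X Y = ev F Y X"
  by (simp add: ev_def swF_def)

lemma bihom_swF:
  assumes "bihomogeneous a b F"
  shows "bihomogeneous b a (swF F)"
proof -
  obtain c where c: "\<And>X0 X1 Y0 Y1. F X0 X1 Y0 Y1 =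
      (\<Sum>i\<le>a. \<Sum>j\<le>b. c i j * X0 ^ (a - i) * X1 ^ i * Y0 ^ (b - j) * Y1 ^ j)"
    using assms(1) unfolding bihomogeneous_def by blast
  show ?thesis unfolding bihomogeneous_def swF_def c
    by (rule exI [of _ "\<lambda>i j. c j i"]) (subst sum.swap, simp add: mult_ac)
qed

lemma bihom_mult_linY:
  assumes "bihomogeneous a b F"
  shows "bihomogeneous a (Suc b) (\<lambda>X0 X1 Y0 Y1. (p * Y0 + q * Y1) * F X0 X1 Y0 Y1)"
  using bihom_swF [OF bihom_mult_linX [OF bihom_swF [OF assms], of p q]] by (simp add: swF_def)

lemma bihom_mult_linX_power:
  assumes "bihomogeneous a b F"
  shows "bihomogeneous (n + a) b (\<lambda>X0 X1 Y0 Y1. (p * X0 + q * X1) ^ n * F X0 X1 Y0 Y1)"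
proof (induction n)
  case (Suc n)
  show ?case using bihom_mult_linX [OF Suc, of p q] by (simp add: mult.assoc)
qed (simp add: assms)

text \<open>One linear factor for each element of \<open>U\<close> and \<open>V\<close>, padded to
  the exact bidegree by powers of the factors vanishing at \<open>perp X\<close> and
  \<open>perp Y\<close>, which are nonzero at \<open>(X, Y)\<close>.\<close>

lemma bihom_prod_lines:
  assumes "finite U" "finite V" "card U \<le> a" "card V \<le> b" "X \<noteq> 0" "Y \<noteq> 0"
    "\<And>u. u \<in> U \<Longrightarrow> u \<noteq> PT X" "\<And>v. v \<in> V \<Longrightarrow> v \<noteq> PT Y"
  obtains P where "bihomogeneous a b P" "ev P X Y \<noteq> 0"
    "\<And>X' Y'. X' \<noteq> 0 \<Longrightarrow> PT X' \<in> U \<Longrightarrow> ev P X' Y' = 0"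
    "\<And>X' Y'. Y' \<noteq> 0 \<Longrightarrow> PT Y' \<in> V \<Longrightarrow> ev P X' Y' = 0"
proof -
  define P0 :: form where "P0 = (\<lambda>X0 X1 Y0 Y1. (\<Prod>u\<in>U. - snd (rp u) * X0 + fst (rp u) * X1))"
  have P0: "bihomogeneous (card U) 0 P0"
    unfolding P0_def using assms(1)
  proof (induction U)
    case empty
    show ?case using bihom_const [of 1] by simp
  next
    case (insert u U)
    then show ?case using bihom_mult_linX [OF insert.IH, of "- snd (rp u)" "fst (rp u)"] by simp
  qed
  define P1 :: form where "P1 = (\<lambda>X0 X1 Y0 Y1. (\<Prod>v\<in>V. - snd (rp v) * Y0 + fst (rp v) * Y1) * P0 X0 X1 Y0 Y1)"
  have P1: "bihomogeneous (card U) (card V) P1"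
    unfolding P1_def using assms(2)
  proof (induction V)
    case empty
    show ?case using P0 by simp
  next
    case (insert v V)
    then show ?case using bihom_mult_linY [OF insert.IH, of "- snd (rp v)" "fst (rp v)"]
      by (simp add: mult.assoc)
  qed
  define P2 :: form where "P2 = (\<lambda>X0 X1 Y0 Y1. (- snd (perp X) * X0 + fst (perp X) * X1) ^ (a - card U) * P1 X0 X1 Y0 Y1)"
  have P2: "bihomogeneous a (card V) P2"
    using bihom_mult_linX_power [OF P1, where n = "a - card U" and p = "- snd (perp X)" and q = "fst (perp X)"]
      assms(3) unfolding P2_def by simp
  define P3 :: form where "P3 = swF (\<lambda>X0 X1 Y0 Y1. (- snd (perp Y) * X0 + fst (perp Y) * X1) ^ (b - card V) * swF P2 X0 X1 Y0 Y1)"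
  have P3: "bihomogeneous a b P3"
    using bihom_swF [OF bihom_mult_linX_power [OF bihom_swF [OF P2], where n = "b - card V" and p = "- snd (perp Y)" and q = "fst (perp Y)"]]
      assms(4) unfolding P3_def by simp
  have ev3: "ev P3 X' Y' = dt (perp Y) Y' ^ (b - card V) * (dt (perp X) X' ^ (a - card U) *
      ((\<Prod>v\<in>V. dt (rp v) Y') * (\<Prod>u\<in>U. dt (rp u) X')))" for X' Y'
    by (simp add: P3_def P2_def P1_def P0_def ev_def swF_def dt_def)
  have dtrp: "dt (rp u) Z = 0 \<longleftrightarrow> u = PT Z" if "Z \<noteq> 0" for u Z
    using PT_eq_iff [OF rp(1) that, of u] by (simp add: rp)
  show ?thesis
  proof (rule that [OF P3])
    have "dt (perp X) X \<noteq> 0" "dt (perp Y) Y \<noteq> 0"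
      using dt_perp_nonzero [OF assms(5)] dt_perp_nonzero [OF assms(6)]
        dt_commute [of X "perp X"] dt_commute [of Y "perp Y"] by auto
    then show "ev P3 X Y \<noteq> 0"
      unfolding ev3 using assms dtrp by auto
    show "ev P3 X' Y' = 0" if "X' \<noteq> 0" "PT X' \<in> U" for X' Y'
      unfolding ev3 using that dtrp [OF that(1)] assms(1) by auto
    show "ev P3 X' Y' = 0" if "Y' \<noteq> 0" "PT Y' \<in> V" for X' Y'
      unfolding ev3 using that dtrp [OF that(1)] assms(2) by auto
  qed
qed

lemma isCont_holomorphic_0:
  assumes "g holomorphic_on ball 0 r" "r > 0"
  shows "isCont g 0"
  using assms by (meson centre_in_ball continuous_on_eq_continuous_at holomorphic_on_imp_continuous_on open_ball)

text \<open>Since \<open>P\<close> vanishes at all poles but \<open>(e, k)\<close>, the sum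
  \<open>Rs\<close> vanishes on good columns. Multiplied by \<open>x\<close>, its terms on the other
  branches over \<open>e\<close> tend to \<open>0\<close>, and therefore so does the term
  \<open>T q\<close> of the pole. A nonzero value of \<open>P\<close> at the pole would keep
  \<open>T q\<close> away from \<open>0\<close>.\<close>

lemma cayley_bacharach:
  assumes bih: "bihomogeneous a b F" and "smf F" "a \<ge> 2" "b \<ge> 2"
    and P: "bihomogeneous (a - 2) (b - 2) P"
    and mer: "merom F \<xi> Q" and sp: "simple_poles F \<xi> Q"
    and "e \<noteq> 0" "k \<noteq> 0" "ev F e k = 0" "(PT e, PT k) \<in> Q"
    and van: "\<And>X Y. X \<noteq> 0 \<Longrightarrow> Y \<noteq> 0 \<Longrightarrow> ev F X Y = 0 \<Longrightarrow> (PT X, PT Y) \<in> Q \<Longrightarrow>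
      (PT X, PT Y) \<noteq> (PT e, PT k) \<Longrightarrow> ev P X Y = 0"
  shows "ev P e k = 0"
proof -
  define d where "d = perp e"
  have ed: "dt e d \<noteq> 0" unfolding d_def by (rule dt_perp_nonzero [OF assms(8)])
  define q where "q = PT k"
  have q: "q \<in> col F e" using col_iff [OF bih assms(9)] assms(10) by (simp add: q_def)
  \<comment> \<open>The branches are centred at the chosen representatives, so \<open>k\<close> is
    replaced by the representative of the same point; homogeneity carries the result back.\<close>
  define k' m where "k' = rp q" and "m = perp k'"
  have k': "k' \<noteq> 0" "PT k' = q" by (simp_all add: k'_def rp)
  have km: "dt k' m \<noteq> 0" unfolding m_def by (rule dt_perp_nonzero [OF k'(1)])
  have ek: "ev F e k' = 0" using q by (simp add: col_iff_rp k'_def)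
  have kQ: "(PT e, PT k') \<in> Q" using assms(11) k' by (simp add: q_def)
  have u: "unram F e" by (rule simple_polesD(1) [OF sp ed km ek kQ])
  have b1: "b \<ge> 1" using assms(4) by simp
  note fin = col_card(1) [OF bih assms(2) b1 assms(8)]
  obtain r g where r: "r > 0" and g: "\<And>y. y \<in> col F e \<Longrightarrow> g y holomorphic_on ball 0 r \<and> g y 0 = 0 \<and>
      (\<forall>x\<in>ball 0 r. ev F (lin e d x) (lin (rp y) (perp (rp y)) (g y x)) = 0)"
    and col: "\<And>x. x \<in> ball 0 r \<Longrightarrow> inj_on (\<lambda>y. PT (lin (rp y) (perp (rp y)) (g y x))) (col F e) \<and>
      col F (lin e d x) = (\<lambda>y. PT (lin (rp y) (perp (rp y)) (g y x))) ` col F e"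
    using branches [OF bih assms(2,4) ed u] by blast
  define h where "h y x = PT (lin (rp y) (perp (rp y)) (g y x))" for y x
  define T where "T y x = x * tm F P \<xi> (lin e d x) (h y x)" for y x
  have evr: "\<forall>\<^sub>F x in at (0 :: complex). norm x < \<rho>" if "\<rho> > 0" for \<rho>
    using that by (auto simp: eventually_at intro!: exI [of _ \<rho>])
  have lim: "(T y \<longlongrightarrow> 0) (at 0)" if y: "y \<in> col F e" "y \<noteq> q" for y
  proof (rule tendstoI)
    fix \<epsilon> :: real assume \<epsilon>: "\<epsilon> > 0"
    have ky: "dt (rp y) (perp (rp y)) \<noteq> 0" by (rule dt_perp_nonzero [OF rp(1)])
    have ey: "ev F e (rp y) = 0" using y by (simp add: col_iff_rp)
    have vy: "(PT e, PT (rp y)) \<in> Q \<Longrightarrow> ev P e (rp y) = 0"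
      using van [OF assms(8) rp(1) ey] y(2) by (simp add: rp q_def)
    obtain \<delta> where \<delta>: "\<delta> > 0" "\<And>x t. x \<noteq> 0 \<Longrightarrow> norm x < \<delta> \<Longrightarrow> norm t < \<delta> \<Longrightarrow>
        ev F (lin e d x) (lin (rp y) (perp (rp y)) t) = 0 \<Longrightarrow>
        norm (x * tm F P \<xi> (lin e d x) (PT (lin (rp y) (perp (rp y)) t))) \<le> \<epsilon> / 2"
      using tm_small [OF bih assms(2,4) P mer sp ed ky ey vy, of "\<epsilon> / 2"] \<epsilon> by fastforce
    have "isCont (g y) 0" using g [OF y(1)] r isCont_holomorphic_0 by blast
    then have "(g y \<longlongrightarrow> 0) (at 0)" using g [OF y(1)] by (simp add: isCont_def)
    then have "\<forall>\<^sub>F x in at 0. norm (g y x) < \<delta>" using tendstoD [OF _ \<delta>(1)] by fastforce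
    moreover have "\<forall>\<^sub>F x in at (0 :: complex). x \<noteq> 0" by (simp add: eventually_at_filter)
    ultimately show "\<forall>\<^sub>F x in at 0. dist (T y x) 0 < \<epsilon>"
      using evr [OF r] evr [OF \<delta>(1)]
    proof eventually_elim
      case (elim x)
      have "norm (T y x) \<le> \<epsilon> / 2"
        unfolding T_def h_def using \<delta>(2) [OF elim(2,4,1)] g [OF y(1)] elim(3) by simp
      then show ?case using \<epsilon> by simp
    qed
  qed
  obtain \<rho> where \<rho>: "\<rho> > 0" "\<And>x. x \<noteq> 0 \<Longrightarrow> norm x < \<rho> \<Longrightarrow> good F Q (lin e d x)"
    using good_punctured [OF bih assms(2,4) mer sp ed] by blast
  have R0: "Rs F P \<xi> (lin e d x) = 0" if "x \<noteq> 0" "norm x < \<rho>" for x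
  proof (rule Rs_vanishes [OF bih assms(2-4) P mer sp ed _ that(1) \<rho>(2) [OF that]])
    fix X Y assume *: "X \<noteq> 0" "Y \<noteq> 0" "ev F X Y = 0" "(PT X, PT Y) \<in> Q" "dt X e \<noteq> 0"
    then have "PT X \<noteq> PT e" using PT_eq_iff assms(8) by blast
    then show "ev P X Y = 0" using van * by blast
  qed
  have "\<forall>\<^sub>F x in at (0 :: complex). x \<noteq> 0" by (simp add: eventually_at_filter)
  then have "\<forall>\<^sub>F x in at 0. - (\<Sum>y\<in>col F e - {q}. T y x) = T q x"
    using evr [OF r] evr [OF \<rho>(1)]
  proof eventually_elim
    case (elim x)
    have xr: "x \<in> ball 0 r" using elim by simp
    have inj: "inj_on (\<lambda>y. h y x) (col F e)" and img: "col F (lin e d x) = (\<lambda>y. h y x) ` col F e"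
      using col [OF xr] unfolding h_def by blast+
    have "0 = x * Rs F P \<xi> (lin e d x)" using R0 elim by simp
    also have "\<dots> = (\<Sum>y\<in>col F e. T y x)"
      unfolding Rs_def img sum.reindex [OF inj] sum_distrib_left T_def by simp
    also have "\<dots> = T q x + (\<Sum>y\<in>col F e - {q}. T y x)"
      by (rule sum.remove [OF fin q])
    finally have "(\<Sum>y\<in>col F e - {q}. T y x) = - T q x" by (simp add: add_eq_0_iff)
    then show ?case by simp
  qed
  moreover have "((\<lambda>x. - (\<Sum>y\<in>col F e - {q}. T y x)) \<longlongrightarrow> - (\<Sum>y\<in>col F e - {q}. 0)) (at 0)"
    by (intro tendsto_minus tendsto_sum lim) auto
  ultimately have Tq: "(T q \<longlongrightarrow> 0) (at 0)"
    using Lim_transform_eventually by fastforce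
  obtain M N \<delta> where MN: "poly2 M" "poly2 N" "\<delta> > 0"
    "\<And>x y. norm x < \<delta> \<Longrightarrow> norm y < \<delta> \<Longrightarrow> ev F (lin e d x) (lin k' m y) = 0 \<Longrightarrow>
         (M x y \<noteq> 0 \<or> N x y \<noteq> 0) \<and>
         ((PT (lin e d x), PT (lin k' m y)) \<in> Q \<longleftrightarrow> N x y = 0) \<and>
         (N x y \<noteq> 0 \<longrightarrow> \<xi> (PT (lin e d x), PT (lin k' m y)) = M x y / N x y)"
    using meromD [OF mer ed km ek] by (elim exE conjE) blast
  have N0: "N 0 0 = 0" and M0: "M 0 0 \<noteq> 0" using MN(4) [of 0 0] MN(3) ek kQ by auto
  define G where "G = g q"
  have G: "G holomorphic_on ball 0 r" "G 0 = 0"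
    "\<And>x. x \<in> ball 0 r \<Longrightarrow> ev F (lin e d x) (lin k' m (G x)) = 0"
    using g [OF q] by (auto simp: G_def k'_def m_def)
  have Gl: "(G \<longlongrightarrow> 0) (at 0)" using isCont_holomorphic_0 [OF G(1) r] G(2) by (simp add: isCont_def)
  define f where "f = (\<lambda>x y. ev F (lin e d x) (lin k' m y))"
  have f: "poly2 f" unfolding f_def by (rule poly2_slice [OF bih])
  define n where "n = (\<lambda>x. N x (G x))"
  have "(G has_field_derivative deriv G 0) (at 0)"
    using holomorphic_derivI [OF G(1) open_ball] r by simp
  then have "(n has_field_derivative d1 N 0 (G 0) * 1 + d2 N 0 (G 0) * deriv G 0) (at 0)"
    unfolding n_def by (intro poly2_has_field_derivative MN DERIV_ident)
  then have "((\<lambda>x. n x / x) \<longlongrightarrow> d1 N 0 (G 0) * 1 + d2 N 0 (G 0) * deriv G 0) (at 0)"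
    unfolding has_field_derivative_iff using N0 G(2) by (simp add: n_def)
  then obtain c where nl: "((\<lambda>x. n x / x) \<longlongrightarrow> c) (at 0)" by blast
  have kap: "kap F (lin e d x) (lin k' m y) * dt k' m = d2 f x y" if "f x y = 0" for x y
    using dY_eq_kap [OF bih lin_nonzero [OF km], of "lin e d x" y m] that km by (simp add: f_def d2_slice)
  \<comment> \<open>The definition of \<open>T q\<close> solved for \<open>P\<close>. All other
    factors have finite limits: \<open>n x / x\<close> tends to the derivative of \<open>N\<close>
    along the branch, which starts at a zero of \<open>N\<close>, and \<open>M\<close> stays
    nonzero. So \<open>P\<close> tends to \<open>0\<close> along the branch.\<close>
  have main: "\<forall>\<^sub>F x in at 0. T q x * (n x / x) * d2 f x (G x) / (dt k' m * M x (G x)) =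
      ev P (lin e d x) (lin k' m (G x))"
  proof -
    have "\<forall>\<^sub>F x in at 0. norm (G x) < \<delta>" using tendstoD [OF Gl MN(3)] by simp
    moreover have "((\<lambda>x. M x (G x)) \<longlongrightarrow> M 0 0) (at 0)"
      by (rule poly2_tendsto [OF MN(1) tendsto_ident_at Gl])
    then have "\<forall>\<^sub>F x in at 0. M x (G x) \<noteq> 0" by (rule tendsto_imp_eventually_ne [OF _ M0])
    moreover have "\<forall>\<^sub>F x in at (0 :: complex). x \<noteq> 0" by (simp add: eventually_at_filter)
    ultimately show ?thesis using evr [OF r] evr [OF MN(3)] evr [OF \<rho>(1)]
    proof eventually_elim
      case (elim x)
      have z: "ev F (lin e d x) (lin k' m (G x)) = 0" using G(3) elim by simp
      have hq: "h q x = PT (lin k' m (G x))" by (simp add: h_def k'_def m_def G_def)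
      have gd: "good F Q (lin e d x)" using \<rho>(2) elim by blast
      then have nQ: "(PT (lin e d x), PT (lin k' m (G x))) \<notin> Q"
        using col_iff [OF bih lin_nonzero [OF km]] z unfolding good_def by blast
      then have n0: "n x \<noteq> 0" and \<xi>: "\<xi> (PT (lin e d x), PT (lin k' m (G x))) = M x (G x) / n x"
        using MN(4) [of x "G x"] elim z unfolding n_def by auto
      have "kap F (lin e d x) (lin k' m (G x)) \<noteq> 0"
        using gd z lin_nonzero [OF km] unfolding good_def unram_def by blast
      moreover have "d2 f x (G x) = kap F (lin e d x) (lin k' m (G x)) * dt k' m"
        using kap [of x "G x"] z by (simp add: f_def)
      ultimately show ?case
        unfolding T_def hq tm_PT [OF bih P assms(4) lin_nonzero [OF km] z] \<xi>
        using n0 elim(2,3) km by simp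
    qed
  qed
  have "((\<lambda>x. T q x * (n x / x) * d2 f x (G x) / (dt k' m * M x (G x))) \<longlongrightarrow>
      0 * c * d2 f 0 0 / (dt k' m * M 0 0)) (at 0)"
    using M0 km
    by (intro tendsto_divide tendsto_mult tendsto_const Tq nl
        poly2_tendsto [OF poly2_d2 [OF f] tendsto_ident_at Gl]
        poly2_tendsto [OF MN(1) tendsto_ident_at Gl]) auto
  then have "((\<lambda>x. ev P (lin e d x) (lin k' m (G x))) \<longlongrightarrow> 0) (at 0)"
    using Lim_transform_eventually [OF _ main] by simp
  moreover have "((\<lambda>x. ev P (lin e d x) (lin k' m (G x))) \<longlongrightarrow> ev P (lin e d 0) (lin k' m 0)) (at 0)"
    by (intro ev_tendsto [OF P] lin_tendsto Gl tendsto_ident_at)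
  ultimately have "ev P e k' = 0" using tendsto_unique [OF at_neq_bot] by (metis lin_0)
  moreover have "k' \<noteq> 0" "dt k' k = 0" using k' PT_eq_iff [OF k'(1) assms(9)] by (auto simp: q_def)
  then obtain t where "k = sc t k'" using dt_eq_0E by blast
  ultimately show ?thesis by (simp add: ev_sc_right [OF P])
qed

section \<open>Automorphisms are linear\<close>

definition regular :: "form \<Rightarrow> (proj1 \<times> proj1 \<Rightarrow> proj1) \<Rightarrow> bool" where
  "regular F \<phi> \<longleftrightarrow> (\<forall>e d k m. dt e d \<noteq> 0 \<longrightarrow> dt k m \<noteq> 0 \<longrightarrow> ev F e k = 0 \<longrightarrow>
     (\<exists>A0 A1 \<delta>. poly2 A0 \<and> poly2 A1 \<and> \<delta> > 0 \<and>
       (\<forall>x y. norm x < \<delta> \<longrightarrow> norm y < \<delta> \<longrightarrow> ev F (lin e d x) (lin k m y) = 0 \<longrightarrow>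
         (A0 x y, A1 x y) \<noteq> 0 \<and> \<phi> (PT (lin e d x), PT (lin k m y)) = PT (A0 x y, A1 x y))))"

text \<open>The affine coordinate of the target line with its pole at \<open>PT l\<close> and its
  zero at \<open>PT (perp l)\<close>, composed with \<open>\<phi>\<close>.\<close>

definition xi :: "cvec \<Rightarrow> (proj1 \<times> proj1 \<Rightarrow> proj1) \<Rightarrow> proj1 \<times> proj1 \<Rightarrow> complex" where
  "xi l \<phi> p = dt (perp l) (rp (\<phi> p)) / dt l (rp (\<phi> p))"

definition poles :: "cvec \<Rightarrow> (proj1 \<times> proj1 \<Rightarrow> proj1) \<Rightarrow> (proj1 \<times> proj1) set" where
  "poles l \<phi> = {p. \<phi> p = PT l}"

lemma xi_PT:
  assumes "\<phi> p = PT u" "u \<noteq> 0"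
  shows "xi l \<phi> p = dt (perp l) u / dt l u"
proof -
  obtain t where "t \<noteq> 0" "rp (PT u) = sc t u" using rp_PTE assms(2) by blast
  then show ?thesis by (simp add: xi_def assms(1))
qed

lemma regularD:
  assumes "regular F \<phi>" "dt e d \<noteq> 0" "dt k m \<noteq> 0" "ev F e k = 0"
  shows "\<exists>A0 A1 \<delta>. poly2 A0 \<and> poly2 A1 \<and> \<delta> > 0 \<and>
       (\<forall>x y. norm x < \<delta> \<longrightarrow> norm y < \<delta> \<longrightarrow> ev F (lin e d x) (lin k m y) = 0 \<longrightarrow>
         (A0 x y, A1 x y) \<noteq> 0 \<and> \<phi> (PT (lin e d x), PT (lin k m y)) = PT (A0 x y, A1 x y))"
  using assms(1) [unfolded regular_def, rule_format, OF assms(2-4)] .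

lemma poly2_dt: "poly2 A0 \<Longrightarrow> poly2 A1 \<Longrightarrow> poly2 (\<lambda>x y. dt l (A0 x y, A1 x y))"
  unfolding dt_def fst_conv snd_conv by (intro poly2_diff poly2.mult poly2.const)

lemma dt_zero_both:
  assumes "dt l u = 0" "dt (perp l) u = 0" "l \<noteq> 0"
  shows "u = 0"
proof (rule ccontr)
  assume u: "u \<noteq> 0"
  have "dt u l = 0" "dt u (perp l) = 0" using assms(1,2) by (simp_all add: dt_commute [of u])
  then obtain s t where st: "l = sc s u" "perp l = sc t u" by (metis dt_eq_0E u)
  have "dt l (perp l) = 0" unfolding st(2) by (subst st(1)) (simp add: dt_def [of u u])
  then show False using dt_perp_nonzero [OF assms(3)] by simp
qed

section \<open>Poles over an unramified value are simple\<close>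

lemma merom_regular:
  assumes "regular F \<phi>" "l \<noteq> 0"
  shows "merom F (xi l \<phi>) (poles l \<phi>)"
  unfolding merom_def
proof (intro allI impI)
  fix e d k m assume *: "dt e d \<noteq> 0" "dt k m \<noteq> 0" "ev F e k = 0"
  obtain A0 A1 \<delta> where A: "poly2 A0" "poly2 A1" "\<delta> > 0"
    "\<And>x y. norm x < \<delta> \<Longrightarrow> norm y < \<delta> \<Longrightarrow> ev F (lin e d x) (lin k m y) = 0 \<Longrightarrow>
         (A0 x y, A1 x y) \<noteq> 0 \<and> \<phi> (PT (lin e d x), PT (lin k m y)) = PT (A0 x y, A1 x y)"
    using regularD [OF assms(1) *] by (elim exE conjE) blast
  define M where "M = (\<lambda>x y. dt (perp l) (A0 x y, A1 x y))"
  define N where "N = (\<lambda>x y. dt l (A0 x y, A1 x y))"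
  have "poly2 M" "poly2 N" unfolding M_def N_def by (rule poly2_dt [OF A(1,2)])+
  moreover have "(M x y \<noteq> 0 \<or> N x y \<noteq> 0) \<and>
      ((PT (lin e d x), PT (lin k m y)) \<in> poles l \<phi> \<longleftrightarrow> N x y = 0) \<and>
      (N x y \<noteq> 0 \<longrightarrow> xi l \<phi> (PT (lin e d x), PT (lin k m y)) = M x y / N x y)"
    if z: "norm x < \<delta>" "norm y < \<delta>" "ev F (lin e d x) (lin k m y) = 0" for x y
  proof -
    have nz: "(A0 x y, A1 x y) \<noteq> 0" and \<phi>: "\<phi> (PT (lin e d x), PT (lin k m y)) = PT (A0 x y, A1 x y)"
      using A(4) [OF z] by auto
    have "(PT (lin e d x), PT (lin k m y)) \<in> poles l \<phi> \<longleftrightarrow> N x y = 0"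
      unfolding poles_def mem_Collect_eq \<phi> N_def using PT_eq_iff [OF assms(2) nz] by auto
    moreover have "M x y \<noteq> 0 \<or> N x y \<noteq> 0"
      using dt_zero_both [OF _ _ assms(2)] nz unfolding M_def N_def by blast
    ultimately show ?thesis using xi_PT [where \<phi> = \<phi> and p = "(PT (lin e d x), PT (lin k m y))", OF \<phi> nz] by (simp add: M_def N_def)
  qed
  ultimately show "\<exists>M N \<delta>. poly2 M \<and> poly2 N \<and> 0 < \<delta> \<and>
       (\<forall>x y. norm x < \<delta> \<longrightarrow> norm y < \<delta> \<longrightarrow> ev F (lin e d x) (lin k m y) = 0 \<longrightarrow>
         (M x y \<noteq> 0 \<or> N x y \<noteq> 0) \<and>
         ((PT (lin e d x), PT (lin k m y)) \<in> poles l \<phi> \<longleftrightarrow> N x y = 0) \<and>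
         (N x y \<noteq> 0 \<longrightarrow> xi l \<phi> (PT (lin e d x), PT (lin k m y)) = M x y / N x y))"
    using A(3) by blast
qed

text \<open>Over an unramified \<open>l\<close> the curve is locally a graph over the first
  coordinate, so nearby points with equal first coordinates coincide. Vectors rather than points
  appear because the lemma is applied to the homogeneous values of regular maps.\<close>

lemma unram_unique:
  assumes bih: "bihomogeneous a b G" and u: "unram G l" and l: "l \<noteq> 0" and k: "k \<noteq> 0" and z: "ev G l k = 0"
  shows "\<exists>\<epsilon>>0. \<forall>X Y Y'. dist X l < \<epsilon> \<longrightarrow> dist Y k < \<epsilon> \<longrightarrow> dist Y' k < \<epsilon> \<longrightarrow>
    ev G X Y = 0 \<longrightarrow> ev G X Y' = 0 \<longrightarrow> dt Y Y' = 0"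
proof -
  define d where "d = perp l"
  define m where "m = perp k"
  have ld: "dt l d \<noteq> 0" and km: "dt k m \<noteq> 0" unfolding d_def m_def using dt_perp_nonzero l k by auto
  have "kap G l k \<noteq> 0" using u k z unfolding unram_def by blast
  then have "d2 (\<lambda>x y. ev G (lin l d x) (lin k m y)) 0 0 \<noteq> 0"
    using dY_eq_kap [OF bih k z, of m] km by (simp add: d2_slice)
  moreover have "ev G (lin l d 0) (lin k m 0) = 0" using z by simp
  ultimately obtain \<delta> \<epsilon> g where g: "\<delta> > 0" "\<epsilon> > 0"
    "\<And>x y. norm x < \<delta> \<Longrightarrow> norm y < \<epsilon> \<Longrightarrow> ev G (lin l d x) (lin k m y) = 0 \<Longrightarrow> y = g x"
    using implicit_function [OF poly2_slice [OF bih]] by blast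
  have coord: "\<exists>\<eta>>0. \<forall>X. dist X u < \<eta> \<longrightarrow> dt X v \<noteq> 0 \<and> norm (dt u X / dt X v) < \<rho>"
    if "dt u v \<noteq> 0" "\<rho> > 0" for u v \<rho>
  proof -
    have t: "((\<lambda>X. dt X v) \<longlongrightarrow> dt u v) (nhds u)"
      by (intro dt_tendsto tendsto_const filterlim_ident)
    have "((\<lambda>X. dt u X / dt X v) \<longlongrightarrow> dt u u / dt u v) (nhds u)"
      by (intro tendsto_divide dt_tendsto tendsto_const filterlim_ident that)
    then have "\<forall>\<^sub>F X in nhds u. norm (dt u X / dt X v) < \<rho>"
      using tendstoD [OF _ that(2)] by (fastforce simp: dt_def [of u u])
    moreover have "\<forall>\<^sub>F X in nhds u. dt X v \<noteq> 0" by (rule tendsto_imp_eventually_ne [OF t that(1)])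
    ultimately have "\<forall>\<^sub>F X in nhds u. dt X v \<noteq> 0 \<and> norm (dt u X / dt X v) < \<rho>"
      by eventually_elim simp
    then show ?thesis unfolding eventually_nhds_metric .
  qed
  obtain \<eta>1 where \<eta>1: "\<eta>1 > 0" "\<And>X. dist X l < \<eta>1 \<Longrightarrow> dt X d \<noteq> 0 \<and> norm (dt l X / dt X d) < \<delta>"
    using coord [OF ld g(1)] by blast
  obtain \<eta>2 where \<eta>2: "\<eta>2 > 0" "\<And>X. dist X k < \<eta>2 \<Longrightarrow> dt X m \<noteq> 0 \<and> norm (dt k X / dt X m) < \<epsilon>"
    using coord [OF km g(2)] by blast
  show ?thesis
  proof (rule exI [of _ "min \<eta>1 \<eta>2"], rule conjI [rotated], intro allI impI)
    fix X Y Y' assume *: "dist X l < min \<eta>1 \<eta>2" "dist Y k < min \<eta>1 \<eta>2" "dist Y' k < min \<eta>1 \<eta>2"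
      "ev G X Y = 0" "ev G X Y' = 0"
    have X: "dt X d \<noteq> 0" "norm (dt l X / dt X d) < \<delta>" using \<eta>1(2) [of X] *(1) by auto
    have "dt k Z / dt Z m = g (dt l X / dt X d)" if "dist Z k < \<eta>2" "ev G X Z = 0" for Z
    proof (rule g(3) [OF X(2)])
      have Z: "dt Z m \<noteq> 0" "norm (dt k Z / dt Z m) < \<epsilon>" using \<eta>2(2) that(1) by auto
      show "norm (dt k Z / dt Z m) < \<epsilon>" by (rule Z(2))
      have "ev G (sc (dt X d / dt l d) (lin l d (dt l X / dt X d))) (sc (dt Z m / dt k m) (lin k m (dt k Z / dt Z m))) = 0"
        using basis_expand_lin [OF ld X(1)] basis_expand_lin [OF km Z(1)] that(2) by simp
      then show "ev G (lin l d (dt l X / dt X d)) (lin k m (dt k Z / dt Z m)) = 0"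
        using X Z ld km by (simp add: ev_sc [OF bih])
    qed
    then have eq: "dt k Y / dt Y m = dt k Y' / dt Y' m" using * by simp
    have Y: "dt Y m \<noteq> 0" "dt Y' m \<noteq> 0" using \<eta>2(2) * by auto
    show "dt Y Y' = 0"
      by (subst basis_expand_lin [OF km Y(1)], subst basis_expand_lin [OF km Y(2)])
        (simp add: eq dt_def [of "lin k m _" "lin k m _"])
  qed (use \<eta>1 \<eta>2 in auto)
qed

text \<open>A Pluecker relation. With \<open>m\<close> independent of \<open>l\<close>, equal ratios
  \<open>dt l u / dt m u\<close> and \<open>dt l v / dt m v\<close> mean that \<open>u\<close> and
  \<open>v\<close> are proportional.\<close>

lemma dt_cross:
  "dt l u * dt m v - dt l v * dt m u = dt l m * dt u v"
  by (simp add: dt_def algebra_simps)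

text \<open>Along the branch through a pole, \<open>v\<close> is the reciprocal of
  \<open>\<xi>\<close>. It is injective: equal values of \<open>v\<close> mean equal values of
  \<open>\<phi>\<close>, then of \<open>\<psi>\<close> because the target column over
  \<open>l\<close> is unramified, and \<open>(\<phi>, \<psi>)\<close> is injective. An injective
  holomorphic function has nonzero derivative, so the pole of \<open>\<xi>\<close> is simple in
  \<open>x\<close>, the local parameter on the unramified column over \<open>e\<close>.\<close>

lemma simple_poles_regular:
  assumes bih: "bihomogeneous a b F" and "smf F" "b \<ge> 2"
    and bihG: "bihomogeneous a' b' G" and "b' \<ge> 2"
    and \<phi>: "regular F \<phi>" and \<psi>: "regular F \<psi>"
    and inj: "\<And>p p'. p \<in> zero_locus F \<Longrightarrow> p' \<in> zero_locus F \<Longrightarrow> \<phi> p = \<phi> p' \<Longrightarrow> \<psi> p = \<psi> p' \<Longrightarrow> p = p'"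
    and maps: "\<And>p. p \<in> zero_locus F \<Longrightarrow> (\<phi> p, \<psi> p) \<in> zero_locus G"
    and l: "l \<noteq> 0" "unram G l"
    and unr: "\<And>e k. e \<noteq> 0 \<Longrightarrow> k \<noteq> 0 \<Longrightarrow> ev F e k = 0 \<Longrightarrow> \<phi> (PT e, PT k) = PT l \<Longrightarrow> unram F e"
  shows "simple_poles F (xi l \<phi>) (poles l \<phi>)"
  unfolding simple_poles_def
proof (intro allI impI)
  fix e d k m assume ed: "dt e d \<noteq> 0" and km: "dt k m \<noteq> 0" and ek: "ev F e k = 0"
    and Q: "(PT e, PT k) \<in> poles l \<phi>"
  have e0: "e \<noteq> 0" and k0: "k \<noteq> 0" using dt_nonzeroD(1) ed km by auto
  have u: "unram F e" using unr [OF e0 k0 ek] Q by (simp add: poles_def)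
  define f where "f = (\<lambda>x y. ev F (lin e d x) (lin k m y))"
  have f: "poly2 f" unfolding f_def by (rule poly2_slice [OF bih])
  have "kap F e k \<noteq> 0" using u k0 ek unfolding unram_def by blast
  then have "d2 f 0 0 \<noteq> 0" using dY_eq_kap [OF bih k0 ek, of m] km by (simp add: f_def d2_slice)
  moreover have "f 0 0 = 0" using ek by (simp add: f_def)
  ultimately obtain \<delta> \<epsilon> g where g: "\<delta> > 0" "\<epsilon> > 0" "g holomorphic_on ball 0 \<delta>" "g 0 = 0"
    "\<And>x. norm x < \<delta> \<Longrightarrow> f x (g x) = 0"
    "\<And>x y. norm x < \<delta> \<Longrightarrow> norm y < \<epsilon> \<Longrightarrow> f x y = 0 \<Longrightarrow> y = g x"
    using implicit_function [OF f] by blast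
  obtain A0 A1 \<delta>1 where A: "poly2 A0" "poly2 A1" "\<delta>1 > 0"
    "\<And>x y. norm x < \<delta>1 \<Longrightarrow> norm y < \<delta>1 \<Longrightarrow> ev F (lin e d x) (lin k m y) = 0 \<Longrightarrow>
         (A0 x y, A1 x y) \<noteq> 0 \<and> \<phi> (PT (lin e d x), PT (lin k m y)) = PT (A0 x y, A1 x y)"
    using regularD [OF \<phi> ed km ek] by (elim exE conjE) blast
  obtain B0 B1 \<delta>2 where B: "poly2 B0" "poly2 B1" "\<delta>2 > 0"
    "\<And>x y. norm x < \<delta>2 \<Longrightarrow> norm y < \<delta>2 \<Longrightarrow> ev F (lin e d x) (lin k m y) = 0 \<Longrightarrow>
         (B0 x y, B1 x y) \<noteq> 0 \<and> \<psi> (PT (lin e d x), PT (lin k m y)) = PT (B0 x y, B1 x y)"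
    using regularD [OF \<psi> ed km ek] by (elim exE conjE) blast
  define \<alpha> where "\<alpha> x = (A0 x (g x), A1 x (g x))" for x
  define \<beta> where "\<beta> x = (B0 x (g x), B1 x (g x))" for x
  have \<alpha>0: "\<alpha> 0 \<noteq> 0" "\<phi> (PT e, PT k) = PT (\<alpha> 0)" using A(3) A(4) [of 0 0] ek g(4) by (auto simp: \<alpha>_def)
  have \<beta>0: "\<beta> 0 \<noteq> 0" "\<psi> (PT e, PT k) = PT (\<beta> 0)" using B(3) B(4) [of 0 0] ek g(4) by (auto simp: \<beta>_def)
  have dt\<alpha>0: "dt l (\<alpha> 0) = 0" using Q \<alpha>0 PT_eq_iff [OF l(1) \<alpha>0(1)] by (simp add: poles_def)
  then obtain t where t: "\<alpha> 0 = sc t l" using dt_eq_0E l(1) by blast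
  have t0: "t \<noteq> 0" using t \<alpha>0(1) by auto
  have ua: "unram G (\<alpha> 0)" unfolding t using unram_sc [OF bihG t0 assms(5)] l(2) by simp
  have zG: "ev G (\<alpha> 0) (\<beta> 0) = 0"
    using maps [of "(PT e, PT k)"] zero_locus_iff [OF bih e0 k0] ek
      zero_locus_iff [OF bihG \<alpha>0(1) \<beta>0(1)] \<alpha>0(2) \<beta>0(2) by simp
  obtain \<eta> where \<eta>: "\<eta> > 0" "\<And>X Y Y'. dist X (\<alpha> 0) < \<eta> \<Longrightarrow> dist Y (\<beta> 0) < \<eta> \<Longrightarrow> dist Y' (\<beta> 0) < \<eta> \<Longrightarrow>
    ev G X Y = 0 \<Longrightarrow> ev G X Y' = 0 \<Longrightarrow> dt Y Y' = 0"
    using unram_unique [OF bihG ua \<alpha>0(1) \<beta>0(1) zG] by blast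
  have gc: "isCont g 0" by (rule isCont_holomorphic_0 [OF g(3,1)])
  have gl: "(g \<longlongrightarrow> 0) (nhds 0)" using gc g(4) unfolding isCont_def tendsto_at_iff_tendsto_nhds by simp
  have \<alpha>l: "(\<alpha> \<longlongrightarrow> \<alpha> 0) (nhds 0)" and \<beta>l: "(\<beta> \<longlongrightarrow> \<beta> 0) (nhds 0)"
    unfolding \<alpha>_def \<beta>_def g(4)
    by (intro tendsto_Pair poly2_tendsto [OF A(1) filterlim_ident gl] poly2_tendsto [OF A(2) filterlim_ident gl]
        poly2_tendsto [OF B(1) filterlim_ident gl] poly2_tendsto [OF B(2) filterlim_ident gl])+
  have dtp0: "dt (perp l) (\<alpha> 0) \<noteq> 0" using dt_zero_both [OF dt\<alpha>0 _ l(1)] \<alpha>0(1) by blast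
  have "((\<lambda>x. dt (perp l) (\<alpha> x)) \<longlongrightarrow> dt (perp l) (\<alpha> 0)) (nhds 0)"
    by (intro dt_tendsto tendsto_const \<alpha>l)
  then have "\<forall>\<^sub>F x in nhds 0. dt (perp l) (\<alpha> x) \<noteq> 0" by (rule tendsto_imp_eventually_ne [OF _ dtp0])
  moreover have "\<forall>\<^sub>F x in nhds 0. norm (g x) < min \<delta>1 \<delta>2"
    using tendstoD [OF gl, of "min \<delta>1 \<delta>2"] A(3) B(3) by simp
  moreover have "\<forall>\<^sub>F x in nhds 0. dist (\<alpha> x) (\<alpha> 0) < \<eta>" by (rule tendstoD [OF \<alpha>l \<eta>(1)])
  moreover have "\<forall>\<^sub>F x in nhds 0. dist (\<beta> x) (\<beta> 0) < \<eta>" by (rule tendstoD [OF \<beta>l \<eta>(1)])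
  ultimately have "\<forall>\<^sub>F x in nhds 0. dt (perp l) (\<alpha> x) \<noteq> 0 \<and> norm (g x) < min \<delta>1 \<delta>2 \<and>
      dist (\<alpha> x) (\<alpha> 0) < \<eta> \<and> dist (\<beta> x) (\<beta> 0) < \<eta>"
    by eventually_elim blast
  then obtain r0 where r0: "r0 > 0" "\<And>x. norm x < r0 \<Longrightarrow> dt (perp l) (\<alpha> x) \<noteq> 0 \<and> norm (g x) < min \<delta>1 \<delta>2 \<and>
      dist (\<alpha> x) (\<alpha> 0) < \<eta> \<and> dist (\<beta> x) (\<beta> 0) < \<eta>"
    unfolding eventually_nhds_metric by auto
  define r where "r = min (min r0 \<delta>) (min \<delta>1 \<delta>2)"
  have r: "r > 0" using r0 g A B by (simp add: r_def)
  have pt: "f x (g x) = 0" "\<alpha> x \<noteq> 0" "\<phi> (PT (lin e d x), PT (lin k m (g x))) = PT (\<alpha> x)"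
      "\<beta> x \<noteq> 0" "\<psi> (PT (lin e d x), PT (lin k m (g x))) = PT (\<beta> x)" "ev G (\<alpha> x) (\<beta> x) = 0"
      "(PT (lin e d x), PT (lin k m (g x))) \<in> zero_locus F"
    if x: "norm x < r" for x
  proof -
    have x': "norm x < \<delta>" "norm x < \<delta>1" "norm x < \<delta>2" "norm x < r0"
      using x unfolding r_def min_less_iff_conj by blast+
    have gx: "norm (g x) < \<delta>1" "norm (g x) < \<delta>2" using r0(2) [OF x'(4)] unfolding min_less_iff_conj by blast+
    show 1: "f x (g x) = 0" using g(5) x' by blast
    show 2: "\<alpha> x \<noteq> 0" "\<phi> (PT (lin e d x), PT (lin k m (g x))) = PT (\<alpha> x)"
      using A(4) [OF x'(2) gx(1)] 1 unfolding \<alpha>_def f_def by blast+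
    show 3: "\<beta> x \<noteq> 0" "\<psi> (PT (lin e d x), PT (lin k m (g x))) = PT (\<beta> x)"
      using B(4) [OF x'(3) gx(2)] 1 unfolding \<beta>_def f_def by blast+
    show 4: "(PT (lin e d x), PT (lin k m (g x))) \<in> zero_locus F"
      using zero_locus_iff [OF bih lin_nonzero [OF ed] lin_nonzero [OF km]] 1 by (simp add: f_def)
    show "ev G (\<alpha> x) (\<beta> x) = 0"
      using maps [OF 4] zero_locus_iff [OF bihG 2(1) 3(1)] 2(2) 3(2) by simp
  qed
  define v where "v x = dt l (\<alpha> x) / dt (perp l) (\<alpha> x)" for x
  have ne: "dt (perp l) (\<alpha> x) \<noteq> 0" if "norm x < r" for x
    using r0(2) [of x] that unfolding r_def min_less_iff_conj by blast
  have "g holomorphic_on ball 0 r" using g(3) by (rule holomorphic_on_subset) (auto simp: r_def)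
  then have hA: "(\<lambda>x. A0 x (g x)) holomorphic_on ball 0 r" "(\<lambda>x. A1 x (g x)) holomorphic_on ball 0 r"
    by (rule poly2_holomorphic_on [OF A(1) holomorphic_on_ident] poly2_holomorphic_on [OF A(2) holomorphic_on_ident])+
  have hv: "v holomorphic_on ball 0 r"
    unfolding v_def
  proof (rule holomorphic_on_divide)
    show "(\<lambda>x. dt l (\<alpha> x)) holomorphic_on ball 0 r" "(\<lambda>x. dt (perp l) (\<alpha> x)) holomorphic_on ball 0 r"
      unfolding dt_def \<alpha>_def fst_conv snd_conv by (intro holomorphic_intros hA)+
  qed (use ne in auto)
  have "inj_on v (ball 0 r)"
  proof (rule inj_onI)
    fix x1 x2 assume "x1 \<in> ball 0 r" "x2 \<in> ball 0 r" and eq: "v x1 = v x2"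
    then have x: "norm x1 < r" "norm x2 < r" by auto
    have "dt l (\<alpha> x1) * dt (perp l) (\<alpha> x2) = dt l (\<alpha> x2) * dt (perp l) (\<alpha> x1)"
      using eq ne [OF x(1)] ne [OF x(2)] by (simp add: v_def field_simps)
    then have "dt l (perp l) * dt (\<alpha> x1) (\<alpha> x2) = 0" using dt_cross [of l "\<alpha> x1" "perp l" "\<alpha> x2"] by simp
    then have dA: "dt (\<alpha> x1) (\<alpha> x2) = 0" using dt_perp_nonzero [OF l(1)] by simp
    then obtain s where s: "\<alpha> x2 = sc s (\<alpha> x1)" using dt_eq_0E pt(2) [OF x(1)] by blast
    have s0: "s \<noteq> 0" using s pt(2) [OF x(2)] by auto
    have "ev G (\<alpha> x1) (\<beta> x2) = 0" using pt(6) [OF x(2)] s s0 by (simp add: ev_sc_left [OF bihG])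
    then have dB: "dt (\<beta> x1) (\<beta> x2) = 0"
      using \<eta>(2) [of "\<alpha> x1" "\<beta> x1" "\<beta> x2"] r0(2) [of x1] r0(2) [of x2] pt(6) [OF x(1)] x
      unfolding r_def min_less_iff_conj by blast
    have "(PT (lin e d x1), PT (lin k m (g x1))) = (PT (lin e d x2), PT (lin k m (g x2)))"
    proof (rule inj [OF pt(7) [OF x(1)] pt(7) [OF x(2)]])
      show "\<phi> (PT (lin e d x1), PT (lin k m (g x1))) = \<phi> (PT (lin e d x2), PT (lin k m (g x2)))"
        unfolding pt(3) [OF x(1)] pt(3) [OF x(2)] using PT_eq_iff pt(2) x dA by blast
      show "\<psi> (PT (lin e d x1), PT (lin k m (g x1))) = \<psi> (PT (lin e d x2), PT (lin k m (g x2)))"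
        unfolding pt(5) [OF x(1)] pt(5) [OF x(2)] using PT_eq_iff pt(4) x dB by blast
    qed
    then have "dt (lin e d x1) (lin e d x2) = 0"
      using PT_eq_iff [OF lin_nonzero [OF ed] lin_nonzero [OF ed]] by simp
    then have "(x2 - x1) * dt e d = 0" by (simp add: dt_def lin_def algebra_simps)
    then show "x1 = x2" using ed by simp
  qed
  then have dv: "deriv v 0 \<noteq> 0"
    using holomorphic_injective_imp_regular [OF hv open_ball] r by simp
  have v0: "v 0 = 0" by (simp add: v_def dt\<alpha>0)
  have "(v has_field_derivative deriv v 0) (at 0)"
    using holomorphic_derivI [OF hv open_ball] r by simp
  then have "((\<lambda>x. v x / x) \<longlongrightarrow> deriv v 0) (at 0)" using v0 by (simp add: has_field_derivative_iff)
  then have "((\<lambda>x. norm (v x / x)) \<longlongrightarrow> norm (deriv v 0)) (at 0)" by (rule tendsto_norm)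
  moreover have "norm (deriv v 0) / 2 < norm (deriv v 0)" using dv by simp
  ultimately have "\<forall>\<^sub>F x in at 0. norm (deriv v 0) / 2 < norm (v x / x)" by (rule order_tendstoD)
  then obtain r1 where r1: "r1 > 0" "\<And>x. x \<noteq> 0 \<Longrightarrow> norm x < r1 \<Longrightarrow> norm (deriv v 0) / 2 < norm (v x / x)"
    unfolding eventually_at by auto
  have "(PT (lin e d x), PT (lin k m y)) \<notin> poles l \<phi> \<and>
      norm (x * xi l \<phi> (PT (lin e d x), PT (lin k m y))) \<le> inverse (norm (deriv v 0) / 2)"
    if x0: "x \<noteq> 0" and x: "norm x < min (min r r1) \<epsilon>" and y: "norm y < min (min r r1) \<epsilon>"
      and z: "ev F (lin e d x) (lin k m y) = 0" for x y
  proof -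
    have xr: "norm x < r" "norm x < r1" "norm y < \<epsilon>" using x y unfolding min_less_iff_conj by blast+
    have "norm x < \<delta>" using xr(1) by (simp add: r_def)
    then have yg: "y = g x" using g(6) xr(3) z unfolding f_def by blast
    have lt: "norm (deriv v 0) / 2 < norm (v x / x)" using r1(2) [OF x0 xr(2)] .
    have v: "v x / x \<noteq> 0" using lt by (metis dv divide_pos_pos less_asym norm_zero zero_less_norm_iff zero_less_numeral)
    have le: "inverse (norm (v x / x)) \<le> inverse (norm (deriv v 0) / 2)"
      by (rule le_imp_inverse_le) (use lt dv in auto)
    have nz: "dt l (\<alpha> x) \<noteq> 0" using v by (auto simp: v_def)
    have np: "(PT (lin e d x), PT (lin k m y)) \<notin> poles l \<phi>"
      using pt(2,3) [OF xr(1)] yg PT_eq_iff [OF l(1) pt(2) [OF xr(1)]] nz by (auto simp: poles_def)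
    have eq: "x * xi l \<phi> (PT (lin e d x), PT (lin k m y)) = inverse (v x / x)"
      unfolding yg xi_PT [where \<phi> = \<phi> and p = "(PT (lin e d x), PT (lin k m (g x)))", OF pt(3,2) [OF xr(1)]] v_def
      by simp
    show ?thesis unfolding eq norm_inverse using np le by blast
  qed
  moreover have "min (min r r1) \<epsilon> > 0" using r r1 g by simp
  ultimately show "unram F e \<and> (\<exists>B \<delta>. \<delta> > 0 \<and> (\<forall>x y. x \<noteq> 0 \<longrightarrow> norm x < \<delta> \<longrightarrow> norm y < \<delta> \<longrightarrow>
       ev F (lin e d x) (lin k m y) = 0 \<longrightarrow> (PT (lin e d x), PT (lin k m y)) \<notin> poles l \<phi> \<and>
       norm (x * xi l \<phi> (PT (lin e d x), PT (lin k m y))) \<le> B))"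
    using u by blast
qed

text \<open>Take for \<open>P\<close> the product of the rows through the other points of the column, and compare
  \<open>\<xi>\<close> with the constant function \<open>1\<close>.\<close>

lemma column_constant:
  assumes bih: "bihomogeneous a b F" and "smf F" "a \<ge> 2" "b \<ge> 2"
    and mer: "merom F \<xi> Q" and sp: "simple_poles F \<xi> Q" and ed: "dt e d \<noteq> 0"
    and allin: "\<And>X Y. X \<noteq> 0 \<Longrightarrow> Y \<noteq> 0 \<Longrightarrow> ev F X Y = 0 \<Longrightarrow> (PT X, PT Y) \<in> Q \<Longrightarrow> dt X e = 0"
    and "x \<noteq> 0" and gd: "good F Q (lin e d x)"
    and y: "y1 \<in> col F (lin e d x)" "y2 \<in> col F (lin e d x)"
  shows "\<xi> (PT (lin e d x), y1) = \<xi> (PT (lin e d x), y2)"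
proof (cases "y1 = y2")
  case False
  define X where "X = lin e d x"
  have X0: "X \<noteq> 0" unfolding X_def by (rule lin_nonzero [OF ed])
  have b1: "b \<ge> 1" using assms(4) by simp
  have u: "unram F X" using gd by (simp add: good_def X_def)
  note fin = col_card(1) [OF bih assms(2) b1 X0]
  define V where "V = col F X - {y1, y2}"
  \<comment> \<open>An unramified column has exactly \<open>b\<close> points, so omitting two of
    them uses up the degree of \<open>P\<close> in \<open>Y\<close>.\<close>
  have "card V = b - 2"
    using col_card(3) [OF bih assms(2) b1 X0 u] card_Diff_subset [of "{y1, y2}" "col F X"] y False
    by (simp add: V_def X_def)
  then have cV: "finite V" "card V \<le> b - 2" using fin by (simp_all add: V_def)
  have nV: "\<And>v. v \<in> V \<Longrightarrow> v \<noteq> PT (rp y1)" by (auto simp: V_def rp)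
  obtain P where P: "bihomogeneous (a - 2) (b - 2) P" "ev P X (rp y1) \<noteq> 0"
    "\<And>X' Y'. Y' \<noteq> 0 \<Longrightarrow> PT Y' \<in> V \<Longrightarrow> ev P X' Y' = 0"
    using bihom_prod_lines [of "{}" V "a - 2" "b - 2" X "rp y1"] cV X0 rp(1) nV by auto
  have mer1: "merom F (\<lambda>_. 1) {}"
    unfolding merom_def
    by (intro allI impI exI [of _ "\<lambda>_ _. 1"] exI [of _ 1]) (auto intro: poly2.const)
  have sp1: "simple_poles F (\<lambda>_. 1) {}" by (simp add: simple_poles_def)
  have gd1: "good F {} X" using u by (simp add: good_def)
  have split: "Rs F P \<eta> X = tm F P \<eta> X y1 + tm F P \<eta> X y2" for \<eta>
  proof -
    have "tm F P \<eta> X v = 0" if "v \<in> V" for v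
      using P(3) [OF rp(1), of v X] that by (simp add: tm_def rp)
    then have "(\<Sum>v\<in>V. tm F P \<eta> X v) = 0" by simp
    moreover have "Rs F P \<eta> X = (\<Sum>v\<in>V. tm F P \<eta> X v) + (\<Sum>v\<in>{y1, y2}. tm F P \<eta> X v)"
      unfolding Rs_def V_def by (rule sum.subset_diff) (use y fin in \<open>auto simp: X_def\<close>)
    ultimately show ?thesis using False by simp
  qed
  have "Rs F P \<xi> X = 0" unfolding X_def
    by (rule Rs_vanishes [OF bih assms(2-4) P(1) mer sp ed _ assms(9) gd]) (use allin in blast)
  then have 1: "tm F P \<xi> X y1 + tm F P \<xi> X y2 = 0" by (simp add: split)
  have "Rs F P (\<lambda>_. 1) X = 0" unfolding X_def
    by (rule Rs_vanishes [OF bih assms(2-4) P(1) mer1 sp1 ed _ assms(9) gd1 [unfolded X_def]]) auto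
  then have 2: "tm F P (\<lambda>_. 1) X y1 + tm F P (\<lambda>_. 1) X y2 = 0" by (simp add: split)
  \<comment> \<open>The vanishing sum for the constant \<open>1\<close> makes the weights at
    \<open>y1\<close> and \<open>y2\<close> equal to \<open>c\<close> and \<open>- c\<close>; the
    vanishing sum for \<open>\<xi>\<close> then equates its two values.\<close>
  define c where "c = ev P X (rp y1) / kap F X (rp y1)"
  have "kap F X (rp y1) \<noteq> 0" using u y(1) rp(1) unfolding unram_def by (simp add: col_iff_rp X_def)
  then have c: "c \<noteq> 0" using P(2) by (simp add: c_def)
  have "ev P X (rp y2) / kap F X (rp y2) = - c" using 2 by (simp add: tm_def c_def eq_neg_iff_add_eq_0 add.commute)
  then have "c * \<xi> (PT X, y1) = c * \<xi> (PT X, y2)" using 1 by (simp add: tm_def c_def)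
  then show ?thesis using c by (simp add: X_def)
qed simp

text \<open>Being constant on columns, \<open>\<xi>\<close> is its trace \<open>T\<close> divided by
  \<open>b\<close>, a function of \<open>x\<close> alone. All poles lie over \<open>e\<close> and
  are simple, and \<open>T / x\<close> tends to \<open>0\<close> at infinity. So
  \<open>x * T\<close> extends to an entire function of growth less than \<open>x ^ 2\<close>, that
  is, to a linear one.\<close>

lemma xi_linear:
  assumes bih: "bihomogeneous a b F" and "smf F" "a \<ge> 2" "b \<ge> 2"
    and mer: "merom F \<xi> Q" and sp: "simple_poles F \<xi> Q" and ed: "dt e d \<noteq> 0"
    and allin: "\<And>X Y. X \<noteq> 0 \<Longrightarrow> Y \<noteq> 0 \<Longrightarrow> ev F X Y = 0 \<Longrightarrow> (PT X, PT Y) \<in> Q \<Longrightarrow> dt X e = 0"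
  shows "\<exists>\<alpha> \<beta>. \<forall>x. x \<noteq> 0 \<longrightarrow> good F Q (lin e d x) \<longrightarrow>
    (\<forall>y\<in>col F (lin e d x). x * \<xi> (PT (lin e d x), y) = \<alpha> + \<beta> * x)"
proof -
  have b1: "b \<ge> 1" using assms(4) by simp
  have de: "dt d e \<noteq> 0" using ed dt_commute [of e d] by auto
  define T where "T e d x = (\<Sum>y\<in>col F (lin e d x). \<xi> (PT (lin e d x), y))" for e d x
  define h where "h x = x * T e d x" for x
  define S where "S = insert 0 {x. \<not> good F Q (lin e d x)}"
  have lim0: "((\<lambda>x. x * T e' d' x) \<longlongrightarrow> 0) (at 0)"
    if ed': "dt e' d' \<noteq> 0" and ne: "dt e' e \<noteq> 0" for e' d'
  proof -
    have e0: "e' \<noteq> 0" using dt_nonzeroD(1) ed' .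
    have "((\<lambda>x. \<Sum>y\<in>col F (lin e' d' x). x * \<xi> (PT (lin e' d' x), y)) \<longlongrightarrow> 0) (at 0)"
    proof (rule column_tendsto_0 [OF bih assms(2) b1 ed'])
      fix k m and \<epsilon> :: real assume km: "dt k m \<noteq> 0" and ek: "ev F e' k = 0" and \<epsilon>: "\<epsilon> > 0"
      have nQ: "(PT e', PT k) \<notin> Q" using allin [OF e0 dt_nonzeroD(1) [OF km] ek] ne by blast
      obtain M N \<delta> where MN: "poly2 M" "poly2 N" "\<delta> > 0"
        "\<And>x y. norm x < \<delta> \<Longrightarrow> norm y < \<delta> \<Longrightarrow> ev F (lin e' d' x) (lin k m y) = 0 \<Longrightarrow>
             ((PT (lin e' d' x), PT (lin k m y)) \<in> Q \<longleftrightarrow> N x y = 0) \<and>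
             (N x y \<noteq> 0 \<longrightarrow> \<xi> (PT (lin e' d' x), PT (lin k m y)) = M x y / N x y)"
        using meromD [OF mer ed' km ek] by (elim exE conjE) blast
      have N0: "N 0 0 \<noteq> 0" using MN(4) [of 0 0] MN(3) ek nQ by simp
      obtain B1 \<delta>1 where B1: "\<delta>1 > 0" "B1 > 0" "\<And>x y. norm x < \<delta>1 \<Longrightarrow> norm y < \<delta>1 \<Longrightarrow> norm (M x y) \<le> B1"
        using poly2_bounded_near [OF MN(1)] by blast
      obtain B2 \<delta>2 where B2: "\<delta>2 > 0" "B2 > 0"
        "\<And>x y. norm x < \<delta>2 \<Longrightarrow> norm y < \<delta>2 \<Longrightarrow> N x y \<noteq> 0 \<and> norm (inverse (N x y)) \<le> B2"
        using poly2_inverse_bounded_near [OF MN(2) N0] by blast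
      define \<rho> where "\<rho> = min (min \<delta> \<delta>1) (min \<delta>2 (\<epsilon> / (B1 * B2)))"
      have "norm (x * \<xi> (PT (lin e' d' x), PT (lin k m y))) \<le> \<epsilon>"
        if x: "norm x < \<rho>" and y: "norm y < \<rho>" and z: "ev F (lin e' d' x) (lin k m y) = 0" for x y
      proof -
        have x': "norm x < \<delta>" "norm x < \<delta>1" "norm x < \<delta>2" "norm x < \<epsilon> / (B1 * B2)"
          and y': "norm y < \<delta>" "norm y < \<delta>1" "norm y < \<delta>2"
          using x y unfolding \<rho>_def min_less_iff_conj by blast+
        have N: "N x y \<noteq> 0" "norm (inverse (N x y)) \<le> B2" using B2(3) [OF x'(3) y'(3)] by blast+
        have \<xi>: "\<xi> (PT (lin e' d' x), PT (lin k m y)) = M x y * inverse (N x y)"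
          using MN(4) [OF x'(1) y'(1) z] N(1) unfolding divide_inverse by blast
        have "norm (x * \<xi> (PT (lin e' d' x), PT (lin k m y))) = norm x * (norm (M x y) * norm (inverse (N x y)))"
          unfolding \<xi> by (simp only: norm_mult)
        also have "\<dots> \<le> (\<epsilon> / (B1 * B2)) * (B1 * B2)"
          by (intro mult_mono less_imp_le [OF x'(4)] B1(3) [OF x'(2) y'(2)] N(2) mult_nonneg_nonneg norm_ge_zero
              divide_nonneg_nonneg less_imp_le [OF \<epsilon>] less_imp_le [OF B1(2)] less_imp_le [OF B2(2)])
        also have "\<dots> = \<epsilon>" using B1(2) B2(2) by simp
        finally show ?thesis .
      qed
      moreover have "\<rho> > 0" using MN(3) B1 B2 \<epsilon> by (simp add: \<rho>_def)
      ultimately show "\<exists>\<delta>>0. \<forall>x y. x \<noteq> 0 \<longrightarrow> norm x < \<delta> \<longrightarrow> norm y < \<delta> \<longrightarrow> ev F (lin e' d' x) (lin k m y) = 0 \<longrightarrow>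
        norm (x * \<xi> (PT (lin e' d' x), PT (lin k m y))) \<le> \<epsilon>" by blast
    qed
    then show ?thesis by (simp add: T_def sum_distrib_left)
  qed
  have lim1: "((\<lambda>x. x * (x * T e d x)) \<longlongrightarrow> 0) (at 0)"
  proof -
    have "((\<lambda>x. \<Sum>y\<in>col F (lin e d x). x * (x * \<xi> (PT (lin e d x), y))) \<longlongrightarrow> 0) (at 0)"
    proof (rule column_tendsto_0 [OF bih assms(2) b1 ed])
      fix k m and \<epsilon> :: real assume km: "dt k m \<noteq> 0" and ek: "ev F e k = 0" and \<epsilon>: "\<epsilon> > 0"
      have "\<exists>B \<delta>. \<delta> > 0 \<and> (\<forall>x y. x \<noteq> 0 \<longrightarrow> norm x < \<delta> \<longrightarrow> norm y < \<delta> \<longrightarrow>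
       ev F (lin e d x) (lin k m y) = 0 \<longrightarrow> norm (x * \<xi> (PT (lin e d x), PT (lin k m y))) \<le> B)"
      proof (cases "(PT e, PT k) \<in> Q")
        case True
        then show ?thesis using simple_polesD(2) [OF sp ed km ek] by blast
      next
        case False
        obtain M N \<delta> where MN: "poly2 M" "poly2 N" "\<delta> > 0"
          "\<And>x y. norm x < \<delta> \<Longrightarrow> norm y < \<delta> \<Longrightarrow> ev F (lin e d x) (lin k m y) = 0 \<Longrightarrow>
               ((PT (lin e d x), PT (lin k m y)) \<in> Q \<longleftrightarrow> N x y = 0) \<and>
               (N x y \<noteq> 0 \<longrightarrow> \<xi> (PT (lin e d x), PT (lin k m y)) = M x y / N x y)"
          using meromD [OF mer ed km ek] by (elim exE conjE) blast
        have N0: "N 0 0 \<noteq> 0" using MN(4) [of 0 0] MN(3) ek False by simp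
        obtain B1 \<delta>1 where B1: "\<delta>1 > 0" "B1 > 0" "\<And>x y. norm x < \<delta>1 \<Longrightarrow> norm y < \<delta>1 \<Longrightarrow> norm (x * M x y) \<le> B1"
          using poly2_bounded_near [OF poly2.mult [OF poly2.fst MN(1)]] by blast
        obtain B2 \<delta>2 where B2: "\<delta>2 > 0" "B2 > 0"
          "\<And>x y. norm x < \<delta>2 \<Longrightarrow> norm y < \<delta>2 \<Longrightarrow> N x y \<noteq> 0 \<and> norm (inverse (N x y)) \<le> B2"
          using poly2_inverse_bounded_near [OF MN(2) N0] by blast
        have "norm (x * \<xi> (PT (lin e d x), PT (lin k m y))) \<le> B1 * B2"
          if x: "norm x < min \<delta> (min \<delta>1 \<delta>2)" and y: "norm y < min \<delta> (min \<delta>1 \<delta>2)"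
            and z: "ev F (lin e d x) (lin k m y) = 0" for x y
        proof -
          have x': "norm x < \<delta>" "norm x < \<delta>1" "norm x < \<delta>2" and y': "norm y < \<delta>" "norm y < \<delta>1" "norm y < \<delta>2"
            using x y unfolding min_less_iff_conj by blast+
          have N: "N x y \<noteq> 0" "norm (inverse (N x y)) \<le> B2" using B2(3) [OF x'(3) y'(3)] by blast+
          have \<xi>: "\<xi> (PT (lin e d x), PT (lin k m y)) = M x y * inverse (N x y)"
            using MN(4) [OF x'(1) y'(1) z] N(1) unfolding divide_inverse by blast
          have "norm (x * \<xi> (PT (lin e d x), PT (lin k m y))) = norm (x * M x y) * norm (inverse (N x y))"
            unfolding \<xi> by (simp only: norm_mult mult.assoc)
          also have "\<dots> \<le> B1 * B2"
            by (intro mult_mono B1(3) [OF x'(2) y'(2)] N(2) norm_ge_zero less_imp_le [OF B1(2)])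
          finally show ?thesis .
        qed
        moreover have "min \<delta> (min \<delta>1 \<delta>2) > 0" using MN(3) B1 B2 by simp
        ultimately show ?thesis by blast
      qed
      then obtain B \<delta> where B: "\<delta> > 0" "\<And>x y. x \<noteq> 0 \<Longrightarrow> norm x < \<delta> \<Longrightarrow> norm y < \<delta> \<Longrightarrow>
          ev F (lin e d x) (lin k m y) = 0 \<Longrightarrow> norm (x * \<xi> (PT (lin e d x), PT (lin k m y))) \<le> B"
        by blast
      define \<rho> where "\<rho> = min \<delta> (\<epsilon> / (\<bar>B\<bar> + 1))"
      have "norm (x * (x * \<xi> (PT (lin e d x), PT (lin k m y)))) \<le> \<epsilon>"
        if "x \<noteq> 0" and x: "norm x < \<rho>" and y: "norm y < \<rho>" and z: "ev F (lin e d x) (lin k m y) = 0" for x y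
      proof -
        have x': "norm x < \<delta>" "norm x < \<epsilon> / (\<bar>B\<bar> + 1)" "norm y < \<delta>"
          using x y unfolding \<rho>_def min_less_iff_conj by blast+
        have "norm (x * \<xi> (PT (lin e d x), PT (lin k m y))) \<le> \<bar>B\<bar> + 1"
          using B(2) [OF that(1) x'(1,3) z] by simp
        then have "norm x * norm (x * \<xi> (PT (lin e d x), PT (lin k m y))) \<le> (\<epsilon> / (\<bar>B\<bar> + 1)) * (\<bar>B\<bar> + 1)"
          using x'(2) \<epsilon> by (intro mult_mono) auto
        also have "\<dots> = \<epsilon>" by simp
        finally show ?thesis by (simp only: norm_mult)
      qed
      moreover have "\<rho> > 0" using B \<epsilon> by (simp add: \<rho>_def)
      ultimately show "\<exists>\<delta>>0. \<forall>x y. x \<noteq> 0 \<longrightarrow> norm x < \<delta> \<longrightarrow> norm y < \<delta> \<longrightarrow> ev F (lin e d x) (lin k m y) = 0 \<longrightarrow>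
        norm (x * (x * \<xi> (PT (lin e d x), PT (lin k m y)))) \<le> \<epsilon>" by blast
    qed
    then show ?thesis by (simp add: T_def sum_distrib_left)
  qed
  have "\<exists>\<alpha> \<beta>. \<forall>x. x \<notin> S \<longrightarrow> h x = \<alpha> + \<beta> * x"
  proof (rule linear_off_finite)
    show "finite S" unfolding S_def using finite_bad [OF bih assms(2,4) mer sp ed] by simp
    show "h field_differentiable at s" if "s \<notin> S" for s
    proof -
      define e' where "e' = lin e d s"
      have ed': "dt e' d \<noteq> 0" using ed by (simp add: e'_def)
      have gd: "good F Q e'" using that by (simp add: S_def e'_def)
      have "(\<lambda>x. \<Sum>y\<in>col F (lin e' d x). \<xi> (PT (lin e' d x), y)) field_differentiable at 0"
      proof (rule trace_differentiable [OF bih assms(2,4) ed'])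
        show "unram F e'" using gd by (simp add: good_def)
        fix k m assume km: "dt k m \<noteq> 0" and ek: "ev F e' k = 0"
        have nQ: "(PT e', PT k) \<notin> Q"
          using gd col_iff [OF bih dt_nonzeroD(1) [OF km]] ek by (simp add: good_def)
        obtain M N \<delta> where MN: "poly2 M" "poly2 N" "\<delta> > 0"
          "\<And>x y. norm x < \<delta> \<Longrightarrow> norm y < \<delta> \<Longrightarrow> ev F (lin e' d x) (lin k m y) = 0 \<Longrightarrow>
               ((PT (lin e' d x), PT (lin k m y)) \<in> Q \<longleftrightarrow> N x y = 0) \<and>
               (N x y \<noteq> 0 \<longrightarrow> \<xi> (PT (lin e' d x), PT (lin k m y)) = M x y / N x y)"
          using meromD [OF mer ed' km ek] by (elim exE conjE) blast
        have N0: "N 0 0 \<noteq> 0" using MN(4) [of 0 0] MN(3) ek nQ by simp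
        obtain \<delta>' where \<delta>': "\<delta>' > 0" "\<And>x y. norm x < \<delta>' \<Longrightarrow> norm y < \<delta>' \<Longrightarrow> N x y \<noteq> 0"
          using poly2_near_nonzero [OF MN(2) N0] by blast
        have "\<xi> (PT (lin e' d x), PT (lin k m y)) = M x y / N x y"
          if "norm x < min \<delta> \<delta>'" "norm y < min \<delta> \<delta>'" "ev F (lin e' d x) (lin k m y) = 0" for x y
          using MN(4) [of x y] \<delta>'(2) [of x y] that unfolding min_less_iff_conj by blast
        moreover have "min \<delta> \<delta>' > 0" using MN \<delta>' by simp
        ultimately show "\<exists>K L \<delta>. poly2 K \<and> poly2 L \<and> L 0 0 \<noteq> 0 \<and> 0 < \<delta> \<and>
            (\<forall>x y. norm x < \<delta> \<longrightarrow> norm y < \<delta> \<longrightarrow> ev F (lin e' d x) (lin k m y) = 0 \<longrightarrow>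
              \<xi> (PT (lin e' d x), PT (lin k m y)) = K x y / L x y)"
          using MN(1,2) N0 by blast
      qed
      then have "(\<lambda>x. T e d (s + x)) field_differentiable at 0"
        by (simp add: T_def e'_def lin_lin)
      then have "T e d field_differentiable at s" by (rule differentiable_shift)
      then show ?thesis unfolding h_def by (intro field_differentiable_mult field_differentiable_ident)
    qed
    show "((\<lambda>x. (x - s) * h x) \<longlongrightarrow> 0) (at s)" if "s \<in> S" for s
    proof (cases "s = 0")
      case True
      then show ?thesis using lim1 by (simp add: h_def)
    next
      case False
      have "dt (lin e d s) e \<noteq> 0" using ed False dt_commute [of "lin e d s" e] by simp
      then have c0: "((\<lambda>x. x * T (lin e d s) d x) \<longlongrightarrow> 0) (at 0)"
        using ed by (intro lim0) auto
      have 1: "((\<lambda>x. (x - s) * T e d x) \<longlongrightarrow> 0) (at s)"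
        by (rule tendsto_shift_0) (use c0 in \<open>simp add: T_def lin_lin\<close>)
      have "((\<lambda>x. x * ((x - s) * T e d x)) \<longlongrightarrow> s * 0) (at s)"
        by (intro tendsto_mult 1 tendsto_ident_at)
      then show ?thesis by (simp add: h_def algebra_simps)
    qed
    have "((\<lambda>x. inverse x * T d e (inverse x)) \<longlongrightarrow> 0) at_infinity"
      by (rule filterlim_compose [OF lim0 [OF de de]])
        (auto simp: filterlim_at intro!: tendsto_inverse_0 eventually_not_equal_at_infinity)
    moreover have "\<forall>\<^sub>F x in at_infinity. inverse x * T d e (inverse x) = h x / x\<^sup>2"
      using eventually_not_equal_at_infinity [of 0]
    proof eventually_elim
      case (elim x)
      have "col F (sc x (lin d e (inverse x))) = col F (lin d e (inverse x))"
        unfolding set_eq_iff col_iff_rp using elim by (simp add: ev_sc_left [OF bih])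
      then show ?case
        unfolding h_def T_def lin_infinity [OF elim]
        using elim by (simp add: PT_sc [OF elim lin_nonzero [OF de]] field_simps power2_eq_square)
    qed
    ultimately show "((\<lambda>x. h x / x\<^sup>2) \<longlongrightarrow> 0) at_infinity" by (rule Lim_transform_eventually)
  qed
  then obtain \<alpha> \<beta> where \<alpha>\<beta>: "\<And>x. x \<notin> S \<Longrightarrow> h x = \<alpha> + \<beta> * x" by blast
  have "x * \<xi> (PT (lin e d x), y) = \<alpha> / of_nat b + \<beta> / of_nat b * x"
    if x: "x \<noteq> 0" and gd: "good F Q (lin e d x)" and y: "y \<in> col F (lin e d x)" for x y
  proof -
    have "T e d x = (\<Sum>y'\<in>col F (lin e d x). \<xi> (PT (lin e d x), y))"
      unfolding T_def by (rule sum.cong [OF refl], rule column_constant [OF assms x gd _ y]) auto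
    also have "\<dots> = of_nat b * \<xi> (PT (lin e d x), y)"
      using col_card(3) [OF bih assms(2) b1 lin_nonzero [OF ed]] gd by (simp add: good_def)
    finally have "of_nat b * (x * \<xi> (PT (lin e d x), y)) = \<alpha> + \<beta> * x"
      using \<alpha>\<beta> [of x] x gd by (simp add: S_def h_def mult.left_commute)
    then show ?thesis using b1 by (simp add: field_simps)
  qed
  then show ?thesis by blast
qed

section \<open>Linear maps and the linearity of a component\<close>

definition linv :: "(cvec \<Rightarrow> cvec) \<Rightarrow> bool" where
  "linv g \<longleftrightarrow> (\<exists>p q r s. p * s - q * r \<noteq> 0 \<and> g = (\<lambda>X. (p * fst X + q * snd X, r * fst X + s * snd X)))"

lemma linvI:
  assumes "p * s - q * r \<noteq> 0" "\<And>X. g X = (p * fst X + q * snd X, r * fst X + s * snd X)"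
  shows "linv g"
  unfolding linv_def using assms by (intro exI [of _ p] exI [of _ q] exI [of _ r] exI [of _ s]) auto

lemma linv_comp:
  assumes "linv g" "linv h"
  shows "linv (\<lambda>X. g (h X))"
proof -
  obtain p q r s where g: "p * s - q * r \<noteq> 0" "g = (\<lambda>X. (p * fst X + q * snd X, r * fst X + s * snd X))"
    using assms(1) unfolding linv_def by blast
  obtain p' q' r' s' where h: "p' * s' - q' * r' \<noteq> 0" "h = (\<lambda>X. (p' * fst X + q' * snd X, r' * fst X + s' * snd X))"
    using assms(2) unfolding linv_def by blast
  have "(p * p' + q * r') * (r * q' + s * s') - (p * q' + q * s') * (r * p' + s * r') =
      (p * s - q * r) * (p' * s' - q' * r')" by (simp add: algebra_simps)
  then have "(p * p' + q * r') * (r * q' + s * s') - (p * q' + q * s') * (r * p' + s * r') \<noteq> 0"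
    using g(1) h(1) by simp
  then show ?thesis by (rule linvI) (simp add: g(2) h(2) algebra_simps)
qed

lemma linv_nonzero:
  assumes "linv g" "X \<noteq> 0"
  shows "g X \<noteq> 0"
proof
  obtain p q r s where g: "p * s - q * r \<noteq> 0" "g = (\<lambda>X. (p * fst X + q * snd X, r * fst X + s * snd X))"
    using assms(1) unfolding linv_def by blast
  assume "g X = 0"
  then have 1: "p * fst X + q * snd X = 0" "r * fst X + s * snd X = 0" by (simp_all add: g(2) vec_eq_0_iff)
  have "(p * s - q * r) * fst X = s * (p * fst X + q * snd X) - q * (r * fst X + s * snd X)"
    "(p * s - q * r) * snd X = p * (r * fst X + s * snd X) - r * (p * fst X + q * snd X)"
    by (simp_all add: algebra_simps)
  then have "fst X = 0" "snd X = 0" using 1 g(1) by simp_all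
  then show False using assms(2) by (simp add: vec_eq_0_iff)
qed

lemma linv_sc: "linv g \<Longrightarrow> g (sc c X) = sc c (g X)"
  unfolding linv_def by (auto simp: sc_def algebra_simps)

lemma poly2_linv:
  assumes "linv g"
  shows "poly2 (\<lambda>x y. fst (g (lin e d x)))" "poly2 (\<lambda>x y. snd (g (lin e d x)))"
proof -
  obtain p q r s where g: "g = (\<lambda>X. (p * fst X + q * snd X, r * fst X + s * snd X))"
    using assms(1) unfolding linv_def by blast
  show "poly2 (\<lambda>x y. fst (g (lin e d x)))" "poly2 (\<lambda>x y. snd (g (lin e d x)))"
    unfolding g lin_def fst_conv snd_conv by (intro poly2.intros)+
qed

lemma dt_lin_nonzero_near:
  assumes "dt e d \<noteq> 0" "v \<noteq> 0"
  shows "\<exists>\<delta>>0. \<forall>x. x \<noteq> 0 \<longrightarrow> norm x < \<delta> \<longrightarrow> dt (lin e d x) v \<noteq> 0"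
proof -
  have eq: "dt (lin e d x) v = dt e v + x * dt d v" for x by (simp add: dt_def lin_def algebra_simps)
  show ?thesis
  proof (cases "dt e v = 0")
    case True
    have "dt d v \<noteq> 0"
    proof
      assume "dt d v = 0"
      then have "v = 0" using basis_expand [OF assms(1), of v] True
        by (simp add: dt_commute [of v] sc_def zero_prod_def)
      then show False using assms(2) by simp
    qed
    then show ?thesis using True eq by (intro exI [of _ 1]) auto
  next
    case False
    have "poly2 (\<lambda>x y. dt e v + x * dt d v)" by (rule poly2_linear)
    then obtain \<delta> where "\<delta> > 0" "\<And>x y :: complex. norm x < \<delta> \<Longrightarrow> norm y < \<delta> \<Longrightarrow> dt e v + x * dt d v \<noteq> 0"
      using poly2_near_nonzero [of "\<lambda>x y. dt e v + x * dt d v"] False by auto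
    then show ?thesis using eq by (intro exI [of _ \<delta>]) (metis norm_zero)
  qed
qed

text \<open>Zeros persist from the column over \<open>e\<close> to neighbouring columns, so every
  point of the curve is a limit of points over a punctured neighbourhood of \<open>e\<close>. This
  extends identities from good columns to the whole curve.\<close>

lemma nearby_point:
  assumes bih: "bihomogeneous a b F" and "smf F" "b \<ge> 1" and ed: "dt e d \<noteq> 0" and km: "dt k m \<noteq> 0"
    and ek: "ev F e k = 0" and "\<epsilon> > 0" and "\<exists>\<delta>>0. \<forall>x. x \<noteq> 0 \<longrightarrow> norm x < \<delta> \<longrightarrow> R x"
  shows "\<exists>x y. x \<noteq> 0 \<and> norm x < \<epsilon> \<and> norm y < \<epsilon> \<and> ev F (lin e d x) (lin k m y) = 0 \<and> R x"
proof -
  obtain \<delta> where \<delta>: "\<delta> > 0" "\<And>x. x \<noteq> 0 \<Longrightarrow> norm x < \<delta> \<Longrightarrow> R x" using assms(8) by blast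
  obtain y1 where y1: "ev F (lin e d 0) (lin k m y1) \<noteq> 0"
    using chart_nonzero [OF bih assms(2,3) dt_nonzeroD(1) [OF ed] km] by auto
  have z: "ev F (lin e d 0) (lin k m 0) = 0" using ek by simp
  obtain \<delta>' where \<delta>': "\<delta>' > 0" "\<And>x. norm x < \<delta>' \<Longrightarrow> \<exists>y. norm y < \<epsilon> \<and> ev F (lin e d x) (lin k m y) = 0"
    using poly2_root_nearby [OF poly2_slice [OF bih] z y1 assms(7)] by blast
  define \<rho> where "\<rho> = min \<epsilon> (min \<delta> \<delta>')"
  define x where "x = complex_of_real (\<rho> / 2)"
  have m: "\<rho> > 0" using \<delta>(1) \<delta>'(1) assms(7) by (simp add: \<rho>_def)
  then have x: "x \<noteq> 0" "norm x < \<rho>" unfolding x_def norm_of_real by simp_all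
  then have x': "norm x < \<epsilon>" "norm x < \<delta>" "norm x < \<delta>'" by (simp_all add: \<rho>_def)
  show ?thesis using x(1) x' \<delta>(2) \<delta>'(2) by blast
qed

lemma ex_punctured_conj:
  fixes R R' :: "complex \<Rightarrow> bool"
  assumes "\<exists>\<delta>>0. \<forall>x. x \<noteq> 0 \<longrightarrow> norm x < \<delta> \<longrightarrow> R x" "\<exists>\<delta>>0. \<forall>x. x \<noteq> 0 \<longrightarrow> norm x < \<delta> \<longrightarrow> R' x"
  shows "\<exists>\<delta>>0. \<forall>x. x \<noteq> 0 \<longrightarrow> norm x < \<delta> \<longrightarrow> R x \<and> R' x"
proof -
  obtain \<delta> \<delta>' where "\<delta> > 0" "\<delta>' > 0" "\<And>x. x \<noteq> 0 \<Longrightarrow> norm x < \<delta> \<Longrightarrow> R x" "\<And>x. x \<noteq> 0 \<Longrightarrow> norm x < \<delta>' \<Longrightarrow> R' x"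
    using assms by blast
  then show ?thesis by (intro exI [of _ "min \<delta> \<delta>'"]) simp
qed

text \<open>With \<open>x = dt e X / dt X d\<close>, the relation
  \<open>x * \<xi> = \<alpha> + \<beta> * x\<close> says that \<open>\<xi>\<close> is the ratio of
  the two entries of \<open>g2 X\<close>. The map \<open>g1\<close> inverts
  \<open>u \<mapsto> (dt (perp l) u, dt l u)\<close>, so \<open>g1 (g2 X)\<close> represents the
  value of \<open>\<phi>\<close>.\<close>

lemma regular_map_linear:
  assumes bih: "bihomogeneous a b F" and "smf F" "a \<ge> 2" "b \<ge> 2"
    and \<phi>: "regular F \<phi>" and l: "l \<noteq> 0" and sp: "simple_poles F (xi l \<phi>) (poles l \<phi>)"
    and ek: "e \<noteq> 0" "k \<noteq> 0" "ev F e k = 0" "\<phi> (PT e, PT k) = PT l"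
    and allin: "\<And>X Y. X \<noteq> 0 \<Longrightarrow> Y \<noteq> 0 \<Longrightarrow> ev F X Y = 0 \<Longrightarrow> \<phi> (PT X, PT Y) = PT l \<Longrightarrow> dt X e = 0"
  shows "\<exists>g. linv g \<and> (\<forall>X Y. X \<noteq> 0 \<longrightarrow> Y \<noteq> 0 \<longrightarrow> ev F X Y = 0 \<longrightarrow> \<phi> (PT X, PT Y) = PT (g X))"
proof -
  define Q where "Q = poles l \<phi>"
  define d where "d = perp e"
  have ed: "dt e d \<noteq> 0" unfolding d_def by (rule dt_perp_nonzero [OF ek(1)])
  have d0: "d \<noteq> 0" using dt_nonzeroD(2) ed .
  have b1: "b \<ge> 1" using assms(4) by simp
  note mer = merom_regular [OF \<phi> l, folded Q_def]
  note sp' = sp [folded Q_def]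
  have "\<exists>\<alpha> \<beta>. \<forall>x. x \<noteq> 0 \<longrightarrow> good F Q (lin e d x) \<longrightarrow>
    (\<forall>y\<in>col F (lin e d x). x * xi l \<phi> (PT (lin e d x), y) = \<alpha> + \<beta> * x)"
    by (rule xi_linear [OF bih assms(2-4) mer sp' ed]) (use allin in \<open>simp add: Q_def poles_def\<close>)
  then obtain \<alpha> \<beta> where lin: "\<And>x y. x \<noteq> 0 \<Longrightarrow> good F Q (lin e d x) \<Longrightarrow> y \<in> col F (lin e d x) \<Longrightarrow>
      x * xi l \<phi> (PT (lin e d x), y) = \<alpha> + \<beta> * x" by blast
  have lm: "dt l (perp l) \<noteq> 0" by (rule dt_perp_nonzero [OF l])
  have "\<alpha> \<noteq> 0"
  proof
    \<comment> \<open>Then \<open>\<xi>\<close> would be the constant \<open>\<beta>\<close> on good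
      columns, so \<open>M = \<beta> * N\<close> at points close to the pole \<open>(e, k)\<close>,
      where \<open>N\<close> is small and \<open>M\<close> is not.\<close>
    assume \<alpha>: "\<alpha> = 0"
    define m where "m = perp k"
    have km: "dt k m \<noteq> 0" unfolding m_def by (rule dt_perp_nonzero [OF ek(2)])
    obtain M N \<delta> where MN: "poly2 M" "poly2 N" "\<delta> > 0"
      "\<And>x y. norm x < \<delta> \<Longrightarrow> norm y < \<delta> \<Longrightarrow> ev F (lin e d x) (lin k m y) = 0 \<Longrightarrow>
           (M x y \<noteq> 0 \<or> N x y \<noteq> 0) \<and>
           ((PT (lin e d x), PT (lin k m y)) \<in> Q \<longleftrightarrow> N x y = 0) \<and>
           (N x y \<noteq> 0 \<longrightarrow> xi l \<phi> (PT (lin e d x), PT (lin k m y)) = M x y / N x y)"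
      using meromD [OF mer ed km ek(3)] by (elim exE conjE) blast
    have "N 0 0 = 0" "M 0 0 \<noteq> 0" using MN(3) MN(4) [of 0 0] ek by (auto simp: Q_def poles_def)
    then have H0: "M 0 0 - \<beta> * N 0 0 \<noteq> 0" by simp
    have "poly2 (\<lambda>x y. M x y - \<beta> * N x y)" by (intro poly2_diff poly2.mult poly2.const MN)
    then obtain \<delta>' where \<delta>': "\<delta>' > 0" "\<And>x y. norm x < \<delta>' \<Longrightarrow> norm y < \<delta>' \<Longrightarrow> M x y - \<beta> * N x y \<noteq> 0"
      using poly2_near_nonzero [of "\<lambda>x y. M x y - \<beta> * N x y", OF _ H0] by blast
    have "min \<delta> \<delta>' > 0" using MN(3) \<delta>'(1) by simp
    then obtain x y where xy: "x \<noteq> 0" "norm x < min \<delta> \<delta>'" "norm y < min \<delta> \<delta>'"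
      "ev F (lin e d x) (lin k m y) = 0" "good F Q (lin e d x)"
      using nearby_point [OF bih assms(2) b1 ed km ek(3) _ good_punctured [OF bih assms(2,4) mer sp' ed]] by blast
    have ycol: "PT (lin k m y) \<in> col F (lin e d x)" using col_iff [OF bih lin_nonzero [OF km]] xy(4) by simp
    have x': "norm x < \<delta>" "norm y < \<delta>" "norm x < \<delta>'" "norm y < \<delta>'" using xy(2,3) by simp_all
    have "(PT (lin e d x), PT (lin k m y)) \<notin> Q" using xy(5) ycol unfolding good_def by blast
    then have N: "N x y \<noteq> 0" and \<xi>: "xi l \<phi> (PT (lin e d x), PT (lin k m y)) = M x y / N x y"
      using MN(4) [OF x'(1,2) xy(4)] by blast+
    have "M x y = \<beta> * N x y" using lin [OF xy(1,5) ycol] N xy(1) unfolding \<xi> \<alpha> by (simp add: field_simps)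
    then show False using \<delta>'(2) [OF x'(3,4)] by simp
  qed
  define g1 :: "cvec \<Rightarrow> cvec" where "g1 Z = sc (- (fst Z / dt l (perp l))) l + sc (snd Z / dt l (perp l)) (perp l)" for Z
  define g2 :: "cvec \<Rightarrow> cvec" where "g2 X = (\<alpha> * dt X d + \<beta> * dt e X, dt e X)" for X
  have g1: "linv g1"
  proof (rule linvI)
    define c where "c = dt l (perp l)"
    have "(- fst l / c) * (snd (perp l) / c) - (fst (perp l) / c) * (- snd l / c) = - (dt l (perp l) / (c * c))"
      by (simp add: dt_def diff_divide_distrib mult.commute)
    then show "(- fst l / c) * (snd (perp l) / c) - (fst (perp l) / c) * (- snd l / c) \<noteq> 0"
      using lm by (simp add: c_def)
    show "g1 X = (- fst l / c * fst X + fst (perp l) / c * snd X, - snd l / c * fst X + snd (perp l) / c * snd X)" for X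
      by (simp add: g1_def sc_def c_def mult.commute)
  qed
  have g2: "linv g2"
  proof (rule linvI)
    have "(\<alpha> * snd d - \<beta> * snd e) * fst e - (\<beta> * fst e - \<alpha> * fst d) * (- snd e) = \<alpha> * dt e d"
      by (simp add: dt_def algebra_simps)
    then show "(\<alpha> * snd d - \<beta> * snd e) * fst e - (\<beta> * fst e - \<alpha> * fst d) * (- snd e) \<noteq> 0"
      using \<open>\<alpha> \<noteq> 0\<close> ed by simp
    show "g2 X = ((\<alpha> * snd d - \<beta> * snd e) * fst X + (\<beta> * fst e - \<alpha> * fst d) * snd X, - snd e * fst X + fst e * snd X)" for X
      by (simp add: g2_def dt_def algebra_simps)
  qed
  define g where "g = (\<lambda>X. g1 (g2 X))"
  have g: "linv g" unfolding g_def by (rule linv_comp [OF g1 g2])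
  have dself: "dt u u = 0" for u by (simp add: dt_def)
  have dadd: "dt u (v + w) = dt u v + dt u w" for u v w by (simp add: dt_def algebra_simps)
  have gl: "dt l (g X) = dt e X" "dt (perp l) (g X) = \<alpha> * dt X d + \<beta> * dt e X" for X
    using lm by (simp_all add: g_def g1_def g2_def dadd dself dt_commute [of "perp l" l])
  have generic: "dt u (g X) = 0"
    if X: "good F Q X" "dt X d \<noteq> 0" "dt X e \<noteq> 0" and Y: "Y \<noteq> 0" "ev F X Y = 0"
      and u: "u \<noteq> 0" "\<phi> (PT X, PT Y) = PT u" for X Y u
  proof -
    define x where "x = dt e X / dt X d"
    define c where "c = dt X d / dt e d"
    have c: "c \<noteq> 0" "X = sc c (lin e d x)"
      using basis_expand_lin [OF ed X(2)] X(2) ed by (auto simp: c_def x_def)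
    have x0: "x \<noteq> 0" using X(2,3) by (simp add: x_def dt_commute [of e X])
    have gd: "good F Q (lin e d x)" using X(1) good_sc [OF bih c(1) assms(4) lin_nonzero [OF ed]] c(2) by simp
    have "ev F (lin e d x) Y = 0" using Y(2) c by (simp add: ev_sc_left [OF bih])
    then have yc: "PT Y \<in> col F (lin e d x)" using col_iff [OF bih Y(1)] by simp
    have PX: "PT (lin e d x) = PT X" using PT_sc [OF c(1) lin_nonzero [OF ed]] c(2) by simp
    have "(PT X, PT Y) \<notin> Q" using gd yc PX unfolding good_def by simp
    then have lu: "dt l u \<noteq> 0" using PT_eq_iff [OF l u(1)] u(2) by (auto simp: Q_def poles_def)
    have "x * (dt (perp l) u / dt l u) = \<alpha> + \<beta> * x"
      using lin [OF x0 gd yc] xi_PT [where \<phi> = \<phi> and p = "(PT X, PT Y)", OF u(2,1)] by (simp add: PX)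
    then have "dt e X * dt (perp l) u = (\<alpha> * dt X d + \<beta> * dt e X) * dt l u"
      using lu X(2) by (simp add: x_def field_simps)
    then have "dt l u * dt (perp l) (g X) - dt l (g X) * dt (perp l) u = 0"
      by (simp add: gl mult.commute)
    then show ?thesis unfolding dt_cross using lm by simp
  qed
  have "\<phi> (PT X, PT Y) = PT (g X)" if XY: "X \<noteq> 0" "Y \<noteq> 0" "ev F X Y = 0" for X Y
  proof -
    define d' where "d' = perp X"
    define m' where "m' = perp Y"
    have Xd: "dt X d' \<noteq> 0" and Ym: "dt Y m' \<noteq> 0" unfolding d'_def m'_def using dt_perp_nonzero XY by auto
    obtain A0 A1 \<delta> where A: "poly2 A0" "poly2 A1" "\<delta> > 0"
      "\<And>x y. norm x < \<delta> \<Longrightarrow> norm y < \<delta> \<Longrightarrow> ev F (lin X d' x) (lin Y m' y) = 0 \<Longrightarrow>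
           (A0 x y, A1 x y) \<noteq> 0 \<and> \<phi> (PT (lin X d' x), PT (lin Y m' y)) = PT (A0 x y, A1 x y)"
      using regularD [OF \<phi> Xd Ym XY(3)] by (elim exE conjE) blast
    \<comment> \<open>\<open>H = 0\<close> expresses that \<open>\<phi>\<close> and \<open>g\<close>
      agree. This is known on good columns other than those of \<open>d\<close> and
      \<open>e\<close>, and a nonzero value of \<open>H\<close> at the given point would persist to
      such columns.\<close>
    define H where "H = (\<lambda>x y. A0 x y * snd (g (lin X d' x)) - A1 x y * fst (g (lin X d' x)))"
    have H: "poly2 H" unfolding H_def by (intro poly2_diff poly2.mult A poly2_linv g)
    have Hdt: "H x y = dt (A0 x y, A1 x y) (g (lin X d' x))" for x y by (simp add: H_def dt_def)
    have "H 0 0 = 0"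
    proof (rule ccontr)
      assume "H 0 0 \<noteq> 0"
      then obtain \<delta>' where \<delta>': "\<delta>' > 0" "\<And>x y. norm x < \<delta>' \<Longrightarrow> norm y < \<delta>' \<Longrightarrow> H x y \<noteq> 0"
        using poly2_near_nonzero [OF H] by blast
      have mn: "min \<delta> \<delta>' > 0" using A(3) \<delta>'(1) by simp
      have "\<exists>\<delta>>0. \<forall>x. x \<noteq> 0 \<longrightarrow> norm x < \<delta> \<longrightarrow>
          good F Q (lin X d' x) \<and> dt (lin X d' x) d \<noteq> 0 \<and> dt (lin X d' x) e \<noteq> 0"
        by (intro ex_punctured_conj good_punctured [OF bih assms(2,4) mer sp' Xd]
            dt_lin_nonzero_near [OF Xd d0] dt_lin_nonzero_near [OF Xd ek(1)])
      from nearby_point [OF bih assms(2) b1 Xd Ym XY(3) mn this]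
      obtain x y where xy: "norm x < min \<delta> \<delta>'" "norm y < min \<delta> \<delta>'"
        "ev F (lin X d' x) (lin Y m' y) = 0" "good F Q (lin X d' x)"
        "dt (lin X d' x) d \<noteq> 0" "dt (lin X d' x) e \<noteq> 0"
        by blast
      have x': "norm x < \<delta>" "norm y < \<delta>" "norm x < \<delta>'" "norm y < \<delta>'" using xy(1,2) by simp_all
      have "dt (A0 x y, A1 x y) (g (lin X d' x)) = 0"
        using generic [OF xy(4-6) lin_nonzero [OF Ym] xy(3)] A(4) [OF x'(1,2) xy(3)] by blast
      then show False using \<delta>'(2) [OF x'(3,4)] by (simp add: Hdt)
    qed
    then have "dt (A0 0 0, A1 0 0) (g X) = 0" by (simp add: Hdt)
    moreover have "(A0 0 0, A1 0 0) \<noteq> 0" "\<phi> (PT X, PT Y) = PT (A0 0 0, A1 0 0)"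
      using A(4) [of 0 0] A(3) XY(3) by auto
    ultimately show ?thesis using PT_eq_iff linv_nonzero [OF g XY(1)] by metis
  qed
  then show ?thesis using g by blast
qed

lemma inj_PT_lin:
  assumes "dt e d \<noteq> 0"
  shows "inj (\<lambda>x. PT (lin e d x))"
proof (rule injI)
  fix x y assume "PT (lin e d x) = PT (lin e d y)"
  then have "dt (lin e d x) (lin e d y) = 0"
    using PT_eq_iff [OF lin_nonzero [OF assms] lin_nonzero [OF assms]] by simp
  then have "(y - x) * dt e d = 0" by (simp add: lin_def dt_def algebra_simps)
  then show "x = y" using assms by simp
qed

lemma zero_locusE:
  assumes "bihomogeneous a b F" "p \<in> zero_locus F"
  shows "\<exists>X Y. X \<noteq> 0 \<and> Y \<noteq> 0 \<and> ev F X Y = 0 \<and> p = (PT X, PT Y)"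
  using zero_locus_iff [OF assms(1) rp(1) rp(1), of "fst p" "snd p"] assms(2)
  by (intro exI [of _ "rp (fst p)"] exI [of _ "rp (snd p)"]) (simp add: rp)

lemma zero_locus_swF: "p \<in> zero_locus (swF F) \<longleftrightarrow> prod.swap p \<in> zero_locus F"
  unfolding zero_locus_def swF_def by (cases p) auto

lemma dX_swF [simp]: "dX (swF F) X Y d = dY F Y X d"
  by (simp add: dX_def dY_def)

lemma dY_swF [simp]: "dY (swF F) X Y d = dX F Y X d"
  by (simp add: dX_def dY_def)

lemma smf_swF: "smf F \<Longrightarrow> smf (swF F)"
  unfolding smf_def by auto

lemma regular_swF:
  assumes "regular F \<phi>"
  shows "regular (swF F) (\<lambda>p. \<phi> (prod.swap p))"
  unfolding regular_def
proof (intro allI impI)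
  fix e d k m assume *: "dt e d \<noteq> 0" "dt k m \<noteq> 0" "ev (swF F) e k = 0"
  obtain A0 A1 \<delta> where A: "poly2 A0" "poly2 A1" "\<delta> > 0"
    "\<And>x y. norm x < \<delta> \<Longrightarrow> norm y < \<delta> \<Longrightarrow> ev F (lin k m x) (lin e d y) = 0 \<Longrightarrow>
         (A0 x y, A1 x y) \<noteq> 0 \<and> \<phi> (PT (lin k m x), PT (lin e d y)) = PT (A0 x y, A1 x y)"
    using regularD [OF assms *(2,1)] *(3) by (simp add: ev_swF) blast
  show "\<exists>A0 A1 \<delta>. poly2 A0 \<and> poly2 A1 \<and> \<delta> > 0 \<and>
       (\<forall>x y. norm x < \<delta> \<longrightarrow> norm y < \<delta> \<longrightarrow> ev (swF F) (lin e d x) (lin k m y) = 0 \<longrightarrow>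
         (A0 x y, A1 x y) \<noteq> 0 \<and> \<phi> (prod.swap (PT (lin e d x), PT (lin k m y))) = PT (A0 x y, A1 x y))"
    by (rule exI [of _ "\<lambda>x y. A0 y x"], rule exI [of _ "\<lambda>x y. A1 y x"], rule exI [of _ \<delta>])
      (use A poly2_flip in auto)
qed

section \<open>Position of the poles over a general value\<close>

lemma finite_ramified_points:
  assumes bih: "bihomogeneous a b F" and "smf F" "b \<ge> 2"
  shows "finite {p \<in> zero_locus F. \<exists>X. X \<noteq> 0 \<and> fst p = PT X \<and> \<not> unram F X}"
proof -
  define e d :: cvec where "e = (1, 0)" and "d = (0, 1)"
  have ed: "dt e d \<noteq> 0" by (simp add: e_def d_def dt_def)
  have b1: "b \<ge> 1" using assms(3) by simp
  \<comment> \<open>\<open>d\<close> is added because the chart misses the column over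
    \<open>PT d\<close>.\<close>
  define B where "B = insert d (lin e d ` {x. \<not> unram F (lin e d x)})"
  have nz: "X \<noteq> 0" if "X \<in> B" for X
    using that lin_nonzero [OF ed] dt_nonzeroD(2) [OF ed] by (auto simp: B_def)
  have "finite B" unfolding B_def using finite_ramified [OF bih assms(2,3) ed] by simp
  then have "finite (\<Union>X\<in>B. (\<lambda>y. (PT X, y)) ` col F X)"
    using col_card(1) [OF bih assms(2) b1] nz by auto
  moreover have "{p \<in> zero_locus F. \<exists>X. X \<noteq> 0 \<and> fst p = PT X \<and> \<not> unram F X} \<subseteq>
      (\<Union>X\<in>B. (\<lambda>y. (PT X, y)) ` col F X)"
  proof clarify
    fix x y X assume p: "(x, y) \<in> zero_locus F" and X: "X \<noteq> 0" "fst (x, y) = PT X" "\<not> unram F X"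
    have "\<exists>Z\<in>B. PT Z = PT X"
    proof (cases "dt X d = 0")
      case True
      then show ?thesis using PT_eq_iff [OF X(1) dt_nonzeroD(2) [OF ed]] by (auto simp: B_def)
    next
      case False
      define t where "t = dt e X / dt X d"
      define c where "c = dt X d / dt e d"
      have c: "c \<noteq> 0" "X = sc c (lin e d t)"
        using basis_expand_lin [OF ed False] False ed by (auto simp: c_def t_def)
      have "\<not> unram F (lin e d t)" using X(3) unram_sc [OF bih c(1) assms(3)] c(2) by simp
      then show ?thesis using PT_sc [OF c(1) lin_nonzero [OF ed]] c(2) by (auto simp: B_def)
    qed
    then obtain Z where Z: "Z \<in> B" "PT Z = PT X" by blast
    then have "y \<in> col F Z" using col_iff_zero_locus [OF bih nz] p X(2) by simp
    then show "(x, y) \<in> (\<Union>X\<in>B. (\<lambda>y. (PT X, y)) ` col F X)"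
      by (intro UN_I [OF Z(1)] image_eqI [of _ _ y]) (use Z X(2) in auto)
  qed
  ultimately show ?thesis by (rule finite_subset [rotated])
qed

text \<open>Finitely many points of the curve lie on ramified columns or rows, and their images
  under \<open>\<phi>\<close> exclude finitely many values \<open>l\<close>. Rows are included
  because the argument is repeated with the factors exchanged.\<close>

lemma generic_value:
  assumes bih: "bihomogeneous a b F" and "smf F" "a \<ge> 2" "b \<ge> 2"
    and bihG: "bihomogeneous a' b' G" and "smf G" "b' \<ge> 2"
  shows "\<exists>l. l \<noteq> 0 \<and> unram G l \<and> (\<forall>X Y. X \<noteq> 0 \<longrightarrow> Y \<noteq> 0 \<longrightarrow> ev F X Y = 0 \<longrightarrow>
    \<phi> (PT X, PT Y) = PT l \<longrightarrow> unram F X \<and> unram (swF F) Y)"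
proof -
  define e d :: cvec where "e = (1, 0)" and "d = (0, 1)"
  have ed: "dt e d \<noteq> 0" by (simp add: e_def d_def dt_def)
  define B1 where "B1 = {p \<in> zero_locus F. \<exists>X. X \<noteq> 0 \<and> fst p = PT X \<and> \<not> unram F X}"
  define B2 where "B2 = {p \<in> zero_locus (swF F). \<exists>X. X \<noteq> 0 \<and> fst p = PT X \<and> \<not> unram (swF F) X}"
  have fin: "finite B1" "finite B2" unfolding B1_def B2_def
    by (rule finite_ramified_points [OF bih assms(2,4)]
        finite_ramified_points [OF bihom_swF [OF bih] smf_swF [OF assms(2)] assms(3)])+
  note inj = inj_PT_lin [OF ed]
  define S where "S = {x. \<not> unram G (lin e d x)} \<union> (\<lambda>x. PT (lin e d x)) -` (\<phi> ` (B1 \<union> prod.swap ` B2))"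
  have "finite S" unfolding S_def
    using finite_ramified [OF bihG assms(6,7) ed] fin by (intro finite_UnI finite_vimageI inj) auto
  then obtain x where x: "x \<notin> S" using ex_new_if_finite infinite_UNIV_char_0 by blast
  define l where "l = lin e d x"
  have "unram F X \<and> unram (swF F) Y"
    if XY: "X \<noteq> 0" "Y \<noteq> 0" "ev F X Y = 0" "\<phi> (PT X, PT Y) = PT l" for X Y
  proof -
    have z: "(PT X, PT Y) \<in> zero_locus F" using zero_locus_iff [OF bih XY(1,2)] XY(3) by simp
    have "\<phi> (PT X, PT Y) \<notin> \<phi> ` (B1 \<union> prod.swap ` B2)"
      using x unfolding XY(4) S_def l_def by blast
    then have "(PT X, PT Y) \<notin> B1 \<union> prod.swap ` B2" by blast
    then have n1: "(PT X, PT Y) \<notin> B1" and n2: "(PT Y, PT X) \<notin> B2" by force+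
    have "(PT Y, PT X) \<in> zero_locus (swF F)" using z by (simp add: zero_locus_swF)
    then show ?thesis using n1 n2 z XY(1,2) unfolding B1_def B2_def by auto
  qed
  moreover have "l \<noteq> 0" "unram G l" using x lin_nonzero [OF ed] by (auto simp: l_def S_def)
  ultimately show ?thesis by blast
qed

text \<open>Suppose not. The other poles on the column of \<open>q\<close> are at most
  \<open>b - 2\<close> and are covered by rows; those on its row are at most \<open>a - 2\<close>
  and are covered by columns; the rest can be covered by either kind. There are
  \<open>card Q' - 1 \<le> a + b - 4\<close> poles besides \<open>q\<close>, so the lines suffice.
  Their product does not vanish at \<open>q\<close>, against
  \<open>cayley_bacharach\<close>.\<close>

lemma fibre_line:
  assumes bih: "bihomogeneous a b F" and "smf F" "a \<ge> 2" "b \<ge> 2"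
    and mer: "merom F \<xi> Q" and sp: "simple_poles F \<xi> Q"
    and Q': "Q' = Q \<inter> zero_locus F" "finite Q'" "card Q' + 3 \<le> a + b" and q: "q \<in> Q'"
  shows "b \<le> card {p \<in> Q'. fst p = fst q} \<or> a \<le> card {p \<in> Q'. snd p = snd q}"
proof (rule ccontr)
  assume neg: "\<not> ?thesis"
  define e k where "e = rp (fst q)" and "k = rp (snd q)"
  have ek: "e \<noteq> 0" "k \<noteq> 0" "PT e = fst q" "PT k = snd q" by (simp_all add: e_def k_def rp)
  have z: "ev F e k = 0" using zero_locus_iff [OF bih ek(1,2)] q Q' ek by simp
  have qQ: "(PT e, PT k) \<in> Q" using q Q' ek by simp
  define C where "C = {p \<in> Q'. fst p = fst q} - {q}"
  define R where "R = {p \<in> Q'. snd p = snd q} - {q}"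
  define W where "W = Q' - {q} - C - R"
  have fin: "finite C" "finite R" "finite W" using Q'(2) by (simp_all add: C_def R_def W_def)
  have "card C = card {p \<in> Q'. fst p = fst q} - 1" "card R = card {p \<in> Q'. snd p = snd q} - 1"
    using q Q'(2) by (simp_all add: C_def R_def card_Diff_singleton_if)
  moreover have "card {p \<in> Q'. fst p = fst q} < b" "card {p \<in> Q'. snd p = snd q} < a" using neg by auto
  ultimately have cC: "card C \<le> b - 2" and cR: "card R \<le> a - 2" by linarith+
  have un: "Q' - {q} = C \<union> R \<union> W" by (auto simp: C_def R_def W_def)
  have "card (C \<union> R \<union> W) = card (C \<union> R) + card W"
    by (rule card_Un_disjoint) (use fin in \<open>auto simp: W_def\<close>)
  moreover have "card (C \<union> R) = card C + card R"
    by (rule card_Un_disjoint) (use fin in \<open>auto simp: C_def R_def prod_eq_iff\<close>)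
  moreover have "card (C \<union> R \<union> W) = card Q' - 1" unfolding un [symmetric] using q Q'(2) by simp
  moreover have "card Q' > 0" using q Q'(2) card_gt_0_iff by blast
  ultimately have sum: "card C + card R + card W + 4 \<le> a + b"
    using Q'(3) by linarith
  define n where "n = min (card W) (b - 2 - card C)"
  obtain W1 where W1: "W1 \<subseteq> W" "card W1 = n" "finite W1"
    using obtain_subset_with_card_n [of n W] by (auto simp: n_def)
  define U where "U = fst ` (R \<union> (W - W1))"
  define V where "V = snd ` (C \<union> W1)"
  have fUV: "finite U" "finite V" using fin W1 by (auto simp: U_def V_def)
  have "card V \<le> card (C \<union> W1)" unfolding V_def by (rule card_image_le) (use fin W1 in auto)
  also have "\<dots> \<le> card C + card W1" by (rule card_Un_le)
  also have "\<dots> \<le> b - 2" using W1(2) cC by (simp add: n_def)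
  finally have cV: "card V \<le> b - 2" .
  have "card U \<le> card (R \<union> (W - W1))" unfolding U_def by (rule card_image_le) (use fin W1 in auto)
  also have "\<dots> \<le> card R + card (W - W1)" by (rule card_Un_le)
  also have "\<dots> = card R + (card W - n)" using W1 fin by (simp add: card_Diff_subset)
  also have "\<dots> \<le> a - 2" using sum cC cR assms(3,4) unfolding n_def min_def by (cases "card W \<le> b - 2 - card C") simp_all
  finally have cU: "card U \<le> a - 2" .
  have nU: "u \<noteq> PT e" if "u \<in> U" for u
    using that W1(1) by (auto simp: U_def R_def W_def C_def ek prod_eq_iff)
  have nV: "v \<noteq> PT k" if "v \<in> V" for v
    using that W1(1) by (auto simp: V_def R_def W_def C_def ek prod_eq_iff)
  obtain P where P: "bihomogeneous (a - 2) (b - 2) P" "ev P e k \<noteq> 0"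
    "\<And>X' Y'. X' \<noteq> 0 \<Longrightarrow> PT X' \<in> U \<Longrightarrow> ev P X' Y' = 0"
    "\<And>X' Y'. Y' \<noteq> 0 \<Longrightarrow> PT Y' \<in> V \<Longrightarrow> ev P X' Y' = 0"
    using bihom_prod_lines [OF fUV cU cV ek(1,2) nU nV] by metis
  have "ev P e k = 0"
  proof (rule cayley_bacharach [OF bih assms(2-4) P(1) mer sp ek(1,2) z qQ])
    fix X Y assume XY: "X \<noteq> 0" "Y \<noteq> 0" "ev F X Y = 0" "(PT X, PT Y) \<in> Q" "(PT X, PT Y) \<noteq> (PT e, PT k)"
    have "(PT X, PT Y) \<in> Q' - {q}"
      using XY zero_locus_iff [OF bih XY(1,2)] Q'(1) ek by auto
    then have "(PT X, PT Y) \<in> C \<union> W1 \<or> (PT X, PT Y) \<in> R \<union> (W - W1)"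
      unfolding un by blast
    then have "PT Y \<in> V \<or> PT X \<in> U" unfolding U_def V_def by (metis fst_conv snd_conv image_eqI)
    then show "ev P X Y = 0" using P(3,4) XY(1,2) by blast
  qed
  then show False using P(2) by simp
qed

text \<open>The bijection maps the poles onto the column over \<open>l\<close>, so their number is
  \<open>b\<close>, and \<open>a \<ge> 3\<close> gives the count required by
  \<open>fibre_line\<close>. If they fill a column, then \<open>\<phi>\<close> is linear in
  \<open>X\<close>. Otherwise some row contains at least \<open>a\<close> of them; for
  \<open>a < b\<close> they need not fill it, and only the coincidence of two values of
  \<open>\<phi>\<close> on one row is recorded.\<close>

lemma component_alternative:
  assumes bih: "bihomogeneous a b F" and "smf F" "a \<ge> 3" "b \<ge> 3"
    and \<phi>: "regular F \<phi>" and \<psi>: "regular F \<psi>"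
    and bij: "bij_betw (\<lambda>p. (\<phi> p, \<psi> p)) (zero_locus F) (zero_locus F)"
  shows "(\<exists>g. linv g \<and> (\<forall>X Y. X \<noteq> 0 \<longrightarrow> Y \<noteq> 0 \<longrightarrow> ev F X Y = 0 \<longrightarrow> \<phi> (PT X, PT Y) = PT (g X))) \<or>
    (a \<le> b \<and> (\<exists>p\<in>zero_locus F. \<exists>p'\<in>zero_locus F. p \<noteq> p' \<and> snd p = snd p' \<and> \<phi> p = \<phi> p') \<and>
      (a = b \<longrightarrow> (\<exists>g. linv g \<and> (\<forall>X Y. X \<noteq> 0 \<longrightarrow> Y \<noteq> 0 \<longrightarrow> ev F X Y = 0 \<longrightarrow> \<phi> (PT X, PT Y) = PT (g Y)))))"
proof -
  have a2: "a \<ge> 2" and b2: "b \<ge> 2" and b1: "b \<ge> 1" using assms(3,4) by auto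
  note bih' = bihom_swF [OF bih]
  note smf' = smf_swF [OF assms(2)]
  obtain l where l: "l \<noteq> 0" "unram F l" and unr: "\<And>X Y. X \<noteq> 0 \<Longrightarrow> Y \<noteq> 0 \<Longrightarrow> ev F X Y = 0 \<Longrightarrow>
    \<phi> (PT X, PT Y) = PT l \<Longrightarrow> unram F X \<and> unram (swF F) Y"
    using generic_value [OF bih assms(2) a2 b2 bih assms(2) b2, of \<phi>] by blast
  have inj: "p = p'" if "p \<in> zero_locus F" "p' \<in> zero_locus F" "\<phi> p = \<phi> p'" "\<psi> p = \<psi> p'" for p p'
    using bij that unfolding bij_betw_def inj_on_def by blast
  have maps: "(\<phi> p, \<psi> p) \<in> zero_locus F" if "p \<in> zero_locus F" for p
    using bij that unfolding bij_betw_def by blast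
  have sp: "simple_poles F (xi l \<phi>) (poles l \<phi>)"
    by (rule simple_poles_regular [OF bih assms(2) b2 bih b2 \<phi> \<psi> inj maps l]) (use unr in auto)
  have sp': "simple_poles (swF F) (xi l (\<lambda>p. \<phi> (prod.swap p))) (poles l (\<lambda>p. \<phi> (prod.swap p)))"
  proof (rule simple_poles_regular [OF bih' smf' a2 bih b2 regular_swF [OF \<phi>] regular_swF [OF \<psi>] _ _ l])
    fix p p' assume "p \<in> zero_locus (swF F)" "p' \<in> zero_locus (swF F)"
      "\<phi> (prod.swap p) = \<phi> (prod.swap p')" "\<psi> (prod.swap p) = \<psi> (prod.swap p')"
    then have "prod.swap p = prod.swap p'" using inj by (simp add: zero_locus_swF)
    then show "p = p'" by (metis swap_swap)
  next
    show "(\<phi> (prod.swap p), \<psi> (prod.swap p)) \<in> zero_locus F" if "p \<in> zero_locus (swF F)" for p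
      using maps that by (simp add: zero_locus_swF)
    show "unram (swF F) e" if "e \<noteq> 0" "k \<noteq> 0" "ev (swF F) e k = 0" "\<phi> (prod.swap (PT e, PT k)) = PT l" for e k
      using unr [of k e] that by simp
  qed
  note mer = merom_regular [OF \<phi> l(1)]
  define Q' where "Q' = poles l \<phi> \<inter> zero_locus F"
  have img: "(\<lambda>p. (\<phi> p, \<psi> p)) ` Q' = (\<lambda>y. (PT l, y)) ` col F l"
  proof
    show "(\<lambda>p. (\<phi> p, \<psi> p)) ` Q' \<subseteq> (\<lambda>y. (PT l, y)) ` col F l"
    proof clarify
      fix p assume "p \<in> Q'"
      then have "\<phi> p = PT l" "(\<phi> p, \<psi> p) \<in> zero_locus F" using maps [of p] by (simp_all add: Q'_def poles_def)
      then show "(\<phi> p, \<psi> p) \<in> (\<lambda>y. (PT l, y)) ` col F l"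
        using col_iff_zero_locus [OF bih l(1)] by auto
    qed
    show "(\<lambda>y. (PT l, y)) ` col F l \<subseteq> (\<lambda>p. (\<phi> p, \<psi> p)) ` Q'"
    proof clarify
      fix y assume "y \<in> col F l"
      then have "(PT l, y) \<in> zero_locus F" using col_iff_zero_locus [OF bih l(1)] by simp
      then obtain p where "p \<in> zero_locus F" "(\<phi> p, \<psi> p) = (PT l, y)"
        using bij unfolding bij_betw_def by (metis (no_types, lifting) imageE)
      then show "(PT l, y) \<in> (\<lambda>p. (\<phi> p, \<psi> p)) ` Q'"
        by (intro image_eqI [of _ _ p]) (auto simp: Q'_def poles_def)
    qed
  qed
  have injQ: "inj_on (\<lambda>p. (\<phi> p, \<psi> p)) Q'"
    using inj by (auto simp: inj_on_def Q'_def)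
  have fin: "finite Q'"
    using finite_imageD [OF _ injQ] col_card(1) [OF bih assms(2) b1 l(1)] by (simp add: img)
  have "card Q' = card ((\<lambda>y. (PT l, y)) ` col F l)" using card_image [OF injQ] img by simp
  also have "\<dots> = b"
    using col_card(3) [OF bih assms(2) b1 l] by (subst card_image) (auto simp: inj_on_def)
  finally have card: "card Q' = b" .
  then obtain q where q: "q \<in> Q'" using b1 by fastforce
  define e k where "e = rp (fst q)" and "k = rp (snd q)"
  have ek: "e \<noteq> 0" "k \<noteq> 0" "PT e = fst q" "PT k = snd q" by (simp_all add: e_def k_def rp)
  have z: "ev F e k = 0" using zero_locus_iff [OF bih ek(1,2)] q ek by (simp add: Q'_def)
  have \<phi>q: "\<phi> (PT e, PT k) = PT l" using q ek by (simp add: Q'_def poles_def)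
  have mem: "(PT X, PT Y) \<in> Q'" if "X \<noteq> 0" "Y \<noteq> 0" "ev F X Y = 0" "\<phi> (PT X, PT Y) = PT l" for X Y
    using that zero_locus_iff [OF bih that(1,2)] by (simp add: Q'_def poles_def)
  have "card Q' + 3 \<le> a + b" using card assms(3) by simp
  from fibre_line [OF bih assms(2) a2 b2 mer sp Q'_def fin this q] show ?thesis
  proof
    assume "b \<le> card {p \<in> Q'. fst p = fst q}"
    then have eq: "{p \<in> Q'. fst p = fst q} = Q'"
      using card fin by (intro card_seteq) auto
    have "fst p = PT e" if "p \<in> Q'" for p
      using that by (subst (asm) eq [symmetric]) (simp add: ek)
    then have "dt X e = 0" if "X \<noteq> 0" "Y \<noteq> 0" "ev F X Y = 0" "\<phi> (PT X, PT Y) = PT l" for X Y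
      using mem [OF that] PT_eq_iff [OF that(1) ek(1)] by fastforce
    then show ?thesis
      using regular_map_linear [OF bih assms(2) a2 b2 \<phi> l(1) sp ek(1,2) z \<phi>q] by blast
  next
    assume row: "a \<le> card {p \<in> Q'. snd p = snd q}"
    have "card {p \<in> Q'. snd p = snd q} \<le> b" using card card_mono [OF fin, of "{p \<in> Q'. snd p = snd q}"] by auto
    then have ab: "a \<le> b" using row by simp
    have "1 < card {p \<in> Q'. snd p = snd q}" using row assms(3) by simp
    then obtain p p' where "p \<in> Q'" "p' \<in> Q'" "snd p = snd q" "snd p' = snd q" "p \<noteq> p'"
      using card_le_Suc0_iff_eq [of "{p \<in> Q'. snd p = snd q}"] fin by (force simp: not_le [symmetric])
    then have two: "\<exists>p\<in>zero_locus F. \<exists>p'\<in>zero_locus F. p \<noteq> p' \<and> snd p = snd p' \<and> \<phi> p = \<phi> p'"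
      by (intro bexI [of _ p] bexI [of _ p']) (auto simp: Q'_def poles_def)
    have "\<exists>g. linv g \<and> (\<forall>X Y. X \<noteq> 0 \<longrightarrow> Y \<noteq> 0 \<longrightarrow> ev F X Y = 0 \<longrightarrow> \<phi> (PT X, PT Y) = PT (g Y))" if "a = b"
    proof -
      have eq: "{p \<in> Q'. snd p = snd q} = Q'"
        using card fin row that by (intro card_seteq) auto
      have "snd p = PT k" if "p \<in> Q'" for p
        using that by (subst (asm) eq [symmetric]) (simp add: ek)
      then have "dt Y k = 0" if "X \<noteq> 0" "Y \<noteq> 0" "ev F X Y = 0" "\<phi> (PT X, PT Y) = PT l" for X Y
        using mem [OF that] PT_eq_iff [OF that(2) ek(2)] by fastforce
      then have "\<exists>g. linv g \<and> (\<forall>X Y. X \<noteq> 0 \<longrightarrow> Y \<noteq> 0 \<longrightarrow> ev (swF F) X Y = 0 \<longrightarrow>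
          \<phi> (prod.swap (PT X, PT Y)) = PT (g X))"
        by (intro regular_map_linear [OF bih' smf' b2 a2 regular_swF [OF \<phi>] l(1) sp' ek(2,1)])
          (use z \<phi>q in auto)
      then show ?thesis by auto
    qed
    then show ?thesis using ab two by blast
  qed
qed

text \<open>The alternatives for \<open>\<phi>\<close> are combined with those for
  \<open>\<psi>\<close>, obtained by exchanging the factors. If \<open>\<phi>\<close> depends on
  \<open>X\<close> alone, then \<open>\<psi>\<close> cannot take the same value twice on a column,
  so it depends on \<open>Y\<close> alone. If not, then two points of a row with the same
  \<open>\<phi>\<close> show that \<open>\<psi>\<close> does not depend on \<open>Y\<close> alone
  either, and both \<open>a \<le> b\<close> and \<open>b \<le> a\<close> result.\<close>

theorem automorphism_linear:
  assumes bih: "bihomogeneous a b F" and "smf F" "a \<ge> 3" "b \<ge> 3"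
    and \<phi>: "regular F \<phi>" and \<psi>: "regular F \<psi>"
    and bij: "bij_betw (\<lambda>p. (\<phi> p, \<psi> p)) (zero_locus F) (zero_locus F)"
  shows "\<exists>g h. linv g \<and> linv h \<and>
    ((\<forall>X Y. X \<noteq> 0 \<longrightarrow> Y \<noteq> 0 \<longrightarrow> ev F X Y = 0 \<longrightarrow> \<phi> (PT X, PT Y) = PT (g X) \<and> \<psi> (PT X, PT Y) = PT (h Y)) \<or>
     a = b \<and> (\<forall>X Y. X \<noteq> 0 \<longrightarrow> Y \<noteq> 0 \<longrightarrow> ev F X Y = 0 \<longrightarrow> \<phi> (PT X, PT Y) = PT (g Y) \<and> \<psi> (PT X, PT Y) = PT (h X)))"
proof -
  have inj: "p = p'" if "p \<in> zero_locus F" "p' \<in> zero_locus F" "\<phi> p = \<phi> p'" "\<psi> p = \<psi> p'" for p p'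
    using bij that unfolding bij_betw_def inj_on_def by blast
  note 1 = component_alternative [OF assms]
  have "bij_betw (\<lambda>p. (\<psi> (prod.swap p), \<phi> (prod.swap p))) (zero_locus (swF F)) (zero_locus (swF F))"
  proof -
    have s: "bij_betw prod.swap (zero_locus (swF F)) (zero_locus F)"
      "bij_betw prod.swap (zero_locus F) (zero_locus (swF F))"
      by (rule bij_betw_byWitness [of _ prod.swap]; auto simp: zero_locus_swF)+
    show ?thesis
      using bij_betw_trans [OF bij_betw_trans [OF s(1) bij] s(2)] by (simp add: o_def)
  qed
  note 2 = component_alternative [OF bihom_swF [OF bih] smf_swF [OF assms(2)] assms(4,3)
      regular_swF [OF \<psi>] regular_swF [OF \<phi>] this]
  have 2: "(\<exists>h. linv h \<and> (\<forall>X Y. X \<noteq> 0 \<longrightarrow> Y \<noteq> 0 \<longrightarrow> ev F X Y = 0 \<longrightarrow> \<psi> (PT X, PT Y) = PT (h Y))) \<or>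
    (b \<le> a \<and> (\<exists>p\<in>zero_locus F. \<exists>p'\<in>zero_locus F. p \<noteq> p' \<and> fst p = fst p' \<and> \<psi> p = \<psi> p') \<and>
      (b = a \<longrightarrow> (\<exists>h. linv h \<and> (\<forall>X Y. X \<noteq> 0 \<longrightarrow> Y \<noteq> 0 \<longrightarrow> ev F X Y = 0 \<longrightarrow> \<psi> (PT X, PT Y) = PT (h X)))))"
  proof -
    have "\<exists>p\<in>zero_locus F. \<exists>p'\<in>zero_locus F. p \<noteq> p' \<and> fst p = fst p' \<and> \<psi> p = \<psi> p'"
      if "\<exists>p\<in>zero_locus (swF F). \<exists>p'\<in>zero_locus (swF F). p \<noteq> p' \<and> snd p = snd p' \<and> \<psi> (prod.swap p) = \<psi> (prod.swap p')"
    proof -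
      from that obtain p p' where p: "p \<in> zero_locus (swF F)" "p' \<in> zero_locus (swF F)" "p \<noteq> p'" "snd p = snd p'"
        "\<psi> (prod.swap p) = \<psi> (prod.swap p')" by blast
      then show ?thesis
        by (intro bexI [of _ "prod.swap p"] bexI [of _ "prod.swap p'"])
          (auto simp: zero_locus_swF prod_eq_iff)
    qed
    note two = this
    from 2 show ?thesis
    proof (elim disjE conjE exE)
      fix h assume "linv h" "\<forall>X Y. X \<noteq> 0 \<longrightarrow> Y \<noteq> 0 \<longrightarrow> ev (swF F) X Y = 0 \<longrightarrow> \<psi> (prod.swap (PT X, PT Y)) = PT (h X)"
      then show ?thesis by (intro disjI1 exI [of _ h]) simp
    next
      assume "b \<le> a" and ex: "\<exists>p\<in>zero_locus (swF F). \<exists>p'\<in>zero_locus (swF F). p \<noteq> p' \<and> snd p = snd p' \<and>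
          \<psi> (prod.swap p) = \<psi> (prod.swap p')"
        and imp: "b = a \<longrightarrow> (\<exists>h. linv h \<and> (\<forall>X Y. X \<noteq> 0 \<longrightarrow> Y \<noteq> 0 \<longrightarrow> ev (swF F) X Y = 0 \<longrightarrow>
          \<psi> (prod.swap (PT X, PT Y)) = PT (h Y)))"
      have "\<exists>h. linv h \<and> (\<forall>X Y. X \<noteq> 0 \<longrightarrow> Y \<noteq> 0 \<longrightarrow> ev F X Y = 0 \<longrightarrow> \<psi> (PT X, PT Y) = PT (h X))" if ba: "b = a"
      proof -
        obtain h where "linv h" "\<forall>X Y. X \<noteq> 0 \<longrightarrow> Y \<noteq> 0 \<longrightarrow> ev (swF F) X Y = 0 \<longrightarrow>
          \<psi> (prod.swap (PT X, PT Y)) = PT (h Y)" using imp ba by blast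
        then show ?thesis by (intro exI [of _ h]) simp
      qed
      then show ?thesis using \<open>b \<le> a\<close> two [OF ex] by blast
    qed
  qed
  show ?thesis
  proof (cases "\<exists>g. linv g \<and> (\<forall>X Y. X \<noteq> 0 \<longrightarrow> Y \<noteq> 0 \<longrightarrow> ev F X Y = 0 \<longrightarrow> \<phi> (PT X, PT Y) = PT (g X))")
    case True
    then obtain g where g: "linv g" "\<And>X Y. X \<noteq> 0 \<Longrightarrow> Y \<noteq> 0 \<Longrightarrow> ev F X Y = 0 \<Longrightarrow> \<phi> (PT X, PT Y) = PT (g X)" by blast
    have "\<not> (\<exists>p\<in>zero_locus F. \<exists>p'\<in>zero_locus F. p \<noteq> p' \<and> fst p = fst p' \<and> \<psi> p = \<psi> p')"
    proof
      assume "\<exists>p\<in>zero_locus F. \<exists>p'\<in>zero_locus F. p \<noteq> p' \<and> fst p = fst p' \<and> \<psi> p = \<psi> p'"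
      then obtain p p' where p: "p \<in> zero_locus F" "p' \<in> zero_locus F" "\<psi> p = \<psi> p'" "p \<noteq> p'" "fst p = fst p'"
        by blast
      have "\<phi> p = PT (g (rp (fst p)))" if "p \<in> zero_locus F" for p
        using g(2) [OF rp(1) rp(1), of "fst p" "snd p"] zero_locus_iff [OF bih rp(1) rp(1), of "fst p" "snd p"] that
        by (simp add: rp)
      then have "p = p'" using p by (intro inj) auto
      then show False using p(4) by simp
    qed
    then obtain h where "linv h" "\<forall>X Y. X \<noteq> 0 \<longrightarrow> Y \<noteq> 0 \<longrightarrow> ev F X Y = 0 \<longrightarrow> \<psi> (PT X, PT Y) = PT (h Y)"
      using 2 by (elim disjE conjE exE) simp_all
    then show ?thesis
      using g by (intro exI [of _ g] exI [of _ h]) simp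
  next
    case False
    then have F1: "a \<le> b" "\<exists>p\<in>zero_locus F. \<exists>p'\<in>zero_locus F. p \<noteq> p' \<and> snd p = snd p' \<and> \<phi> p = \<phi> p'"
      and g: "a = b \<Longrightarrow> \<exists>g. linv g \<and> (\<forall>X Y. X \<noteq> 0 \<longrightarrow> Y \<noteq> 0 \<longrightarrow> ev F X Y = 0 \<longrightarrow> \<phi> (PT X, PT Y) = PT (g Y))"
      using 1 by blast+
    have "\<not> (\<exists>h. linv h \<and> (\<forall>X Y. X \<noteq> 0 \<longrightarrow> Y \<noteq> 0 \<longrightarrow> ev F X Y = 0 \<longrightarrow> \<psi> (PT X, PT Y) = PT (h Y)))"
    proof
      assume "\<exists>h. linv h \<and> (\<forall>X Y. X \<noteq> 0 \<longrightarrow> Y \<noteq> 0 \<longrightarrow> ev F X Y = 0 \<longrightarrow> \<psi> (PT X, PT Y) = PT (h Y))"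
      then obtain h where h: "\<And>X Y. X \<noteq> 0 \<Longrightarrow> Y \<noteq> 0 \<Longrightarrow> ev F X Y = 0 \<Longrightarrow> \<psi> (PT X, PT Y) = PT (h Y)" by blast
      have \<psi>h: "\<psi> p = PT (h (rp (snd p)))" if "p \<in> zero_locus F" for p
        using h [OF rp(1) rp(1), of "fst p" "snd p"] zero_locus_iff [OF bih rp(1) rp(1), of "fst p" "snd p"] that
        by (simp add: rp)
      obtain p p' where p: "p \<in> zero_locus F" "p' \<in> zero_locus F" "\<phi> p = \<phi> p'" "p \<noteq> p'" "snd p = snd p'"
        using F1(2) by blast
      have "p = p'" using p \<psi>h by (intro inj) auto
      then show False using p(4) by simp
    qed
    with 2 have "b \<le> a" and h: "b = a \<Longrightarrow> \<exists>h. linv h \<and> (\<forall>X Y. X \<noteq> 0 \<longrightarrow> Y \<noteq> 0 \<longrightarrow> ev F X Y = 0 \<longrightarrow> \<psi> (PT X, PT Y) = PT (h X))"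
      by (elim disjE; simp)+
    then have ab: "a = b" using F1(1) by simp
    obtain g where g': "linv g" "\<forall>X Y. X \<noteq> 0 \<longrightarrow> Y \<noteq> 0 \<longrightarrow> ev F X Y = 0 \<longrightarrow> \<phi> (PT X, PT Y) = PT (g Y)"
      using g [OF ab] by (elim exE conjE)
    obtain h where h': "linv h" "\<forall>X Y. X \<noteq> 0 \<longrightarrow> Y \<noteq> 0 \<longrightarrow> ev F X Y = 0 \<longrightarrow> \<psi> (PT X, PT Y) = PT (h X)"
      using h [OF ab [symmetric]] by (elim exE conjE)
    show ?thesis
      by (intro exI [of _ g] exI [of _ h]) (use g' h' ab in simp)
  qed
qed

section \<open>Linear equivalence of forms\<close>

text \<open>\<open>H\<close> is nonzero at the centre of the charts, hence for small coordinates,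
  where the forms describing the morphism restrict to polynomial functions.\<close>

lemma morphism_regular:
  assumes bih: "bihomogeneous a b F" and "morphism (zero_locus F) D f"
  shows "regular F (\<lambda>p. fst (f p))" "regular F (\<lambda>p. snd (f p))"
proof -
  have local: "\<exists>A0 A1 B0 B1 \<delta>. poly2 A0 \<and> poly2 A1 \<and> poly2 B0 \<and> poly2 B1 \<and> \<delta> > 0 \<and>
      (\<forall>x y. norm x < \<delta> \<longrightarrow> norm y < \<delta> \<longrightarrow> ev F (lin e d x) (lin k m y) = 0 \<longrightarrow>
        (A0 x y, A1 x y) \<noteq> 0 \<and> (B0 x y, B1 x y) \<noteq> 0 \<and>
        f (PT (lin e d x), PT (lin k m y)) = (PT (A0 x y, A1 x y), PT (B0 x y, B1 x y)))"
    if ed: "dt e d \<noteq> 0" and km: "dt k m \<noteq> 0" and ek: "ev F e k = 0" for e d k m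
  proof -
    have "(PT e, PT k) \<in> zero_locus F"
      using zero_locus_iff [OF bih dt_nonzeroD(1) [OF ed] dt_nonzeroD(1) [OF km]] ek by simp
    then obtain H h h' i j n n' A0 A1 B0 B1 where H: "bihomogeneous h h' H" "(PT e, PT k) \<notin> zero_locus H"
      and AB: "bihomogeneous i j A0" "bihomogeneous i j A1" "bihomogeneous n n' B0" "bihomogeneous n n' B1"
      and f: "\<And>X0 X1 Y0 Y1. (X0, X1) \<noteq> (0, 0) \<Longrightarrow> (Y0, Y1) \<noteq> (0, 0) \<Longrightarrow>
           (pt X0 X1, pt Y0 Y1) \<in> zero_locus F - zero_locus H \<Longrightarrow>
           (A0 X0 X1 Y0 Y1, A1 X0 X1 Y0 Y1) \<noteq> (0, 0) \<and>
           (B0 X0 X1 Y0 Y1, B1 X0 X1 Y0 Y1) \<noteq> (0, 0) \<and>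
           f (pt X0 X1, pt Y0 Y1) =
             (pt (A0 X0 X1 Y0 Y1) (A1 X0 X1 Y0 Y1), pt (B0 X0 X1 Y0 Y1) (B1 X0 X1 Y0 Y1))"
      using assms(2) unfolding morphism_def by (elim conjE ballE [of _ _ "(PT e, PT k)"]) (elim exE conjE, blast, simp)
    have "ev H (lin e d 0) (lin k m 0) \<noteq> 0"
      using H zero_locus_iff [OF H(1) dt_nonzeroD(1) [OF ed] dt_nonzeroD(1) [OF km]] by simp
    then obtain \<delta> where \<delta>: "\<delta> > 0" "\<And>x y. norm x < \<delta> \<Longrightarrow> norm y < \<delta> \<Longrightarrow> ev H (lin e d x) (lin k m y) \<noteq> 0"
      using poly2_near_nonzero [OF poly2_slice [OF H(1), of e d k m]] by blast
    have "(ev A0 (lin e d x) (lin k m y), ev A1 (lin e d x) (lin k m y)) \<noteq> 0 \<and>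
        (ev B0 (lin e d x) (lin k m y), ev B1 (lin e d x) (lin k m y)) \<noteq> 0 \<and>
        f (PT (lin e d x), PT (lin k m y)) = (PT (ev A0 (lin e d x) (lin k m y), ev A1 (lin e d x) (lin k m y)),
          PT (ev B0 (lin e d x) (lin k m y), ev B1 (lin e d x) (lin k m y)))"
      if xy: "norm x < \<delta>" "norm y < \<delta>" "ev F (lin e d x) (lin k m y) = 0" for x y
    proof -
      note nz = lin_nonzero [OF ed, of x] lin_nonzero [OF km, of y]
      have "(PT (lin e d x), PT (lin k m y)) \<in> zero_locus F - zero_locus H"
        using zero_locus_iff [OF bih nz] zero_locus_iff [OF H(1) nz] xy \<delta>(2) by simp
      then show ?thesis
        using f [of "fst (lin e d x)" "snd (lin e d x)" "fst (lin k m y)" "snd (lin k m y)"] nz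
        by (simp add: PT_def ev_def zero_prod_def)
    qed
    then show ?thesis
      using poly2_slice [OF AB(1)] poly2_slice [OF AB(2)] poly2_slice [OF AB(3)] poly2_slice [OF AB(4)] \<delta>(1)
      by (intro exI [of _ "\<lambda>x y. ev A0 (lin e d x) (lin k m y)"] exI [of _ "\<lambda>x y. ev A1 (lin e d x) (lin k m y)"]
          exI [of _ "\<lambda>x y. ev B0 (lin e d x) (lin k m y)"] exI [of _ "\<lambda>x y. ev B1 (lin e d x) (lin k m y)"]
          exI [of _ \<delta>] conjI) simp_all
  qed
  show "regular F (\<lambda>p. fst (f p))" unfolding regular_def
  proof (intro allI impI)
    fix e d k m assume "dt e d \<noteq> 0" "dt k m \<noteq> 0" "ev F e k = 0"
    from local [OF this] obtain A0 A1 B0 B1 \<delta> where "poly2 A0" "poly2 A1" "\<delta> > 0"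
      "\<And>x y. norm x < \<delta> \<Longrightarrow> norm y < \<delta> \<Longrightarrow> ev F (lin e d x) (lin k m y) = 0 \<Longrightarrow>
        (A0 x y, A1 x y) \<noteq> 0 \<and> f (PT (lin e d x), PT (lin k m y)) = (PT (A0 x y, A1 x y), PT (B0 x y, B1 x y))"
      by (elim exE conjE) blast
    then show "\<exists>A0 A1 \<delta>. poly2 A0 \<and> poly2 A1 \<and> \<delta> > 0 \<and>
       (\<forall>x y. norm x < \<delta> \<longrightarrow> norm y < \<delta> \<longrightarrow> ev F (lin e d x) (lin k m y) = 0 \<longrightarrow>
         (A0 x y, A1 x y) \<noteq> 0 \<and> fst (f (PT (lin e d x), PT (lin k m y))) = PT (A0 x y, A1 x y))"
      by (intro exI [of _ A0] exI [of _ A1] exI [of _ \<delta>]) simp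
  qed
  show "regular F (\<lambda>p. snd (f p))" unfolding regular_def
  proof (intro allI impI)
    fix e d k m assume "dt e d \<noteq> 0" "dt k m \<noteq> 0" "ev F e k = 0"
    from local [OF this] obtain A0 A1 B0 B1 \<delta> where "poly2 B0" "poly2 B1" "\<delta> > 0"
      "\<And>x y. norm x < \<delta> \<Longrightarrow> norm y < \<delta> \<Longrightarrow> ev F (lin e d x) (lin k m y) = 0 \<Longrightarrow>
        (B0 x y, B1 x y) \<noteq> 0 \<and> f (PT (lin e d x), PT (lin k m y)) = (PT (A0 x y, A1 x y), PT (B0 x y, B1 x y))"
      by (elim exE conjE) blast
    then show "\<exists>A0 A1 \<delta>. poly2 A0 \<and> poly2 A1 \<and> \<delta> > 0 \<and>
       (\<forall>x y. norm x < \<delta> \<longrightarrow> norm y < \<delta> \<longrightarrow> ev F (lin e d x) (lin k m y) = 0 \<longrightarrow>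
         (A0 x y, A1 x y) \<noteq> 0 \<and> snd (f (PT (lin e d x), PT (lin k m y))) = PT (A0 x y, A1 x y))"
      by (intro exI [of _ B0] exI [of _ B1] exI [of _ \<delta>]) simp
  qed
qed

lemma bihom_sum:
  assumes "\<And>i. i \<in> A \<Longrightarrow> bihomogeneous a b (G i)"
  shows "bihomogeneous a b (\<lambda>X0 X1 Y0 Y1. \<Sum>i\<in>A. G i X0 X1 Y0 Y1)"
  using assms
proof (induction A rule: infinite_finite_induct)
  case (insert i A)
  then show ?case using bihom_add [of a b "G i" "\<lambda>X0 X1 Y0 Y1. \<Sum>i\<in>A. G i X0 X1 Y0 Y1"] by simp
qed (auto simp: bihomogeneous_def intro!: exI [of _ "\<lambda>_ _. 0"])

lemma linv_form:
  assumes "linv g"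
  obtains p q r s where "g = (\<lambda>X. (p * fst X + q * snd X, r * fst X + s * snd X))"
  using assms unfolding linv_def by blast

definition pullback :: "form \<Rightarrow> (cvec \<Rightarrow> cvec) \<Rightarrow> (cvec \<Rightarrow> cvec) \<Rightarrow> form" where
  "pullback F g h = (\<lambda>X0 X1 Y0 Y1. ev F (g (X0, X1)) (h (Y0, Y1)))"

lemma ev_pullback [simp]: "ev (pullback F g h) X Y = ev F (g X) (h Y)"
  by (simp add: pullback_def ev_def)

lemma bihom_linear_powers:
  "bihomogeneous (i + i') (j + j') (\<lambda>X0 X1 Y0 Y1.
     (p * X0 + q * X1) ^ i * ((r * X0 + s * X1) ^ i' * ((t * Y0 + u * Y1) ^ j * ((v * Y0 + w * Y1) ^ j' * c))))"
proof -
  have Y: "bihomogeneous a (n + b) (\<lambda>X0 X1 Y0 Y1. (p * Y0 + q * Y1) ^ n * G X0 X1 Y0 Y1)"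
    if "bihomogeneous a b G" for a b G n p q
    using bihom_swF [OF bihom_mult_linX_power [OF bihom_swF [OF that], of n p q]] by (simp add: swF_def)
  have "bihomogeneous 0 (j' + 0) (\<lambda>X0 X1 Y0 Y1. (v * Y0 + w * Y1) ^ j' * c)"
    by (rule Y [OF bihom_const])
  from Y [OF this, of j t u]
  have "bihomogeneous 0 (j + j') (\<lambda>X0 X1 Y0 Y1. (t * Y0 + u * Y1) ^ j * ((v * Y0 + w * Y1) ^ j' * c))"
    by simp
  from bihom_mult_linX_power [OF bihom_mult_linX_power [OF this, of i' r s], of i p q]
  show ?thesis by simp
qed

lemma bihom_pullback:
  assumes "bihomogeneous a b F" "linv g" "linv h"
  shows "bihomogeneous a b (pullback F g h)"
proof -
  obtain c where c: "\<And>X0 X1 Y0 Y1. F X0 X1 Y0 Y1 =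
      (\<Sum>i\<le>a. \<Sum>j\<le>b. c i j * X0 ^ (a - i) * X1 ^ i * Y0 ^ (b - j) * Y1 ^ j)"
    using assms(1) unfolding bihomogeneous_def by blast
  obtain p q r s where g: "g = (\<lambda>X. (p * fst X + q * snd X, r * fst X + s * snd X))"
    using linv_form [OF assms(2)] .
  obtain t u v w where h: "h = (\<lambda>X. (t * fst X + u * snd X, v * fst X + w * snd X))"
    using linv_form [OF assms(3)] .
  have "bihomogeneous a b (\<lambda>X0 X1 Y0 Y1. \<Sum>i\<le>a. \<Sum>j\<le>b. (p * X0 + q * X1) ^ (a - i) *
      ((r * X0 + s * X1) ^ i * ((t * Y0 + u * Y1) ^ (b - j) * ((v * Y0 + w * Y1) ^ j * c i j))))"
  proof (intro bihom_sum)
    fix i j assume "i \<in> {..a}" "j \<in> {..b}"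
    then show "bihomogeneous a b (\<lambda>X0 X1 Y0 Y1. (p * X0 + q * X1) ^ (a - i) *
      ((r * X0 + s * X1) ^ i * ((t * Y0 + u * Y1) ^ (b - j) * ((v * Y0 + w * Y1) ^ j * c i j))))"
      using bihom_linear_powers [of "a - i" i "b - j" j p q r s t u v w "c i j"] by simp
  qed
  then show ?thesis unfolding pullback_def ev_def c g h by (simp add: mult_ac)
qed

lemma linv_inverse:
  assumes "linv g"
  obtains g' where "linv g'" "\<And>X. g (g' X) = X" "\<And>X. g' (g X) = X"
proof -
  obtain p q r s where D: "p * s - q * r \<noteq> 0" and g: "g = (\<lambda>X. (p * fst X + q * snd X, r * fst X + s * snd X))"
    using assms unfolding linv_def by blast
  define D where "D = p * s - q * r"
  have D0: "D \<noteq> 0" using D by (simp add: D_def)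
  define g' :: "cvec \<Rightarrow> cvec" where "g' X = ((s / D) * fst X + (- q / D) * snd X, (- r / D) * fst X + (p / D) * snd X)" for X
  have "(s / D) * (p / D) - (- q / D) * (- r / D) = D / (D * D)"
    by (simp add: D_def diff_divide_distrib mult.commute)
  then have "linv g'" using D0 by (intro linvI [of "s / D" "p / D" "- q / D" "- r / D"]) (auto simp: g'_def)
  moreover have "g (g' X) = X" for X
  proof -
    have "p * (s / D * fst X + - q / D * snd X) + q * (- r / D * fst X + p / D * snd X) = D / D * fst X"
      "r * (s / D * fst X + - q / D * snd X) + s * (- r / D * fst X + p / D * snd X) = D / D * snd X"
      by (simp_all add: D_def field_simps)
    then show ?thesis using D0 by (simp add: g g'_def prod_eq_iff)
  qed
  moreover have "g' (g X) = X" for X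
  proof -
    have "s / D * (p * fst X + q * snd X) + - q / D * (r * fst X + s * snd X) = D / D * fst X"
      "- r / D * (p * fst X + q * snd X) + p / D * (r * fst X + s * snd X) = D / D * snd X"
      by (simp_all add: D_def field_simps)
    then show ?thesis using D0 by (simp add: g g'_def prod_eq_iff)
  qed
  ultimately show ?thesis by (rule that)
qed

definition mob :: "(cvec \<Rightarrow> cvec) \<Rightarrow> proj1 \<Rightarrow> proj1" where
  "mob g x = PT (g (rp x))"

lemma mob_PT:
  assumes "linv g" "X \<noteq> 0"
  shows "mob g (PT X) = PT (g X)"
proof -
  obtain t where "t \<noteq> 0" "rp (PT X) = sc t X" using rp_PTE assms(2) by blast
  then show ?thesis
    unfolding mob_def using PT_sc [OF _ linv_nonzero [OF assms]] by (simp add: linv_sc [OF assms(1)])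
qed

text \<open>The forms are valid on the whole product, so the constant \<open>1\<close> serves as
  \<open>H\<close> at every point.\<close>

lemma morphism_of_forms:
  assumes "\<phi> ` C \<subseteq> D"
    and "bihomogeneous k l A0" "bihomogeneous k l A1" "bihomogeneous m n B0" "bihomogeneous m n B1"
    and "\<And>X Y. X \<noteq> 0 \<Longrightarrow> Y \<noteq> 0 \<Longrightarrow> (ev A0 X Y, ev A1 X Y) \<noteq> 0 \<and> (ev B0 X Y, ev B1 X Y) \<noteq> 0 \<and>
      \<phi> (PT X, PT Y) = (PT (ev A0 X Y, ev A1 X Y), PT (ev B0 X Y, ev B1 X Y))"
  shows "morphism C D \<phi>"
  unfolding morphism_def
proof (intro conjI ballI assms(1))
  fix z assume "z \<in> C"
  have 1: "bihomogeneous 0 0 (\<lambda>X0 X1 Y0 Y1. 1)" by (rule bihom_const)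
  have 2: "z \<notin> zero_locus (\<lambda>X0 X1 Y0 Y1. 1)" by (simp add: zero_locus_def)
  have 3: "(A0 X0 X1 Y0 Y1, A1 X0 X1 Y0 Y1) \<noteq> (0, 0) \<and>
           (B0 X0 X1 Y0 Y1, B1 X0 X1 Y0 Y1) \<noteq> (0, 0) \<and>
           \<phi> (pt X0 X1, pt Y0 Y1) =
             (pt (A0 X0 X1 Y0 Y1) (A1 X0 X1 Y0 Y1), pt (B0 X0 X1 Y0 Y1) (B1 X0 X1 Y0 Y1))"
    if "(X0, X1) \<noteq> (0, 0)" "(Y0, Y1) \<noteq> (0, 0)" for X0 X1 Y0 Y1
    using assms(6) [of "(X0, X1)" "(Y0, Y1)"] that by (simp add: ev_def PT_def zero_prod_def)
  show "\<exists>H h h' k l m n A0 A1 B0 B1.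
        bihomogeneous h h' H \<and> z \<notin> zero_locus H \<and>
        bihomogeneous k l A0 \<and> bihomogeneous k l A1 \<and>
        bihomogeneous m n B0 \<and> bihomogeneous m n B1 \<and>
        (\<forall>X0 X1 Y0 Y1. (X0, X1) \<noteq> (0, 0) \<longrightarrow> (Y0, Y1) \<noteq> (0, 0) \<longrightarrow>
           (pt X0 X1, pt Y0 Y1) \<in> C - zero_locus H \<longrightarrow>
           (A0 X0 X1 Y0 Y1, A1 X0 X1 Y0 Y1) \<noteq> (0, 0) \<and>
           (B0 X0 X1 Y0 Y1, B1 X0 X1 Y0 Y1) \<noteq> (0, 0) \<and>
           \<phi> (pt X0 X1, pt Y0 Y1) =
             (pt (A0 X0 X1 Y0 Y1) (A1 X0 X1 Y0 Y1), pt (B0 X0 X1 Y0 Y1) (B1 X0 X1 Y0 Y1)))"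
    by (rule exI [of _ "\<lambda>X0 X1 Y0 Y1. 1"], rule exI [of _ 0], rule exI [of _ 0], rule exI [of _ k],
        rule exI [of _ l], rule exI [of _ m], rule exI [of _ n], rule exI [of _ A0], rule exI [of _ A1],
        rule exI [of _ B0], rule exI [of _ B1]) (use 1 2 3 assms(2-5) in simp)
qed

lemma linv_forms:
  assumes "linv g"
  obtains A0 A1 where "bihomogeneous 1 0 A0" "bihomogeneous 1 0 A1" "\<And>X Y. (ev A0 X Y, ev A1 X Y) = g X"
proof -
  obtain p q r s where g: "g = (\<lambda>X. (p * fst X + q * snd X, r * fst X + s * snd X))"
    using linv_form [OF assms] .
  have *: "bihomogeneous 1 0 (\<lambda>X0 X1 Y0 Y1. p * X0 + q * X1)" for p q
    using bihom_mult_linX [OF bihom_const [of 1], of p q] by simp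
  show ?thesis by (rule that [OF * [of p q] * [of r s]]) (simp add: g ev_def)
qed

lemma morphism_linear:
  assumes "linv g" "linv h"
  shows "(\<lambda>p. (mob g (fst p), mob h (snd p))) ` C \<subseteq> D \<Longrightarrow> morphism C D (\<lambda>p. (mob g (fst p), mob h (snd p)))"
    and "(\<lambda>p. (mob h (snd p), mob g (fst p))) ` C \<subseteq> D \<Longrightarrow> morphism C D (\<lambda>p. (mob h (snd p), mob g (fst p)))"
proof -
  obtain A0 A1 where A: "bihomogeneous 1 0 A0" "bihomogeneous 1 0 A1" "\<And>X Y. (ev A0 X Y, ev A1 X Y) = g X" by (rule linv_forms [OF assms(1)]) (rule that)
  obtain B0 B1 where B: "bihomogeneous 1 0 B0" "bihomogeneous 1 0 B1" "\<And>X Y. (ev B0 X Y, ev B1 X Y) = h X" by (rule linv_forms [OF assms(2)]) (rule that)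
  note B' = bihom_swF [OF B(1)] bihom_swF [OF B(2)]
  show "(\<lambda>p. (mob g (fst p), mob h (snd p))) ` C \<subseteq> D \<Longrightarrow> morphism C D (\<lambda>p. (mob g (fst p), mob h (snd p)))"
    by (erule morphism_of_forms [OF _ A(1,2) B'])
      (simp add: A B mob_PT linv_nonzero assms)
  show "(\<lambda>p. (mob h (snd p), mob g (fst p))) ` C \<subseteq> D \<Longrightarrow> morphism C D (\<lambda>p. (mob h (snd p), mob g (fst p)))"
    by (erule morphism_of_forms [OF _ B' A(1,2)])
      (simp add: A B mob_PT linv_nonzero assms)
qed

lemma isomorphicI:
  assumes "morphism C D \<phi>" "morphism D C \<psi>" "\<And>p. p \<in> C \<Longrightarrow> \<psi> (\<phi> p) = p" "\<And>q. q \<in> D \<Longrightarrow> \<phi> (\<psi> q) = q"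
  shows "isomorphic C D"
proof -
  have im: "\<phi> ` C \<subseteq> D" "\<psi> ` D \<subseteq> C" using assms(1,2) by (simp_all add: morphism_def)
  have bij: "bij_betw \<phi> C D"
    using assms(3,4) im by (intro bij_betw_byWitness [of _ \<psi>]) auto
  have inv: "inv_into C \<phi> q = \<psi> q" if "q \<in> D" for q
    using bij im assms(4) that by (intro inv_into_f_eq) (auto simp: bij_betw_def)
  have "morphism D C (inv_into C \<phi>)"
    using assms(2) im inv unfolding morphism_def by (simp add: image_subset_iff)
  then show ?thesis unfolding isomorphic_def isomorphism_def using bij assms(1) by blast
qed

lemma mob_inverse:
  assumes "linv g" "linv g'" "\<And>X. g (g' X) = X"
  shows "mob g (mob g' x) = x"
  using mob_PT [OF assms(1) linv_nonzero [OF assms(2) rp(1)]] by (simp add: mob_def [of g'] assms(3) rp)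

text \<open>Independent coordinate changes in the two factors together with a scalar. The scalar and
  one diagonal ratio in each factor are the three scalings that normalize coefficients
  later.\<close>

definition lequiv :: "form \<Rightarrow> form \<Rightarrow> bool" where
  "lequiv F E \<longleftrightarrow> (\<exists>c g h. c \<noteq> 0 \<and> linv g \<and> linv h \<and> (\<forall>X Y. ev E X Y = c * ev F (g X) (h Y)))"

lemma lequiv_trans:
  assumes "lequiv F G" "lequiv G E"
  shows "lequiv F E"
proof -
  obtain c g h where 1: "c \<noteq> 0" "linv g" "linv h" "\<And>X Y. ev G X Y = c * ev F (g X) (h Y)"
    using assms(1) unfolding lequiv_def by blast
  obtain c' g' h' where 2: "c' \<noteq> 0" "linv g'" "linv h'" "\<And>X Y. ev E X Y = c' * ev G (g' X) (h' Y)"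
    using assms(2) unfolding lequiv_def by blast
  show ?thesis unfolding lequiv_def
    by (intro exI [of _ "c' * c"] exI [of _ "\<lambda>X. g (g' X)"] exI [of _ "\<lambda>X. h (h' X)"])
      (simp add: 1 2 linv_comp)
qed

lemma lequiv_swF: "lequiv F E \<Longrightarrow> lequiv (swF F) (swF E)"
  unfolding lequiv_def by (simp, metis)

lemma lin_linv: "linv g \<Longrightarrow> lin (g X) (g d) x = g (lin X d x)"
  unfolding linv_def by (auto simp: lin_def algebra_simps)

lemma dt_linv:
  assumes "linv g"
  shows "dt (g X) (g Y) = 0 \<longleftrightarrow> dt X Y = 0"
proof -
  obtain p q r s where g: "p * s - q * r \<noteq> 0" "g = (\<lambda>X. (p * fst X + q * snd X, r * fst X + s * snd X))"
    using assms unfolding linv_def by blast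
  have "dt (g X) (g Y) = (p * s - q * r) * dt X Y"
    by (simp add: g(2) dt_def algebra_simps)
  then show ?thesis using g(1) by simp
qed

lemma bihom_lequiv:
  assumes "bihomogeneous a b F" "lequiv F E"
  shows "bihomogeneous a b E"
proof -
  obtain c g h where 1: "c \<noteq> 0" "linv g" "linv h" "\<And>X Y. ev E X Y = c * ev F (g X) (h Y)"
    using assms(2) unfolding lequiv_def by blast
  have "E = (\<lambda>X0 X1 Y0 Y1. c * pullback F g h X0 X1 Y0 Y1)"
    using 1(4) [of "(x, y)" "(z, w)" for x y z w] by (simp add: fun_eq_iff pullback_def ev_def)
  then show ?thesis using bihom_cmult [OF bihom_pullback [OF assms(1) 1(2,3)]] by simp
qed

lemma smf_lequiv:
  assumes bih: "bihomogeneous a b F" and "smf F" "lequiv F E"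
  shows "smf E"
proof -
  obtain c g h where 1: "c \<noteq> 0" "linv g" "linv h" "\<And>X Y. ev E X Y = c * ev F (g X) (h Y)"
    using assms(3) unfolding lequiv_def by blast
  have "((\<lambda>x. ev E (lin X d x) Y) has_field_derivative c * dX F (g X) (h Y) (g d)) (at 0)" for X Y d
    unfolding 1(4) lin_linv [OF 1(2), symmetric] by (rule DERIV_cmult [OF dX_linear(1) [OF bih]])
  then have X: "dX E X Y d = c * dX F (g X) (h Y) (g d)" for X Y d
    unfolding dX_def [of E] by (rule DERIV_imp_deriv)
  have "((\<lambda>y. ev E X (lin Y m y)) has_field_derivative c * dY F (g X) (h Y) (h m)) (at 0)" for X Y m
    unfolding 1(4) lin_linv [OF 1(3), symmetric] by (rule DERIV_cmult [OF dY_linear(1) [OF bih]])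
  then have Y: "dY E X Y m = c * dY F (g X) (h Y) (h m)" for X Y m
    unfolding dY_def [of E] by (rule DERIV_imp_deriv)
  show ?thesis unfolding smf_def
  proof (intro allI impI)
    fix X Y d m :: cvec
    assume "X \<noteq> 0" "Y \<noteq> 0" "ev E X Y = 0" "dt X d \<noteq> 0" "dt Y m \<noteq> 0"
    then show "dX E X Y d \<noteq> 0 \<or> dY E X Y m \<noteq> 0"
      using assms(2) [unfolded smf_def, rule_format, of "g X" "h Y" "g d" "h m"] 1
      by (simp add: X Y linv_nonzero dt_linv)
  qed
qed

lemma smooth_form_lequiv: "smooth_form a b F \<Longrightarrow> lequiv F E \<Longrightarrow> smooth_form a b E"
  using bihom_lequiv smf_lequiv unfolding smooth_form_iff by blast

lemma zero_locus_linear: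
  assumes "bihomogeneous a b F" "bihomogeneous a b E" "c \<noteq> 0" "linv g" "linv h"
    "\<And>X Y. ev E X Y = c * ev F (g X) (h Y)" "p \<in> zero_locus E"
  shows "(mob g (fst p), mob h (snd p)) \<in> zero_locus F"
  using assms(3,6) zero_locus_iff [OF assms(2) rp(1) rp(1), of "fst p" "snd p"]
    zero_locus_iff [OF assms(1) linv_nonzero [OF assms(4) rp(1)] linv_nonzero [OF assms(5) rp(1)], of "fst p" "snd p"] assms(7)
  by (simp add: mob_def rp)

text \<open>The second part composes with the exchange of the factors. For \<open>a = b\<close> a
  normal form may be reached only after that exchange.\<close>

lemma isomorphic_lequiv:
  assumes bih: "bihomogeneous a b F" and "lequiv F E"
  shows "isomorphic (zero_locus F) (zero_locus E)"
    and "isomorphic (zero_locus (swF F)) (zero_locus E)"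
proof -
  obtain c g h where 1: "c \<noteq> 0" "linv g" "linv h" "\<And>X Y. ev E X Y = c * ev F (g X) (h Y)"
    using assms(2) unfolding lequiv_def by blast
  obtain g' where g': "linv g'" "\<And>X. g (g' X) = X" "\<And>X. g' (g X) = X" by (rule linv_inverse [OF 1(2)]) (rule that)
  obtain h' where h': "linv h'" "\<And>X. h (h' X) = X" "\<And>X. h' (h X) = X" by (rule linv_inverse [OF 1(3)]) (rule that)
  have 2: "1 / c \<noteq> 0" "ev F X Y = 1 / c * ev E (g' X) (h' Y)" for X Y
    using 1 by (simp_all add: g' h')
  note bihE = bihom_lequiv [OF assms]
  note z1 = zero_locus_linear [OF bih bihE 1] and z2 = zero_locus_linear [OF bihE bih 2(1) g'(1) h'(1) 2(2)]
  note m = mob_inverse [OF 1(2) g'(1,2)] mob_inverse [OF g'(1) 1(2) g'(3)]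
    mob_inverse [OF 1(3) h'(1,2)] mob_inverse [OF h'(1) 1(3) h'(3)]
  show "isomorphic (zero_locus F) (zero_locus E)"
    by (rule isomorphicI [OF morphism_linear(1) [OF g'(1) h'(1)] morphism_linear(1) [OF 1(2,3)]])
      (use z1 z2 m in auto)
  have z1': "(mob h (snd p), mob g (fst p)) \<in> zero_locus (swF F)" if "p \<in> zero_locus E" for p
    using z1 [OF that] by (simp add: zero_locus_swF)
  have z2': "(mob g' (snd p), mob h' (fst p)) \<in> zero_locus E" if "p \<in> zero_locus (swF F)" for p
    using z2 [of "prod.swap p"] that by (simp add: zero_locus_swF)
  show "isomorphic (zero_locus (swF F)) (zero_locus E)"
    by (rule isomorphicI [OF morphism_linear(2) [OF h'(1) g'(1)] morphism_linear(2) [OF 1(2,3)]])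
      (use z1' z2' m in auto)
qed

section \<open>Automorphisms of finite order\<close>

lemma BijGroup_simps:
  "carrier (BijGroup C) = Bij C" "\<one>\<^bsub>BijGroup C\<^esub> = (\<lambda>x\<in>C. x)"
  "f \<in> Bij C \<Longrightarrow> g \<in> Bij C \<Longrightarrow> f \<otimes>\<^bsub>BijGroup C\<^esub> g = compose C f g"
  by (simp_all add: BijGroup_def)

text \<open>Powers in \<open>BijGroup C\<close> agree with iterates on \<open>C\<close> and are
  extensional, so a power is the unit as soon as it fixes every point of \<open>C\<close>.\<close>

lemma automorphismsD:
  assumes "f \<in> automorphisms C"
  shows "bij_betw f C C" "morphism C C f"
    and "(\<forall>p\<in>C. (f ^^ k) p = p) \<longleftrightarrow> aut_order C f dvd k"
proof -
  have f: "f \<in> Bij C" "morphism C C f"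
    using assms by (simp_all add: automorphisms_def isomorphism_def)
  then show "bij_betw f C C" "morphism C C f" by (simp_all add: Bij_def)
  interpret group "BijGroup C" by (rule group_BijGroup)
  have car: "f \<in> carrier (BijGroup C)" using f(1) by (simp only: BijGroup_simps)
  have B: "f [^]\<^bsub>BijGroup C\<^esub> n \<in> Bij C" for n :: nat
    using nat_pow_closed [OF car, of n] by (simp only: BijGroup_simps)
  have pow: "(f [^]\<^bsub>BijGroup C\<^esub> n) p = (f ^^ n) p" if "p \<in> C" for n :: nat and p
    using that
  proof (induction n arbitrary: p)
    case 0
    then show ?case by (simp add: BijGroup_simps)
  next
    case (Suc n)
    have "f p \<in> C" using f(1) Suc.prems by (auto simp: Bij_def bij_betw_def)
    then have "(f [^]\<^bsub>BijGroup C\<^esub> n) (f p) = (f ^^ n) (f p)" by (rule Suc.IH)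
    moreover have "(f [^]\<^bsub>BijGroup C\<^esub> Suc n) p = (f [^]\<^bsub>BijGroup C\<^esub> n) (f p)"
      using Suc.prems f(1) B [of n] by (simp add: BijGroup_simps compose_def)
    ultimately show ?case by (simp add: funpow_swap1)
  qed
  have "f [^]\<^bsub>BijGroup C\<^esub> k = \<one>\<^bsub>BijGroup C\<^esub> \<longleftrightarrow> (\<forall>p\<in>C. (f ^^ k) p = p)"
  proof
    assume "f [^]\<^bsub>BijGroup C\<^esub> k = \<one>\<^bsub>BijGroup C\<^esub>"
    then show "\<forall>p\<in>C. (f ^^ k) p = p" using pow [of _ k] by (auto simp: BijGroup_simps)
  next
    assume *: "\<forall>p\<in>C. (f ^^ k) p = p"
    show "f [^]\<^bsub>BijGroup C\<^esub> k = \<one>\<^bsub>BijGroup C\<^esub>"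
    proof (rule extensionalityI)
      show "f [^]\<^bsub>BijGroup C\<^esub> k \<in> extensional C" using B [of k] by (rule Bij_imp_extensional)
    qed (use * pow [of _ k] in \<open>auto simp: BijGroup_simps\<close>)
  qed
  then show "(\<forall>p\<in>C. (f ^^ k) p = p) \<longleftrightarrow> aut_order C f dvd k"
    using pow_eq_id [OF car, of k] by (simp add: aut_order_def)
qed

section \<open>Diagonalization of linear maps of finite order\<close>

definition bas :: "cvec \<Rightarrow> cvec \<Rightarrow> cvec \<Rightarrow> cvec" where
  "bas v w X = sc (fst X) v + sc (snd X) w"

definition dg :: "complex \<Rightarrow> complex \<Rightarrow> cvec \<Rightarrow> cvec" where
  "dg \<alpha> \<beta> X = (\<alpha> * fst X, \<beta> * snd X)"

lemma linv_bas:
  assumes "dt v w \<noteq> 0"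
  shows "linv (bas v w)"
  by (rule linvI [of "fst v" "snd w" "fst w" "snd v"])
    (use assms in \<open>simp_all add: bas_def sc_def dt_def mult.commute\<close>)

lemma linv_dg: "\<alpha> \<noteq> 0 \<Longrightarrow> \<beta> \<noteq> 0 \<Longrightarrow> linv (dg \<alpha> \<beta>)"
  by (rule linvI [of \<alpha> \<beta> 0 0]) (simp_all add: dg_def)

lemma linv_add: "linv g \<Longrightarrow> g (X + Y) = g X + g Y"
  unfolding linv_def by (auto simp: algebra_simps)

lemma linv_bas_apply:
  assumes "linv g"
  shows "g (bas v w X) = bas (g v) (g w) X"
  by (simp add: bas_def linv_add [OF assms] linv_sc [OF assms])

lemma linv_funpow: "linv g \<Longrightarrow> linv (g ^^ n)"
proof (induction n)
  case 0
  show ?case by (rule linvI [of 1 1 0 0]) simp_all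
next
  case (Suc n)
  then show ?case using linv_comp [OF Suc.prems Suc.IH] by (simp add: o_def)
qed

text \<open>Eigenvectors are the zeros of the binary quadratic form \<open>dt X (g X)\<close>, so
  one exists over the complex numbers.\<close>

lemma linv_eigenvector:
  assumes "linv g"
  shows "\<exists>v \<alpha>. v \<noteq> 0 \<and> \<alpha> \<noteq> 0 \<and> g v = sc \<alpha> v"
proof -
  obtain p q r s where g: "g = (\<lambda>X. (p * fst X + q * snd X, r * fst X + s * snd X))"
    using assms unfolding linv_def by blast
  define k where "k j = (if j = 0 then r else if j = 1 then s - p else - q)" for j :: nat
  have "dt X (g X) = (\<Sum>j\<le>2. k j * fst X ^ (2 - j) * snd X ^ j)" for X
    by (simp add: g dt_def k_def numeral_2_eq_2 algebra_simps)
  then have "bform 2 (\<lambda>X. dt X (g X))" unfolding bform_def by blast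
  then obtain v where v: "v \<noteq> 0" "dt v (g v) = 0" by (rule bform_root) simp_all
  then obtain \<alpha> where \<alpha>: "g v = sc \<alpha> v" using dt_eq_0E by blast
  then have "\<alpha> \<noteq> 0" using linv_nonzero [OF assms v(1)] by auto
  then show ?thesis using v \<alpha> by blast
qed

text \<open>A Jordan block of size two has infinite order in \<open>PGL\<^sub>2\<close>.\<close>

lemma linv_diagonalizable:
  assumes g: "linv g" and "n > 0" and triv: "\<And>X. dt X ((g ^^ n) X) = 0"
  shows "\<exists>v w \<alpha> \<beta>. dt v w \<noteq> 0 \<and> \<alpha> \<noteq> 0 \<and> \<beta> \<noteq> 0 \<and> g v = sc \<alpha> v \<and> g w = sc \<beta> w"
proof -
  obtain v \<alpha> where v: "v \<noteq> 0" "\<alpha> \<noteq> 0" "g v = sc \<alpha> v" using linv_eigenvector [OF g] by blast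
  define u where "u = perp v"
  have vu: "dt v u \<noteq> 0" using dt_perp_nonzero [OF v(1)] by (simp add: u_def)
  obtain \<beta> \<gamma> where gu: "g u = sc \<gamma> v + sc \<beta> u" using basis_expand [OF vu] by blast
  have "dt (g v) (g u) = \<alpha> * \<beta> * dt v u"
    by (simp add: v(3) gu) (simp add: dt_def sc_def algebra_simps)
  then have \<beta>: "\<beta> \<noteq> 0" using dt_linv [OF g, of v u] vu by auto
  show ?thesis
  proof (cases "\<alpha> = \<beta>")
    case False
    \<comment> \<open>The shear that removes the off-diagonal entry: \<open>u + c v\<close> is an
      eigenvector for \<open>\<beta>\<close> exactly if
      \<open>\<gamma> + c * \<alpha> = c * \<beta>\<close>.\<close>
    define c where "c = \<gamma> / (\<beta> - \<alpha>)"
    have c: "\<gamma> + c * \<alpha> = c * \<beta>" using False by (simp add: c_def field_simps)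
    define w where "w = u + sc c v"
    have "g w = sc \<gamma> v + sc \<beta> u + sc c (sc \<alpha> v)"
      by (simp add: w_def linv_add [OF g] linv_sc [OF g] gu v(3))
    also have "\<dots> = sc (\<gamma> + c * \<alpha>) v + sc \<beta> u" by (simp add: sc_def algebra_simps prod_eq_iff)
    also have "\<dots> = sc \<beta> w" unfolding c by (simp add: w_def sc_def algebra_simps prod_eq_iff)
    finally have "g w = sc \<beta> w" .
    moreover have "dt v w \<noteq> 0" using vu by (simp add: w_def dt_def sc_def algebra_simps)
    ultimately show ?thesis using v \<beta> by blast
  next
    case True
    \<comment> \<open>Powers of a Jordan block. For \<open>m = n > 0\<close> the coefficient of
      \<open>v\<close> must vanish, which forces \<open>\<gamma> = 0\<close>.\<close>
    have pow: "(g ^^ m) u = sc (of_nat m * \<alpha> ^ m * \<gamma> / \<alpha>) v + sc (\<alpha> ^ m) u" for m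
    proof (induction m)
      case (Suc m)
      have "(g ^^ Suc m) u = sc (of_nat m * \<alpha> ^ m * \<gamma> / \<alpha>) (sc \<alpha> v) + sc (\<alpha> ^ m) (sc \<gamma> v + sc \<alpha> u)"
        by (simp add: Suc linv_add [OF g] linv_sc [OF g] v(3) gu True)
      then show ?case using v(2) by (simp add: sc_def prod_eq_iff field_simps)
    qed (simp add: sc_def prod_eq_iff)
    have "dt u ((g ^^ n) u) = of_nat n * \<alpha> ^ n * \<gamma> / \<alpha> * dt u v"
      unfolding pow by (simp add: dt_def sc_def algebra_simps)
    then have "\<gamma> = 0" using triv [of u] v(2) vu assms(2) dt_commute [of u v] by auto
    then have "g u = sc \<beta> u" by (simp add: gu sc_def)
    then show ?thesis using v \<beta> vu by blast
  qed
qed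

lemma bas_dg: "bas (sc \<alpha> v) (sc \<beta> w) X = bas v w (dg \<alpha> \<beta> X)"
  by (simp add: bas_def dg_def sc_def algebra_simps)

lemma diagonal_funpow:
  assumes "\<And>X. g (B X) = B (dg \<alpha> \<beta> X)"
  shows "(g ^^ k) (B X) = B (dg (\<alpha> ^ k) (\<beta> ^ k) X)"
proof (induction k)
  case (Suc k)
  then show ?case by (simp add: assms) (simp add: dg_def mult.assoc)
qed (simp add: dg_def)

lemma diagonal_trivial_iff:
  assumes "linv B" "\<And>X. g (B X) = B (dg \<alpha> \<beta> X)" "\<alpha> \<noteq> 0"
  shows "(\<forall>X. dt X ((g ^^ k) X) = 0) \<longleftrightarrow> (\<beta> / \<alpha>) ^ k = 1"
proof -
  obtain B' where B': "\<And>X. B (B' X) = X" by (rule linv_inverse [OF assms(1)]) (rule that)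
  have "(\<forall>X. dt X ((g ^^ k) X) = 0) \<longleftrightarrow> (\<forall>X. dt (B X) ((g ^^ k) (B X)) = 0)" using B' by metis
  also have "\<dots> \<longleftrightarrow> (\<forall>X. dt X (dg (\<alpha> ^ k) (\<beta> ^ k) X) = 0)"
    by (simp add: diagonal_funpow [of g B \<alpha> \<beta>, OF assms(2)] dt_linv [OF assms(1)])
  also have "\<dots> \<longleftrightarrow> \<alpha> ^ k = \<beta> ^ k"
  proof
    assume "\<forall>X. dt X (dg (\<alpha> ^ k) (\<beta> ^ k) X) = 0"
    \<comment> \<open>\<open>(1, 1)\<close> has both coordinates nonzero, so among diagonal maps
      only the scalar ones fix its point.\<close>
    from this [rule_format, of "(1, 1)"] show "\<alpha> ^ k = \<beta> ^ k" by (simp add: dt_def dg_def)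
  qed (simp add: dt_def dg_def)
  also have "\<dots> \<longleftrightarrow> (\<beta> / \<alpha>) ^ k = 1" using assms(3) by (auto simp: field_simps)
  finally show ?thesis .
qed

lemma bform_zero:
  assumes "bform b G" "b \<ge> 1" "A \<subseteq> zer G" "finite A \<longrightarrow> card A > b"
  shows "G m = 0"
proof (rule ccontr)
  assume "G m \<noteq> 0"
  note z = bform_zeros [OF assms(1) this assms(2)]
  then have "finite A" "card A \<le> b"
    using finite_subset [OF assms(3)] card_mono [OF z(1) assms(3)] by auto
  then show False using assms(4) by simp
qed

text \<open>A form vanishing on the curve and at one further point of an unramified column vanishes on
  that column, hence on almost all rows, hence everywhere.\<close>

lemma forms_proportional:
  assumes bih: "bihomogeneous a b F" and "smf F" "a \<ge> 2" "b \<ge> 2" and bihG: "bihomogeneous a b G"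
    and van: "\<And>X Y. X \<noteq> 0 \<Longrightarrow> Y \<noteq> 0 \<Longrightarrow> ev F X Y = 0 \<Longrightarrow> ev G X Y = 0"
  shows "\<exists>\<gamma>. \<forall>X Y. ev G X Y = \<gamma> * ev F X Y"
proof -
  have ab1: "a \<ge> 1" "b \<ge> 1" using assms by simp_all
  define e d :: cvec where "e = (1, 0)" and "d = (0, 1)"
  have ed: "dt e d \<noteq> 0" by (simp add: e_def d_def dt_def)
  note bih' = bihom_swF [OF bih] and smf' = smf_swF [OF assms(2)]
  obtain x0 where x0: "unram F (lin e d x0)"
    using ex_new_if_finite [OF infinite_UNIV_char_0 finite_ramified [OF bih assms(2,4) ed]] by auto
  define X0 where "X0 = lin e d x0"
  have X0: "X0 \<noteq> 0" "unram F X0" using x0 lin_nonzero [OF ed] by (auto simp: X0_def)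
  obtain Y0 where Y0: "Y0 \<noteq> 0" "ev F X0 Y0 \<noteq> 0"
    using column_not_contained [OF bih assms(2) ab1(2) X0(1)] by blast
  \<comment> \<open>Chosen so that \<open>H = G - \<gamma> F\<close> vanishes at
    \<open>(X0, Y0)\<close> as well. Together with the \<open>b\<close> points of the curve on this
    column it has \<open>b + 1\<close> zeros there, one too many for a form of degree
    \<open>b\<close> in \<open>Y\<close>.\<close>
  define \<gamma> where "\<gamma> = ev G X0 Y0 / ev F X0 Y0"
  define H where "H = (\<lambda>X0 X1 Y0 Y1. G X0 X1 Y0 Y1 + (- \<gamma>) * F X0 X1 Y0 Y1)"
  have evH: "ev H X Y = ev G X Y - \<gamma> * ev F X Y" for X Y by (simp add: H_def ev_def)
  have bihH: "bihomogeneous a b H"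
    unfolding H_def by (rule bihom_add [OF bihG bihom_cmult [OF bih]])
  have H0: "ev H X Y = 0" if "X \<noteq> 0" "Y \<noteq> 0" "ev F X Y = 0" for X Y
    using van [OF that] that(3) by (simp add: evH)
  have HX0: "ev H X0 m = 0" for m
  proof (rule bform_zero [OF bform_ev [OF bihH] ab1(2)])
    have "PT Y0 \<notin> col F X0" using col_iff [OF bih Y0(1)] Y0(2) by simp
    then show "finite (insert (PT Y0) (col F X0)) \<longrightarrow> b < card (insert (PT Y0) (col F X0))"
      using col_card [OF bih assms(2) ab1(2) X0(1)] X0(2) by simp
    have "ev H X0 Y0 = 0" using Y0 by (simp add: evH \<gamma>_def)
    then show "insert (PT Y0) (col F X0) \<subseteq> zer (ev H X0)"
      using zer_iff [OF bform_ev [OF bihH] Y0(1)] H0 [OF X0(1) rp(1)] by (auto simp: zer_def col_iff_rp)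
  qed
  have row: "ev H m Y = 0" if "Y \<noteq> 0" "unram (swF F) Y" "ev F X0 Y \<noteq> 0" for Y m
  proof -
    have "ev (swF H) Y m = 0"
    proof (rule bform_zero [OF bform_ev [OF bihom_swF [OF bihH]] ab1(1)])
      have "PT X0 \<notin> col (swF F) Y" using col_iff [OF bih' X0(1)] that(3) by simp
      then show "finite (insert (PT X0) (col (swF F) Y)) \<longrightarrow> a < card (insert (PT X0) (col (swF F) Y))"
        using col_card [OF bih' smf' ab1(1) that(1)] that(2) by simp
      show "insert (PT X0) (col (swF F) Y) \<subseteq> zer (ev (swF H) Y)"
        using zer_iff [OF bform_ev [OF bihom_swF [OF bihH]] X0(1)] H0 [OF rp(1) that(1)] HX0
        by (auto simp: zer_def col_iff_rp)
    qed
    then show ?thesis by simp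
  qed
  define S where "S = {y. \<not> unram (swF F) (lin e d y)} \<union> (\<lambda>y. PT (lin e d y)) -` col F X0"
  have "finite S" unfolding S_def
    using finite_ramified [OF bih' smf' assms(3) ed] col_card(1) [OF bih assms(2) ab1(2) X0(1)]
    by (intro finite_UnI finite_vimageI inj_PT_lin [OF ed]) auto
  then have inf: "infinite ((\<lambda>y. PT (lin e d y)) ` (- S))"
    using finite_imageD [OF _ inj_on_subset [OF inj_PT_lin [OF ed] subset_UNIV]]
    by (metis finite_compl infinite_UNIV_char_0)
  have "ev H X m = 0" for X m
  proof (rule bform_zero [OF bform_ev [OF bihH] ab1(2)])
    show "(\<lambda>y. PT (lin e d y)) ` (- S) \<subseteq> zer (ev H X)"
    proof clarify
      fix y assume "y \<notin> S"
      then have "ev H X (lin e d y) = 0"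
        using col_iff [OF bih lin_nonzero [OF ed]] by (intro row lin_nonzero ed) (auto simp: S_def)
      then show "PT (lin e d y) \<in> zer (ev H X)"
        using zer_iff [OF bform_ev [OF bihH] lin_nonzero [OF ed]] by simp
    qed
  qed (use inf in simp)
  then show ?thesis using evH by (intro exI [of _ \<gamma>]) simp
qed

section \<open>Coefficient arrays and divisibility of determinants\<close>

definition FA :: "nat \<Rightarrow> nat \<Rightarrow> (nat \<Rightarrow> nat \<Rightarrow> complex) \<Rightarrow> form" where
  "FA a b c = (\<lambda>X0 X1 Y0 Y1. \<Sum>i\<le>a. \<Sum>j\<le>b. c i j * X0 ^ (a - i) * X1 ^ i * Y0 ^ (b - j) * Y1 ^ j)"

definition supp :: "nat \<Rightarrow> nat \<Rightarrow> (nat \<Rightarrow> nat \<Rightarrow> complex) \<Rightarrow> (nat \<times> nat) set" where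
  "supp a b c = {(i, j). i \<le> a \<and> j \<le> b \<and> c i j \<noteq> 0}"

lemma bihom_FA: "bihomogeneous a b (FA a b c)"
  unfolding bihomogeneous_def FA_def by blast

lemma FA_eq_0:
  assumes "\<And>X Y. ev (FA a b c) X Y = 0" "i \<le> a" "j \<le> b"
  shows "c i j = 0"
proof -
  have "(\<Sum>i\<le>a. (\<Sum>j\<le>b. c i j * y ^ j) * x ^ i) = 0" for x y
    using assms(1) [of "(1, x)" "(1, y)"] by (simp add: ev_def FA_def sum_distrib_right sum_distrib_left mult_ac)
  then have "(\<Sum>j\<le>b. c i j * y ^ j) = 0" for y
    using polyfun_eq_0 [where n = a and c = "\<lambda>i. \<Sum>j\<le>b. c i j * y ^ j"] assms(2) by simp
  then show ?thesis using polyfun_eq_0 [where n = b and c = "c i"] assms(3) by simp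
qed

lemma FA_dg:
  "ev (FA a b c) (dg \<alpha> \<beta> X) (dg \<alpha>' \<beta>' Y) =
    ev (FA a b (\<lambda>i j. c i j * (\<alpha> ^ (a - i) * \<beta> ^ i * \<alpha>' ^ (b - j) * \<beta>' ^ j))) X Y"
  by (simp add: ev_def FA_def dg_def power_mult_distrib mult_ac)

text \<open>Monomials are eigenvectors of diagonal maps, and coefficients are unique; so all
  monomials that occur share the eigenvalue \<open>\<gamma>\<close>.\<close>

lemma FA_semi_invariant:
  assumes "\<And>X Y. ev (FA a b c) (dg \<alpha> \<beta> X) (dg \<alpha>' \<beta>' Y) = \<gamma> * ev (FA a b c) X Y" "(i, j) \<in> supp a b c"
  shows "\<alpha> ^ (a - i) * \<beta> ^ i * \<alpha>' ^ (b - j) * \<beta>' ^ j = \<gamma>"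
proof -
  have "ev (FA a b (\<lambda>i j. c i j * (\<alpha> ^ (a - i) * \<beta> ^ i * \<alpha>' ^ (b - j) * \<beta>' ^ j - \<gamma>))) X Y = 0" for X Y
  proof -
    have "ev (FA a b (\<lambda>i j. c i j * (\<alpha> ^ (a - i) * \<beta> ^ i * \<alpha>' ^ (b - j) * \<beta>' ^ j - \<gamma>))) X Y =
        ev (FA a b (\<lambda>i j. c i j * (\<alpha> ^ (a - i) * \<beta> ^ i * \<alpha>' ^ (b - j) * \<beta>' ^ j))) X Y - \<gamma> * ev (FA a b c) X Y"
      by (simp add: ev_def FA_def sum_distrib_left algebra_simps flip: sum_subtractf)
    then show ?thesis using assms(1) FA_dg by simp
  qed
  from FA_eq_0 [OF this, of i j] show ?thesis using assms(2) by (simp add: supp_def)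
qed

lemma FA_of_bihom:
  assumes "bihomogeneous a b F"
  shows "\<exists>c. F = FA a b c"
  using assms unfolding bihomogeneous_def FA_def fun_eq_iff by blast

lemma column_nonempty:
  assumes "bihomogeneous a b F" "b \<ge> 1"
  shows "\<exists>Y. Y \<noteq> 0 \<and> ev F X Y = 0"
  using bform_root [OF bform_ev [OF assms(1), of X] assms(2)] by blast

lemma PT_pair_eq_iff:
  assumes "X \<noteq> 0" "X' \<noteq> 0" "Y \<noteq> 0" "Y' \<noteq> 0"
  shows "(PT X', PT Y') = (PT X, PT Y) \<longleftrightarrow> dt X X' = 0 \<and> dt Y Y' = 0"
  unfolding prod.inject eq_commute [of "PT X'"] eq_commute [of "PT Y'"]
    PT_eq_iff [OF assms(1,2)] PT_eq_iff [OF assms(3,4)] by (rule refl)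

lemma dt_0_left [simp]: "dt 0 X = 0"
  by (simp add: dt_def)

lemma power_int_eq_1_iff:
  assumes "\<And>k. (\<rho> :: complex) ^ k = 1 \<and> \<sigma> ^ k = (1 :: complex) \<longleftrightarrow> (N :: nat) dvd k"
  shows "\<rho> powi D = 1 \<and> \<sigma> powi D = 1 \<longleftrightarrow> int N dvd D"
proof -
  have *: "x powi D = 1 \<longleftrightarrow> x ^ nat \<bar>D\<bar> = 1" for x :: complex
  proof (cases "D \<ge> 0")
    case False
    then have "x powi D = inverse (x ^ nat \<bar>D\<bar>)"
      using power_int_minus [of x "- D"] by (simp add: power_int_nonneg_exp)
    then show ?thesis by simp
  qed (simp add: power_int_nonneg_exp)
  show ?thesis unfolding * assms using dvd_abs_iff [of "int N" D] by (simp add: nat_abs_dvd_iff flip: int_dvd_int_iff)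
qed

text \<open>The two factors of each product come from difference vectors of exponents that occur. In
  this form the condition passes to reflected and transposed arrays, which the eigenvalues
  themselves would obscure.\<close>

definition dets :: "nat \<Rightarrow> nat \<Rightarrow> nat \<Rightarrow> (nat \<Rightarrow> nat \<Rightarrow> complex) \<Rightarrow> bool" where
  "dets N a b c \<longleftrightarrow> (\<forall>i j i' j' k l k' l'. (i, j) \<in> supp a b c \<longrightarrow> (i', j') \<in> supp a b c \<longrightarrow>
     (k, l) \<in> supp a b c \<longrightarrow> (k', l') \<in> supp a b c \<longrightarrow>
     int N dvd (int i - int i') * (int l - int l') - (int k - int k') * (int j - int j'))"

text \<open>Each difference \<open>(m, n)\<close> of exponents is a relation
  \<open>\<rho> powi m * \<sigma> powi n = 1\<close>. Eliminating \<open>\<sigma>\<close> or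
  \<open>\<rho>\<close> from two relations by Cramer's rule shows that both become \<open>1\<close>
  when raised to the determinant, which is therefore a multiple of the order \<open>N\<close> of the
  pair.\<close>

lemma dets_of_characters:
  assumes nz: "\<rho> \<noteq> 0" "\<sigma> \<noteq> 0" and order: "\<And>k. \<rho> ^ k = 1 \<and> \<sigma> ^ k = 1 \<longleftrightarrow> N dvd k"
    and const: "\<And>i j. (i, j) \<in> supp a b c \<Longrightarrow> \<rho> ^ i * \<sigma> ^ j = (\<gamma> :: complex)"
  shows "dets N a b c"
  unfolding dets_def
proof (intro allI impI)
  fix i j i' j' k l k' l'
  assume s: "(i, j) \<in> supp a b c" "(i', j') \<in> supp a b c" "(k, l) \<in> supp a b c" "(k', l') \<in> supp a b c"
  have rel: "\<rho> powi (int i - int i') * \<sigma> powi (int j - int j') = 1"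
    if "(i, j) \<in> supp a b c" "(i', j') \<in> supp a b c" for i j i' j'
  proof -
    have "\<rho> ^ i * \<sigma> ^ j = \<rho> ^ i' * \<sigma> ^ j'" using const that by simp
    then show ?thesis using nz by (simp add: power_int_diff field_simps)
  qed
  define m n p q where "m = int i - int i'" and "n = int j - int j'" and "p = int k - int k'" and "q = int l - int l'"
  have 1: "\<rho> powi m * \<sigma> powi n = 1" "\<rho> powi p * \<sigma> powi q = 1"
    using rel s by (simp_all add: m_def n_def p_def q_def)
  have "\<rho> powi (m * q - p * n) = (\<rho> powi m * \<sigma> powi n) powi q / (\<rho> powi p * \<sigma> powi q) powi n"
    using nz by (simp add: power_int_diff power_int_mult_distrib mult.commute [of q n] flip: power_int_mult)
  moreover have "\<sigma> powi (m * q - p * n) = (\<rho> powi p * \<sigma> powi q) powi m / (\<rho> powi m * \<sigma> powi n) powi p"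
    using nz by (simp add: power_int_diff power_int_mult_distrib mult.commute [of q m] mult.commute [of p n]
        mult.commute [of p m] flip: power_int_mult)
  ultimately have "\<rho> powi (m * q - p * n) = 1 \<and> \<sigma> powi (m * q - p * n) = 1" using 1 by simp
  then show "int N dvd (int i - int i') * (int l - int l') - (int k - int k') * (int j - int j')"
    unfolding power_int_eq_1_iff [OF order] by (simp add: m_def n_def p_def q_def)
qed

lemma pullback_array:
  assumes "bihomogeneous a b F" "linv B" "linv B'"
  shows "\<exists>c. FA a b c = pullback F B B' \<and> lequiv F (FA a b c)"
proof -
  obtain c where c: "pullback F B B' = FA a b c" using FA_of_bihom [OF bihom_pullback [OF assms]] by blast
  have "lequiv F (FA a b c)" unfolding lequiv_def
    by (rule exI [of _ 1], rule exI [of _ B], rule exI [of _ B']) (use assms in \<open>simp flip: c\<close>)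
  then show ?thesis using c by auto
qed

text \<open>Every column and every row meets the curve, so \<open>f ^^ k\<close> is trivial on the
  curve exactly if the \<open>k\<close>-th iterates of \<open>g\<close> and \<open>h\<close> are
  trivial on the line. This transfers the order \<open>N\<close> to the pair of eigenvalue ratios,
  while \<open>forms_proportional\<close> makes \<open>F\<close> semi-invariant.\<close>

lemma linear_automorphism_array:
  assumes bih: "bihomogeneous a b F" and "smf F" "a \<ge> 2" "b \<ge> 2" and gh: "linv g" "linv h"
    and act: "\<And>X Y. X \<noteq> 0 \<Longrightarrow> Y \<noteq> 0 \<Longrightarrow> ev F X Y = 0 \<Longrightarrow> f (PT X, PT Y) = (PT (g X), PT (h Y))"
    and maps: "f ` zero_locus F \<subseteq> zero_locus F"
    and order: "\<And>k. (\<forall>p\<in>zero_locus F. (f ^^ k) p = p) \<longleftrightarrow> N dvd k" and "N > 0"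
  shows "\<exists>c. lequiv F (FA a b c) \<and> dets N a b c"
proof -
  have ab1: "a \<ge> 1" "b \<ge> 1" using assms by simp_all
  have ev0: "ev F (g X) (h Y) = 0" if "X \<noteq> 0" "Y \<noteq> 0" "ev F X Y = 0" for X Y
  proof -
    have "(PT X, PT Y) \<in> zero_locus F" using zero_locus_iff [OF bih that(1,2)] that(3) by simp
    then have "(PT (g X), PT (h Y)) \<in> zero_locus F" using maps act [OF that] by force
    then show ?thesis
      using zero_locus_iff [OF bih linv_nonzero [OF gh(1) that(1)] linv_nonzero [OF gh(2) that(2)]] by simp
  qed
  have pow: "(f ^^ k) (PT X, PT Y) = (PT ((g ^^ k) X), PT ((h ^^ k) Y)) \<and> ev F ((g ^^ k) X) ((h ^^ k) Y) = 0"
    if "X \<noteq> 0" "Y \<noteq> 0" "ev F X Y = 0" for X Y k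
  proof (induction k)
    case (Suc k)
    note nz = linv_nonzero [OF linv_funpow [OF gh(1)] that(1)] linv_nonzero [OF linv_funpow [OF gh(2)] that(2)]
    show ?case using act [OF nz] ev0 [OF nz] Suc by simp
  qed (simp add: that)
  have triv: "(\<forall>X. dt X ((g ^^ k) X) = 0) \<and> (\<forall>Y. dt Y ((h ^^ k) Y) = 0) \<longleftrightarrow> N dvd k" for k
  proof -
    have *: "(f ^^ k) (PT X, PT Y) = (PT X, PT Y) \<longleftrightarrow> dt X ((g ^^ k) X) = 0 \<and> dt Y ((h ^^ k) Y) = 0"
      if "X \<noteq> 0" "Y \<noteq> 0" "ev F X Y = 0" for X Y
      unfolding conjunct1 [OF pow [OF that, of k]]
      by (intro PT_pair_eq_iff that linv_nonzero [OF linv_funpow] gh)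
    show ?thesis unfolding order [symmetric]
    proof
      assume "(\<forall>X. dt X ((g ^^ k) X) = 0) \<and> (\<forall>Y. dt Y ((h ^^ k) Y) = 0)"
      then show "\<forall>p\<in>zero_locus F. (f ^^ k) p = p" using * zero_locusE [OF bih] by metis
    next
      assume fk: "\<forall>p\<in>zero_locus F. (f ^^ k) p = p"
      have z: "dt X ((g ^^ k) X) = 0 \<and> dt Y ((h ^^ k) Y) = 0" if "X \<noteq> 0" "Y \<noteq> 0" "ev F X Y = 0" for X Y
        using * [OF that] fk zero_locus_iff [OF bih that(1,2)] that(3) by blast
      have "dt X ((g ^^ k) X) = 0" for X
        using column_nonempty [OF bih ab1(2), of X] z by (metis dt_0_left)
      moreover have "dt Y ((h ^^ k) Y) = 0" for Y
        using column_nonempty [OF bihom_swF [OF bih] ab1(1), of Y] z by (metis dt_0_left ev_swF)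
      ultimately show "(\<forall>X. dt X ((g ^^ k) X) = 0) \<and> (\<forall>Y. dt Y ((h ^^ k) Y) = 0)" by blast
    qed
  qed
  have trivN: "\<And>X. dt X ((g ^^ N) X) = 0" "\<And>Y. dt Y ((h ^^ N) Y) = 0" using triv [of N] by auto
  obtain v w \<alpha> \<beta> where g: "dt v w \<noteq> 0" "\<alpha> \<noteq> 0" "\<beta> \<noteq> 0" "g v = sc \<alpha> v" "g w = sc \<beta> w"
    using linv_diagonalizable [OF gh(1) assms(10) trivN(1)] by blast
  obtain v' w' \<alpha>' \<beta>' where h: "dt v' w' \<noteq> 0" "\<alpha>' \<noteq> 0" "\<beta>' \<noteq> 0" "h v' = sc \<alpha>' v'" "h w' = sc \<beta>' w'"
    using linv_diagonalizable [OF gh(2) assms(10) trivN(2)] by blast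
  note B = linv_bas [OF g(1)] linv_bas [OF h(1)]
  have gB: "g (bas v w X) = bas v w (dg \<alpha> \<beta> X)" "h (bas v' w' X) = bas v' w' (dg \<alpha>' \<beta>' X)" for X
    by (simp_all add: linv_bas_apply gh g h bas_dg)
  obtain c where c: "FA a b c = pullback F (bas v w) (bas v' w')" "lequiv F (FA a b c)"
    using pullback_array [OF bih B] by blast
  have "\<exists>\<gamma>. \<forall>X Y. ev (pullback F g h) X Y = \<gamma> * ev F X Y"
    by (rule forms_proportional [OF bih assms(2-4) bihom_pullback [OF bih gh]]) (use ev0 in simp)
  then obtain \<gamma> where "\<forall>X Y. ev (pullback F g h) X Y = \<gamma> * ev F X Y" by blast
  then have \<gamma>: "ev F (g X) (h Y) = \<gamma> * ev F X Y" for X Y by simp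
  have inv: "ev (FA a b c) (dg \<alpha> \<beta> X) (dg \<alpha>' \<beta>' Y) = \<gamma> * ev (FA a b c) X Y" for X Y
    by (simp add: c(1) \<gamma> flip: gB)
  have "dets N a b c"
  proof (rule dets_of_characters [of "\<beta> / \<alpha>" "\<beta>' / \<alpha>'" N a b c "\<gamma> / (\<alpha> ^ a * \<alpha>' ^ b)"])
    show "(\<beta> / \<alpha>) ^ k = 1 \<and> (\<beta>' / \<alpha>') ^ k = 1 \<longleftrightarrow> N dvd k" for k
      using triv [of k] diagonal_trivial_iff [OF B(1) gB(1) g(2), of k] diagonal_trivial_iff [OF B(2) gB(2) h(2), of k]
      by simp
    show "(\<beta> / \<alpha>) ^ i * (\<beta>' / \<alpha>') ^ j = \<gamma> / (\<alpha> ^ a * \<alpha>' ^ b)" if s: "(i, j) \<in> supp a b c" for i j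
    proof -
      have "i \<le> a" "j \<le> b" using s by (simp_all add: supp_def)
      then have "\<alpha> ^ a = \<alpha> ^ (a - i) * \<alpha> ^ i" "\<alpha>' ^ b = \<alpha>' ^ (b - j) * \<alpha>' ^ j" by (simp_all flip: power_add)
      then show ?thesis using FA_semi_invariant [OF inv s] g(2) h(2) by (simp add: power_divide field_simps)
    qed
  qed (use g h in simp_all)
  then show ?thesis using c(2) by blast
qed

text \<open>The square of \<open>f\<close> acts by \<open>u = g h\<close> and
  \<open>u' = h g\<close>, which are conjugate by \<open>h\<close>. In an eigenbasis of
  \<open>u\<close> and its image under \<open>h\<close> both have the same diagonal form, so a
  single ratio \<open>\<rho>\<close> is left, and \<open>\<rho> ^ (i + j)\<close> is constant on the
  support. As \<open>\<rho> ^ k = 1\<close> means that \<open>f ^^ (2 * k)\<close> is trivial,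
  \<open>N\<close> divides twice the differences of these sums.\<close>

lemma swapping_automorphism_array:
  assumes bih: "bihomogeneous a a F" and "smf F" "a \<ge> 2" and gh: "linv g" "linv h"
    and act: "\<And>X Y. X \<noteq> 0 \<Longrightarrow> Y \<noteq> 0 \<Longrightarrow> ev F X Y = 0 \<Longrightarrow> f (PT X, PT Y) = (PT (g Y), PT (h X))"
    and maps: "f ` zero_locus F \<subseteq> zero_locus F"
    and order: "\<And>k. (\<forall>p\<in>zero_locus F. (f ^^ k) p = p) \<longleftrightarrow> N dvd k" and "N > 0"
  shows "\<exists>c. lequiv F (FA a a c) \<and> (\<forall>i j i' j'. (i, j) \<in> supp a a c \<longrightarrow> (i', j') \<in> supp a a c \<longrightarrow>
    int N dvd 2 * ((int i + int j) - (int i' + int j')))"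
proof -
  have a1: "a \<ge> 1" using assms by simp
  have ev0: "ev F (g Y) (h X) = 0" if "X \<noteq> 0" "Y \<noteq> 0" "ev F X Y = 0" for X Y
  proof -
    have "(PT X, PT Y) \<in> zero_locus F" using zero_locus_iff [OF bih that(1,2)] that(3) by simp
    then have "(PT (g Y), PT (h X)) \<in> zero_locus F" using maps act [OF that] by force
    then show ?thesis
      using zero_locus_iff [OF bih linv_nonzero [OF gh(1) that(2)] linv_nonzero [OF gh(2) that(1)]] by simp
  qed
  define u where "u = (\<lambda>X. g (h X))"
  define u' where "u' = (\<lambda>X. h (g X))"
  have uv: "linv u" "linv u'" using linv_comp gh by (auto simp: u_def u'_def)
  have pow: "(f ^^ (2 * k)) (PT X, PT Y) = (PT ((u ^^ k) X), PT ((u' ^^ k) Y)) \<and> ev F ((u ^^ k) X) ((u' ^^ k) Y) = 0"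
    if "X \<noteq> 0" "Y \<noteq> 0" "ev F X Y = 0" for X Y k
  proof (induction k)
    case (Suc k)
    note nz = linv_nonzero [OF linv_funpow [OF uv(1)] that(1), of k] linv_nonzero [OF linv_funpow [OF uv(2)] that(2), of k]
    have z: "ev F ((u ^^ k) X) ((u' ^^ k) Y) = 0" using Suc by simp
    note nz' = linv_nonzero [OF gh(1) nz(2)] linv_nonzero [OF gh(2) nz(1)]
    show ?case using act [OF nz z] ev0 [OF nz z] act [OF nz'] ev0 [OF nz'] Suc by (simp add: u_def u'_def)
  qed (simp add: that)
  have triv: "(\<forall>X. dt X ((u ^^ k) X) = 0) \<longleftrightarrow> N dvd 2 * k" for k
  proof -
    have *: "(f ^^ (2 * k)) (PT X, PT Y) = (PT X, PT Y) \<longleftrightarrow> dt X ((u ^^ k) X) = 0 \<and> dt Y ((u' ^^ k) Y) = 0"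
      if "X \<noteq> 0" "Y \<noteq> 0" "ev F X Y = 0" for X Y
      unfolding conjunct1 [OF pow [OF that, of k]]
      by (intro PT_pair_eq_iff that linv_nonzero [OF linv_funpow] uv)
    show ?thesis unfolding order [symmetric]
    proof
      assume t: "\<forall>X. dt X ((u ^^ k) X) = 0"
      have u'g: "(u' ^^ k) (h X) = h ((u ^^ k) X)" for X
        by (induction k) (simp_all add: u_def u'_def)
      obtain h' where h': "linv h'" "\<And>X. h (h' X) = X" "\<And>X. h' (h X) = X"
        by (rule linv_inverse [OF gh(2)]) (rule that)
      have "dt Y ((u' ^^ k) Y) = 0" for Y
        using u'g [of "h' Y"] dt_linv [OF gh(2), of "h' Y" "(u ^^ k) (h' Y)"] t by (simp add: h')
      then show "\<forall>p\<in>zero_locus F. (f ^^ (2 * k)) p = p" using t * zero_locusE [OF bih] by metis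
    next
      assume fk: "\<forall>p\<in>zero_locus F. (f ^^ (2 * k)) p = p"
      have z: "dt X ((u ^^ k) X) = 0" if "X \<noteq> 0" "Y \<noteq> 0" "ev F X Y = 0" for X Y
        using * [OF that] fk zero_locus_iff [OF bih that(1,2)] that(3) by blast
      show "\<forall>X. dt X ((u ^^ k) X) = 0"
      proof
        show "dt X ((u ^^ k) X) = 0" for X
          using column_nonempty [OF bih a1, of X] z by (metis dt_0_left)
      qed
    qed
  qed
  have trivN: "\<And>X. dt X ((u ^^ N) X) = 0" using triv [of N] by auto
  obtain v w \<alpha> \<beta> where e: "dt v w \<noteq> 0" "\<alpha> \<noteq> 0" "\<beta> \<noteq> 0" "u v = sc \<alpha> v" "u w = sc \<beta> w"
    using linv_diagonalizable [OF uv(1) assms(9) trivN] by blast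
  define v' w' where "v' = h v" and "w' = h w"
  have B: "linv (bas v w)" "linv (bas v' w')"
    using linv_bas [of v w] linv_bas [of v' w'] e(1) dt_linv [OF gh(2), of v w] by (simp_all add: v'_def w'_def)
  have hB: "h (bas v w X) = bas v' w' X" for X by (simp add: linv_bas_apply gh v'_def w'_def)
  have gB: "g (bas v' w' X) = bas v w (dg \<alpha> \<beta> X)" for X
    using e(4,5) by (simp add: linv_bas_apply gh v'_def w'_def u_def bas_dg)
  have uB: "u (bas v w X) = bas v w (dg \<alpha> \<beta> X)" for X by (simp add: u_def hB gB)
  obtain c where c: "FA a a c = pullback F (bas v w) (bas v' w')" "lequiv F (FA a a c)"
    using pullback_array [OF bih B] by blast
  have "\<exists>\<gamma>. \<forall>X Y. ev (swF (pullback F g h)) X Y = \<gamma> * ev F X Y"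
    by (rule forms_proportional [OF bih assms(2,3,3) bihom_swF [OF bihom_pullback [OF bih gh]]]) (use ev0 in simp)
  then obtain \<gamma> where "\<forall>X Y. ev (swF (pullback F g h)) X Y = \<gamma> * ev F X Y" by blast
  then have \<gamma>: "ev F (g Y) (h X) = \<gamma> * ev F X Y" for X Y by simp
  \<comment> \<open>In these bases \<open>h\<close> is the identity and \<open>g\<close> is
    diagonal. Applying the relation twice restores the order of the arguments and gives
    semi-invariance under the square of \<open>f\<close>.\<close>
  have inv1: "ev (FA a a c) (dg \<alpha> \<beta> Y) X = \<gamma> * ev (FA a a c) X Y" for X Y
    by (simp add: c(1) \<gamma> flip: gB hB)
  have inv: "ev (FA a a c) (dg \<alpha> \<beta> X) (dg \<alpha> \<beta> Y) = \<gamma>\<^sup>2 * ev (FA a a c) X Y" for X Y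
    by (simp add: inv1 power2_eq_square)
  define \<rho> where "\<rho> = \<beta> / \<alpha>"
  have \<rho>0: "\<rho> \<noteq> 0" using e by (simp add: \<rho>_def)
  have ord: "\<rho> ^ k = 1 \<longleftrightarrow> N dvd 2 * k" for k
    using triv [of k] diagonal_trivial_iff [OF B(1) uB e(2), of k] by (simp add: \<rho>_def)
  have con: "\<rho> ^ (i + j) = \<gamma>\<^sup>2 / (\<alpha> ^ a * \<alpha> ^ a)" if s: "(i, j) \<in> supp a a c" for i j
  proof -
    have "i \<le> a" "j \<le> a" using s by (simp_all add: supp_def)
    then have "\<alpha> ^ a * \<alpha> ^ a = (\<alpha> ^ (a - i) * \<alpha> ^ i) * (\<alpha> ^ (a - j) * \<alpha> ^ j)" by (simp flip: power_add)
    then show ?thesis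
      using FA_semi_invariant [OF inv s] e(2) unfolding \<rho>_def power_divide by (simp add: power_add field_simps)
  qed
  have D: "int N dvd 2 * D" if "\<rho> powi D = 1" for D
  proof -
    have "\<rho> ^ nat \<bar>D\<bar> = 1"
    proof (cases "D \<ge> 0")
      case False
      then have "\<rho> powi D = inverse (\<rho> ^ nat \<bar>D\<bar>)"
        using power_int_minus [of \<rho> "- D"] by (simp add: power_int_nonneg_exp)
      then show ?thesis using that by simp
    qed (use that in \<open>simp add: power_int_nonneg_exp\<close>)
    then have "N dvd 2 * nat \<bar>D\<bar>" using ord by simp
    then have "int N dvd \<bar>2 * D\<bar>" by (simp add: abs_mult flip: int_dvd_int_iff)
    then show ?thesis by (simp only: dvd_abs_iff)
  qed
  have "int N dvd 2 * ((int i + int j) - (int i' + int j'))"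
    if "(i, j) \<in> supp a a c" "(i', j') \<in> supp a a c" for i j i' j'
  proof (rule D)
    have "\<rho> ^ (i + j) = \<rho> ^ (i' + j')" using con [OF that(1)] con [OF that(2)] by simp
    then show "\<rho> powi ((int i + int j) - (int i' + int j')) = 1"
      using \<rho>0 power_int_diff [of \<rho> "int (i + j)" "int (i' + j')"] unfolding power_int_of_nat by simp
  qed
  then show ?thesis using c(2) by blast
qed

section \<open>Exponents of the monomials\<close>

definition reflX :: "nat \<Rightarrow> (nat \<Rightarrow> nat \<Rightarrow> complex) \<Rightarrow> nat \<Rightarrow> nat \<Rightarrow> complex" where
  "reflX a c = (\<lambda>i j. c (a - i) j)"

definition reflY :: "nat \<Rightarrow> (nat \<Rightarrow> nat \<Rightarrow> complex) \<Rightarrow> nat \<Rightarrow> nat \<Rightarrow> complex" where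
  "reflY b c = (\<lambda>i j. c i (b - j))"

lemma swF_FA: "swF (FA a b c) = FA b a (\<lambda>i j. c j i)"
  unfolding swF_def FA_def by (subst sum.swap, simp add: mult_ac)

lemma supp_swap: "(i, j) \<in> supp b a (\<lambda>i j. c j i) \<longleftrightarrow> (j, i) \<in> supp a b c"
  by (auto simp: supp_def)

lemma supp_reflX: "(i, j) \<in> supp a b (reflX a c) \<longleftrightarrow> i \<le> a \<and> (a - i, j) \<in> supp a b c"
  by (auto simp: supp_def reflX_def)

lemma supp_reflY: "(i, j) \<in> supp a b (reflY b c) \<longleftrightarrow> j \<le> b \<and> (i, b - j) \<in> supp a b c"
  by (auto simp: supp_def reflY_def)

lemma linv_flip: "linv prod.swap"
  unfolding linv_def by (rule exI [of _ 0], rule exI [of _ 1], rule exI [of _ 1], rule exI [of _ 0]) (simp add: fun_eq_iff prod.swap_def)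

lemma ev_reflX: "ev (FA a b (reflX a c)) X Y = ev (FA a b c) (prod.swap X) Y"
  unfolding ev_def FA_def reflX_def
  by (rule sum.reindex_bij_witness [of _ "\<lambda>i. a - i" "\<lambda>i. a - i"]) (auto simp: mult_ac)

lemma ev_reflY: "ev (FA a b (reflY b c)) X Y = ev (FA a b c) X (prod.swap Y)"
  unfolding ev_def FA_def reflY_def
  by (rule sum.cong [OF refl], rule sum.reindex_bij_witness [of _ "\<lambda>i. b - i" "\<lambda>i. b - i"]) (auto simp: mult_ac)

lemma linv_id: "linv (\<lambda>X. X)"
  by (rule linvI [of 1 1 0 0]) simp_all

lemma lequiv_reflX: "lequiv (FA a b c) (FA a b (reflX a c))"
  unfolding lequiv_def
  by (rule exI [of _ 1], rule exI [of _ "prod.swap"], rule exI [of _ "\<lambda>X. X"])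
    (simp add: linv_id linv_flip ev_reflX)

lemma lequiv_reflY: "lequiv (FA a b c) (FA a b (reflY b c))"
  unfolding lequiv_def
  by (rule exI [of _ 1], rule exI [of _ "\<lambda>X. X"], rule exI [of _ "prod.swap"])
    (simp add: linv_id linv_flip ev_reflY)

lemma dets_swap:
  assumes "dets N a b c"
  shows "dets N b a (\<lambda>i j. c j i)"
  unfolding dets_def
proof (intro allI impI)
  fix i j i' j' k l k' l'
  assume s: "(i, j) \<in> supp b a (\<lambda>i j. c j i)" "(i', j') \<in> supp b a (\<lambda>i j. c j i)"
    "(k, l) \<in> supp b a (\<lambda>i j. c j i)" "(k', l') \<in> supp b a (\<lambda>i j. c j i)"
  show "int N dvd (int i - int i') * (int l - int l') - (int k - int k') * (int j - int j')"
    using assms [unfolded dets_def, rule_format, OF s(3,4,1,2) [THEN iffD1 [OF supp_swap]]]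
    by (simp add: mult.commute)
qed

lemma dets_reflX:
  assumes "dets N a b c"
  shows "dets N a b (reflX a c)"
  unfolding dets_def supp_reflX
proof (intro allI impI)
  fix i j i' j' k l k' l'
  assume s: "i \<le> a \<and> (a - i, j) \<in> supp a b c" "i' \<le> a \<and> (a - i', j') \<in> supp a b c"
    "k \<le> a \<and> (a - k, l) \<in> supp a b c" "k' \<le> a \<and> (a - k', l') \<in> supp a b c"
  note * = s [THEN conjunct2]
  have "int N dvd - ((int i - int i') * (int l - int l') - (int k - int k') * (int j - int j'))"
    using assms [unfolded dets_def, rule_format, OF *] s by (simp add: of_nat_diff algebra_simps)
  then show "int N dvd (int i - int i') * (int l - int l') - (int k - int k') * (int j - int j')"
    by (simp only: dvd_minus_iff)
qed

text \<open>Otherwise \<open>([1:0], [1:0])\<close> lies on the curve and both affine derivatives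
  there, \<open>c 1 0\<close> and \<open>c 0 1\<close>, vanish.\<close>

lemma corner_support:
  assumes "smf (FA a b c)" "a \<ge> 1" "b \<ge> 1"
  shows "c 0 0 \<noteq> 0 \<or> c 1 0 \<noteq> 0 \<or> c 0 1 \<noteq> 0"
proof (rule ccontr)
  assume "\<not> ?thesis"
  then have 0: "c 0 0 = 0" "c 1 0 = 0" "c 0 1 = 0" by auto
  define e d :: cvec where "e = (1, 0)" and "d = (0, 1)"
  have p0: "(\<Sum>j\<le>n. g j * 0 ^ j) = g 0" for g :: "nat \<Rightarrow> complex" and n
    by (subst sum.atMost_shift) simp
  have X: "ev (FA a b c) (lin e d x) e = (\<Sum>i\<le>a. c i 0 * x ^ i)" for x
    by (simp add: ev_def FA_def e_def d_def lin_def p0)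
  have Y: "ev (FA a b c) e (lin e d y) = (\<Sum>j\<le>b. c 0 j * y ^ j)" for y
  proof -
    have "ev (FA a b c) e (lin e d y) = (\<Sum>i\<le>a. (\<Sum>j\<le>b. c i j * y ^ j) * 0 ^ i)"
      by (simp add: ev_def FA_def e_def d_def lin_def sum_distrib_left mult_ac)
    then show ?thesis by (simp only: p0)
  qed
  have der: "((\<lambda>x. \<Sum>i\<le>n. g i * x ^ i) has_field_derivative 0) (at 0)"
    if "g 1 = 0" for g :: "nat \<Rightarrow> complex" and n
  proof -
    have "((\<lambda>x. \<Sum>i\<le>n. g i * x ^ i) has_field_derivative (\<Sum>i\<le>n. g i * (of_nat i * 0 ^ (i - 1)))) (at 0)"
      by (rule DERIV_sum) (auto intro!: derivative_eq_intros)
    moreover have "g i * (of_nat i * 0 ^ (i - 1)) = 0" for i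
      using that by (cases "i = 1") (auto simp: power_0_left)
    ultimately show ?thesis by (simp only: sum.neutral_const)
  qed
  have "dX (FA a b c) e e d = 0" "dY (FA a b c) e e d = 0"
    unfolding dX_def dY_def X Y using der 0(2,3) by (auto intro!: DERIV_imp_deriv)
  moreover have "ev (FA a b c) e e = 0"
    using X [of 0] 0(1) p0 [of "\<lambda>i. c i 0"] by simp
  moreover have "dt e d \<noteq> 0" by (simp add: e_def d_def dt_def)
  ultimately show False using assms(1) dt_nonzeroD(1) [of e d] unfolding smf_def by blast
qed

text \<open>Otherwise every monomial is divisible by \<open>X1\<close>, and the curve contains the
  column over \<open>[1:0]\<close>.\<close>

lemma column_support:
  assumes "smf (FA a b c)" "b \<ge> 1"
  shows "\<exists>j. (0, j) \<in> supp a b c"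
proof (rule ccontr)
  assume "\<not> ?thesis"
  then have 0: "c 0 j = 0" if "j \<le> b" for j using that by (auto simp: supp_def)
  have p0: "(\<Sum>j\<le>n. g j * 0 ^ j) = g 0" for g :: "nat \<Rightarrow> complex" and n
    by (subst sum.atMost_shift) simp
  have "ev (FA a b c) (1, 0) Y = 0" for Y
  proof -
    have "ev (FA a b c) (1, 0) Y = (\<Sum>i\<le>a. (\<Sum>j\<le>b. c i j * fst Y ^ (b - j) * snd Y ^ j) * 0 ^ i)"
      by (simp add: ev_def FA_def sum_distrib_left mult_ac)
    then show ?thesis using 0 by (simp add: p0)
  qed
  moreover have "(1, 0) \<noteq> (0 :: cvec)" by (simp add: vec_eq_0_iff)
  then obtain Y where "ev (FA a b c) (1, 0) Y \<noteq> 0"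
    using column_not_contained [OF bihom_FA assms] by blast
  ultimately show False by blast
qed

text \<open>Offsets of an exponent from a corner of the rectangle \<open>{..a} \<times> {..b}\<close>.\<close>

definition crn :: "nat \<Rightarrow> nat \<Rightarrow> bool" where
  "crn e d \<longleftrightarrow> e = 0 \<and> d = 0 \<or> e = 1 \<and> d = 0 \<or> e = 0 \<and> d = 1"

text \<open>Reflections of the exponents are coordinate exchanges \<open>X0\<close>,
  \<open>X1\<close> or \<open>Y0\<close>, \<open>Y1\<close>; they preserve smoothness and move every
  corner to the origin.\<close>

lemma corners_support:
  assumes bih: "bihomogeneous a b F" and "smf F" "lequiv F (FA a b c)" "a \<ge> 1" "b \<ge> 1"
  shows "\<exists>e d. crn e d \<and> (e, d) \<in> supp a b c" "\<exists>e d. crn e d \<and> (a - e, d) \<in> supp a b c"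
    "\<exists>e d. crn e d \<and> (e, b - d) \<in> supp a b c" "\<exists>e d. crn e d \<and> (a - e, b - d) \<in> supp a b c"
proof -
  have 1: "\<exists>e d. crn e d \<and> (e, d) \<in> supp a b c" if "lequiv F (FA a b c)" for c
  proof -
    have "c 0 0 \<noteq> 0 \<or> c 1 0 \<noteq> 0 \<or> c 0 1 \<noteq> 0"
      by (rule corner_support [OF smf_lequiv [OF bih assms(2) that] assms(4,5)])
    then have "(0, 0) \<in> supp a b c \<or> (1, 0) \<in> supp a b c \<or> (0, 1) \<in> supp a b c"
      using assms(4,5) by (simp add: supp_def)
    then show ?thesis unfolding crn_def by blast
  qed
  note X = lequiv_trans [OF _ lequiv_reflX] and Y = lequiv_trans [OF _ lequiv_reflY]
  show "\<exists>e d. crn e d \<and> (e, d) \<in> supp a b c" by (rule 1 [OF assms(3)])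
  show "\<exists>e d. crn e d \<and> (a - e, d) \<in> supp a b c"
    using 1 [OF X [OF assms(3)]] by (auto simp: supp_reflX)
  show "\<exists>e d. crn e d \<and> (e, b - d) \<in> supp a b c"
    using 1 [OF Y [OF assms(3)]] by (auto simp: supp_reflY)
  show "\<exists>e d. crn e d \<and> (a - e, b - d) \<in> supp a b c"
    using 1 [OF X [OF Y [OF assms(3)]]] by (auto simp: supp_reflX supp_reflY)
qed

text \<open>The determinant of the two edges at a corner, multiplied out: \<open>P\<close> stands for \<open>A * B\<close>, so that the
  case distinctions below are linear.\<close>

definition cdet :: "int \<Rightarrow> int \<Rightarrow> int \<Rightarrow> nat \<Rightarrow> nat \<Rightarrow> nat \<Rightarrow> nat \<Rightarrow> nat \<Rightarrow> nat \<Rightarrow> int" where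
  "cdet P A B x1 y1 x2 y2 x3 y3 =
    P - A * (int y1 + int y3) - B * (int x1 + int x2) + (int x1 + int x2) * (int y1 + int y3)
      - (int x3 - int x1) * (int y2 - int y1)"

text \<open>The condition on \<open>P\<close> stands for \<open>(A - 4) * (B - 4) \<ge> 0\<close>,
  and \<open>P - A - B + 2\<close> is the smallest order in question,
  \<open>(a - 1) * (b - 1) + 1\<close>. For each of the 27 choices of offsets the claims are linear
  in \<open>P\<close>, \<open>A\<close>, \<open>B\<close>, \<open>N\<close>.\<close>

lemma cdet_bounds:
  assumes "crn x1 y1" "crn x2 y2" "crn x3 y3" "A \<ge> 4" "B \<ge> 4" "P \<ge> 4 * A + 4 * B - 16" "N \<ge> P - A - B + 2"
  shows "0 < cdet P A B x1 y1 x2 y2 x3 y3" "cdet P A B x1 y1 x2 y2 x3 y3 < 2 * N"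
  using assms unfolding crn_def cdet_def by (elim disjE conjE; simp)+

lemma dvd_pos_unique:
  assumes "(N :: int) dvd D" "0 < D" "D < 2 * N"
  shows "D = N"
proof -
  obtain k where k: "D = N * k" using assms(1) by blast
  have N: "N > 0" using assms(2,3) by linarith
  then have "0 < k" using assms(2) by (simp add: k zero_less_mult_iff)
  moreover have "k < 2" using assms(3) N by (simp add: k mult.commute [of N k])
  ultimately have "0 < k" "k < 2" by simp_all
  then have "k = 1" by simp
  then show ?thesis using k by simp
qed

text \<open>Each corner determinant is a multiple of \<open>N\<close> strictly between
  \<open>0\<close> and \<open>2 * N\<close>. Neighbouring corners have opposite orientation, which
  explains the sign in two of the four divisibilities.\<close>

lemma corner_determinants:
  assumes "dets N a b c" "a \<ge> 4" "b \<ge> 4" "int N \<ge> int a * int b - int a - int b + 2"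
    and crn: "crn x1 y1" "crn x2 y2" "crn x3 y3" "crn x4 y4"
    and s: "(x1, y1) \<in> supp a b c" "(a - x2, y2) \<in> supp a b c" "(x3, b - y3) \<in> supp a b c" "(a - x4, b - y4) \<in> supp a b c"
  shows "cdet (int a * int b) (int a) (int b) x1 y1 x2 y2 x3 y3 = int N"
    "cdet (int a * int b) (int a) (int b) x2 y2 x1 y1 x4 y4 = int N"
    "cdet (int a * int b) (int a) (int b) x3 y3 x4 y4 x1 y1 = int N"
    "cdet (int a * int b) (int a) (int b) x4 y4 x3 y3 x2 y2 = int N"
proof -
  have le: "x2 \<le> a" "x4 \<le> a" "y3 \<le> b" "y4 \<le> b" using crn assms(2,3) unfolding crn_def by auto
  have AB: "int a \<ge> 4" "int b \<ge> 4" using assms(2,3) by simp_all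
  have "0 \<le> (int a - 4) * (int b - 4)" using AB by simp
  then have P: "int a * int b \<ge> 4 * int a + 4 * int b - 16" by (simp add: algebra_simps)
  note u = dvd_pos_unique [OF _ cdet_bounds [OF _ _ _ AB P assms(4)]]
  note D = assms(1) [unfolded dets_def, rule_format]
  have 1: "int N dvd cdet (int a * int b) (int a) (int b) x1 y1 x2 y2 x3 y3"
    using D [OF s(2,1,3,1)] le by (simp add: cdet_def of_nat_diff algebra_simps)
  have 2: "int N dvd - cdet (int a * int b) (int a) (int b) x2 y2 x1 y1 x4 y4"
    using D [OF s(1,2,4,2)] le by (simp add: cdet_def of_nat_diff algebra_simps)
  have 3: "int N dvd - cdet (int a * int b) (int a) (int b) x3 y3 x4 y4 x1 y1"
    using D [OF s(4,3,1,3)] le by (simp add: cdet_def of_nat_diff algebra_simps)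
  have 4: "int N dvd cdet (int a * int b) (int a) (int b) x4 y4 x3 y3 x2 y2"
    using D [OF s(3,4,2,4)] le by (simp add: cdet_def of_nat_diff algebra_simps)
  show "cdet (int a * int b) (int a) (int b) x1 y1 x2 y2 x3 y3 = int N" by (rule u [OF 1 crn(1,2,3) crn(1,2,3)])
  show "cdet (int a * int b) (int a) (int b) x2 y2 x1 y1 x4 y4 = int N"
    by (rule u [OF 2 [unfolded dvd_minus_iff] crn(2,1,4) crn(2,1,4)])
  show "cdet (int a * int b) (int a) (int b) x3 y3 x4 y4 x1 y1 = int N"
    by (rule u [OF 3 [unfolded dvd_minus_iff] crn(3,4,1) crn(3,4,1)])
  show "cdet (int a * int b) (int a) (int b) x4 y4 x3 y3 x2 y2 = int N"
    by (rule u [OF 4 crn(4,3,2) crn(4,3,2)])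
qed

text \<open>A check of all 81 combinations of offsets. Besides the normal forms and their mirror
  images there remain patterns that require \<open>A = B\<close>, settled by exchanging the factors,
  and numerically consistent ones, such as those with \<open>P - B = P - 2 * A\<close>, which only
  the monomials on the sides of the rectangle exclude.\<close>

lemma corner_patterns:
  assumes crn: "crn x1 y1" "crn x2 y2" "crn x3 y3" "crn x4 y4" and AB: "A \<ge> 4" "B \<ge> 4"
    and c: "cdet P A B x1 y1 x2 y2 x3 y3 = N" "cdet P A B x2 y2 x1 y1 x4 y4 = N"
      "cdet P A B x3 y3 x4 y4 x1 y1 = N" "cdet P A B x4 y4 x3 y3 x2 y2 = N"
  shows "N = P \<Longrightarrow> x1 = 0 \<and> y1 = 0 \<and> x2 = 0 \<and> y2 = 0 \<and> x3 = 0 \<and> y3 = 0 \<and> x4 = 0 \<and> y4 = 0"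
    and "N = P - B \<Longrightarrow>
      y1 = 0 \<and> y2 = 0 \<and> y3 = 0 \<and> y4 = 0 \<and> x1 + x2 = 1 \<and> x3 + x4 = 1 \<or>
      A = B \<and> x1 = 0 \<and> x2 = 0 \<and> x3 = 0 \<and> x4 = 0 \<and> y1 + y3 = 1 \<and> y2 + y4 = 1 \<or>
      N = P - 2 * A \<and> x1 = 0 \<and> x2 = 0 \<and> x3 = 0 \<and> x4 = 0 \<and> y1 = 1 \<and> y2 = 1 \<and> y3 = 1 \<and> y4 = 1"
    and "N = P - A - B + 2 \<Longrightarrow>
      x1 = 1 \<and> y1 = 0 \<and> x2 = 0 \<and> y2 = 1 \<and> x3 = 0 \<and> y3 = 1 \<and> x4 = 1 \<and> y4 = 0 \<or>
      x1 = 0 \<and> y1 = 1 \<and> x2 = 1 \<and> y2 = 0 \<and> x3 = 1 \<and> y3 = 0 \<and> x4 = 0 \<and> y4 = 1 \<or>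
      N = P - 2 * A \<and> x1 = 0 \<and> x2 = 0 \<and> x3 = 0 \<and> x4 = 0 \<and> y1 = 1 \<and> y2 = 1 \<and> y3 = 1 \<and> y4 = 1 \<or>
      N = P - 2 * B \<and> y1 = 0 \<and> y2 = 0 \<and> y3 = 0 \<and> y4 = 0 \<and> x1 = 1 \<and> x2 = 1 \<and> x3 = 1 \<and> x4 = 1"
proof -
  note c' = c [unfolded cdet_def]
  show "N = P \<Longrightarrow> x1 = 0 \<and> y1 = 0 \<and> x2 = 0 \<and> y2 = 0 \<and> x3 = 0 \<and> y3 = 0 \<and> x4 = 0 \<and> y4 = 0"
    using crn AB c' unfolding crn_def by (elim disjE conjE; simp)
  show "N = P - B \<Longrightarrow>
      y1 = 0 \<and> y2 = 0 \<and> y3 = 0 \<and> y4 = 0 \<and> x1 + x2 = 1 \<and> x3 + x4 = 1 \<or>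
      A = B \<and> x1 = 0 \<and> x2 = 0 \<and> x3 = 0 \<and> x4 = 0 \<and> y1 + y3 = 1 \<and> y2 + y4 = 1 \<or>
      N = P - 2 * A \<and> x1 = 0 \<and> x2 = 0 \<and> x3 = 0 \<and> x4 = 0 \<and> y1 = 1 \<and> y2 = 1 \<and> y3 = 1 \<and> y4 = 1"
    using crn AB c' unfolding crn_def by (elim disjE conjE; simp)
  show "N = P - A - B + 2 \<Longrightarrow>
      x1 = 1 \<and> y1 = 0 \<and> x2 = 0 \<and> y2 = 1 \<and> x3 = 0 \<and> y3 = 1 \<and> x4 = 1 \<and> y4 = 0 \<or>
      x1 = 0 \<and> y1 = 1 \<and> x2 = 1 \<and> y2 = 0 \<and> x3 = 1 \<and> y3 = 0 \<and> x4 = 0 \<and> y4 = 1 \<or>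
      N = P - 2 * A \<and> x1 = 0 \<and> x2 = 0 \<and> x3 = 0 \<and> x4 = 0 \<and> y1 = 1 \<and> y2 = 1 \<and> y3 = 1 \<and> y4 = 1 \<or>
      N = P - 2 * B \<and> y1 = 0 \<and> y2 = 0 \<and> y3 = 0 \<and> y4 = 0 \<and> x1 = 1 \<and> x2 = 1 \<and> x3 = 1 \<and> x4 = 1"
    using crn AB c' unfolding crn_def by (elim disjE conjE; simp)
qed

section \<open>Normal forms\<close>

lemma complex_root_exists:
  assumes "z \<noteq> 0" "n > 0"
  shows "\<exists>w. w \<noteq> 0 \<and> w ^ n = (z :: complex)"
proof -
  obtain w where "z = w ^ n" using exists_complex_root [of n z] assms(2) by auto
  then show ?thesis using assms by (intro exI [of _ w]) (auto simp: power_0_left)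
qed

lemma FA_support:
  assumes "supp a b c \<subseteq> S" "S \<subseteq> {..a} \<times> {..b}"
  shows "FA a b c X0 X1 Y0 Y1 = (\<Sum>(i, j)\<in>S. c i j * X0 ^ (a - i) * X1 ^ i * Y0 ^ (b - j) * Y1 ^ j)"
proof -
  have "FA a b c X0 X1 Y0 Y1 = (\<Sum>(i, j)\<in>{..a} \<times> {..b}. c i j * X0 ^ (a - i) * X1 ^ i * Y0 ^ (b - j) * Y1 ^ j)"
    unfolding FA_def by (rule sum.cartesian_product)
  also have "\<dots> = (\<Sum>(i, j)\<in>S. c i j * X0 ^ (a - i) * X1 ^ i * Y0 ^ (b - j) * Y1 ^ j)"
    using assms by (intro sum.mono_neutral_right) (auto simp: supp_def)
  finally show ?thesis .
qed

text \<open>Scaling the equation by \<open>\<kappa>\<close>, \<open>X1\<close> by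
  \<open>\<mu>\<close> and \<open>Y1\<close> by \<open>\<nu>\<close> multiplies the coefficient at
  \<open>(i, j)\<close> by \<open>\<kappa> * \<mu> ^ i * \<nu> ^ j\<close>; three of the four
  weights can thus be prescribed when the resulting equations are solvable.\<close>

lemma lequiv_four_terms:
  assumes "lequiv F (FA a b c)" "supp a b c \<subseteq> {(i1, j1), (i2, j2), (i3, j3), (i4, j4)}"
    "distinct [(i1, j1), (i2, j2), (i3, j3), (i4, j4)]"
    "i1 \<le> a" "i2 \<le> a" "i3 \<le> a" "i4 \<le> a" "j1 \<le> b" "j2 \<le> b" "j3 \<le> b" "j4 \<le> b"
    and nz: "\<kappa> \<noteq> 0" "\<mu> \<noteq> 0" "\<nu> \<noteq> 0"
    and w: "\<kappa> * c i1 j1 * \<mu> ^ i1 * \<nu> ^ j1 = w1" "\<kappa> * c i2 j2 * \<mu> ^ i2 * \<nu> ^ j2 = w2"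
      "\<kappa> * c i3 j3 * \<mu> ^ i3 * \<nu> ^ j3 = w3" "\<kappa> * c i4 j4 * \<mu> ^ i4 * \<nu> ^ j4 = w4"
  shows "lequiv F (\<lambda>X0 X1 Y0 Y1.
    w1 * X0 ^ (a - i1) * X1 ^ i1 * Y0 ^ (b - j1) * Y1 ^ j1 + w2 * X0 ^ (a - i2) * X1 ^ i2 * Y0 ^ (b - j2) * Y1 ^ j2 +
    w3 * X0 ^ (a - i3) * X1 ^ i3 * Y0 ^ (b - j3) * Y1 ^ j3 + w4 * X0 ^ (a - i4) * X1 ^ i4 * Y0 ^ (b - j4) * Y1 ^ j4)"
    (is "lequiv F ?E")
proof (rule lequiv_trans [OF assms(1)])
  have *: "ev (FA a b c) X Y =
      c i1 j1 * fst X ^ (a - i1) * snd X ^ i1 * fst Y ^ (b - j1) * snd Y ^ j1 +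
      c i2 j2 * fst X ^ (a - i2) * snd X ^ i2 * fst Y ^ (b - j2) * snd Y ^ j2 +
      c i3 j3 * fst X ^ (a - i3) * snd X ^ i3 * fst Y ^ (b - j3) * snd Y ^ j3 +
      c i4 j4 * fst X ^ (a - i4) * snd X ^ i4 * fst Y ^ (b - j4) * snd Y ^ j4" for X Y
    unfolding ev_def using assms(3)
    by (subst FA_support [OF assms(2)]) (use assms(4-11) in \<open>simp_all add: add.assoc\<close>)
  show "lequiv (FA a b c) ?E" unfolding lequiv_def
  proof (intro exI conjI allI)
    show "ev ?E X Y = \<kappa> * ev (FA a b c) (dg 1 \<mu> X) (dg 1 \<nu> Y)" for X Y
      unfolding * w [symmetric] by (simp add: ev_def dg_def power_mult_distrib algebra_simps)
  qed (use nz in \<open>simp_all add: linv_dg\<close>)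
qed

definition formI :: "nat \<Rightarrow> nat \<Rightarrow> complex \<Rightarrow> form" where
  "formI a b s = (\<lambda>X0 X1 Y0 Y1. X0 ^ a * Y0 ^ b + X0 ^ a * Y1 ^ b + X1 ^ a * Y0 ^ b + s * X1 ^ a * Y1 ^ b)"

definition formII :: "nat \<Rightarrow> nat \<Rightarrow> complex \<Rightarrow> form" where
  "formII a b s = (\<lambda>X0 X1 Y0 Y1. X0 ^ a * Y0 ^ b + X0 ^ (a - 1) * X1 * Y1 ^ b
     + X0 * X1 ^ (a - 1) * Y0 ^ b + s * X1 ^ a * Y1 ^ b)"

definition formIV :: "nat \<Rightarrow> nat \<Rightarrow> complex \<Rightarrow> complex \<Rightarrow> form" where
  "formIV a b s s' = (\<lambda>X0 X1 Y0 Y1. X0 ^ (a - 1) * X1 * Y0 ^ b + X0 ^ a * Y0 * Y1 ^ (b - 1)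
     + s * X1 ^ a * Y0 ^ (b - 1) * Y1 + s' * X0 * X1 ^ (a - 1) * Y1 ^ b)"

lemma dvd_le_cases:
  assumes "(b :: nat) dvd j" "j \<le> b"
  shows "j = 0 \<or> j = b"
  using assms dvd_imp_le [of b j] by auto

lemma normal_formI:
  assumes lq: "lequiv F (FA a b c)" and dets: "dets (a * b) a b c" and ab: "a \<ge> 4" "b \<ge> 4"
    and s: "(0, 0) \<in> supp a b c" "(a, 0) \<in> supp a b c" "(0, b) \<in> supp a b c" "(a, b) \<in> supp a b c"
  shows "\<exists>s. s \<noteq> 0 \<and> lequiv F (formI a b s)"
proof -
  note D = dets [unfolded dets_def, rule_format]
  have sub: "supp a b c \<subseteq> {(0, 0), (0, b), (a, 0), (a, b)}"
  proof (rule subrelI, rule ccontr)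
    fix i j assume "(i, j) \<in> supp a b c" and n: "(i, j) \<notin> {(0, 0), (0, b), (a, 0), (a, b)}"
    then have ij: "(i, j) \<in> supp a b c" "(i, j) \<noteq> (0, b)" "(i, j) \<noteq> (a, 0)" "(i, j) \<noteq> (a, b)" by simp_all
    from ij have le: "i \<le> a" "j \<le> b" by (simp_all add: supp_def)
    \<comment> \<open>The determinant with the horizontal edge of length \<open>a\<close> isolates
      \<open>j\<close>; the vertical edge of length \<open>b\<close> does the same for
      \<open>i\<close> below.\<close>
    have "int (a * b) dvd int (a * j)" using D [OF s(2,1) ij(1) s(1)] by simp
    then have "b dvd j" using ab unfolding int_dvd_int_iff by simp
    then have j: "j = 0 \<or> j = b" using le dvd_le_cases by simp
    have "int (a * b) dvd int (b * i)" using D [OF ij(1) s(1,3,1)] by (simp add: mult.commute)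
    then have "a dvd i" using ab unfolding int_dvd_int_iff by (simp add: mult.commute [of a])
    then have "i = 0 \<or> i = a" using le dvd_le_cases by simp
    then have "(i, j) = (0, 0)" using j ij by auto
    then show False using n by simp
  qed
  have c0: "c 0 0 \<noteq> 0" "c a 0 \<noteq> 0" "c 0 b \<noteq> 0" "c a b \<noteq> 0" using s by (simp_all add: supp_def)
  define \<kappa> where "\<kappa> = 1 / c 0 0"
  have \<kappa>: "\<kappa> \<noteq> 0" "\<kappa> * c 0 0 = 1" using c0 by (simp_all add: \<kappa>_def)
  obtain \<mu> where \<mu>: "\<mu> \<noteq> 0" "\<mu> ^ a = 1 / (\<kappa> * c a 0)"
    using complex_root_exists [of "1 / (\<kappa> * c a 0)" a] c0 \<kappa> ab by auto
  obtain \<nu> where \<nu>: "\<nu> \<noteq> 0" "\<nu> ^ b = 1 / (\<kappa> * c 0 b)"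
    using complex_root_exists [of "1 / (\<kappa> * c 0 b)" b] c0 \<kappa> ab by auto
  define s where "s = \<kappa> * c a b * \<mu> ^ a * \<nu> ^ b"
  have "lequiv F (formI a b s)"
    using lequiv_four_terms [OF lq sub _ _ _ _ _ _ _ _ _ \<kappa>(1) \<mu>(1) \<nu>(1), of 1 1 1 s] ab c0 \<kappa> \<mu>(2) \<nu>(2)
    by (simp add: formI_def s_def)
  moreover have "s \<noteq> 0" using c0 \<kappa> \<mu> \<nu> by (simp add: s_def)
  ultimately show ?thesis by blast
qed

lemma normal_formII:
  assumes lq: "lequiv F (FA a b c)" and dets: "dets ((a - 1) * b) a b c" and ab: "a \<ge> 4" "b \<ge> 4"
    and s: "(0, 0) \<in> supp a b c" "(a - 1, 0) \<in> supp a b c" "(1, b) \<in> supp a b c" "(a, b) \<in> supp a b c"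
  shows "\<exists>s. s \<noteq> 0 \<and> lequiv F (formII a b s)"
proof -
  note D = dets [unfolded dets_def, rule_format]
  have sub: "supp a b c \<subseteq> {(0, 0), (1, b), (a - 1, 0), (a, b)}"
  proof (rule subrelI, rule ccontr)
    fix i j assume "(i, j) \<in> supp a b c" and n: "(i, j) \<notin> {(0, 0), (1, b), (a - 1, 0), (a, b)}"
    then have ij: "(i, j) \<in> supp a b c" "(i, j) \<noteq> (1, b)" "(i, j) \<noteq> (a - 1, 0)" "(i, j) \<noteq> (a, b)" by simp_all
    from ij have le: "i \<le> a" "j \<le> b" by (simp_all add: supp_def)
    have "int ((a - 1) * b) dvd int ((a - 1) * j)" using D [OF s(2,1) ij(1) s(1)] by simp
    then have "b dvd j" using ab unfolding int_dvd_int_iff by simp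
    then have j: "j = 0 \<or> j = b" using le dvd_le_cases by simp
    \<comment> \<open>The determinant with the slanted edge from \<open>(0, 0)\<close> to
      \<open>(1, b)\<close>. It makes \<open>a - 1\<close> divide \<open>i\<close> if
      \<open>j = 0\<close> and \<open>i - 1\<close> if \<open>j = b\<close>, and
      \<open>i \<le> a\<close> leaves only the four known exponents.\<close>
    have N: "int ((a - 1) * b) dvd int i * int b - int j"
      using D [OF ij(1) s(1,3,1)] by simp
    have "(i, j) = (0, 0)"
    proof (cases "j = 0")
      case True
      then have "int ((a - 1) * b) dvd int (i * b)" using N by simp
      then have d: "a - 1 dvd i" using ab unfolding int_dvd_int_iff by simp
      then obtain k where k: "i = (a - 1) * k" by blast
      have "k < 2"
      proof (rule ccontr)
        assume "\<not> k < 2"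
        then have "(a - 1) * 2 \<le> i" unfolding k by (intro mult_le_mono2) simp
        then show False using le ab by simp
      qed
      then have "k = 0 \<or> k = 1" by auto
      then show ?thesis using True k ij by auto
    next
      case False
      then have jb: "j = b" using j by simp
      then have "int b * int (a - 1) dvd int b * (int i - 1)" using N
        by (simp add: right_diff_distrib mult.commute)
      then have "int (a - 1) dvd int i - 1" using ab by simp
      then obtain k where k: "int i - 1 = int (a - 1) * k" by blast
      have "k = 0 \<or> k = 1"
      proof (rule ccontr)
        assume "\<not> (k = 0 \<or> k = 1)"
        then consider "k \<le> -1" | "k \<ge> 2" by linarith
        then show False
        proof cases
          case 1
          then have "int (a - 1) * k \<le> int (a - 1) * (-1)" by (intro mult_left_mono) simp_all
          then show False using k ab by simp
        next
          case 2
          then have "int (a - 1) * 2 \<le> int (a - 1) * k" by (intro mult_left_mono) simp_all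
          then show False using k ab le by simp
        qed
      qed
      then show ?thesis using k jb ij ab by auto
    qed
    then show False using n by simp
  qed
  have c0: "c 0 0 \<noteq> 0" "c (a - 1) 0 \<noteq> 0" "c 1 b \<noteq> 0" "c a b \<noteq> 0" using s by (simp_all add: supp_def)
  define \<kappa> where "\<kappa> = 1 / c 0 0"
  have \<kappa>: "\<kappa> \<noteq> 0" "\<kappa> * c 0 0 = 1" using c0 by (simp_all add: \<kappa>_def)
  \<comment> \<open>The monomial at \<open>(a - 1, 0)\<close> does not involve \<open>\<nu>\<close>,
    so it determines \<open>\<mu>\<close>; with \<open>\<mu>\<close> known, the one at
    \<open>(1, b)\<close> determines \<open>\<nu>\<close>.\<close>
  obtain \<mu> where \<mu>: "\<mu> \<noteq> 0" "\<mu> ^ (a - 1) = 1 / (\<kappa> * c (a - 1) 0)"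
    using complex_root_exists [of "1 / (\<kappa> * c (a - 1) 0)" "a - 1"] c0 \<kappa> ab by auto
  obtain \<nu> where \<nu>: "\<nu> \<noteq> 0" "\<nu> ^ b = 1 / (\<kappa> * c 1 b * \<mu>)"
    using complex_root_exists [of "1 / (\<kappa> * c 1 b * \<mu>)" b] c0 \<kappa> \<mu> ab by auto
  define s where "s = \<kappa> * c a b * \<mu> ^ a * \<nu> ^ b"
  have "lequiv F (\<lambda>X0 X1 Y0 Y1.
    1 * X0 ^ (a - 0) * X1 ^ 0 * Y0 ^ (b - 0) * Y1 ^ 0 + 1 * X0 ^ (a - 1) * X1 ^ 1 * Y0 ^ (b - b) * Y1 ^ b +
    1 * X0 ^ (a - (a - 1)) * X1 ^ (a - 1) * Y0 ^ (b - 0) * Y1 ^ 0 + s * X0 ^ (a - a) * X1 ^ a * Y0 ^ (b - b) * Y1 ^ b)"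
    by (rule lequiv_four_terms [OF lq sub _ _ _ _ _ _ _ _ _ \<kappa>(1) \<mu>(1) \<nu>(1)])
      (use ab c0 \<kappa> \<mu> \<nu> in \<open>simp_all add: s_def\<close>)
  then have "lequiv F (formII a b s)" using ab by (simp add: formII_def)
  moreover have "s \<noteq> 0" using c0 \<kappa> \<mu> \<nu> by (simp add: s_def)
  ultimately show ?thesis by blast
qed

lemma normal_formIV:
  assumes lq: "lequiv F (FA a b c)" and dets: "dets ((a - 1) * (b - 1) + 1) a b c" and ab: "a \<ge> 4" "b \<ge> 4"
    and s: "(1, 0) \<in> supp a b c" "(a, 1) \<in> supp a b c" "(0, b - 1) \<in> supp a b c" "(a - 1, b) \<in> supp a b c"
  shows "\<exists>s s'. s \<noteq> 0 \<and> s' \<noteq> 0 \<and> lequiv F (formIV a b s s')"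
proof -
  note D = dets [unfolded dets_def, rule_format]
  define A B where "A = int (a - 1)" and "B = int (b - 1)"
  have AB: "A \<ge> 3" "B \<ge> 3" "int a = A + 1" "int b = B + 1" using ab by (simp_all add: A_def B_def)
  have sub: "supp a b c \<subseteq> {(1, 0), (0, b - 1), (a, 1), (a - 1, b)}"
  proof (rule subrelI, rule ccontr)
    fix i j assume "(i, j) \<in> supp a b c" and n: "(i, j) \<notin> {(1, 0), (0, b - 1), (a, 1), (a - 1, b)}"
    then have ij: "(i, j) \<in> supp a b c" "(i, j) \<noteq> (0, b - 1)" "(i, j) \<noteq> (a, 1)" "(i, j) \<noteq> (a - 1, b)" by simp_all
    have "i \<le> a" "j \<le> b" using ij(1) by (simp_all add: supp_def)
    then have le: "int i \<le> A + 1" "int j \<le> B + 1" using AB(3,4) by linarith+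
    \<comment> \<open>The determinant with the edge from \<open>(1, 0)\<close> to
      \<open>(a, 1)\<close>. The ranges of \<open>i\<close> and \<open>j\<close> leave only the
      multiples \<open>0\<close> and \<open>1\<close> of \<open>A * B + 1\<close>: the former gives
      \<open>(1, 0)\<close> and \<open>(a, 1)\<close>, the latter \<open>(0, b - 1)\<close> and
      \<open>(a - 1, b)\<close>.\<close>
    have N: "A * B + 1 dvd A * int j - (int i - 1)"
    proof -
      have "int ((a - 1) * (b - 1) + 1) = A * B + 1" by (simp only: A_def B_def of_nat_mult of_nat_add of_nat_1)
      moreover have "(int a - int 1) * (int j - int 0) - (int i - int 1) * (int 1 - int 0) = A * int j - (int i - 1)"
        using AB(3) by simp
      ultimately show ?thesis using D [OF s(2,1) ij(1) s(1)] by (simp only: of_nat_0 of_nat_1)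
    qed
    have i0: "0 \<le> int i" by simp
    have AB3: "A * 3 \<le> A * B" using AB by (intro mult_left_mono) simp_all
    have "A * int j \<le> A * (B + 1)" using AB le by (intro mult_left_mono) simp_all
    then have "A * int j \<le> A * B + A" by (simp only: distrib_left mult_1_right)
    then have up: "A * int j - (int i - 1) < 2 * (A * B + 1)" using AB3 AB(1) i0 by presburger
    have "0 \<le> A * int j" using AB by simp
    then have "- A \<le> A * int j - (int i - 1)" using le by linarith
    then have lo: "- (A * B + 1) < A * int j - (int i - 1)" using AB3 AB by linarith
    obtain k where k: "A * int j - (int i - 1) = (A * B + 1) * k" using N by blast
    have pos: "A * B + 1 > 0" using AB3 AB by linarith
    have "(A * B + 1) * k < (A * B + 1) * 2" using up unfolding k by (simp only: mult.commute)
    then have "k < 2" using pos by (simp only: mult_less_cancel_left_pos)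
    moreover have "- 1 < k"
    proof -
      have "(A * B + 1) * (-1) < (A * B + 1) * k" using lo unfolding k by simp
      then show ?thesis using pos by (simp only: mult_less_cancel_left_pos)
    qed
    ultimately consider "k = 0" | "k = 1" by linarith
    then have "(i, j) = (1, 0)"
    proof cases
      case 1
      then have e: "A * int j = int i - 1" using k by simp
      consider "j = 0" | "j = 1" | "j \<ge> 2" by linarith
      then show ?thesis
      proof cases
        case 1
        then show ?thesis using e by simp
      next
        case 2
        then show ?thesis using e ij(3) AB by simp
      next
        case 3
        then have "A * 2 \<le> A * int j" using AB by (intro mult_left_mono) simp_all
        then show ?thesis using e le AB by linarith
      qed
    next
      case 2
      then have e: "A * int j = A * B + int i" using k by simp
      consider "int j = B" | "int j = B + 1" | "int j < B" using le by linarith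
      then show ?thesis
      proof cases
        case 1
        then have "i = 0" "j = b - 1" using e by (simp_all add: B_def)
        then show ?thesis using ij(2) by simp
      next
        case 2
        then have "int i = A" using e by (simp add: algebra_simps)
        then have "i = a - 1" by (simp add: A_def)
        moreover have "j = b" using 2 AB(4) by linarith
        ultimately have "i = a - 1" "j = b" by simp_all
        then show ?thesis using ij(4) by simp
      next
        case 3
        then have "A * int j \<le> A * (B - 1)" using AB by (intro mult_left_mono) simp_all
        then show ?thesis using e AB by (simp add: algebra_simps)
      qed
    qed
    then show False using n by simp
  qed
  have c0: "c 1 0 \<noteq> 0" "c a 1 \<noteq> 0" "c 0 (b - 1) \<noteq> 0" "c (a - 1) b \<noteq> 0" using s by (simp_all add: supp_def)
  define \<kappa> where "\<kappa> = 1 / c 1 0"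
  have \<kappa>: "\<kappa> \<noteq> 0" "\<kappa> * c 1 0 = 1" using c0 by (simp_all add: \<kappa>_def)
  \<comment> \<open>Two coefficients are to become \<open>1\<close>, which \<open>\<kappa>\<close>
    and \<open>\<nu>\<close> achieve with \<open>\<mu> = 1\<close>; the other two become the
    parameters.\<close>
  obtain \<nu> where \<nu>: "\<nu> \<noteq> 0" "\<nu> ^ (b - 1) = 1 / (\<kappa> * c 0 (b - 1))"
    using complex_root_exists [of "1 / (\<kappa> * c 0 (b - 1))" "b - 1"] c0 \<kappa> ab by auto
  define s s' where "s = \<kappa> * c a 1 * \<nu>" and "s' = \<kappa> * c (a - 1) b * \<nu> ^ b"
  have "lequiv F (\<lambda>X0 X1 Y0 Y1.
    1 * X0 ^ (a - 1) * X1 ^ 1 * Y0 ^ (b - 0) * Y1 ^ 0 + 1 * X0 ^ (a - 0) * X1 ^ 0 * Y0 ^ (b - (b - 1)) * Y1 ^ (b - 1) +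
    s * X0 ^ (a - a) * X1 ^ a * Y0 ^ (b - 1) * Y1 ^ 1 + s' * X0 ^ (a - (a - 1)) * X1 ^ (a - 1) * Y0 ^ (b - b) * Y1 ^ b)"
    by (rule lequiv_four_terms [OF lq sub _ _ _ _ _ _ _ _ _ \<kappa>(1) one_neq_zero \<nu>(1)])
      (use ab c0 \<kappa> \<nu> in \<open>simp_all add: s_def s'_def\<close>)
  then have "lequiv F (formIV a b s s')" using ab by (simp add: formIV_def)
  moreover have "s \<noteq> 0" "s' \<noteq> 0" using c0 \<kappa> \<nu> by (simp_all add: s_def s'_def)
  ultimately show ?thesis by blast
qed

text \<open>The edge from \<open>(0, 1)\<close> to \<open>(a, 1)\<close> and a monomial one row
  below it have determinant \<open>a\<close>, which \<open>N = a * (b - 2)\<close> cannot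
  divide.\<close>

lemma row_excluded:
  assumes "dets N a b c" "int N = int a * int b - 2 * int a" "a \<ge> 4" "b \<ge> 4"
    and s: "(0, 1) \<in> supp a b c" "(a, 1) \<in> supp a b c" "(i, 0) \<in> supp a b c"
  shows False
proof -
  have "int N dvd (int a - 0) * (1 - 0) - (int 0 - int i) * 0"
    using assms(1) [unfolded dets_def, rule_format, OF s(2,1,1,3)] by simp
  then have "int a * (int b - 2) dvd int a * 1" unfolding assms(2) by (simp add: algebra_simps)
  then have "int b - 2 dvd 1" using assms(3) by (simp only: dvd_mult_cancel_left) simp
  then have "int b - 2 \<le> 1" by (intro zdvd_imp_le) simp_all
  then show False using assms(4) by simp
qed

text \<open>A side of the exponent rectangle without monomials would make a whole column or row part
  of the curve.\<close>

lemma border_support: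
  assumes bih: "bihomogeneous a b F" and "smf F" "lequiv F (FA a b c)" "a \<ge> 1" "b \<ge> 1"
  shows "\<exists>j. (0, j) \<in> supp a b c" "\<exists>j. (a, j) \<in> supp a b c" "\<exists>i. (i, 0) \<in> supp a b c"
proof -
  have 1: "\<exists>j. (0, j) \<in> supp a b c" if "lequiv F (FA a b c)" for c
    by (rule column_support [OF smf_lequiv [OF bih assms(2) that] assms(5)])
  show "\<exists>j. (0, j) \<in> supp a b c" by (rule 1 [OF assms(3)])
  show "\<exists>j. (a, j) \<in> supp a b c"
    using 1 [OF lequiv_trans [OF assms(3) lequiv_reflX]] by (auto simp: supp_reflX)
  have "smf (FA b a (\<lambda>i j. c j i))"
    using smf_swF [OF smf_lequiv [OF bih assms(2,3)]] by (simp add: swF_FA)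
  then obtain i where "(0, i) \<in> supp b a (\<lambda>i j. c j i)" using column_support assms(4) by blast
  then show "\<exists>i. (i, 0) \<in> supp a b c" using supp_swap [of 0 i b a c] by blast
qed

text \<open>Two of the four solutions are the normal form and its reflection. In the other two the
  corner monomials form an upright rectangle of width \<open>a - 1\<close>, and a monomial on the
  side of the exponent rectangle that it misses would make \<open>a - 1\<close> divide
  \<open>a\<close> or \<open>1\<close>.\<close>

lemma normal_formII_flat:
  assumes bih: "bihomogeneous a b F" and "smf F" and lq: "lequiv F (FA a b c)"
    and dets: "dets ((a - 1) * b) a b c" and ab: "a \<ge> 4" "b \<ge> 4"
    and s: "(x1, 0) \<in> supp a b c" "(a - x2, 0) \<in> supp a b c" "(x3, b) \<in> supp a b c" "(a - x4, b) \<in> supp a b c"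
    and x: "x1 + x2 = 1" "x3 + x4 = 1"
  shows "\<exists>s. s \<noteq> 0 \<and> lequiv F (formII a b s)"
proof -
  note D = dets [unfolded dets_def, rule_format]
  have ab1: "a \<ge> 1" "b \<ge> 1" using ab by simp_all
  consider "x1 = 0" "x2 = 1" "x3 = 1" "x4 = 0" | "x1 = 1" "x2 = 0" "x3 = 0" "x4 = 1"
    | "x1 = 0" "x2 = 1" "x3 = 0" "x4 = 1" | "x1 = 1" "x2 = 0" "x3 = 1" "x4 = 0"
    using x by linarith
  then show ?thesis
  proof cases
    case 1
    then show ?thesis using s by (intro normal_formII [OF lq dets ab]) simp_all
  next
    case 2
    show ?thesis
      by (rule normal_formII [OF lequiv_trans [OF lq lequiv_reflX] dets_reflX [OF dets] ab])
        (use s 2 ab in \<open>auto simp: supp_reflX\<close>)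
  next
    case 3
    obtain j where j: "(a, j) \<in> supp a b c" using border_support [OF bih assms(2) lq ab1] by blast
    have "int ((a - 1) * b) dvd int (a * b)"
      using D [OF j s(1,3,1)] 3 by simp
    then have "a - 1 dvd a" using ab unfolding int_dvd_int_iff by simp
    then have "a - 1 dvd a - (a - 1)" by (rule dvd_diff_nat) simp
    then show ?thesis using ab by (simp add: nat_dvd_1_iff_1)
  next
    case 4
    obtain j where j: "(0, j) \<in> supp a b c" using border_support [OF bih assms(2) lq ab1] by blast
    have "int ((a - 1) * b) dvd int (1 * b)"
      using D [OF s(1) j s(3,1)] 4 by simp
    then have "a - 1 dvd 1" using ab unfolding int_dvd_int_iff by simp
    then show ?thesis using ab by (simp add: nat_dvd_1_iff_1)
  qed
qed

section \<open>From the corner monomials to the normal forms\<close>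

lemma four_corners:
  assumes bih: "bihomogeneous a b F" and "smf F" and lq: "lequiv F (FA a b c)"
    and dets: "dets N a b c" and ab: "a \<ge> 4" "b \<ge> 4" and N: "int N \<ge> int a * int b - int a - int b + 2"
  shows "\<exists>x1 y1 x2 y2 x3 y3 x4 y4. crn x1 y1 \<and> crn x2 y2 \<and> crn x3 y3 \<and> crn x4 y4 \<and>
    (x1, y1) \<in> supp a b c \<and> (a - x2, y2) \<in> supp a b c \<and> (x3, b - y3) \<in> supp a b c \<and> (a - x4, b - y4) \<in> supp a b c \<and>
    cdet (int a * int b) (int a) (int b) x1 y1 x2 y2 x3 y3 = int N \<and>
    cdet (int a * int b) (int a) (int b) x2 y2 x1 y1 x4 y4 = int N \<and>
    cdet (int a * int b) (int a) (int b) x3 y3 x4 y4 x1 y1 = int N \<and>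
    cdet (int a * int b) (int a) (int b) x4 y4 x3 y3 x2 y2 = int N"
proof -
  have ab1: "a \<ge> 1" "b \<ge> 1" using ab by simp_all
  note s = corners_support [OF bih assms(2) lq ab1]
  obtain x1 y1 where 1: "crn x1 y1" "(x1, y1) \<in> supp a b c" using s(1) by blast
  obtain x2 y2 where 2: "crn x2 y2" "(a - x2, y2) \<in> supp a b c" using s(2) by blast
  obtain x3 y3 where 3: "crn x3 y3" "(x3, b - y3) \<in> supp a b c" using s(3) by blast
  obtain x4 y4 where 4: "crn x4 y4" "(a - x4, b - y4) \<in> supp a b c" using s(4) by blast
  note d = corner_determinants [OF dets ab N 1(1) 2(1) 3(1) 4(1) 1(2) 2(2) 3(2) 4(2)]
  show ?thesis
    by (rule exI [of _ x1], rule exI [of _ y1], rule exI [of _ x2], rule exI [of _ y2],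
        rule exI [of _ x3], rule exI [of _ y3], rule exI [of _ x4], rule exI [of _ y4])
      (use 1 2 3 4 d in simp)
qed

lemma array_formI:
  assumes bih: "bihomogeneous a b F" and "smf F" and lq: "lequiv F (FA a b c)"
    and dets: "dets (a * b) a b c" and ab: "a \<ge> 4" "b \<ge> 4"
  shows "\<exists>s. s \<noteq> 0 \<and> lequiv F (formI a b s)"
proof -
  have AB: "int a \<ge> 4" "int b \<ge> 4" using ab by simp_all
  have N: "int (a * b) = int a * int b" by simp
  have "int (a * b) \<ge> int a * int b - int a - int b + 2" using AB by simp
  from four_corners [OF bih assms(2) lq dets ab this] obtain x1 y1 x2 y2 x3 y3 x4 y4
    where *: "crn x1 y1" "crn x2 y2" "crn x3 y3" "crn x4 y4"
      and s: "(x1, y1) \<in> supp a b c" "(a - x2, y2) \<in> supp a b c" "(x3, b - y3) \<in> supp a b c" "(a - x4, b - y4) \<in> supp a b c"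
      and d: "cdet (int a * int b) (int a) (int b) x1 y1 x2 y2 x3 y3 = int (a * b)"
        "cdet (int a * int b) (int a) (int b) x2 y2 x1 y1 x4 y4 = int (a * b)"
        "cdet (int a * int b) (int a) (int b) x3 y3 x4 y4 x1 y1 = int (a * b)"
        "cdet (int a * int b) (int a) (int b) x4 y4 x3 y3 x2 y2 = int (a * b)"
    by (elim exE conjE)
  have "x1 = 0 \<and> y1 = 0 \<and> x2 = 0 \<and> y2 = 0 \<and> x3 = 0 \<and> y3 = 0 \<and> x4 = 0 \<and> y4 = 0"
    by (rule corner_patterns(1) [OF * AB d N])
  then show ?thesis using s by (intro normal_formI [OF lq dets ab]) simp_all
qed

lemma array_formII:
  assumes bih: "bihomogeneous a b F" and "smf F" and lq: "lequiv F (FA a b c)"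
    and dets: "dets ((a - 1) * b) a b c" and ab: "a \<ge> 4" "b \<ge> 4"
  shows "\<exists>s. s \<noteq> 0 \<and> (lequiv F (formII a b s) \<or> a = b \<and> lequiv (swF F) (formII a b s))"
proof -
  have AB: "int a \<ge> 4" "int b \<ge> 4" and ab1: "a \<ge> 1" "b \<ge> 1" using ab by simp_all
  have N: "int ((a - 1) * b) = int a * int b - int b" using ab by (simp add: of_nat_diff algebra_simps)
  have "int ((a - 1) * b) \<ge> int a * int b - int a - int b + 2" unfolding N using AB by simp
  from four_corners [OF bih assms(2) lq dets ab this] obtain x1 y1 x2 y2 x3 y3 x4 y4
    where *: "crn x1 y1" "crn x2 y2" "crn x3 y3" "crn x4 y4"
      and s: "(x1, y1) \<in> supp a b c" "(a - x2, y2) \<in> supp a b c" "(x3, b - y3) \<in> supp a b c" "(a - x4, b - y4) \<in> supp a b c"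
      and d: "cdet (int a * int b) (int a) (int b) x1 y1 x2 y2 x3 y3 = int ((a - 1) * b)"
        "cdet (int a * int b) (int a) (int b) x2 y2 x1 y1 x4 y4 = int ((a - 1) * b)"
        "cdet (int a * int b) (int a) (int b) x3 y3 x4 y4 x1 y1 = int ((a - 1) * b)"
        "cdet (int a * int b) (int a) (int b) x4 y4 x3 y3 x2 y2 = int ((a - 1) * b)"
    by (elim exE conjE)
  from corner_patterns(2) [OF * AB d N] show ?thesis
  proof (elim disjE conjE)
    assume "y1 = 0" "y2 = 0" "y3 = 0" "y4 = 0" "x1 + x2 = 1" "x3 + x4 = 1"
    then have "\<exists>s. s \<noteq> 0 \<and> lequiv F (formII a b s)"
      using s by (intro normal_formII_flat [OF bih assms(2) lq dets ab, of x1 x2 x3 x4]) simp_all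
    then show ?thesis by blast
  next
    \<comment> \<open>For \<open>a = b\<close> the pattern of the order \<open>a * (b - 1)\<close>
      occurs as well; transposing the array turns it into the flat one.\<close>
    assume "int a = int b" and y: "x1 = 0" "x2 = 0" "x3 = 0" "x4 = 0" "y1 + y3 = 1" "y2 + y4 = 1"
    then have eq: "a = b" by simp
    define c' where "c' = (\<lambda>i j. c j i)"
    have "lequiv (swF F) (FA a b c')"
      using lequiv_swF [OF lq] eq by (simp add: swF_FA c'_def)
    moreover have "dets ((a - 1) * b) a b c'" using dets_swap [OF dets] eq by (simp add: c'_def)
    moreover have "(i, j) \<in> supp a b c' \<longleftrightarrow> (j, i) \<in> supp a b c" for i j
      using supp_swap [of i j b a c] eq by (simp add: c'_def)
    moreover have "bihomogeneous a b (swF F)" using bihom_swF [OF bih] eq by simp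
    ultimately have "\<exists>s. s \<noteq> 0 \<and> lequiv (swF F) (formII a b s)"
      using s y eq by (intro normal_formII_flat [OF _ smf_swF [OF assms(2)] _ _ ab, of c' y1 y3 y2 y4]) simp_all
    then show ?thesis using eq by blast
  next
    assume "int ((a - 1) * b) = int a * int b - 2 * int a" "x1 = 0" "x2 = 0" "y1 = 1" "y2 = 1"
    then show ?thesis
      using row_excluded [OF dets _ ab] s border_support(3) [OF bih assms(2) lq ab1] by auto
  qed
qed

lemma array_formIV:
  assumes bih: "bihomogeneous a b F" and "smf F" and lq: "lequiv F (FA a b c)"
    and dets: "dets ((a - 1) * (b - 1) + 1) a b c" and ab: "a \<ge> 4" "b \<ge> 4"
  shows "\<exists>s s'. s \<noteq> 0 \<and> s' \<noteq> 0 \<and> lequiv F (formIV a b s s')"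
proof -
  have AB: "int a \<ge> 4" "int b \<ge> 4" and ab1: "a \<ge> 1" "b \<ge> 1" using ab by simp_all
  have N: "int ((a - 1) * (b - 1) + 1) = int a * int b - int a - int b + 2"
    unfolding of_nat_mult of_nat_add of_nat_diff [OF ab1(1)] of_nat_diff [OF ab1(2)] of_nat_1
    by (simp add: algebra_simps)
  have "int ((a - 1) * (b - 1) + 1) \<ge> int a * int b - int a - int b + 2" unfolding N by simp
  from four_corners [OF bih assms(2) lq dets ab this] obtain x1 y1 x2 y2 x3 y3 x4 y4
    where *: "crn x1 y1" "crn x2 y2" "crn x3 y3" "crn x4 y4"
      and s: "(x1, y1) \<in> supp a b c" "(a - x2, y2) \<in> supp a b c" "(x3, b - y3) \<in> supp a b c" "(a - x4, b - y4) \<in> supp a b c"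
      and d: "cdet (int a * int b) (int a) (int b) x1 y1 x2 y2 x3 y3 = int ((a - 1) * (b - 1) + 1)"
        "cdet (int a * int b) (int a) (int b) x2 y2 x1 y1 x4 y4 = int ((a - 1) * (b - 1) + 1)"
        "cdet (int a * int b) (int a) (int b) x3 y3 x4 y4 x1 y1 = int ((a - 1) * (b - 1) + 1)"
        "cdet (int a * int b) (int a) (int b) x4 y4 x3 y3 x2 y2 = int ((a - 1) * (b - 1) + 1)"
    by (elim exE conjE)
  from corner_patterns(3) [OF * AB d N] show ?thesis
  proof (elim disjE conjE)
    assume "x1 = 1" "y1 = 0" "x2 = 0" "y2 = 1" "x3 = 0" "y3 = 1" "x4 = 1" "y4 = 0"
    then show ?thesis using s by (intro normal_formIV [OF lq dets ab]) simp_all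
  next
    \<comment> \<open>Mirror image of the preceding pattern under the exchange of \<open>X0\<close>
      and \<open>X1\<close>.\<close>
    assume "x1 = 0" "y1 = 1" "x2 = 1" "y2 = 0" "x3 = 1" "y3 = 0" "x4 = 0" "y4 = 1"
    then show ?thesis
      using s ab by (intro normal_formIV [OF lequiv_trans [OF lq lequiv_reflX] dets_reflX [OF dets] ab])
        (auto simp: supp_reflX)
  next
    assume "int ((a - 1) * (b - 1) + 1) = int a * int b - 2 * int a" "x1 = 0" "x2 = 0" "y1 = 1" "y2 = 1"
    then show ?thesis
      using row_excluded [OF dets _ ab] s border_support(3) [OF bih assms(2) lq ab1] by auto
  next
    \<comment> \<open>Here all corner monomials avoid the column \<open>i = 0\<close>; the exclusion
      of rows applies to the transposed array.\<close>
    assume N': "int ((a - 1) * (b - 1) + 1) = int a * int b - 2 * int b"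
      and "x1 = 1" "x3 = 1" "y1 = 0" "y3 = 0"
    then have "(0, 1) \<in> supp b a (\<lambda>i j. c j i)" "(b, 1) \<in> supp b a (\<lambda>i j. c j i)"
      using s supp_swap [of 0 1 b a c] supp_swap [of b 1 b a c] by simp_all
    moreover obtain j where "(j, 0) \<in> supp b a (\<lambda>i j. c j i)"
      using border_support(1) [OF bih assms(2) lq ab1] supp_swap [of _ 0 b a c] by blast
    moreover have "int ((a - 1) * (b - 1) + 1) = int b * int a - 2 * int b"
      using N' by (simp only: mult.commute)
    ultimately show ?thesis using row_excluded [OF dets_swap [OF dets] _ ab(2,1)] by blast
  qed
qed

text \<open>The order of an automorphism exchanging the two rulings is at most \<open>2 (a + 1)\<close>.\<close>

lemma swapping_excluded:
  assumes bih: "bihomogeneous a a F" and "smf F" "lequiv F (FA a a c)" and a: "a \<ge> 4"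
    and dv: "\<And>i j i' j'. (i, j) \<in> supp a a c \<Longrightarrow> (i', j') \<in> supp a a c \<Longrightarrow>
      int N dvd 2 * ((int i + int j) - (int i' + int j'))"
    and N: "N = a * a \<or> N = (a - 1) * a \<or> N = (a - 1) * (a - 1) + 1"
  shows False
proof -
  have a1: "a \<ge> 1" using a by simp
  note s = corners_support [OF bih assms(2,3) a1 a1]
  obtain x1 y1 where 1: "crn x1 y1" "(x1, y1) \<in> supp a a c" using s(1) by blast
  obtain x2 y2 where 2: "crn x2 y2" "(a - x2, y2) \<in> supp a a c" using s(2) by blast
  obtain x4 y4 where 4: "crn x4 y4" "(a - x4, a - y4) \<in> supp a a c" using s(4) by blast
  \<comment> \<open>Total exponents near three corners, close to \<open>0\<close>, \<open>a\<close>
    and \<open>2 * a\<close>. Since \<open>t2 - t1\<close> is positive and at most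
    \<open>a + 1\<close>, \<open>N\<close> is at most \<open>2 * a + 2\<close>, which all orders in
    question exceed except \<open>10\<close> for \<open>a = 4\<close>.\<close>
  define t1 t2 t4 where "t1 = int x1 + int y1" and "t2 = int (a - x2) + int y2" and "t4 = int (a - x4) + int (a - y4)"
  have t: "t1 = 0 \<or> t1 = 1" "t2 \<ge> int a - 1" "t2 \<le> int a + 1" "t4 = 2 * int a \<or> t4 = 2 * int a - 1"
    using 1(1) 2(1) 4(1) a unfolding crn_def t1_def t2_def t4_def by (auto simp: of_nat_diff)
  have d: "int N dvd 2 * (t2 - t1)" "int N dvd 2 * (t4 - t2)"
    using dv [OF 2(2) 1(2)] dv [OF 4(2) 2(2)] by (simp_all add: t1_def t2_def t4_def)
  have "int N \<le> 2 * (t2 - t1)" using t a by (intro zdvd_imp_le d) auto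
  then have N1: "int N \<le> 2 * int a + 2" using t by auto
  have n: "(a - 1) * (a - 1) + 1 + 2 * a = a * a + 2" "(a - 1) * a + a = a * a"
  proof -
    obtain m where "a = Suc m" using a by (cases a) auto
    then show "(a - 1) * (a - 1) + 1 + 2 * a = a * a + 2" "(a - 1) * a + a = a * a" by simp_all
  qed
  have "a = 4"
  proof (rule ccontr)
    assume "a \<noteq> 4"
    then have "5 * a \<le> a * a" using a by (intro mult_right_mono) simp_all
    then have "N > 2 * a + 2" using N n a by linarith
    then show False using N1 by linarith
  qed
  \<comment> \<open>Now \<open>5\<close> divides both differences. The first one forces
    \<open>t2 = 5\<close> and \<open>t1 = 0\<close>, while \<open>t4\<close> is \<open>7\<close> or
    \<open>8\<close>.\<close>
  then have N10: "N = 10" using N N1 by auto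
  have "5 dvd t2 - t1" "5 dvd t4 - t2" using d unfolding N10 by presburger+
  then show False using t \<open>a = 4\<close> by presburger
qed

lemma automorphism_array:
  assumes bih: "bihomogeneous a b F" and "smf F" and ab: "a \<ge> 4" "b \<ge> 4"
    and f: "f \<in> automorphisms (zero_locus F)"
    and N: "aut_order (zero_locus F) f = N"
      "N = a * b \<or> N = (a - 1) * b \<or> N = a * (b - 1) \<or> N = (a - 1) * (b - 1) + 1"
  shows "\<exists>c. lequiv F (FA a b c) \<and> dets N a b c"
proof -
  note aut = automorphismsD [OF f]
  have ab': "a \<ge> 3" "b \<ge> 3" "a \<ge> 2" "b \<ge> 2" and N0: "N > 0" using ab N(2) by auto
  have order: "(\<forall>p\<in>zero_locus F. (f ^^ k) p = p) \<longleftrightarrow> N dvd k" for k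
    using aut(3) [of k] N(1) by simp
  have maps: "f ` zero_locus F \<subseteq> zero_locus F" using aut(1) by (simp add: bij_betw_def)
  have bij: "bij_betw (\<lambda>p. (fst (f p), snd (f p))) (zero_locus F) (zero_locus F)" using aut(1) by simp
  obtain g h where gh: "linv g" "linv h" and alt:
    "(\<forall>X Y. X \<noteq> 0 \<longrightarrow> Y \<noteq> 0 \<longrightarrow> ev F X Y = 0 \<longrightarrow> fst (f (PT X, PT Y)) = PT (g X) \<and> snd (f (PT X, PT Y)) = PT (h Y)) \<or>
     a = b \<and> (\<forall>X Y. X \<noteq> 0 \<longrightarrow> Y \<noteq> 0 \<longrightarrow> ev F X Y = 0 \<longrightarrow> fst (f (PT X, PT Y)) = PT (g Y) \<and> snd (f (PT X, PT Y)) = PT (h X))"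
    using automorphism_linear [OF bih assms(2) ab'(1,2) morphism_regular [OF bih aut(2)] bij] by (elim exE conjE)
  from alt show ?thesis
  proof (elim disjE conjE)
    assume act: "\<forall>X Y. X \<noteq> 0 \<longrightarrow> Y \<noteq> 0 \<longrightarrow> ev F X Y = 0 \<longrightarrow> fst (f (PT X, PT Y)) = PT (g X) \<and> snd (f (PT X, PT Y)) = PT (h Y)"
    show ?thesis
      by (rule linear_automorphism_array [OF bih assms(2) ab'(3,4) gh _ maps order N0])
        (use act in \<open>simp add: prod_eq_iff\<close>)
  next
    assume eq: "a = b" and act: "\<forall>X Y. X \<noteq> 0 \<longrightarrow> Y \<noteq> 0 \<longrightarrow> ev F X Y = 0 \<longrightarrow> fst (f (PT X, PT Y)) = PT (g Y) \<and> snd (f (PT X, PT Y)) = PT (h X)"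
    have bih': "bihomogeneous a a F" using bih eq by simp
    have "\<exists>c. lequiv F (FA a a c) \<and> (\<forall>i j i' j'. (i, j) \<in> supp a a c \<longrightarrow> (i', j') \<in> supp a a c \<longrightarrow>
        int N dvd 2 * ((int i + int j) - (int i' + int j')))"
      by (rule swapping_automorphism_array [OF bih' assms(2) ab'(3) gh _ maps order N0])
        (use act in \<open>simp add: prod_eq_iff\<close>)
    then obtain c where c: "lequiv F (FA a a c)" "\<And>i j i' j'. (i, j) \<in> supp a a c \<Longrightarrow> (i', j') \<in> supp a a c \<Longrightarrow>
        int N dvd 2 * ((int i + int j) - (int i' + int j'))" by blast
    \<comment> \<open>For \<open>a = b\<close> the orders \<open>(a - 1) * b\<close> and
      \<open>a * (b - 1)\<close> coincide, so three orders remain.\<close>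
    have "N = a * a \<or> N = (a - 1) * a \<or> N = (a - 1) * (a - 1) + 1" using N(2) eq by (auto simp: mult.commute)
    then show ?thesis using swapping_excluded [OF bih' assms(2) c(1) ab(1) c(2)] by blast
  qed
qed

theorem theorem1p2:
  fixes a b :: nat
    and F :: form
    and C :: "(proj1 \<times> proj1) set"
    and f :: "proj1 \<times> proj1 \<Rightarrow> proj1 \<times> proj1"
  assumes "a \<ge> 4" and "b \<ge> 4"
    and "smooth_form a b F" and "C = zero_locus F"
    and "f \<in> automorphisms C"
  shows
    "(aut_order C f = a * b \<longrightarrow>
        (\<exists>s E. s \<noteq> 0 \<and>
           E = (\<lambda>X0 X1 Y0 Y1.
                  X0 ^ a * Y0 ^ b + X0 ^ a * Y1 ^ b + X1 ^ a * Y0 ^ b + s * X1 ^ a * Y1 ^ b) \<and>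
           smooth_form a b E \<and> isomorphic C (zero_locus E))) \<and>
     (aut_order C f = (a - 1) * b \<longrightarrow>
        (\<exists>s E. s \<noteq> 0 \<and>
           E = (\<lambda>X0 X1 Y0 Y1.
                  X0 ^ a * Y0 ^ b + X0 ^ (a - 1) * X1 * Y1 ^ b
                  + X0 * X1 ^ (a - 1) * Y0 ^ b + s * X1 ^ a * Y1 ^ b) \<and>
           smooth_form a b E \<and> isomorphic C (zero_locus E))) \<and>
     (aut_order C f = a * (b - 1) \<longrightarrow>
        (\<exists>s E. s \<noteq> 0 \<and>
           E = (\<lambda>X0 X1 Y0 Y1.
                  X0 ^ a * Y0 ^ b + X1 ^ a * Y0 ^ (b - 1) * Y1
                  + X0 ^ a * Y0 * Y1 ^ (b - 1) + s * X1 ^ a * Y1 ^ b) \<and>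
           smooth_form a b E \<and> isomorphic C (zero_locus E))) \<and>
     (aut_order C f = (a - 1) * (b - 1) + 1 \<longrightarrow>
        (\<exists>s s' E. s \<noteq> 0 \<and> s' \<noteq> 0 \<and>
           (E = (\<lambda>X0 X1 Y0 Y1.
                  X0 ^ (a - 1) * X1 * Y0 ^ b + X0 ^ a * Y0 * Y1 ^ (b - 1)
                  + s * X1 ^ a * Y0 ^ (b - 1) * Y1 + s' * X0 * X1 ^ (a - 1) * Y1 ^ b) \<or>
            E = (\<lambda>X0 X1 Y0 Y1.
                  X0 ^ a * Y0 ^ (b - 1) * Y1 + X0 * X1 ^ (a - 1) * Y0 ^ b
                  + s * X0 ^ (a - 1) * X1 * Y1 ^ b + s' * X1 ^ a * Y0 * Y1 ^ (b - 1))) \<and>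
           smooth_form a b E \<and> isomorphic C (zero_locus E)))"
proof -
  have bih: "bihomogeneous a b F" and smf: "smf F" using assms(3) by (simp_all add: smooth_form_iff)
  note ab = assms(1,2)
  note array = automorphism_array [OF bih smf ab assms(5) [unfolded assms(4)]]
  have ord: "aut_order C f = aut_order (zero_locus F) f" by (simp add: assms(4))
  have transfer: "smooth_form a b E \<and> isomorphic C (zero_locus E)" if "lequiv F E" for E
    using smooth_form_lequiv [OF assms(3) that] isomorphic_lequiv(1) [OF bih that] by (simp add: assms(4))
  \<comment> \<open>\<open>swF F\<close> describes the image of \<open>C\<close> under the exchange
    of the factors, hence the bidegree \<open>(b, a)\<close>; the isomorphism starts from
    \<open>C\<close> itself.\<close>
  have transfer_swap: "smooth_form b a E \<and> isomorphic C (zero_locus E)" if "lequiv (swF F) E" for E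
  proof -
    have "smooth_form b a (swF F)" using bihom_swF [OF bih] smf_swF [OF smf] by (simp add: smooth_form_iff)
    then show ?thesis
      using smooth_form_lequiv [OF _ that] isomorphic_lequiv(2) [OF bihom_swF [OF bih] that] by (simp add: assms(4))
  qed
  have 1: "\<exists>s. s \<noteq> 0 \<and> smooth_form a b (formI a b s) \<and> isomorphic C (zero_locus (formI a b s))"
    if N: "aut_order C f = a * b"
  proof -
    obtain c where "lequiv F (FA a b c)" "dets (a * b) a b c" using array [of "a * b"] N ord by auto
    then obtain s where "s \<noteq> 0" "lequiv F (formI a b s)" using array_formI [OF bih smf _ _ ab] by blast
    then show ?thesis using transfer by blast
  qed
  have 2: "\<exists>s. s \<noteq> 0 \<and> smooth_form a b (formII a b s) \<and> isomorphic C (zero_locus (formII a b s))"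
    if N: "aut_order C f = (a - 1) * b"
  proof -
    obtain c where "lequiv F (FA a b c)" "dets ((a - 1) * b) a b c" using array [of "(a - 1) * b"] N ord by auto
    then obtain s where s: "s \<noteq> 0" "lequiv F (formII a b s) \<or> a = b \<and> lequiv (swF F) (formII a b s)"
      using array_formII [OF bih smf _ _ ab] by blast
    then show ?thesis using transfer transfer_swap by blast
  qed
  \<comment> \<open>Part (iii) is part (ii) for the transposed equation \<open>swF F\<close> of
    bidegree \<open>(b, a)\<close>, with the normal form transposed back.\<close>
  have 3: "\<exists>s. s \<noteq> 0 \<and> smooth_form a b (swF (formII b a s)) \<and> isomorphic C (zero_locus (swF (formII b a s)))"
    if N: "aut_order C f = a * (b - 1)"
  proof -
    obtain c where c: "lequiv F (FA a b c)" "dets (a * (b - 1)) a b c" using array [of "a * (b - 1)"] N ord by auto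
    have "lequiv (swF F) (FA b a (\<lambda>i j. c j i))" using lequiv_swF [OF c(1)] by (simp add: swF_FA)
    moreover have "dets ((b - 1) * a) b a (\<lambda>i j. c j i)" using dets_swap [OF c(2)] by (simp only: mult.commute)
    ultimately obtain s where s: "s \<noteq> 0" "lequiv (swF F) (formII b a s) \<or> b = a \<and> lequiv F (formII b a s)"
      using array_formII [OF bihom_swF [OF bih] smf_swF [OF smf] _ _ ab(2,1)] unfolding swF_swF by blast
    then have "lequiv F (swF (formII b a s)) \<or> b = a \<and> lequiv (swF F) (swF (formII b a s))"
      using lequiv_swF [of "swF F"] lequiv_swF [of F] by auto
    then show ?thesis using s(1) transfer transfer_swap by blast
  qed
  have swap: "swF (formII b a s) = (\<lambda>X0 X1 Y0 Y1. X0 ^ a * Y0 ^ b + X1 ^ a * Y0 ^ (b - 1) * Y1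
      + X0 ^ a * Y0 * Y1 ^ (b - 1) + s * X1 ^ a * Y1 ^ b)" for s
    by (simp add: swF_def formII_def fun_eq_iff mult_ac)
  have 4: "\<exists>s s'. s \<noteq> 0 \<and> s' \<noteq> 0 \<and> smooth_form a b (formIV a b s s') \<and> isomorphic C (zero_locus (formIV a b s s'))"
    if N: "aut_order C f = (a - 1) * (b - 1) + 1"
  proof -
    obtain c where "lequiv F (FA a b c)" "dets ((a - 1) * (b - 1) + 1) a b c"
      using array [of "(a - 1) * (b - 1) + 1"] N ord by auto
    then obtain s s' where "s \<noteq> 0" "s' \<noteq> 0" "lequiv F (formIV a b s s')"
      using array_formIV [OF bih smf _ _ ab] by blast
    then show ?thesis using transfer by blast
  qed
  show ?thesis
    using 1 2 3 4 unfolding formI_def formII_def [of a b] formIV_def swap by blast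
qed

end
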